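(* Let $A$ be a Noetherian commutative ring whose underlying abelian group is torsion-free. Let $\eta\in H^1_{fl}(\mathcal{M}_{fm\mathbb{Z}};\omega)$ be the generator of this group (the element which yields, via the Adams–Novikov spectral sequence, the generator of the first stable homotopy group of spheres $\pi_1^{st}(S^0)\cong\mathbb{Z}/2\mathbb{Z}$). Then $\eta$ is the image, under the map \[ H^1_{fl}(\mathcal{M}_{fm\mathbb{Z}}^{2\text{-}buds}; \omega) \rightarrow H^1_{fl}(\mathcal{M}_{fm\mathbb{Z}}; \omega) \] induced by taking underlying $2$-buds, of a unique element of $H^1_{fl}(\mathcal{M}_{fm\mathbb{Z}}^{2\text{-}buds}; \omega)$, and the image of this element under the map \[ H^1_{fl}(\mathcal{M}_{fm\mathbb{Z}}^{2\text{-}buds}; \omega) \rightarrow H^1_{fl}(\mathcal{M}_{fmA}^{2\text{-}buds}; \omega) \] induced by taking underlying formal group law $2$-buds is a generator of the $A$-module $H^1_{fl}(\mathcal{M}_{fmA}^{2\text{-}buds}; \omega)$.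
   Context: Formal $A$-module 2-buds: for a commutative ring $A$ and commutative $A$-algebra $R$, a formal $A$-module $2$-bud over $R$ is an element $F\in R[[X,Y]]/(X,Y)^3$ satisfying the commutative formal group law axioms modulo $(X,Y)^3$, with a ring homomorphism $\rho:A\to\mathrm{End}(F)\subseteq R[[X]]/(X^3)$ (addition $F(f,g)$, multiplication composition) with $\rho(a)\equiv aX \bmod X^2$. Strict isomorphisms are isomorphisms $f\equiv X \bmod X^2$. The groupoid of these is corepresented by the graded Hopf algebroid $(L^A_{2\text{-}buds},L^A_{2\text{-}buds}B)$ described as follows. Let $\mathrm{Dr}^A$ be the $A$-module generated by symbols $\gamma$ and $c_a$ ($a\in A$), in degree $2$, subject to $(a^2-a)\gamma=2c_a$, $c_{a+b}-c_a-c_b=ab\gamma$, $ac_b+b^2c_a=c_{ab}$ for all $a,b\in A$. Then $L^A_{2\text{-}buds}=\mathrm{Sym}_A(\mathrm{Dr}^A)$, $L^A_{2\text{-}buds}B=L^A_{2\text{-}buds}[t]$ with $|t|=2$, $\eta_L(x)=x$, $\eta_R(\gamma)=\gamma+2t$, $\eta_R(c_a)=c_a+(a^2-a)t$, $\Delta(t)=t\otimes1+1\otimes t$, $\epsilon(t)=0$. $\mathcal{M}_{fmA}^{2\text{-}buds}$ is the Artin stack obtained by stackifying the groupoid scheme $(\mathrm{Spec}\,L^A_{2\text{-}buds},\mathrm{Spec}\,L^A_{2\text{-}buds}B)$, $\omega$ is its line bundle of invariant differentials (corresponding to the graded comodule $\Sigma^2L^A_{2\text{-}buds}$), and $H^s_{fl}(\mathcal{M}_{fmA}^{2\text{-}buds};\omega^{\otimes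 n})=\mathrm{Cotor}^{s,2n}_{L^A_{2\text{-}buds}B}(L^A_{2\text{-}buds},L^A_{2\text{-}buds})$, the cohomology of the cobar complex in cohomological degree $s$ and internal degree $2n$. Formal $\mathbb{Z}$-modules are formal group laws. The graded Hopf algebroid $(L,LB)$ classifying formal group laws and strict isomorphisms has $L$ the Lazard ring and $LB=L[t_1,t_2,\dots]$, $|t_i|=2i$ (isomorphic to $(\pi_*MU,\pi_*(MU\wedge MU))$); $\mathcal{M}_{fm\mathbb{Z}}$ is the associated moduli stack, and $H^s_{fl}(\mathcal{M}_{fm\mathbb{Z}};\omega^{\otimes n})=\mathrm{Cotor}^{s,2n}_{LB}(L,L)$, the $E_2$-term of the Adams–Novikov spectral sequence. The first map in the claim is induced by the map of Hopf algebroids $(L^{\mathbb{Z}}_{2\text{-}buds},L^{\mathbb{Z}}_{2\text{-}buds}B)\to(L,LB)$ classifying the underlying $2$-bud (strict isomorphism of 2-buds) of the universal formal group law (strict isomorphism). The second is induced by the map $(L^{\mathbb{Z}}_{2\text{-}buds},L^{\mathbb{Z}}_{2\text{-}buds}B)\to(L^A_{2\text{-}buds},L^A_{2\text{-}buds}B)$ sending $\gamma\mapsto\gamma$, $t\mapsto t$. *)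

theory Defs
  imports "HOL-Algebra.Algebra" "HOL-Algebra.Indexed_Polynomials"
begin

section \<open>Algebra missing from the library\<close>

subsection \<open>Polynomials and power series in a set of variables\<close>

text \<open>As in \<^theory>\<open>HOL-Algebra.Indexed_Polynomials\<close>, a monomial is a multiset of variables and a
  (possibly infinite) series is its coefficient function.\<close>

definition series_ring :: "('a, 'm) ring_scheme \<Rightarrow> 'v set \<Rightarrow> ('v multiset \<Rightarrow> 'a) ring" where
  "series_ring R V =
    \<lparr>carrier = {p. (\<forall>m. p m \<in> carrier R) \<and> (\<forall>m. \<not> set_mset m \<subseteq> V \<longrightarrow> p m = \<zero>\<^bsub>R\<^esub>)},
     monoid.mult = (\<lambda>p q m. \<Oplus>\<^bsub>R\<^esub>k\<in>{k. k \<subseteq># m}. p k \<otimes>\<^bsub>R\<^esub> q (m - k)),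
     monoid.one = (\<lambda>m. if m = {#} then \<one>\<^bsub>R\<^esub> else \<zero>\<^bsub>R\<^esub>),
     ring.zero = (\<lambda>m. \<zero>\<^bsub>R\<^esub>),
     ring.add = (\<lambda>p q m. p m \<oplus>\<^bsub>R\<^esub> q m)\<rparr>"

definition mpoly_ring :: "('a, 'm) ring_scheme \<Rightarrow> 'v set \<Rightarrow> ('v multiset \<Rightarrow> 'a) ring" where
  "mpoly_ring R V = (series_ring R V)\<lparr>carrier := ring.indexed_pset R V (carrier R)\<rparr>"

text \<open>Substitution of series \<open>\<sigma> v\<close> in the variables \<open>W\<close> for the variables \<open>v\<close> of a series in the
  finite set of variables \<open>V\<close>. It is meant for \<open>\<sigma> v\<close> without constant term: then monomials of
  degree greater than \<open>size m\<close> do not contribute to the coefficient of \<open>m\<close>.\<close>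

definition series_subst ::
  "('a, 'm) ring_scheme \<Rightarrow> 'v set \<Rightarrow> 'w set \<Rightarrow> ('v multiset \<Rightarrow> 'a) \<Rightarrow> ('v \<Rightarrow> 'w multiset \<Rightarrow> 'a)
    \<Rightarrow> 'w multiset \<Rightarrow> 'a" where
  "series_subst R V W F \<sigma> = (\<lambda>m.
    \<Oplus>\<^bsub>R\<^esub>k\<in>{k. set_mset k \<subseteq> V \<and> size k \<le> size m}.
      F k \<otimes>\<^bsub>R\<^esub> (\<Otimes>\<^bsub>series_ring R W\<^esub>v\<in>V. \<sigma> v [^]\<^bsub>series_ring R W\<^esub> count k v) m)"

text \<open>A grading is a family of additive subgroups indexed by the degree; all gradings here are
  concentrated in nonnegative degrees.\<close>

definition trivial_grading :: "('a, 'm) ring_scheme \<Rightarrow> nat \<Rightarrow> 'a set" where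
  "trivial_grading R n = (if n = 0 then carrier R else {\<zero>\<^bsub>R\<^esub>})"

text \<open>The grading of a polynomial ring with coefficient ring graded by \<open>G\<close> and the variable \<open>v\<close>
  in degree \<open>w v\<close>.\<close>

definition mpoly_grading ::
  "('a, 'm) ring_scheme \<Rightarrow> (nat \<Rightarrow> 'a set) \<Rightarrow> 'v set \<Rightarrow> ('v \<Rightarrow> nat) \<Rightarrow> nat \<Rightarrow> ('v multiset \<Rightarrow> 'a) set" where
  "mpoly_grading R G V w n =
    {p \<in> carrier (mpoly_ring R V). \<forall>m.
      if (\<Sum>v\<in>#m. w v) \<le> n then p m \<in> G (n - (\<Sum>v\<in>#m. w v)) else p m = \<zero>\<^bsub>R\<^esub>}"

definition UP_grading ::
  "('a, 'm) ring_scheme \<Rightarrow> (nat \<Rightarrow> 'a set) \<Rightarrow> nat \<Rightarrow> nat \<Rightarrow> (nat \<Rightarrow> 'a) set" where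
  "UP_grading R G d n =
    {p \<in> carrier (UP R). \<forall>k.
      if d * k \<le> n then coeff (UP R) p k \<in> G (n - d * k) else coeff (UP R) p k = \<zero>\<^bsub>R\<^esub>}"

text \<open>The ring homomorphism with a given property; on \<open>carrier R\<close> it is always determined
  by the property in the uses below.\<close>

definition the_hom ::
  "('a, 'm) ring_scheme \<Rightarrow> ('b, 'n) ring_scheme \<Rightarrow> (('a \<Rightarrow> 'b) \<Rightarrow> bool) \<Rightarrow> 'a \<Rightarrow> 'b" where
  "the_hom R S P = (THE h. h \<in> ring_hom R S \<and> h \<in> extensional (carrier R) \<and> P h)"


subsection \<open>Modules\<close>

text \<open>In records of type \<open>module\<close> that are only used as modules the fields \<open>mult\<close> and \<open>one\<close> carry
  no information.\<close>

definition free_module :: "('a, 'm) ring_scheme \<Rightarrow> 'x set \<Rightarrow> ('a, 'x \<Rightarrow> 'a) module" where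
  "free_module R B =
    \<lparr>carrier = {v. (\<forall>x. v x \<in> carrier R) \<and> (\<forall>x. x \<notin> B \<longrightarrow> v x = \<zero>\<^bsub>R\<^esub>) \<and> finite {x. v x \<noteq> \<zero>\<^bsub>R\<^esub>}},
     monoid.mult = undefined, monoid.one = undefined,
     ring.zero = (\<lambda>x. \<zero>\<^bsub>R\<^esub>),
     ring.add = (\<lambda>v w x. v x \<oplus>\<^bsub>R\<^esub> w x),
     smult = (\<lambda>r v x. r \<otimes>\<^bsub>R\<^esub> v x)\<rparr>"

definition unit_vec :: "('a, 'm) ring_scheme \<Rightarrow> 'x \<Rightarrow> 'x \<Rightarrow> 'a" where
  "unit_vec R x = (\<lambda>y. if y = x then \<one>\<^bsub>R\<^esub> else \<zero>\<^bsub>R\<^esub>)"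

definition submodule_generated ::
  "('a, 'm) ring_scheme \<Rightarrow> ('a, 'b, 'n) module_scheme \<Rightarrow> 'b set \<Rightarrow> 'b set" where
  "submodule_generated R M S = \<Inter>{N. submodule N R M \<and> S \<subseteq> N}"

definition quotient_module :: "('a, 'b, 'n) module_scheme \<Rightarrow> 'b set \<Rightarrow> ('a, 'b set) module" where
  "quotient_module M N =
    \<lparr>carrier = a_rcosets\<^bsub>M\<^esub> N,
     monoid.mult = undefined, monoid.one = undefined,
     ring.zero = N,
     ring.add = set_add M,
     smult = (\<lambda>r C. \<Union>x\<in>C. N +>\<^bsub>M\<^esub> (r \<odot>\<^bsub>M\<^esub> x))\<rparr>"

definition module_generator ::
  "('a, 'm) ring_scheme \<Rightarrow> ('a, 'b, 'n) module_scheme \<Rightarrow> 'b \<Rightarrow> bool" where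
  "module_generator R M x \<longleftrightarrow> x \<in> carrier M \<and> carrier M = {r \<odot>\<^bsub>M\<^esub> x | r. r \<in> carrier R}"

text \<open>The symmetric algebra of \<open>M\<close>: polynomials over \<open>R\<close> in the elements of \<open>M\<close>, modulo the
  ideal that makes the inclusion \<open>M \<rightarrow> Sym M\<close> linear over \<open>R\<close>.\<close>

definition Sym_ideal ::
  "('a, 'm) ring_scheme \<Rightarrow> ('a, 'b, 'n) module_scheme \<Rightarrow> ('b multiset \<Rightarrow> 'a) set" where
  "Sym_ideal R M = (let P = mpoly_ring R (carrier M); var = ring.indexed_var R in
    Idl\<^bsub>P\<^esub>
      ({var (x \<oplus>\<^bsub>M\<^esub> y) \<ominus>\<^bsub>P\<^esub> (var x \<oplus>\<^bsub>P\<^esub> var y) | x y. x \<in> carrier M \<and> y \<in> carrier M} \<union>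
       {var (r \<odot>\<^bsub>M\<^esub> x) \<ominus>\<^bsub>P\<^esub> (ring.indexed_const R r \<otimes>\<^bsub>P\<^esub> var x) | r x.
          r \<in> carrier R \<and> x \<in> carrier M}))"

definition Sym ::
  "('a, 'm) ring_scheme \<Rightarrow> ('a, 'b, 'n) module_scheme \<Rightarrow> ('b multiset \<Rightarrow> 'a) set ring" where
  "Sym R M = mpoly_ring R (carrier M) Quot Sym_ideal R M"

definition Sym_const ::
  "('a, 'm) ring_scheme \<Rightarrow> ('a, 'b, 'n) module_scheme \<Rightarrow> 'a \<Rightarrow> ('b multiset \<Rightarrow> 'a) set" where
  "Sym_const R M r = Sym_ideal R M +>\<^bsub>mpoly_ring R (carrier M)\<^esub> ring.indexed_const R r"

definition Sym_incl ::
  "('a, 'm) ring_scheme \<Rightarrow> ('a, 'b, 'n) module_scheme \<Rightarrow> 'b \<Rightarrow> ('b multiset \<Rightarrow> 'a) set" where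
  "Sym_incl R M x = Sym_ideal R M +>\<^bsub>mpoly_ring R (carrier M)\<^esub> ring.indexed_var R x"

text \<open>Grading with \<open>R\<close> in degree 0 and \<open>M\<close> in degree \<open>d\<close>.\<close>

definition Sym_grading ::
  "('a, 'm) ring_scheme \<Rightarrow> ('a, 'b, 'n) module_scheme \<Rightarrow> nat \<Rightarrow> nat \<Rightarrow> ('b multiset \<Rightarrow> 'a) set set" where
  "Sym_grading R M d n =
    (\<lambda>p. Sym_ideal R M +>\<^bsub>mpoly_ring R (carrier M)\<^esub> p) `
      mpoly_grading R (trivial_grading R) (carrier M) (\<lambda>_. d) n"


subsection \<open>Tensor products of commutative rings\<close>

text \<open>The free abelian group on \<open>carrier R \<times> carrier S\<close> with the product that extends
  componentwise multiplication of the generators.\<close>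

definition pair_ring ::
  "('a, 'm) ring_scheme \<Rightarrow> ('b, 'n) ring_scheme \<Rightarrow> ('a \<times> 'b \<Rightarrow>\<^sub>0 int) ring" where
  "pair_ring R S =
    \<lparr>carrier = {c. Poly_Mapping.keys c \<subseteq> carrier R \<times> carrier S},
     monoid.mult = (\<lambda>c d. frag_extend (\<lambda>(x, y). frag_extend (\<lambda>(x', y').
       frag_of (x \<otimes>\<^bsub>R\<^esub> x', y \<otimes>\<^bsub>S\<^esub> y')) d) c),
     monoid.one = frag_of (\<one>\<^bsub>R\<^esub>, \<one>\<^bsub>S\<^esub>),
     ring.zero = 0,
     ring.add = (+)\<rparr>"

text \<open>\<open>R \<otimes>\<^sub>A S\<close>, where \<open>A\<close> acts on \<open>R\<close> through \<open>f\<close> and on \<open>S\<close> through \<open>g\<close>. The additive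
  subgroup generated by the relations is closed under multiplication, so taking the ideal
  they generate does not change the underlying group.\<close>

definition tensor_ideal ::
  "('c, 'l) ring_scheme \<Rightarrow> ('a, 'm) ring_scheme \<Rightarrow> ('c \<Rightarrow> 'a) \<Rightarrow> ('b, 'n) ring_scheme \<Rightarrow> ('c \<Rightarrow> 'b)
    \<Rightarrow> ('a \<times> 'b \<Rightarrow>\<^sub>0 int) set" where
  "tensor_ideal A R f S g = Idl\<^bsub>pair_ring R S\<^esub>
    ({frag_of (x \<oplus>\<^bsub>R\<^esub> x', y) - frag_of (x, y) - frag_of (x', y) | x x' y.
        x \<in> carrier R \<and> x' \<in> carrier R \<and> y \<in> carrier S} \<union>
     {frag_of (x, y \<oplus>\<^bsub>S\<^esub> y') - frag_of (x, y) - frag_of (x, y') | x y y'.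
        x \<in> carrier R \<and> y \<in> carrier S \<and> y' \<in> carrier S} \<union>
     {frag_of (x \<otimes>\<^bsub>R\<^esub> f a, y) - frag_of (x, g a \<otimes>\<^bsub>S\<^esub> y) | x a y.
        x \<in> carrier R \<and> a \<in> carrier A \<and> y \<in> carrier S})"

definition tensor_ring ::
  "('c, 'l) ring_scheme \<Rightarrow> ('a, 'm) ring_scheme \<Rightarrow> ('c \<Rightarrow> 'a) \<Rightarrow> ('b, 'n) ring_scheme \<Rightarrow> ('c \<Rightarrow> 'b)
    \<Rightarrow> ('a \<times> 'b \<Rightarrow>\<^sub>0 int) set ring" where
  "tensor_ring A R f S g = pair_ring R S Quot tensor_ideal A R f S g"

definition pure_tensor ::
  "('c, 'l) ring_scheme \<Rightarrow> ('a, 'm) ring_scheme \<Rightarrow> ('c \<Rightarrow> 'a) \<Rightarrow> ('b, 'n) ring_scheme \<Rightarrow> ('c \<Rightarrow> 'b)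
    \<Rightarrow> 'a \<Rightarrow> 'b \<Rightarrow> ('a \<times> 'b \<Rightarrow>\<^sub>0 int) set" where
  "pure_tensor A R f S g x y = tensor_ideal A R f S g +>\<^bsub>pair_ring R S\<^esub> frag_of (x, y)"


section \<open>Graded Hopf algebroids and their cohomology\<close>

text \<open>Graded Hopf algebroids \<open>(A, \<Gamma>)\<close> over a base ring \<open>K\<close>: \<open>scal : K \<rightarrow> A\<close> is the structure map
  of the \<open>K\<close>-algebra \<open>A\<close>. The conjugation does not enter the cobar complex and is omitted.\<close>

record ('k, 'a, 'g) hopf_algebroid =
  base :: "'k ring"
  obj :: "'a ring"
  mor :: "'g ring"
  scal :: "'k \<Rightarrow> 'a"
  etaL :: "'a \<Rightarrow> 'g"
  etaR :: "'a \<Rightarrow> 'g"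
  comult :: "'g \<Rightarrow> ('g \<times> 'g \<Rightarrow>\<^sub>0 int) set"
  counit :: "'g \<Rightarrow> 'a"
  obj_grading :: "nat \<Rightarrow> 'a set"
  mor_grading :: "nat \<Rightarrow> 'g set"

text \<open>In \<open>\<Gamma> \<otimes>\<^sub>A \<Gamma>\<close> the left factor is a module through the right unit, the right factor through the
  left unit.\<close>

definition mor_tensor :: "('k, 'a, 'g) hopf_algebroid \<Rightarrow> ('g \<times> 'g \<Rightarrow>\<^sub>0 int) set ring" where
  "mor_tensor H = tensor_ring (obj H) (mor H) (etaR H) (mor H) (etaL H)"

definition mor_pure_tensor ::
  "('k, 'a, 'g) hopf_algebroid \<Rightarrow> 'g \<Rightarrow> 'g \<Rightarrow> ('g \<times> 'g \<Rightarrow>\<^sub>0 int) set" where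
  "mor_pure_tensor H = pure_tensor (obj H) (mor H) (etaR H) (mor H) (etaL H)"

text \<open>The part \<open>A \<rightarrow> \<Gamma> \<rightarrow> \<Gamma> \<otimes>\<^sub>A \<Gamma>\<close> of the (unnormalized) cobar complex of \<open>(A, \<Gamma>)\<close>.\<close>

definition cobar_d0 :: "('k, 'a, 'g) hopf_algebroid \<Rightarrow> 'a \<Rightarrow> 'g" where
  "cobar_d0 H a = etaR H a \<ominus>\<^bsub>mor H\<^esub> etaL H a"

definition cobar_d1 :: "('k, 'a, 'g) hopf_algebroid \<Rightarrow> 'g \<Rightarrow> ('g \<times> 'g \<Rightarrow>\<^sub>0 int) set" where
  "cobar_d1 H x =
    (mor_pure_tensor H \<one>\<^bsub>mor H\<^esub> x \<ominus>\<^bsub>mor_tensor H\<^esub> comult H x)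
      \<oplus>\<^bsub>mor_tensor H\<^esub> mor_pure_tensor H x \<one>\<^bsub>mor H\<^esub>"

definition cobar_Z1 :: "('k, 'a, 'g) hopf_algebroid \<Rightarrow> nat \<Rightarrow> ('k, 'g) module" where
  "cobar_Z1 H n =
    \<lparr>carrier = {x \<in> mor_grading H n. cobar_d1 H x = \<zero>\<^bsub>mor_tensor H\<^esub>},
     monoid.mult = undefined, monoid.one = undefined,
     ring.zero = \<zero>\<^bsub>mor H\<^esub>,
     ring.add = ring.add (mor H),
     smult = (\<lambda>r x. etaL H (scal H r) \<otimes>\<^bsub>mor H\<^esub> x)\<rparr>"

definition cobar_B1 :: "('k, 'a, 'g) hopf_algebroid \<Rightarrow> nat \<Rightarrow> 'g set" where
  "cobar_B1 H n = cobar_d0 H ` obj_grading H n"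

text \<open>\<open>Cotor\<^sup>1\<^sup>,\<^sup>n\<close> of \<open>(A, \<Gamma>)\<close> with coefficients in \<open>A\<close>, as a \<open>K\<close>-module, and the map induced by a map
  of Hopf algebroids with component \<open>\<phi>\<close> on \<open>\<Gamma>\<close>.\<close>

definition Cotor1 :: "('k, 'a, 'g) hopf_algebroid \<Rightarrow> nat \<Rightarrow> ('k, 'g set) module" where
  "Cotor1 H n = quotient_module (cobar_Z1 H n) (cobar_B1 H n)"

definition Cotor1_map ::
  "('k, 'a, 'g) hopf_algebroid \<Rightarrow> nat \<Rightarrow> ('h \<Rightarrow> 'g) \<Rightarrow> 'h set \<Rightarrow> 'g set" where
  "Cotor1_map H n \<phi> C = (\<Union>x\<in>C. cobar_B1 H n +>\<^bsub>mor H\<^esub> \<phi> x)"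

text \<open>First flat cohomology of the stack presented by the Hopf algebroid, with coefficients in the
  \<open>n\<close>-th power of the line bundle of invariant differentials.\<close>

definition H1_fl :: "('k, 'a, 'g) hopf_algebroid \<Rightarrow> nat \<Rightarrow> ('k, 'g set) module" where
  "H1_fl H n = Cotor1 H (2 * n)"

definition H1_fl_map ::
  "('k, 'a, 'g) hopf_algebroid \<Rightarrow> nat \<Rightarrow> ('h \<Rightarrow> 'g) \<Rightarrow> 'h set \<Rightarrow> 'g set" where
  "H1_fl_map H n = Cotor1_map H (2 * n)"


section \<open>Formal module 2-buds\<close>

datatype 'a dr_symbol = Gamma | Cee 'a

type_synonym 'a dr = "('a dr_symbol \<Rightarrow> 'a) set"
type_synonym 'a buds = "('a dr multiset \<Rightarrow> 'a) set"

definition dr_free :: "('a, 'm) ring_scheme \<Rightarrow> ('a, 'a dr_symbol \<Rightarrow> 'a) module" where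
  "dr_free A = free_module A (insert Gamma (Cee ` carrier A))"

definition dr_relations :: "('a, 'm) ring_scheme \<Rightarrow> ('a dr_symbol \<Rightarrow> 'a) set" where
  "dr_relations A = (let M = dr_free A; \<gamma> = unit_vec A Gamma; c = (\<lambda>a. unit_vec A (Cee a)) in
    {((a \<otimes>\<^bsub>A\<^esub> a \<ominus>\<^bsub>A\<^esub> a) \<odot>\<^bsub>M\<^esub> \<gamma>) \<ominus>\<^bsub>M\<^esub> (c a \<oplus>\<^bsub>M\<^esub> c a) | a. a \<in> carrier A} \<union>
    {(c (a \<oplus>\<^bsub>A\<^esub> b) \<ominus>\<^bsub>M\<^esub> c a \<ominus>\<^bsub>M\<^esub> c b) \<ominus>\<^bsub>M\<^esub> ((a \<otimes>\<^bsub>A\<^esub> b) \<odot>\<^bsub>M\<^esub> \<gamma>) | a b.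
       a \<in> carrier A \<and> b \<in> carrier A} \<union>
    {((a \<odot>\<^bsub>M\<^esub> c b) \<oplus>\<^bsub>M\<^esub> ((b \<otimes>\<^bsub>A\<^esub> b) \<odot>\<^bsub>M\<^esub> c a)) \<ominus>\<^bsub>M\<^esub> c (a \<otimes>\<^bsub>A\<^esub> b) | a b.
       a \<in> carrier A \<and> b \<in> carrier A})"

definition dr_submodule :: "('a, 'm) ring_scheme \<Rightarrow> ('a dr_symbol \<Rightarrow> 'a) set" where
  "dr_submodule A = submodule_generated A (dr_free A) (dr_relations A)"

definition Dr :: "('a, 'm) ring_scheme \<Rightarrow> ('a, 'a dr) module" where
  "Dr A = quotient_module (dr_free A) (dr_submodule A)"

definition L_buds :: "('a, 'm) ring_scheme \<Rightarrow> 'a buds ring" where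
  "L_buds A = Sym A (Dr A)"

definition buds_gamma :: "('a, 'm) ring_scheme \<Rightarrow> 'a buds" where
  "buds_gamma A = Sym_incl A (Dr A) (dr_submodule A +>\<^bsub>dr_free A\<^esub> unit_vec A Gamma)"

definition buds_c :: "('a, 'm) ring_scheme \<Rightarrow> 'a \<Rightarrow> 'a buds" where
  "buds_c A a = Sym_incl A (Dr A) (dr_submodule A +>\<^bsub>dr_free A\<^esub> unit_vec A (Cee a))"

definition LB_buds :: "('a, 'm) ring_scheme \<Rightarrow> ('a buds, nat \<Rightarrow> 'a buds) up_ring" where
  "LB_buds A = UP (L_buds A)"

definition buds_etaL :: "('a, 'm) ring_scheme \<Rightarrow> 'a buds \<Rightarrow> nat \<Rightarrow> 'a buds" where
  "buds_etaL A x = monom (LB_buds A) x 0"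

definition buds_t :: "('a, 'm) ring_scheme \<Rightarrow> nat \<Rightarrow> 'a buds" where
  "buds_t A = monom (LB_buds A) \<one>\<^bsub>L_buds A\<^esub> 1"

definition buds_scal :: "('a, 'm) ring_scheme \<Rightarrow> 'a \<Rightarrow> 'a buds" where
  "buds_scal A = Sym_const A (Dr A)"

definition buds_etaR :: "('a, 'm) ring_scheme \<Rightarrow> 'a buds \<Rightarrow> nat \<Rightarrow> 'a buds" where
  "buds_etaR A = the_hom (L_buds A) (LB_buds A) (\<lambda>h.
    (\<forall>a\<in>carrier A. h (buds_scal A a) = buds_etaL A (buds_scal A a)) \<and>
    h (buds_gamma A) = buds_etaL A (buds_gamma A) \<oplus>\<^bsub>LB_buds A\<^esub> (buds_t A \<oplus>\<^bsub>LB_buds A\<^esub> buds_t A) \<and>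
    (\<forall>a\<in>carrier A. h (buds_c A a) =
      buds_etaL A (buds_c A a) \<oplus>\<^bsub>LB_buds A\<^esub>
        (buds_etaL A (buds_scal A (a \<otimes>\<^bsub>A\<^esub> a \<ominus>\<^bsub>A\<^esub> a)) \<otimes>\<^bsub>LB_buds A\<^esub> buds_t A)))"

definition buds_comult ::
  "('a, 'm) ring_scheme \<Rightarrow> (nat \<Rightarrow> 'a buds) \<Rightarrow> ((nat \<Rightarrow> 'a buds) \<times> (nat \<Rightarrow> 'a buds) \<Rightarrow>\<^sub>0 int) set" where
  "buds_comult A =
    (let T = tensor_ring (L_buds A) (LB_buds A) (buds_etaR A) (LB_buds A) (buds_etaL A);
         tens = pure_tensor (L_buds A) (LB_buds A) (buds_etaR A) (LB_buds A) (buds_etaL A)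
     in the_hom (LB_buds A) T (\<lambda>h.
       (\<forall>x\<in>carrier (L_buds A). h (buds_etaL A x) = tens (buds_etaL A x) \<one>\<^bsub>LB_buds A\<^esub>) \<and>
       h (buds_t A) = tens (buds_t A) \<one>\<^bsub>LB_buds A\<^esub> \<oplus>\<^bsub>T\<^esub> tens \<one>\<^bsub>LB_buds A\<^esub> (buds_t A)))"

definition buds_counit :: "('a, 'm) ring_scheme \<Rightarrow> (nat \<Rightarrow> 'a buds) \<Rightarrow> 'a buds" where
  "buds_counit A = the_hom (LB_buds A) (L_buds A) (\<lambda>h.
    (\<forall>x\<in>carrier (L_buds A). h (buds_etaL A x) = x) \<and> h (buds_t A) = \<zero>\<^bsub>L_buds A\<^esub>)"

definition M_buds :: "'a ring \<Rightarrow> ('a, 'a buds, nat \<Rightarrow> 'a buds) hopf_algebroid" where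
  "M_buds A =
    \<lparr>base = A,
     obj = L_buds A,
     mor = ring.truncate (LB_buds A),
     scal = buds_scal A,
     etaL = buds_etaL A,
     etaR = buds_etaR A,
     comult = buds_comult A,
     counit = buds_counit A,
     obj_grading = Sym_grading A (Dr A) 2,
     mor_grading = UP_grading (L_buds A) (Sym_grading A (Dr A) 2) 2\<rparr>"


section \<open>Formal group laws\<close>

datatype fgl_var = VX | VY | VZ

definition subst1 ::
  "('a, 'm) ring_scheme \<Rightarrow> 'w set \<Rightarrow> (fgl_var multiset \<Rightarrow> 'a) \<Rightarrow> ('w multiset \<Rightarrow> 'a) \<Rightarrow> 'w multiset \<Rightarrow> 'a" where
  "subst1 R W f u = series_subst R {VX} W f (\<lambda>_. u)"

definition subst2 ::
  "('a, 'm) ring_scheme \<Rightarrow> 'w set \<Rightarrow> (fgl_var multiset \<Rightarrow> 'a) \<Rightarrow>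
    ('w multiset \<Rightarrow> 'a) \<Rightarrow> ('w multiset \<Rightarrow> 'a) \<Rightarrow> 'w multiset \<Rightarrow> 'a" where
  "subst2 R W F u v = series_subst R {VX, VY} W F (\<lambda>x. if x = VX then u else v)"


subsection \<open>The Lazard ring\<close>

definition lazard_vars :: "(nat \<times> nat) set" where
  "lazard_vars = {(i, j). 1 \<le> i \<and> 1 \<le> j}"

definition lazard_poly :: "((nat \<times> nat) multiset \<Rightarrow> int) ring" where
  "lazard_poly = mpoly_ring \<Z> lazard_vars"

text \<open>\<open>X + Y + \<Sum> a\<^bsub>i,j\<^esub> X\<^sup>i Y\<^sup>j\<close>, the sum over \<open>i, j \<ge> 1\<close>.\<close>

definition generic_series :: "fgl_var multiset \<Rightarrow> (nat \<times> nat) multiset \<Rightarrow> int" where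
  "generic_series m =
    (if m = {#VX#} \<or> m = {#VY#} then \<one>\<^bsub>lazard_poly\<^esub>
     else if set_mset m = {VX, VY} then ring.indexed_var \<Z> (count m VX, count m VY)
     else \<zero>\<^bsub>lazard_poly\<^esub>)"

definition lazard_ideal :: "((nat \<times> nat) multiset \<Rightarrow> int) set" where
  "lazard_ideal =
    (let P = lazard_poly; F = generic_series; W = {VX, VY, VZ};
         x = ring.indexed_var P VX; y = ring.indexed_var P VY; z = ring.indexed_var P VZ
     in Idl\<^bsub>P\<^esub>
       ({subst2 P W F (subst2 P W F x y) z m \<ominus>\<^bsub>P\<^esub> subst2 P W F x (subst2 P W F y z) m | m. True} \<union>
        {subst2 P W F x y m \<ominus>\<^bsub>P\<^esub> subst2 P W F y x m | m. True}))"

type_synonym lazard = "((nat \<times> nat) multiset \<Rightarrow> int) set"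

definition L :: "lazard ring" where
  "L = lazard_poly Quot lazard_ideal"

definition universal_fgl :: "fgl_var multiset \<Rightarrow> lazard" where
  "universal_fgl m = lazard_ideal +>\<^bsub>lazard_poly\<^esub> generic_series m"

text \<open>\<open>a\<^bsub>i,j\<^esub>\<close> has degree \<open>2 (i + j - 1)\<close>.\<close>

definition L_grading :: "nat \<Rightarrow> lazard set" where
  "L_grading n = (\<lambda>p. lazard_ideal +>\<^bsub>lazard_poly\<^esub> p) `
    mpoly_grading \<Z> (trivial_grading \<Z>) lazard_vars (\<lambda>(i, j). 2 * (i + j - 1)) n"

definition L_scal :: "int \<Rightarrow> lazard" where
  "L_scal k = [k] \<cdot>\<^bsub>L\<^esub> \<one>\<^bsub>L\<^esub>"


subsection \<open>Strict isomorphisms\<close>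

definition LB :: "(nat multiset \<Rightarrow> lazard) ring" where
  "LB = mpoly_ring L {1..}"

definition LB_t :: "nat \<Rightarrow> nat multiset \<Rightarrow> lazard" where
  "LB_t i = ring.indexed_var L i"

definition LB_etaL :: "lazard \<Rightarrow> nat multiset \<Rightarrow> lazard" where
  "LB_etaL x = ring.indexed_const L x"

text \<open>\<open>f(X) = X + \<Sum> t\<^sub>i X\<^bsup>i+1\<^esup>\<close>.\<close>

definition universal_iso :: "fgl_var multiset \<Rightarrow> nat multiset \<Rightarrow> lazard" where
  "universal_iso m =
    (if m = {#VX#} then \<one>\<^bsub>LB\<^esub>
     else if set_mset m = {VX} then LB_t (size m - 1)
     else \<zero>\<^bsub>LB\<^esub>)"

text \<open>The universal strict isomorphism goes from the left unit's formal group law \<open>F\<close> to the right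
  unit's formal group law \<open>G\<close>, that is \<open>f (F (X, Y)) = G (f X, f Y)\<close>, as in the formulas for 2-buds.\<close>

definition LB_etaR :: "lazard \<Rightarrow> nat multiset \<Rightarrow> lazard" where
  "LB_etaR =
    (let W = {VX, VY}; f = universal_iso
     in the_hom L LB (\<lambda>h.
       subst1 LB W f (\<lambda>m. LB_etaL (universal_fgl m)) =
       subst2 LB W (\<lambda>m. h (universal_fgl m)) f (subst1 LB W f (ring.indexed_var LB VY))))"

text \<open>The diagonal classifies the composite of the isomorphism of the left factor followed by that
  of the right factor.\<close>

definition LB_comult ::
  "(nat multiset \<Rightarrow> lazard) \<Rightarrow> ((nat multiset \<Rightarrow> lazard) \<times> (nat multiset \<Rightarrow> lazard) \<Rightarrow>\<^sub>0 int) set" where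
  "LB_comult =
    (let T = tensor_ring L LB LB_etaR LB LB_etaL;
         tens = pure_tensor L LB LB_etaR LB LB_etaL
     in the_hom LB T (\<lambda>h.
       (\<forall>x\<in>carrier L. h (LB_etaL x) = tens (LB_etaL x) \<one>\<^bsub>LB\<^esub>) \<and>
       (\<lambda>m. h (universal_iso m)) =
         subst1 T {VX} (\<lambda>m. tens \<one>\<^bsub>LB\<^esub> (universal_iso m)) (\<lambda>m. tens (universal_iso m) \<one>\<^bsub>LB\<^esub>)))"

definition LB_counit :: "(nat multiset \<Rightarrow> lazard) \<Rightarrow> lazard" where
  "LB_counit = the_hom LB L (\<lambda>h.
    (\<forall>x\<in>carrier L. h (LB_etaL x) = x) \<and> (\<forall>i\<ge>1. h (LB_t i) = \<zero>\<^bsub>L\<^esub>))"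

definition M_fgl :: "(int, lazard, nat multiset \<Rightarrow> lazard) hopf_algebroid" where
  "M_fgl =
    \<lparr>base = \<Z>,
     obj = L,
     mor = LB,
     scal = L_scal,
     etaL = LB_etaL,
     etaR = LB_etaR,
     comult = LB_comult,
     counit = LB_counit,
     obj_grading = L_grading,
     mor_grading = mpoly_grading L L_grading {1..} (\<lambda>i. 2 * i)\<rparr>"

text \<open>The generator of the group \<open>H\<^sup>1(\<omega>)\<close> of the stack of formal group laws, which has order two.\<close>

definition eta :: "(nat multiset \<Rightarrow> lazard) set" where
  "eta = (THE x. module_generator \<Z> (H1_fl M_fgl 1) x)"


section \<open>The comparison maps\<close>

text \<open>Each map of Hopf algebroids is given by its component on morphism rings; the component on
  object rings is its restriction along the left units.\<close>

text \<open>Underlying 2-buds of the universal formal group law and strict isomorphism: \<open>\<gamma>\<close> goes to the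
  coefficient of \<open>X Y\<close>, and \<open>t\<close> to the coefficient of \<open>X\<^sup>2\<close>. The images of the \<open>c\<^sub>n\<close> are then
  determined, because over the integers \<open>c\<^sub>n\<close> is a multiple of \<open>\<gamma>\<close>.\<close>

definition fgl_underlying_bud :: "(nat \<Rightarrow> int buds) \<Rightarrow> nat multiset \<Rightarrow> lazard" where
  "fgl_underlying_bud = the_hom (LB_buds \<Z>) LB (\<lambda>h.
    h (buds_etaL \<Z> (buds_gamma \<Z>)) = LB_etaL (universal_fgl {#VX, VY#}) \<and>
    h (buds_t \<Z>) = universal_iso {#VX, VX#})"

definition buds_forget :: "('a, 'm) ring_scheme \<Rightarrow> (nat \<Rightarrow> int buds) \<Rightarrow> nat \<Rightarrow> 'a buds" where
  "buds_forget A = the_hom (LB_buds \<Z>) (LB_buds A) (\<lambda>h.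
    h (buds_etaL \<Z> (buds_gamma \<Z>)) = buds_etaL A (buds_gamma A) \<and>
    h (buds_t \<Z>) = buds_t A)"

end

theory Submission
  imports Defs
begin

text \<open>Both Hopf algebroids have an element \<open>\<tau>\<close> of degree 2 on morphisms (\<open>t\<close>, respectively \<open>t\<^sub>1\<close>) with
  \<open>\<Delta> \<tau> = \<tau> \<otimes> 1 + 1 \<otimes> \<tau>\<close>, and every 1-cochain of degree 2 is \<open>\<eta>\<^sub>L u + r \<tau>\<close> with \<open>u\<close> of degree 2 and
  \<open>r\<close> in the base ring. Its coboundary is \<open>\<eta>\<^sub>R u \<otimes> 1\<close>, which the counits detect, so it is a cocycle
  iff \<open>u = 0\<close>. Hence \<open>H\<^sup>1\<close> is generated by the class of \<open>\<tau>\<close> in all cases, and the comparison maps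
  send \<open>t\<close> to \<open>t\<^sub>1\<close> and to \<open>t\<close>. Over the integers \<open>2 \<tau> = \<eta>\<^sub>R \<gamma> - \<eta>\<^sub>L \<gamma>\<close> is a coboundary, while \<open>t\<^sub>1\<close>
  is not one: the coboundaries of degree 2 are the \<open>2 k t\<^sub>1\<close>, and the additive formal group law gives
  a homomorphism from the Lazard ring to the integers.

  The structure maps of formal group laws exist because substituting series of the form
  \<open>x + higher terms\<close> is triangular on coefficients, so that the target \<open>G\<close> of a strict
  isomorphism \<open>f\<close> from \<open>F\<close> is the unique solution of \<open>f (F (X, Y)) = G (f X, f Y)\<close>.\<close>

text \<open>The structure maps, the comparison maps and \<open>eta\<close> are definite
  descriptions, so nothing can be computed with them before a candidate and its uniqueness are
  known. This obstacle shapes the development: most of it consists of universal properties, namely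
  those of polynomial rings, quotients, tensor products, symmetric algebras and the Lazard ring. The
  cohomology itself needs only small degrees. All generators have degree at least 2, so an element
  of degree 2 is linear in them.

  Uniqueness of the preimage is a statement about parity. Since twice \<open>t\<close> is a
  coboundary over the integers, the class of \<open>r\<close> times \<open>t\<close> depends only on
  whether \<open>r\<close> is even, and the comparison with formal group laws preserves this parity;
  the odd multiples, which all give one class, are those that hit \<open>eta\<close>.

  The comparison maps prescribe only the images of \<gamma> and \<open>t\<close>. This determines
  them because over the integers the relations force c_n to be n(n-1)/2 times \<gamma>.\<close>

section \<open>Submultisets and finite sums in abelian monoids\<close>

lemma finite_subset_mset: "finite {k. k \<subseteq># m}"
proof (induction m)
  case empty
  then show ?case by simp
next
  case (add x m)
  have "k \<subseteq># m \<or> (\<exists>l. l \<subseteq># m \<and> k = add_mset x l)" if "k \<subseteq># add_mset x m" for k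
    using that by (cases "x \<in># k")
      (metis insert_DiffM mset_subset_eq_add_mset_cancel, metis diff_single_trivial subset_eq_diff_conv add_mset_add_single)
  then have "{k. k \<subseteq># add_mset x m} \<subseteq> {k. k \<subseteq># m} \<union> add_mset x ` {k. k \<subseteq># m}" by auto
  with add show ?case by (meson finite_UnI finite_imageI finite_subset)
qed

lemma diff_diff_mset_cancel: "k \<subseteq># m \<Longrightarrow> m - (m - k) = (k :: 'a multiset)"
  by (auto simp: multiset_eq_iff subseteq_mset_def)

text \<open>The inner range may depend on the outer index. This is the case for convolutions, where
  a submultiset of a submultiset is summed over.\<close>

lemma (in abelian_monoid) finsum_Sigma:
  assumes "finite A" "\<And>x. x \<in> A \<Longrightarrow> finite (B x)"
    and "\<And>x y. x \<in> A \<Longrightarrow> y \<in> B x \<Longrightarrow> f x y \<in> carrier G"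
  shows "(\<Oplus>x\<in>A. \<Oplus>y\<in>B x. f x y) = (\<Oplus>p\<in>Sigma A B. f (fst p) (snd p))"
  using assms
proof (induction A rule: finite_induct)
  case empty
  then show ?case by simp
next
  case (insert a A)
  have 1: "Sigma (insert a A) B = Pair a ` B a \<union> Sigma A B" by auto
  have fin: "finite (Sigma A B)" using insert by auto
  have "(\<Oplus>p\<in>Pair a ` B a. f (fst p) (snd p)) = (\<Oplus>y\<in>B a. f a y)"
    by (subst add.finprod_reindex) (auto intro!: insert.prems inj_onI)
  moreover have "(\<Oplus>p\<in>Sigma (insert a A) B. f (fst p) (snd p))
      = (\<Oplus>p\<in>Pair a ` B a. f (fst p) (snd p)) \<oplus> (\<Oplus>p\<in>Sigma A B. f (fst p) (snd p))"
    unfolding 1 using insert fin by (intro add.finprod_Un_disjoint) auto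
  moreover have "(\<Oplus>x\<in>insert a A. \<Oplus>y\<in>B x. f x y)
      = (\<Oplus>y\<in>B a. f a y) \<oplus> (\<Oplus>x\<in>A. \<Oplus>y\<in>B x. f x y)"
    using insert by (intro add.finprod_insert) (auto intro!: add.finprod_closed)
  ultimately show ?case using insert by simp
qed

lemma (in abelian_monoid) finsum_reindex_bij_betw:
  assumes "bij_betw h A B" "\<And>y. y \<in> B \<Longrightarrow> f y \<in> carrier G"
  shows "(\<Oplus>x\<in>A. f (h x)) = (\<Oplus>y\<in>B. f y)"
proof -
  have "(\<Oplus>y\<in>h ` A. f y) = (\<Oplus>x\<in>A. f (h x))"
    using assms by (intro add.finprod_reindex) (auto simp: bij_betw_def)
  then show ?thesis using bij_betw_imp_surj_on[OF assms(1)] by simp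
qed

lemma (in abelian_monoid) finsum_eq_single:
  assumes "finite A" "i \<in> A" "\<And>j. j \<in> A \<Longrightarrow> j \<noteq> i \<Longrightarrow> f j = \<zero>" "f i \<in> carrier G"
  shows "(\<Oplus>j\<in>A. f j) = f i"
proof -
  have "(\<Oplus>j\<in>A. f j) = (\<Oplus>j\<in>A. if i = j then f j else \<zero>)"
    using assms by (intro add.finprod_cong') (auto simp: Pi_def)
  also have "\<dots> = f i"
  proof -
    have "(\<lambda>j. if j = i then f i else \<zero>) \<in> A \<rightarrow> carrier G" using assms by auto
    from add.finprod_singleton[OF assms(2,1) this] show ?thesis
      using assms by (smt (verit) add.finprod_cong' zero_closed Pi_I)
  qed
  finally show ?thesis .
qed

section \<open>Rings of power series\<close>

lemma series_carrier_iff: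
  "p \<in> carrier (series_ring R V) \<longleftrightarrow>
    (\<forall>m. p m \<in> carrier R) \<and> (\<forall>m. \<not> set_mset m \<subseteq> V \<longrightarrow> p m = \<zero>\<^bsub>R\<^esub>)"
  by (simp add: series_ring_def)

lemma series_coeff_closed: "p \<in> carrier (series_ring R V) \<Longrightarrow> p m \<in> carrier R"
  by (simp add: series_carrier_iff)

lemma series_coeff_outside:
  "p \<in> carrier (series_ring R V) \<Longrightarrow> \<not> set_mset m \<subseteq> V \<Longrightarrow> p m = \<zero>\<^bsub>R\<^esub>"
  by (simp add: series_carrier_iff)

lemma series_simps:
  "(p \<otimes>\<^bsub>series_ring R V\<^esub> q) m = (\<Oplus>\<^bsub>R\<^esub>k\<in>{k. k \<subseteq># m}. p k \<otimes>\<^bsub>R\<^esub> q (m - k))"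
  "\<one>\<^bsub>series_ring R V\<^esub> = (\<lambda>m. if m = {#} then \<one>\<^bsub>R\<^esub> else \<zero>\<^bsub>R\<^esub>)"
  "\<zero>\<^bsub>series_ring R V\<^esub> = (\<lambda>m. \<zero>\<^bsub>R\<^esub>)"
  "(p \<oplus>\<^bsub>series_ring R V\<^esub> q) m = p m \<oplus>\<^bsub>R\<^esub> q m"
  by (simp_all add: series_ring_def)

context cring
begin

lemma series_mult_closed:
  assumes "p \<in> carrier (series_ring R V)" "q \<in> carrier (series_ring R V)"
  shows "p \<otimes>\<^bsub>series_ring R V\<^esub> q \<in> carrier (series_ring R V)"
proof -
  have "(p \<otimes>\<^bsub>series_ring R V\<^esub> q) m = \<zero>" if m: "\<not> set_mset m \<subseteq> V" for m
  proof -
    have "p k \<otimes> q (m - k) = \<zero>" if "k \<subseteq># m" for k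
    proof (cases "set_mset k \<subseteq> V")
      case True
      have "set_mset m = set_mset k \<union> set_mset (m - k)"
        using that by (metis set_mset_union subset_mset.add_diff_inverse)
      then have "\<not> set_mset (m - k) \<subseteq> V" using True m by blast
      then show ?thesis using assms by (simp add: series_coeff_outside series_coeff_closed)
    next
      case False
      then show ?thesis using assms by (simp add: series_coeff_outside series_coeff_closed)
    qed
    then show ?thesis unfolding series_simps by (intro add.finprod_one_eqI) auto
  qed
  moreover have "(p \<otimes>\<^bsub>series_ring R V\<^esub> q) m \<in> carrier R" for m
    unfolding series_simps using assms by (auto intro!: add.finprod_closed simp: series_coeff_closed)
  ultimately show ?thesis by (simp add: series_carrier_iff)
qed

lemma series_mult_comm:
  fixes p q :: "'v multiset \<Rightarrow> 'a"
  assumes "p \<in> carrier (series_ring R V)" "q \<in> carrier (series_ring R V)"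
  shows "p \<otimes>\<^bsub>series_ring R V\<^esub> q = q \<otimes>\<^bsub>series_ring R V\<^esub> p"
proof
  fix m :: "'v multiset"
  have "bij_betw (\<lambda>k. m - k) {k. k \<subseteq># m} {k. k \<subseteq># m}"
    by (rule bij_betw_byWitness[of _ "\<lambda>k. m - k"]) (auto simp: diff_diff_mset_cancel)
  then have "(\<Oplus>k\<in>{k. k \<subseteq># m}. p (m - k) \<otimes> q (m - (m - k))) = (\<Oplus>k\<in>{k. k \<subseteq># m}. p k \<otimes> q (m - k))"
    by (rule finsum_reindex_bij_betw[where f = "\<lambda>k. p k \<otimes> q (m - k)"])
      (use assms in \<open>auto simp: series_coeff_closed\<close>)
  also have "(\<Oplus>k\<in>{k. k \<subseteq># m}. p (m - k) \<otimes> q (m - (m - k))) = (\<Oplus>k\<in>{k. k \<subseteq># m}. q k \<otimes> p (m - k))"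
    using assms by (intro add.finprod_cong')
      (auto simp: series_coeff_closed m_comm diff_diff_mset_cancel)
  finally show "(p \<otimes>\<^bsub>series_ring R V\<^esub> q) m = (q \<otimes>\<^bsub>series_ring R V\<^esub> p) m"
    unfolding series_simps by simp
qed

text \<open>Both sides sum over the ways to split \<open>m\<close> into three parts. On the left
  these are indexed by the sum of the first two parts together with the first part, on the right by
  the first two parts.\<close>

lemma series_mult_assoc:
  fixes p q r :: "'v multiset \<Rightarrow> 'a"
  assumes "p \<in> carrier (series_ring R V)" "q \<in> carrier (series_ring R V)" "r \<in> carrier (series_ring R V)"
  shows "p \<otimes>\<^bsub>series_ring R V\<^esub> q \<otimes>\<^bsub>series_ring R V\<^esub> r = p \<otimes>\<^bsub>series_ring R V\<^esub> (q \<otimes>\<^bsub>series_ring R V\<^esub> r)"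
proof
  fix m :: "'v multiset"
  note c = assms[THEN series_coeff_closed]
  let ?A = "Sigma {k. k \<subseteq># m} (\<lambda>k. {l. l \<subseteq># k})"
  let ?B = "Sigma {l. l \<subseteq># m} (\<lambda>l. {j. j \<subseteq># m - l})"
  let ?f = "\<lambda>x. p (fst x) \<otimes> (q (snd x) \<otimes> r (m - fst x - snd x))"
  \<comment> \<open>A pair consisting of \<open>k\<close>, the sum of the first two parts, and
    \<open>l\<close>, the first part, goes to the pair of parts \<open>l\<close> and
    \<open>k - l\<close>.\<close>
  have bij: "bij_betw (\<lambda>x. (snd x, fst x - snd x)) ?A ?B"
  proof (rule bij_betw_byWitness[of _ "\<lambda>x. (fst x + snd x, fst x)"])
    have "k - l \<subseteq># m - l" if "k \<subseteq># m" for k l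
      using that by (auto simp: subseteq_mset_def intro: diff_le_mono)
    then show "(\<lambda>x. (snd x, fst x - snd x)) ` ?A \<subseteq> ?B"
      by (auto intro: subset_mset.order_trans)
    have "l + j \<subseteq># m" if "l \<subseteq># m" "j \<subseteq># m - l" for l j
      using that by (simp add: subset_mset.le_diff_conv2 add.commute)
    then show "(\<lambda>x. (fst x + snd x, fst x)) ` ?B \<subseteq> ?A" by auto
  qed auto
  have "(p \<otimes>\<^bsub>series_ring R V\<^esub> q \<otimes>\<^bsub>series_ring R V\<^esub> r) m
      = (\<Oplus>k\<in>{k. k \<subseteq># m}. (\<Oplus>l\<in>{l. l \<subseteq># k}. p l \<otimes> q (k - l)) \<otimes> r (m - k))"
    by (simp add: series_simps)
  also have "\<dots> = (\<Oplus>k\<in>{k. k \<subseteq># m}. \<Oplus>l\<in>{l. l \<subseteq># k}. p l \<otimes> (q (k - l) \<otimes> r (m - k)))"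
    by (intro add.finprod_cong')
      (use c in \<open>auto simp: finsum_ldistr finite_subset_mset m_assoc Pi_def
        intro!: add.finprod_closed add.finprod_cong'\<close>)
  also have "\<dots> = (\<Oplus>x\<in>?A. p (snd x) \<otimes> (q (fst x - snd x) \<otimes> r (m - fst x)))"
    by (rule finsum_Sigma) (use c in \<open>auto simp: finite_subset_mset\<close>)
  also have "\<dots> = (\<Oplus>x\<in>?A. ?f (snd x, fst x - snd x))"
    by (intro add.finprod_cong') (use c in \<open>auto simp: Pi_def\<close>)
  also have "\<dots> = (\<Oplus>x\<in>?B. ?f x)"
    by (rule finsum_reindex_bij_betw[OF bij]) (use c in auto)
  also have "\<dots> = (\<Oplus>l\<in>{l. l \<subseteq># m}. \<Oplus>j\<in>{j. j \<subseteq># m - l}. p l \<otimes> (q j \<otimes> r (m - l - j)))"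
    by (subst finsum_Sigma) (use c in \<open>auto simp: finite_subset_mset\<close>)
  also have "\<dots> = (p \<otimes>\<^bsub>series_ring R V\<^esub> (q \<otimes>\<^bsub>series_ring R V\<^esub> r)) m"
    unfolding series_simps
    by (intro add.finprod_cong')
      (use c in \<open>auto simp: finsum_rdistr finite_subset_mset Pi_def intro!: add.finprod_closed\<close>)
  finally show "(p \<otimes>\<^bsub>series_ring R V\<^esub> q \<otimes>\<^bsub>series_ring R V\<^esub> r) m
    = (p \<otimes>\<^bsub>series_ring R V\<^esub> (q \<otimes>\<^bsub>series_ring R V\<^esub> r)) m" .
qed

lemma series_one_mult:
  assumes "p \<in> carrier (series_ring R V)"
  shows "\<one>\<^bsub>series_ring R V\<^esub> \<otimes>\<^bsub>series_ring R V\<^esub> p = p"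
proof
  fix m
  show "(\<one>\<^bsub>series_ring R V\<^esub> \<otimes>\<^bsub>series_ring R V\<^esub> p) m = p m"
    unfolding series_simps
    by (subst finsum_eq_single[of _ "{#}"])
      (use series_coeff_closed[OF assms] in \<open>auto simp: finite_subset_mset\<close>)
qed

lemma cring_series_ring: "cring (series_ring R V)"
proof (rule cringI)
  show "abelian_group (series_ring R V)"
  proof (rule abelian_groupI)
    fix p assume p: "p \<in> carrier (series_ring R V)"
    have "(\<lambda>m. \<ominus> p m) \<in> carrier (series_ring R V)"
      "(\<lambda>m. \<ominus> p m) \<oplus>\<^bsub>series_ring R V\<^esub> p = \<zero>\<^bsub>series_ring R V\<^esub>"
      using p by (auto simp: series_carrier_iff series_simps fun_eq_iff l_neg)
    then show "\<exists>q\<in>carrier (series_ring R V). q \<oplus>\<^bsub>series_ring R V\<^esub> p = \<zero>\<^bsub>series_ring R V\<^esub>" by blast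
  qed (auto simp: series_carrier_iff series_simps fun_eq_iff a_ac)
  show "comm_monoid (series_ring R V)"
    by (rule comm_monoidI) (blast intro: series_mult_closed series_mult_assoc series_one_mult
      series_mult_comm | simp add: series_carrier_iff series_simps)+
next
  fix p q r assume c: "p \<in> carrier (series_ring R V)" "q \<in> carrier (series_ring R V)"
    "r \<in> carrier (series_ring R V)"
  show "(p \<oplus>\<^bsub>series_ring R V\<^esub> q) \<otimes>\<^bsub>series_ring R V\<^esub> r =
    p \<otimes>\<^bsub>series_ring R V\<^esub> r \<oplus>\<^bsub>series_ring R V\<^esub> q \<otimes>\<^bsub>series_ring R V\<^esub> r"
  proof
    fix m
    show "((p \<oplus>\<^bsub>series_ring R V\<^esub> q) \<otimes>\<^bsub>series_ring R V\<^esub> r) m =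
      (p \<otimes>\<^bsub>series_ring R V\<^esub> r \<oplus>\<^bsub>series_ring R V\<^esub> q \<otimes>\<^bsub>series_ring R V\<^esub> r) m"
      unfolding series_simps using c[THEN series_coeff_closed]
      by (subst add.finprod_multf[symmetric]) (auto simp: l_distr intro!: add.finprod_cong')
  qed
qed

end


section \<open>Polynomial rings\<close>

text \<open>The value of the monomial \<open>m\<close> at \<open>s\<close>. The product runs over
  the variables of \<open>m\<close> only, because the set of all variables is infinite for the
  Lazard ring and for \<open>LB\<close>; \<open>mpow_superset\<close> leads back to the product over
  all variables in \<open>series_subst\<close>.\<close>

definition mpow :: "('b, 'n) ring_scheme \<Rightarrow> ('v \<Rightarrow> 'b) \<Rightarrow> 'v multiset \<Rightarrow> 'b" where
  "mpow S s m = (\<Otimes>\<^bsub>S\<^esub>v\<in>set_mset m. s v [^]\<^bsub>S\<^esub> count m v)"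

text \<open>Evaluation of a polynomial at \<open>s\<close>, with coefficients transported by
  \<open>\<phi>\<close>. A closed formula over the support is chosen because polynomials form an
  inductive set in which one element has many derivations, so that a recursion along the rules would
  have to be shown well defined.\<close>

definition mpoly_eval ::
  "('a, 'm) ring_scheme \<Rightarrow> ('b, 'n) ring_scheme \<Rightarrow> ('a \<Rightarrow> 'b) \<Rightarrow> ('v \<Rightarrow> 'b) \<Rightarrow> ('v multiset \<Rightarrow> 'a) \<Rightarrow> 'b" where
  "mpoly_eval R S \<phi> s p = (\<Oplus>\<^bsub>S\<^esub>m\<in>{m. p m \<noteq> \<zero>\<^bsub>R\<^esub>}. \<phi> (p m) \<otimes>\<^bsub>S\<^esub> mpow S s m)"

context cring
begin

lemma mpow_empty [simp]: "mpow R s {#} = \<one>"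
  by (simp add: mpow_def)

text \<open>Splits off one occurrence of a variable; this is the step of the inductions on
  \<open>mpow\<close> over the monomial.\<close>

lemma mpow_add_mset:
  assumes "s \<in> insert v (set_mset m) \<rightarrow> carrier R"
  shows "mpow R s (add_mset v m) = s v \<otimes> mpow R s m"
proof -
  \<comment> \<open>\<open>?P\<close> collects the variables other than \<open>v\<close>, so both
    sides are \<open>?P\<close> times a power of \<open>s v\<close>. The case in which
    \<open>v\<close> does not occur in \<open>m\<close> is separate because the support then
    grows.\<close>
  let ?U = "set_mset m - {v}" and ?P = "\<Otimes>u\<in>set_mset m - {v}. s u [^] count m u"
  have U: "set_mset (add_mset v m) = insert v ?U" by auto
  have P: "?P \<in> carrier R" using assms by (auto intro!: finprod_closed)
  have "mpow R s (add_mset v m) = s v [^] count (add_mset v m) v \<otimes>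
      (\<Otimes>u\<in>?U. s u [^] count (add_mset v m) u)"
    unfolding mpow_def U using assms by (intro finprod_insert) auto
  also have "(\<Otimes>u\<in>?U. s u [^] count (add_mset v m) u) = ?P"
    using assms by (intro finprod_cong') auto
  finally have 1: "mpow R s (add_mset v m) = s v \<otimes> (s v [^] count m v \<otimes> ?P)"
    using P assms by (simp add: m_ac)
  show ?thesis
  proof (cases "v \<in># m")
    case True
    then have "set_mset m = insert v ?U" by auto
    then have "mpow R s m = (\<Otimes>u\<in>insert v ?U. s u [^] count m u)" unfolding mpow_def by simp
    also have "\<dots> = s v [^] count m v \<otimes> ?P"
      using assms by (intro finprod_insert) auto
    finally show ?thesis using 1 by simp
  next
    case False
    then have "set_mset m = ?U" "count m v = 0" by (auto simp: not_in_iff)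
    then have "mpow R s m = ?P" "s v [^] count m v = \<one>" by (simp_all add: mpow_def)
    then show ?thesis using 1 P by simp
  qed
qed

lemma mpow_closed:
  assumes "s \<in> set_mset m \<rightarrow> carrier R"
  shows "mpow R s m \<in> carrier R"
  unfolding mpow_def using assms by (auto intro!: finprod_closed)

lemma mpow_superset:
  assumes "finite U" "set_mset m \<subseteq> U" "s \<in> U \<rightarrow> carrier R"
  shows "(\<Otimes>v\<in>U. s v [^] count m v) = mpow R s m"
  unfolding mpow_def using assms
  by (intro finprod_mono_neutral_cong_left[symmetric]) (auto simp: not_in_iff)

lemma mpow_cong:
  assumes "\<And>v. v \<in># m \<Longrightarrow> s v = s' v" "s \<in> set_mset m \<rightarrow> carrier R"
  shows "mpow R s m = mpow R s' m"
  unfolding mpow_def using assms by (intro finprod_cong') (auto simp: Pi_def)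

end

lemma ring_hom_mpow:
  assumes "cring R" "cring S" "h \<in> ring_hom R S" "s \<in> set_mset m \<rightarrow> carrier R"
  shows "h (mpow R s m) = mpow S (\<lambda>v. h (s v)) m"
  using assms(4)
proof (induction m)
  case empty
  interpret R: cring R by fact
  interpret S: cring S by fact
  show ?case using ring_hom_one[OF assms(3)] by simp
next
  case (add v m)
  interpret R: cring R by fact
  interpret S: cring S by fact
  have *: "s \<in> insert v (set_mset m) \<rightarrow> carrier R" "s v \<in> carrier R" "s \<in> set_mset m \<rightarrow> carrier R"
    using add.prems by auto
  then have **: "(\<lambda>v. h (s v)) \<in> insert v (set_mset m) \<rightarrow> carrier S"
    using ring_hom_closed[OF assms(3)] by auto
  show ?case using * add.IH
    by (simp add: R.mpow_add_mset S.mpow_add_mset[OF **] ring_hom_mult[OF assms(3)] R.mpow_closed)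
qed

lemma mpoly_ring_ops [simp]:
  "(\<otimes>\<^bsub>mpoly_ring R V\<^esub>) = (\<otimes>\<^bsub>series_ring R V\<^esub>)" "\<one>\<^bsub>mpoly_ring R V\<^esub> = \<one>\<^bsub>series_ring R V\<^esub>"
  "(\<oplus>\<^bsub>mpoly_ring R V\<^esub>) = (\<oplus>\<^bsub>series_ring R V\<^esub>)" "\<zero>\<^bsub>mpoly_ring R V\<^esub> = \<zero>\<^bsub>series_ring R V\<^esub>"
  by (simp_all add: mpoly_ring_def)

context cring
begin

lemma indexed_const_series: "c \<in> carrier R \<Longrightarrow> indexed_const c \<in> carrier (series_ring R V)"
  by (auto simp: series_carrier_iff indexed_const_def)

lemma indexed_var_eq: "indexed_var v = (\<lambda>m. if m = {#v#} then \<one> else \<zero>)"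
  by (rule ext) (auto simp: indexed_var_def indexed_pmult_def indexed_const_def
      dest: multi_member_split)

lemma indexed_var_series: "v \<in> V \<Longrightarrow> indexed_var v \<in> carrier (series_ring R V)"
  by (auto simp: series_carrier_iff indexed_var_eq)

lemma indexed_const_mult:
  assumes "c \<in> carrier R" "p \<in> carrier (series_ring R V)"
  shows "indexed_const c \<otimes>\<^bsub>series_ring R V\<^esub> p = (\<lambda>m. c \<otimes> p m)"
proof
  fix m
  show "(indexed_const c \<otimes>\<^bsub>series_ring R V\<^esub> p) m = c \<otimes> p m"
    unfolding series_simps using assms(1) series_coeff_closed[OF assms(2)]
    by (subst finsum_eq_single[of _ "{#}"]) (auto simp: finite_subset_mset indexed_const_def)
qed

lemma indexed_var_mult:
  assumes "p \<in> carrier (series_ring R V)"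
  shows "indexed_var v \<otimes>\<^bsub>series_ring R V\<^esub> p = indexed_pmult p v"
proof
  fix m
  show "(indexed_var v \<otimes>\<^bsub>series_ring R V\<^esub> p) m = indexed_pmult p v m"
  proof (cases "v \<in># m")
    case True
    then show ?thesis
      unfolding series_simps using series_coeff_closed[OF assms]
      by (subst finsum_eq_single[of _ "{#v#}"])
        (auto simp: finite_subset_mset indexed_var_eq indexed_pmult_def)
  next
    case False
    then have "{#v#} \<noteq> k" if "k \<subseteq># m" for k
      using that by auto
    then show ?thesis
      unfolding series_simps using series_coeff_closed[OF assms] False
      by (subst add.finprod_one_eqI) (auto simp: indexed_var_eq indexed_pmult_def)
  qed
qed

lemma mpoly_carrier: "carrier (mpoly_ring R V) = indexed_pset V (carrier R)"
  by (simp add: mpoly_ring_def)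

lemma mpoly_series: "p \<in> carrier (mpoly_ring R V) \<Longrightarrow> p \<in> carrier (series_ring R V)"
  unfolding mpoly_carrier
proof (induction rule: indexed_pset.induct)
  case (indexed_padd P Q)
  then show ?case by (simp add: indexed_padd_def series_carrier_iff)
next
  case (indexed_pmult P i)
  then show ?case
    by (metis indexed_var_mult indexed_var_series series_mult_closed)
qed (auto intro: indexed_const_series)

lemma mpoly_finite_support: "p \<in> carrier (mpoly_ring R V) \<Longrightarrow> finite {m. p m \<noteq> \<zero>}"
  unfolding mpoly_carrier
proof (induction rule: indexed_pset.induct)
  case (indexed_const k)
  then show ?case by (auto intro: finite_subset[of _ "{{#}}"] simp: indexed_const_def)
next
  case (indexed_padd P Q)
  then show ?case
    by (auto intro: finite_subset[of _ "{m. P m \<noteq> \<zero>} \<union> {m. Q m \<noteq> \<zero>}"] simp: indexed_padd_def)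
next
  case (indexed_pmult P i)
  have "{m. indexed_pmult P i m \<noteq> \<zero>} \<subseteq> add_mset i ` {m. P m \<noteq> \<zero>}"
    by (auto simp: indexed_pmult_def image_iff split: if_splits dest!: multi_member_split)
  then show ?case using indexed_pmult by (meson finite_imageI finite_subset)
qed

text \<open>The induction rule of the inductive set of polynomials, restated with the ring
  operations, so that distributivity and the homomorphism laws apply directly in each case.\<close>

lemma mpoly_induct [consumes 1, case_names const add var]:
  assumes "p \<in> carrier (mpoly_ring R V)"
    and "\<And>c. c \<in> carrier R \<Longrightarrow> P (indexed_const c)"
    and "\<And>p q. p \<in> carrier (mpoly_ring R V) \<Longrightarrow> q \<in> carrier (mpoly_ring R V) \<Longrightarrow> P p \<Longrightarrow> P q \<Longrightarrow>
      P (p \<oplus>\<^bsub>series_ring R V\<^esub> q)"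
    and "\<And>v p. v \<in> V \<Longrightarrow> p \<in> carrier (mpoly_ring R V) \<Longrightarrow> P p \<Longrightarrow>
      P (indexed_var v \<otimes>\<^bsub>series_ring R V\<^esub> p)"
  shows "P p"
  using assms(1) unfolding mpoly_carrier
proof (induction rule: indexed_pset.induct)
  case (indexed_const k)
  then show ?case by (rule assms(2))
next
  case (indexed_padd p q)
  then have "P (p \<oplus>\<^bsub>series_ring R V\<^esub> q)" by (intro assms(3)) (auto simp: mpoly_carrier)
  then show ?case by (simp add: indexed_padd_def series_ring_def)
next
  case (indexed_pmult p v)
  then have "P (indexed_var v \<otimes>\<^bsub>series_ring R V\<^esub> p)" by (intro assms(4)) (auto simp: mpoly_carrier)
  then show ?case using indexed_pmult by (simp add: indexed_var_mult mpoly_series mpoly_carrier)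
qed

lemma indexed_const_mpoly: "c \<in> carrier R \<Longrightarrow> indexed_const c \<in> carrier (mpoly_ring R V)"
  unfolding mpoly_carrier by (rule indexed_pset.indexed_const)

lemma mpoly_add_closed:
  "p \<in> carrier (mpoly_ring R V) \<Longrightarrow> q \<in> carrier (mpoly_ring R V) \<Longrightarrow>
    p \<oplus>\<^bsub>series_ring R V\<^esub> q \<in> carrier (mpoly_ring R V)"
  using indexed_pset.indexed_padd[of p V "carrier R" q]
  by (simp add: mpoly_carrier indexed_padd_def series_ring_def)

lemma mpoly_var_mult_closed:
  "v \<in> V \<Longrightarrow> p \<in> carrier (mpoly_ring R V) \<Longrightarrow>
    indexed_var v \<otimes>\<^bsub>series_ring R V\<^esub> p \<in> carrier (mpoly_ring R V)"
  using indexed_pset.indexed_pmult[of p V "carrier R" v]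
  by (simp add: mpoly_carrier indexed_var_mult[OF mpoly_series[unfolded mpoly_carrier]])

lemma indexed_var_mpoly: "v \<in> V \<Longrightarrow> indexed_var v \<in> carrier (mpoly_ring R V)"
  using indexed_pset.indexed_pmult[OF indexed_pset.indexed_const, of \<one> "carrier R" v V]
  by (simp add: mpoly_carrier indexed_var_def)

text \<open>The base case of closure under products: \<open>mpoly_mult_closed\<close> inducts on the
  left factor, and this lemma handles a constant there by induction on the right factor.\<close>

lemma mpoly_const_mult_closed:
  assumes c: "c \<in> carrier R" and p: "p \<in> carrier (mpoly_ring R V)"
  shows "indexed_const c \<otimes>\<^bsub>series_ring R V\<^esub> p \<in> carrier (mpoly_ring R V)"
proof -
  interpret S: cring "series_ring R V" by (rule cring_series_ring)
  have C: "indexed_const c \<in> carrier (series_ring R V)" by (rule indexed_const_series[OF c])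
  show ?thesis using p
  proof (induction rule: mpoly_induct)
    case (const d)
    have "indexed_const c \<otimes>\<^bsub>series_ring R V\<^esub> indexed_const d = indexed_const (c \<otimes> d)"
      using c const by (simp add: indexed_const_mult indexed_const_series) (auto simp: indexed_const_def)
    then show ?case using c const by (simp add: indexed_const_mpoly)
  next
    case (add p q)
    then show ?case using C by (simp add: S.r_distr mpoly_series mpoly_add_closed)
  next
    case (var v p)
    have "indexed_const c \<otimes>\<^bsub>series_ring R V\<^esub> (indexed_var v \<otimes>\<^bsub>series_ring R V\<^esub> p) =
      indexed_var v \<otimes>\<^bsub>series_ring R V\<^esub> (indexed_const c \<otimes>\<^bsub>series_ring R V\<^esub> p)"
      using C var indexed_var_series[of v V] by (simp add: S.m_lcomm mpoly_series)
    then show ?case using var by (simp add: mpoly_var_mult_closed)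
  qed
qed

lemma mpoly_mult_closed:
  assumes p: "p \<in> carrier (mpoly_ring R V)" and q: "q \<in> carrier (mpoly_ring R V)"
  shows "p \<otimes>\<^bsub>series_ring R V\<^esub> q \<in> carrier (mpoly_ring R V)"
proof -
  interpret S: cring "series_ring R V" by (rule cring_series_ring)
  show ?thesis using p
  proof (induction rule: mpoly_induct)
    case (const d)
    then show ?case using q by (rule mpoly_const_mult_closed)
  next
    case (add p p')
    then show ?case using q by (simp add: S.l_distr mpoly_series mpoly_add_closed)
  next
    case (var v p)
    then show ?case
      using indexed_var_series[of v V] q by (simp add: S.m_assoc mpoly_series mpoly_var_mult_closed)
  qed
qed

lemma one_series_eq_const: "\<one>\<^bsub>series_ring R V\<^esub> = indexed_const \<one>"
  by (auto simp: series_simps indexed_const_def)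

text \<open>The ring axioms for polynomials are inherited from series. Negation is not among the
  rules that build polynomials; it is obtained as multiplication by the constant -1.\<close>

lemma subcring_mpoly: "subcring (carrier (mpoly_ring R V)) (series_ring R V)"
proof -
  interpret S: cring "series_ring R V" by (rule cring_series_ring)
  show ?thesis
  proof (rule S.subcringI', rule S.subringI)
    show "carrier (mpoly_ring R V) \<subseteq> carrier (series_ring R V)" using mpoly_series by blast
    show "\<one>\<^bsub>series_ring R V\<^esub> \<in> carrier (mpoly_ring R V)"
      by (simp add: one_series_eq_const indexed_const_mpoly)
    show "\<ominus>\<^bsub>series_ring R V\<^esub> p \<in> carrier (mpoly_ring R V)" if "p \<in> carrier (mpoly_ring R V)" for p
    proof -
      have "\<ominus>\<^bsub>series_ring R V\<^esub> p = (\<ominus>\<^bsub>series_ring R V\<^esub> \<one>\<^bsub>series_ring R V\<^esub>) \<otimes>\<^bsub>series_ring R V\<^esub> p"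
        using mpoly_series[OF that] by (simp add: S.l_minus)
      moreover have "indexed_const (\<ominus> \<one>) \<oplus>\<^bsub>series_ring R V\<^esub> \<one>\<^bsub>series_ring R V\<^esub> = \<zero>\<^bsub>series_ring R V\<^esub>"
        by (auto simp: series_simps indexed_const_def l_neg fun_eq_iff)
      then have "\<ominus>\<^bsub>series_ring R V\<^esub> \<one>\<^bsub>series_ring R V\<^esub> = indexed_const (\<ominus> \<one>)"
        by (intro S.minus_equality) (auto intro: indexed_const_series)
      ultimately show ?thesis using mpoly_const_mult_closed[OF _ that, of "\<ominus> \<one>"] by simp
    qed
  qed (auto intro: mpoly_add_closed mpoly_mult_closed)
qed

lemma cring_mpoly_ring: "cring (mpoly_ring R V)"
proof -
  interpret S: cring "series_ring R V" by (rule cring_series_ring)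
  have "mpoly_ring R V = (series_ring R V)\<lparr>carrier := carrier (mpoly_ring R V)\<rparr>"
    by (simp add: mpoly_ring_def)
  then show ?thesis using subcring_mpoly S.subcring_iff[of "carrier (mpoly_ring R V)"] mpoly_series
    by (metis subsetI)
qed

lemma indexed_const_hom: "indexed_const \<in> ring_hom R (mpoly_ring R V)"
proof (rule ring_hom_memI)
  fix x y assume "x \<in> carrier R" "y \<in> carrier R"
  then show "indexed_const (x \<otimes> y) = indexed_const x \<otimes>\<^bsub>mpoly_ring R V\<^esub> indexed_const y"
    by (simp add: indexed_const_mult indexed_const_series) (auto simp: indexed_const_def)
qed (auto simp: indexed_const_mpoly one_series_eq_const, auto simp: indexed_const_def series_simps)

lemma indexed_const_hom_series: "indexed_const \<in> ring_hom R (series_ring R V)"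
  using indexed_const_hom[of V] by (auto simp: ring_hom_def indexed_const_series)

lemma mpoly_hom_unique:
  assumes "cring S" "h \<in> ring_hom (mpoly_ring R V) S" "h' \<in> ring_hom (mpoly_ring R V) S"
    and "\<And>c. c \<in> carrier R \<Longrightarrow> h (indexed_const c) = h' (indexed_const c)"
    and "\<And>v. v \<in> V \<Longrightarrow> h (indexed_var v) = h' (indexed_var v)"
    and "p \<in> carrier (mpoly_ring R V)"
  shows "h p = h' p"
  using assms(6)
proof (induction rule: mpoly_induct)
  case (const c)
  then show ?case using assms by simp
next
  case (add p q)
  then show ?case
    using ring_hom_add[OF assms(2), of p q] ring_hom_add[OF assms(3), of p q] by simp
next
  case (var v p)
  then show ?case
    using ring_hom_mult[OF assms(2), of "indexed_var v" p] ring_hom_mult[OF assms(3), of "indexed_var v" p]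
      assms(5) by (simp add: indexed_var_mpoly)
qed

section \<open>Evaluation of polynomials as a ring homomorphism\<close>

context
  fixes S :: "('c, 'n) ring_scheme" and \<phi> :: "'a \<Rightarrow> 'c" and s :: "'v \<Rightarrow> 'c" and V :: "'v set"
  assumes S: "cring S" and \<phi>: "\<phi> \<in> ring_hom R S" and s: "s \<in> V \<rightarrow> carrier S"
begin

interpretation S: cring S by (rule S)
interpretation \<phi>: ring_hom_cring R S \<phi>
  by (intro ring_hom_cringI) (use S \<phi> in \<open>auto intro: cring_axioms\<close>)

lemma mpow_closed_on: "set_mset m \<subseteq> V \<Longrightarrow> mpow S s m \<in> carrier S"
  using s by (intro S.mpow_closed) blast

text \<open>Replaces the support by any larger finite set of monomials, so that evaluations of
  different polynomials become sums over a common index set.\<close>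

lemma mpoly_eval_superset:
  assumes "p \<in> carrier (mpoly_ring R V)" "finite K" "{m. p m \<noteq> \<zero>} \<subseteq> K" "\<And>m. m \<in> K \<Longrightarrow> set_mset m \<subseteq> V"
  shows "mpoly_eval R S \<phi> s p = (\<Oplus>\<^bsub>S\<^esub>m\<in>K. \<phi> (p m) \<otimes>\<^bsub>S\<^esub> mpow S s m)"
  unfolding mpoly_eval_def using assms series_coeff_closed[OF mpoly_series[OF assms(1)]]
  by (intro S.add.finprod_mono_neutral_cong_left) (auto simp: mpow_closed_on)

lemma support_vars: "p \<in> carrier (mpoly_ring R V) \<Longrightarrow> p m \<noteq> \<zero> \<Longrightarrow> set_mset m \<subseteq> V"
  using series_coeff_outside[OF mpoly_series] by blast

lemma mpoly_eval_closed:
  "p \<in> carrier (mpoly_ring R V) \<Longrightarrow> mpoly_eval R S \<phi> s p \<in> carrier S"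
  unfolding mpoly_eval_def using support_vars[of p] series_coeff_closed[OF mpoly_series[of p V]]
  by (intro S.add.finprod_closed) (auto simp: mpow_closed_on)

lemma mpoly_eval_const: "c \<in> carrier R \<Longrightarrow> mpoly_eval R S \<phi> s (indexed_const c) = \<phi> c"
  by (subst mpoly_eval_superset[OF indexed_const_mpoly, of _ "{{#}}"])
    (auto simp: indexed_const_def split: if_splits)

lemma mpoly_eval_var: "v \<in> V \<Longrightarrow> mpoly_eval R S \<phi> s (indexed_var v) = s v"
  using s by (subst mpoly_eval_superset[OF indexed_var_mpoly, of _ "{{#v#}}"])
    (auto simp: indexed_var_eq S.mpow_add_mset Pi_def split: if_splits)

lemma mpoly_eval_add:
  assumes p: "p \<in> carrier (mpoly_ring R V)" and q: "q \<in> carrier (mpoly_ring R V)"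
  shows "mpoly_eval R S \<phi> s (p \<oplus>\<^bsub>series_ring R V\<^esub> q) =
    mpoly_eval R S \<phi> s p \<oplus>\<^bsub>S\<^esub> mpoly_eval R S \<phi> s q"
proof -
  let ?K = "{m. p m \<noteq> \<zero>} \<union> {m. q m \<noteq> \<zero>}"
  have K: "finite ?K" "\<And>m. m \<in> ?K \<Longrightarrow> set_mset m \<subseteq> V"
    using mpoly_finite_support[OF p] mpoly_finite_support[OF q] support_vars[OF p] support_vars[OF q] by auto
  note c = series_coeff_closed[OF mpoly_series[OF p]] series_coeff_closed[OF mpoly_series[OF q]]
  have "mpoly_eval R S \<phi> s (p \<oplus>\<^bsub>series_ring R V\<^esub> q) =
    (\<Oplus>\<^bsub>S\<^esub>m\<in>?K. \<phi> (p m \<oplus> q m) \<otimes>\<^bsub>S\<^esub> mpow S s m)"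
    using K by (subst mpoly_eval_superset[of _ ?K]) (auto simp: mpoly_add_closed p q series_simps)
  also have "\<dots> = (\<Oplus>\<^bsub>S\<^esub>m\<in>?K. \<phi> (p m) \<otimes>\<^bsub>S\<^esub> mpow S s m \<oplus>\<^bsub>S\<^esub> \<phi> (q m) \<otimes>\<^bsub>S\<^esub> mpow S s m)"
    using K(2) c by (intro S.add.finprod_cong') (auto simp: mpow_closed_on S.l_distr)
  also have "\<dots> = mpoly_eval R S \<phi> s p \<oplus>\<^bsub>S\<^esub> mpoly_eval R S \<phi> s q"
    using K c by (subst (1 2) mpoly_eval_superset[of _ ?K])
      (auto simp: p q mpow_closed_on intro!: S.add.finprod_multf)
  finally show ?thesis .
qed

lemma mpoly_eval_const_mult:
  assumes c: "c \<in> carrier R" and q: "q \<in> carrier (mpoly_ring R V)"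
  shows "mpoly_eval R S \<phi> s (indexed_const c \<otimes>\<^bsub>series_ring R V\<^esub> q) = \<phi> c \<otimes>\<^bsub>S\<^esub> mpoly_eval R S \<phi> s q"
proof -
  let ?K = "{m. q m \<noteq> \<zero>}"
  note K = mpoly_finite_support[OF q] support_vars[OF q]
  note cl = series_coeff_closed[OF mpoly_series[OF q]]
  have "mpoly_eval R S \<phi> s (indexed_const c \<otimes>\<^bsub>series_ring R V\<^esub> q) =
    (\<Oplus>\<^bsub>S\<^esub>m\<in>?K. \<phi> (c \<otimes> q m) \<otimes>\<^bsub>S\<^esub> mpow S s m)"
    using K c mpoly_const_mult_closed[OF c q]
    by (subst mpoly_eval_superset[of _ ?K]) (auto simp: indexed_const_mult mpoly_series q)
  also have "\<dots> = (\<Oplus>\<^bsub>S\<^esub>m\<in>?K. \<phi> c \<otimes>\<^bsub>S\<^esub> (\<phi> (q m) \<otimes>\<^bsub>S\<^esub> mpow S s m))"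
    using K cl c by (intro S.add.finprod_cong') (auto simp: mpow_closed_on S.m_assoc)
  also have "\<dots> = \<phi> c \<otimes>\<^bsub>S\<^esub> mpoly_eval R S \<phi> s q"
    unfolding mpoly_eval_def using K cl c by (subst S.finsum_rdistr) (auto simp: mpow_closed_on)
  finally show ?thesis .
qed

lemma mpoly_eval_var_mult:
  assumes v: "v \<in> V" and q: "q \<in> carrier (mpoly_ring R V)"
  shows "mpoly_eval R S \<phi> s (indexed_var v \<otimes>\<^bsub>series_ring R V\<^esub> q) = s v \<otimes>\<^bsub>S\<^esub> mpoly_eval R S \<phi> s q"
proof -
  let ?K = "{m. q m \<noteq> \<zero>}"
  note K = mpoly_finite_support[OF q] support_vars[OF q]
  note cl = series_coeff_closed[OF mpoly_series[OF q]]
  have sv: "s v \<in> carrier S" using v s by auto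
  have "mpoly_eval R S \<phi> s (indexed_var v \<otimes>\<^bsub>series_ring R V\<^esub> q) =
    (\<Oplus>\<^bsub>S\<^esub>m\<in>add_mset v ` ?K. \<phi> (indexed_pmult q v m) \<otimes>\<^bsub>S\<^esub> mpow S s m)"
  proof (subst mpoly_eval_superset[of _ "add_mset v ` ?K"])
    show "{m. (indexed_var v \<otimes>\<^bsub>series_ring R V\<^esub> q) m \<noteq> \<zero>} \<subseteq> add_mset v ` ?K"
      using mpoly_series[OF q]
      by (auto simp: indexed_var_mult indexed_pmult_def split: if_splits dest!: multi_member_split)
    show "set_mset m \<subseteq> V" if "m \<in> add_mset v ` ?K" for m
      using that v K(2) by fastforce
  qed (use K(1) mpoly_series[OF q] mpoly_var_mult_closed[OF v q] in \<open>auto simp: indexed_var_mult\<close>)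
  also have "\<dots> = (\<Oplus>\<^bsub>S\<^esub>m\<in>?K. \<phi> (indexed_pmult q v (add_mset v m)) \<otimes>\<^bsub>S\<^esub> mpow S s (add_mset v m))"
    using K v cl by (intro S.add.finprod_reindex) (auto simp: indexed_pmult_def mpow_closed_on inj_on_def)
  also have "\<dots> = (\<Oplus>\<^bsub>S\<^esub>m\<in>?K. s v \<otimes>\<^bsub>S\<^esub> (\<phi> (q m) \<otimes>\<^bsub>S\<^esub> mpow S s m))"
  proof (intro S.add.finprod_cong')
    fix m assume m: "m \<in> ?K"
    then have "set_mset m \<subseteq> V" using K by auto
    then have "s \<in> insert v (set_mset m) \<rightarrow> carrier S" using s v by auto
    with \<open>set_mset m \<subseteq> V\<close> show "\<phi> (indexed_pmult q v (add_mset v m)) \<otimes>\<^bsub>S\<^esub> mpow S s (add_mset v m) =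
      s v \<otimes>\<^bsub>S\<^esub> (\<phi> (q m) \<otimes>\<^bsub>S\<^esub> mpow S s m)"
      using sv cl by (simp add: indexed_pmult_def S.mpow_add_mset mpow_closed_on S.m_lcomm)
  qed (use K sv cl in \<open>auto simp: mpow_closed_on\<close>)
  also have "\<dots> = s v \<otimes>\<^bsub>S\<^esub> mpoly_eval R S \<phi> s q"
    unfolding mpoly_eval_def using K cl sv by (subst S.finsum_rdistr) (auto simp: mpow_closed_on)
  finally show ?thesis .
qed

text \<open>Induction on the left factor is enough for products, since multiplication by a constant
  and by a variable has been treated for an arbitrary right factor.\<close>

lemma mpoly_eval_hom: "mpoly_eval R S \<phi> s \<in> ring_hom (mpoly_ring R V) S"
proof (rule ring_hom_memI)
  interpret P: cring "series_ring R V" by (rule cring_series_ring)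
  fix p q assume p: "p \<in> carrier (mpoly_ring R V)" and q: "q \<in> carrier (mpoly_ring R V)"
  show "mpoly_eval R S \<phi> s (p \<otimes>\<^bsub>mpoly_ring R V\<^esub> q) =
    mpoly_eval R S \<phi> s p \<otimes>\<^bsub>S\<^esub> mpoly_eval R S \<phi> s q"
    unfolding mpoly_ring_ops using p
  proof (induction rule: mpoly_induct)
    case (const c)
    then show ?case using q by (simp add: mpoly_eval_const_mult mpoly_eval_const)
  next
    case (add p p')
    then show ?case using q
      by (simp add: P.l_distr mpoly_series mpoly_eval_add mpoly_mult_closed S.l_distr mpoly_eval_closed)
  next
    case (var v p)
    moreover have "s v \<in> carrier S" using s var by auto
    ultimately show ?case using q indexed_var_series[of v V]
      by (simp add: P.m_assoc mpoly_series mpoly_eval_var_mult mpoly_mult_closed S.m_assoc mpoly_eval_closed)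
  qed
qed (auto simp: mpoly_eval_closed mpoly_eval_add one_series_eq_const mpoly_eval_const)

end

end


section \<open>Substitution of power series\<close>

definition order_ge :: "('a, 'm) ring_scheme \<Rightarrow> nat \<Rightarrow> ('v multiset \<Rightarrow> 'a) \<Rightarrow> bool" where
  "order_ge R n p \<longleftrightarrow> (\<forall>m. size m < n \<longrightarrow> p m = \<zero>\<^bsub>R\<^esub>)"

lemma finite_bounded_multisets: "finite V \<Longrightarrow> finite {k. set_mset k \<subseteq> V \<and> size k \<le> n}"
proof -
  assume "finite V"
  moreover have "{k. set_mset k \<subseteq> V \<and> size k \<le> n} = (\<Union>i\<le>n. {k. set_mset k \<subseteq> V \<and> size k = i})" by auto
  ultimately show ?thesis by (simp add: finite_multisets_of_size[unfolded multisets_of_size_def])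
qed

context cring
begin

lemma series_finsum_coeff:
  assumes "f \<in> A \<rightarrow> carrier (series_ring R W)"
  shows "(\<Oplus>\<^bsub>series_ring R W\<^esub>a\<in>A. f a) m = (\<Oplus>a\<in>A. f a m)"
proof (cases "finite A")
  case True
  interpret S: cring "series_ring R W" by (rule cring_series_ring)
  show ?thesis using True assms
  proof (induction A rule: finite_induct)
    case (insert a A)
    have *: "f \<in> A \<rightarrow> carrier (series_ring R W)" "f a \<in> carrier (series_ring R W)"
      using insert.prems by auto
    then have **: "(\<lambda>a. f a m) \<in> A \<rightarrow> carrier R" "f a m \<in> carrier R"
      by (auto simp: Pi_def series_coeff_closed)
    show ?case
      using insert.hyps insert.IH[OF *(1)] S.add.finprod_insert[OF insert.hyps *]
        add.finprod_insert[OF insert.hyps **] by (simp add: series_simps)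
  qed (simp add: series_simps)
next
  case False
  interpret S: cring "series_ring R W" by (rule cring_series_ring)
  show ?thesis using False by (simp add: series_simps)
qed

lemma order_ge_mult:
  fixes p q :: "'w multiset \<Rightarrow> 'a"
  assumes "p \<in> carrier (series_ring R W)" "q \<in> carrier (series_ring R W)"
    and "order_ge R a p" "order_ge R b q"
  shows "order_ge R (a + b) (p \<otimes>\<^bsub>series_ring R W\<^esub> q)"
  unfolding order_ge_def
proof (intro allI impI)
  fix m :: "'w multiset" assume m: "size m < a + b"
  have "p k \<otimes> q (m - k) = \<zero>" if "k \<subseteq># m" for k
  proof (cases "size k < a")
    case False
    then have "size (m - k) < b" using m that size_mset_mono[OF that] by (simp add: size_Diff_submset)
    then show ?thesis using assms by (simp add: order_ge_def series_coeff_closed)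
  qed (use assms in \<open>simp add: order_ge_def series_coeff_closed\<close>)
  then show "(p \<otimes>\<^bsub>series_ring R W\<^esub> q) m = \<zero>"
    unfolding series_simps by (intro add.finprod_one_eqI) auto
qed

lemma mpow_series_closed:
  "s \<in> set_mset k \<rightarrow> carrier (series_ring R W) \<Longrightarrow> mpow (series_ring R W) s k \<in> carrier (series_ring R W)"
  by (rule cring.mpow_closed[OF cring_series_ring])

text \<open>Each factor without constant term raises the order by one. This is what justifies the
  bound \<open>size k \<le> size m\<close> in \<open>series_subst\<close>: larger monomials
  contribute nothing to the coefficient of \<open>m\<close>.\<close>

lemma order_ge_mpow:
  assumes "\<And>v. v \<in># k \<Longrightarrow> s v \<in> carrier (series_ring R W)" "\<And>v. v \<in># k \<Longrightarrow> s v {#} = \<zero>"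
  shows "order_ge R (size k) (mpow (series_ring R W) s k)"
  using assms
proof (induction k)
  case empty
  then show ?case by (simp add: order_ge_def)
next
  case (add v k)
  interpret S: cring "series_ring R W" by (rule cring_series_ring)
  have "order_ge R (1 + size k) (s v \<otimes>\<^bsub>series_ring R W\<^esub> mpow (series_ring R W) s k)"
    using add by (intro order_ge_mult mpow_series_closed) (auto simp: order_ge_def)
  then show ?case using add.prems by (subst S.mpow_add_mset) auto
qed

lemma monomial_mpoly:
  "c \<in> carrier R \<Longrightarrow> set_mset k \<subseteq> V \<Longrightarrow> (\<lambda>m. if m = k then c else \<zero>) \<in> carrier (mpoly_ring R V)"
proof (induction k)
  case empty
  then show ?case using indexed_const_mpoly[of c V] by (simp add: indexed_const_def)
next
  case (add v k)
  have "(\<lambda>m. if m = add_mset v k then c else \<zero>) = indexed_pmult (\<lambda>m. if m = k then c else \<zero>) v"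
    by (auto simp: indexed_pmult_def fun_eq_iff dest!: multi_member_split)
  then show ?case
    using add indexed_pset.indexed_pmult[of _ V "carrier R" v] by (simp add: mpoly_carrier)
qed

text \<open>Together with \<open>mpoly_finite_support\<close> this identifies the inductively
  defined polynomials with the series of finite support. The series is assembled one monomial of its
  support at a time.\<close>

lemma mpolyI:
  assumes "p \<in> carrier (series_ring R V)" "finite {m. p m \<noteq> \<zero>}"
  shows "p \<in> carrier (mpoly_ring R V)"
proof -
  have "(\<lambda>m. if m \<in> K then p m else \<zero>) \<in> carrier (mpoly_ring R V)"
    if "finite K" "K \<subseteq> {m. p m \<noteq> \<zero>}" for K
    using that
  proof (induction K rule: finite_induct)
    case empty
    then show ?case using indexed_const_mpoly[of \<zero> V] by (simp add: indexed_zero_def)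
  next
    case (insert a K)
    have "(\<lambda>m. if m \<in> insert a K then p m else \<zero>) =
      (\<lambda>m. if m = a then p a else \<zero>) \<oplus>\<^bsub>series_ring R V\<^esub> (\<lambda>m. if m \<in> K then p m else \<zero>)"
      using insert(2) series_coeff_closed[OF assms(1)] by (auto simp: series_simps fun_eq_iff)
    moreover have "set_mset a \<subseteq> V" using insert.prems series_coeff_outside[OF assms(1)] by auto
    ultimately show ?case using insert series_coeff_closed[OF assms(1)]
      by (auto intro!: mpoly_add_closed monomial_mpoly)
  qed
  from this[OF assms(2)] have "(\<lambda>m. if m \<in> {m. p m \<noteq> \<zero>} then p m else \<zero>) \<in> carrier (mpoly_ring R V)" by blast
  moreover have "(\<lambda>m. if m \<in> {m. p m \<noteq> \<zero>} then p m else \<zero>) = p" by auto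
  ultimately show ?thesis by simp
qed

text \<open>The bridge from series to polynomials: the coefficients of a substitution up to size
  \<open>n\<close> depend only on this polynomial, so identities for polynomials carry over to
  series one coefficient at a time.\<close>

definition series_trunc :: "nat \<Rightarrow> ('v multiset \<Rightarrow> 'a) \<Rightarrow> 'v multiset \<Rightarrow> 'a" where
  "series_trunc n F = (\<lambda>k. if size k \<le> n then F k else \<zero>)"

lemma series_trunc_mpoly:
  assumes "F \<in> carrier (series_ring R V)" "finite V"
  shows "series_trunc n F \<in> carrier (mpoly_ring R V)"
proof (rule mpolyI)
  have "{m. series_trunc n F m \<noteq> \<zero>} \<subseteq> {k. set_mset k \<subseteq> V \<and> size k \<le> n}"
    using series_coeff_outside[OF assms(1)] by (auto simp: series_trunc_def)
  then show "finite {m. series_trunc n F m \<noteq> \<zero>}"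
    by (rule finite_subset) (rule finite_bounded_multisets[OF assms(2)])
qed (use assms in \<open>auto simp: series_trunc_def series_carrier_iff\<close>)

section \<open>Substitution as a ring homomorphism\<close>

context
  fixes V :: "'v set" and W :: "'w set" and \<sigma> :: "'v \<Rightarrow> 'w multiset \<Rightarrow> 'a"
  assumes V: "finite V" and \<sigma>: "\<And>v. v \<in> V \<Longrightarrow> \<sigma> v \<in> carrier (series_ring R W)"
    and \<sigma>0: "\<And>v. v \<in> V \<Longrightarrow> \<sigma> v {#} = \<zero>"
begin

interpretation S: cring "series_ring R W" by (rule cring_series_ring)

lemma mpow_subst_closed: "set_mset k \<subseteq> V \<Longrightarrow> mpow (series_ring R W) \<sigma> k \<in> carrier (series_ring R W)"
  using \<sigma> by (intro mpow_series_closed) auto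

lemma mpow_subst_zero: "set_mset k \<subseteq> V \<Longrightarrow> size m < size k \<Longrightarrow> mpow (series_ring R W) \<sigma> k m = \<zero>"
  using order_ge_mpow[of k \<sigma> W] \<sigma> \<sigma>0 unfolding order_ge_def by blast

lemma series_subst_coeff:
  assumes "\<And>k. F k \<in> carrier R"
  shows "series_subst R V W F \<sigma> m =
    (\<Oplus>k\<in>{k. set_mset k \<subseteq> V \<and> size k \<le> size m}. F k \<otimes> mpow (series_ring R W) \<sigma> k m)"
  unfolding series_subst_def using \<sigma> V assms
  by (intro add.finprod_cong') (auto simp: S.mpow_superset series_coeff_closed[OF mpow_subst_closed] Pi_def)

text \<open>The comparison passes through the union of both index sets. Monomials larger than
  \<open>m\<close> drop out by their order, and small monomials outside \<open>K\<close> have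
  coefficient zero in \<open>F\<close>.\<close>

lemma series_subst_coeff_superset:
  assumes F: "\<And>k. F k \<in> carrier R"
    and K: "finite K" "\<And>k. k \<in> K \<Longrightarrow> set_mset k \<subseteq> V" "\<And>k. set_mset k \<subseteq> V \<Longrightarrow> size k \<le> size m \<Longrightarrow> F k \<noteq> \<zero> \<Longrightarrow> k \<in> K"
  shows "series_subst R V W F \<sigma> m = (\<Oplus>k\<in>K. F k \<otimes> mpow (series_ring R W) \<sigma> k m)"
proof -
  note c = F series_coeff_closed[OF mpow_subst_closed]
  let ?L = "{k. set_mset k \<subseteq> V \<and> size k \<le> size m}" and ?f = "\<lambda>k. F k \<otimes> mpow (series_ring R W) \<sigma> k m"
  have z: "F k = \<zero>" if "set_mset k \<subseteq> V" "size k \<le> size m" "k \<notin> K" for k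
    using K(3) that by blast
  have "(\<Oplus>k\<in>?L. ?f k) = (\<Oplus>k\<in>?L \<union> K. ?f k)"
    using K c finite_bounded_multisets[OF V] mpow_subst_zero
    by (intro add.finprod_mono_neutral_cong_left) (auto simp: Pi_def)
  also have "\<dots> = (\<Oplus>k\<in>K. ?f k)"
    using K(1,2) z c finite_bounded_multisets[OF V]
    by (intro add.finprod_mono_neutral_cong_right) (auto simp: Pi_def)
  finally show ?thesis using series_subst_coeff[OF F] by simp
qed

lemma series_subst_closed:
  assumes "F \<in> carrier (series_ring R V)"
  shows "series_subst R V W F \<sigma> \<in> carrier (series_ring R W)"
proof -
  note F = series_coeff_closed[OF assms]
  have "series_subst R V W F \<sigma> m = \<zero>" if "\<not> set_mset m \<subseteq> W" for m
    unfolding series_subst_coeff[OF F] using series_coeff_outside[OF mpow_subst_closed that] F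
    by (intro add.finprod_one_eqI) auto
  moreover have "series_subst R V W F \<sigma> m \<in> carrier R" for m
    unfolding series_subst_coeff[OF F] using F series_coeff_closed[OF mpow_subst_closed]
    by (intro add.finprod_closed) auto
  ultimately show ?thesis by (simp add: series_carrier_iff)
qed

lemma series_subst_local:
  assumes "F \<in> carrier (series_ring R V)" "\<And>k. size k \<le> size m \<Longrightarrow> F k = G k"
  shows "series_subst R V W F \<sigma> m = series_subst R V W G \<sigma> m"
proof -
  have "G k \<in> carrier R" if "size k \<le> size m" for k
    using series_coeff_closed[OF assms(1), of k] assms(2)[OF that] by simp
  then show ?thesis
    unfolding series_subst_def using assms(2) \<sigma> V
    by (intro add.finprod_cong') (auto simp: Pi_def S.mpow_superset series_coeff_closed[OF mpow_subst_closed])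
qed

lemma series_subst_trunc:
  assumes "F \<in> carrier (series_ring R V)" "size m \<le> n"
  shows "series_subst R V W (series_trunc n F) \<sigma> m = series_subst R V W F \<sigma> m"
  using assms mpoly_series[OF series_trunc_mpoly[OF _ V]]
  by (intro series_subst_local) (auto simp: series_trunc_def)

text \<open>For a polynomial, substitution is evaluation in the series ring of the target variables;
  this is where its homomorphism property comes from.\<close>

lemma mpoly_eval_eq_subst:
  assumes p: "p \<in> carrier (mpoly_ring R V)"
  shows "mpoly_eval R (series_ring R W) indexed_const \<sigma> p = series_subst R V W p \<sigma>"
proof
  fix m
  note F = series_coeff_closed[OF mpoly_series[OF p]]
  have sup: "set_mset k \<subseteq> V" if "p k \<noteq> \<zero>" for k
    using that series_coeff_outside[OF mpoly_series[OF p]] by blast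
  have "mpoly_eval R (series_ring R W) indexed_const \<sigma> p m =
    (\<Oplus>k\<in>{k. p k \<noteq> \<zero>}. (indexed_const (p k) \<otimes>\<^bsub>series_ring R W\<^esub> mpow (series_ring R W) \<sigma> k) m)"
    unfolding mpoly_eval_def using sup F
    by (intro series_finsum_coeff) (auto intro!: S.m_closed mpow_subst_closed indexed_const_series)
  also have "\<dots> = (\<Oplus>k\<in>{k. p k \<noteq> \<zero>}. p k \<otimes> mpow (series_ring R W) \<sigma> k m)"
    using sup F by (intro add.finprod_cong')
      (auto simp: indexed_const_mult mpow_subst_closed series_coeff_closed[OF mpow_subst_closed])
  also have "\<dots> = series_subst R V W p \<sigma> m"
    using mpoly_finite_support[OF p] sup F by (intro series_subst_coeff_superset[symmetric]) auto
  finally show "mpoly_eval R (series_ring R W) indexed_const \<sigma> p m = series_subst R V W p \<sigma> m" .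
qed

lemma series_subst_mpoly_hom:
  "(\<lambda>p. series_subst R V W p \<sigma>) \<in> ring_hom (mpoly_ring R V) (series_ring R W)"
proof -
  have h: "mpoly_eval R (series_ring R W) indexed_const \<sigma> \<in> ring_hom (mpoly_ring R V) (series_ring R W)"
    using \<sigma> by (intro mpoly_eval_hom cring_series_ring indexed_const_hom_series) auto
  interpret P: cring "mpoly_ring R V" by (rule cring_mpoly_ring)
  show ?thesis
  proof (rule ring_hom_memI)
    fix p q assume *: "p \<in> carrier (mpoly_ring R V)" "q \<in> carrier (mpoly_ring R V)"
    show "series_subst R V W (p \<otimes>\<^bsub>mpoly_ring R V\<^esub> q) \<sigma> =
      series_subst R V W p \<sigma> \<otimes>\<^bsub>series_ring R W\<^esub> series_subst R V W q \<sigma>"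
      using ring_hom_mult[OF h *] * mpoly_eval_eq_subst P.m_closed[OF *] by simp
    show "series_subst R V W (p \<oplus>\<^bsub>mpoly_ring R V\<^esub> q) \<sigma> =
      series_subst R V W p \<sigma> \<oplus>\<^bsub>series_ring R W\<^esub> series_subst R V W q \<sigma>"
      using ring_hom_add[OF h *] * mpoly_eval_eq_subst P.a_closed[OF *] by simp
  next
    show "series_subst R V W \<one>\<^bsub>mpoly_ring R V\<^esub> \<sigma> = \<one>\<^bsub>series_ring R W\<^esub>"
      using ring_hom_one[OF h] mpoly_eval_eq_subst[OF P.one_closed] by simp
  qed (auto intro: series_subst_closed mpoly_series)
qed

lemma series_subst_const: "c \<in> carrier R \<Longrightarrow> series_subst R V W (indexed_const c) \<sigma> = indexed_const c"
  using mpoly_eval_eq_subst[OF indexed_const_mpoly, of c] \<sigma>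
    mpoly_eval_const[OF cring_series_ring indexed_const_hom_series, of \<sigma> V W c] by (simp add: Pi_def)

lemma series_subst_var: "v \<in> V \<Longrightarrow> series_subst R V W (indexed_var v) \<sigma> = \<sigma> v"
  using mpoly_eval_eq_subst[OF indexed_var_mpoly, of v] \<sigma>
    mpoly_eval_var[OF cring_series_ring indexed_const_hom_series, of \<sigma> V W v] by (simp add: Pi_def)

lemma series_subst_zero_coeff:
  assumes F: "F \<in> carrier (series_ring R V)"
  shows "series_subst R V W F \<sigma> {#} = F {#}"
  using series_coeff_closed[OF F]
  by (subst series_subst_coeff_superset[of _ "{{#}}"]) (auto simp: series_simps)

text \<open>At the coefficient \<open>m\<close> both arguments may be truncated at
  \<open>size m\<close>, since a coefficient of a product involves only coefficients of its factors
  that are no larger. The truncations are polynomials, for which the claim is known.\<close>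

lemma series_subst_hom:
  "(\<lambda>F. series_subst R V W F \<sigma>) \<in> ring_hom (series_ring R V) (series_ring R W)"
proof (rule ring_hom_memI)
  interpret P: cring "series_ring R V" by (rule cring_series_ring)
  note h = series_subst_mpoly_hom
  fix F G assume *: "F \<in> carrier (series_ring R V)" "G \<in> carrier (series_ring R V)"
  note t = series_trunc_mpoly[OF *(1) V] series_trunc_mpoly[OF *(2) V]
  show "series_subst R V W (F \<otimes>\<^bsub>series_ring R V\<^esub> G) \<sigma> =
      series_subst R V W F \<sigma> \<otimes>\<^bsub>series_ring R W\<^esub> series_subst R V W G \<sigma>"
  proof
    fix m :: "'w multiset"
    let ?n = "size m"
    let ?F = "series_trunc ?n F" and ?G = "series_trunc ?n G"
    have "series_subst R V W (F \<otimes>\<^bsub>series_ring R V\<^esub> G) \<sigma> m =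
      series_subst R V W (?F \<otimes>\<^bsub>series_ring R V\<^esub> ?G) \<sigma> m"
    proof (rule series_subst_local)
      fix k :: "'v multiset" assume k: "size k \<le> size m"
      have "size l \<le> ?n" "size (k - l) \<le> ?n" if "l \<subseteq># k" for l
        using k size_mset_mono[OF that] size_mset_mono[OF diff_subset_eq_self[of k l]] by auto
      then show "(F \<otimes>\<^bsub>series_ring R V\<^esub> G) k = (?F \<otimes>\<^bsub>series_ring R V\<^esub> ?G) k"
        unfolding series_simps using *[THEN series_coeff_closed]
        by (intro add.finprod_cong') (auto simp: series_trunc_def)
    qed (use * in auto)
    also have "\<dots> = (series_subst R V W ?F \<sigma> \<otimes>\<^bsub>series_ring R W\<^esub> series_subst R V W ?G \<sigma>) m"
      using ring_hom_mult[OF h t(1) t(2)] by simp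
    also have "\<dots> = (series_subst R V W F \<sigma> \<otimes>\<^bsub>series_ring R W\<^esub> series_subst R V W G \<sigma>) m"
      unfolding series_simps
    proof (intro add.finprod_cong' refl)
      fix k assume "k \<in> {k. k \<subseteq># m}"
      then have k: "size k \<le> size m" by (auto dest: size_mset_mono)
      then have "size (m - k) \<le> size m" by (auto intro: size_mset_mono)
      with k show "series_subst R V W ?F \<sigma> k \<otimes> series_subst R V W ?G \<sigma> (m - k) =
        series_subst R V W F \<sigma> k \<otimes> series_subst R V W G \<sigma> (m - k)"
        using * by (simp add: series_subst_trunc)
    qed (use *[THEN series_subst_closed, THEN series_coeff_closed] in auto)
    finally show "series_subst R V W (F \<otimes>\<^bsub>series_ring R V\<^esub> G) \<sigma> m =
      (series_subst R V W F \<sigma> \<otimes>\<^bsub>series_ring R W\<^esub> series_subst R V W G \<sigma>) m" .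
  qed
  show "series_subst R V W (F \<oplus>\<^bsub>series_ring R V\<^esub> G) \<sigma> =
      series_subst R V W F \<sigma> \<oplus>\<^bsub>series_ring R W\<^esub> series_subst R V W G \<sigma>"
  proof
    fix m
    have "series_subst R V W (F \<oplus>\<^bsub>series_ring R V\<^esub> G) \<sigma> m =
      series_subst R V W (series_trunc (size m) F \<oplus>\<^bsub>series_ring R V\<^esub> series_trunc (size m) G) \<sigma> m"
      using * by (intro series_subst_local) (auto simp: series_simps series_trunc_def)
    also have "\<dots> = (series_subst R V W F \<sigma> \<oplus>\<^bsub>series_ring R W\<^esub> series_subst R V W G \<sigma>) m"
      using ring_hom_add[OF h t(1) t(2)] * by (simp add: series_simps series_subst_trunc)
    finally show "series_subst R V W (F \<oplus>\<^bsub>series_ring R V\<^esub> G) \<sigma> m =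
      (series_subst R V W F \<sigma> \<oplus>\<^bsub>series_ring R W\<^esub> series_subst R V W G \<sigma>) m" .
  qed
qed (use ring_hom_one[OF series_subst_mpoly_hom] in \<open>auto intro: series_subst_closed\<close>)

end

text \<open>As functions of a polynomial \<open>F\<close> both sides are ring homomorphisms with the
  same values on constants and variables. Truncation at \<open>size m\<close> extends the equality
  to series.\<close>

lemma series_subst_subst:
  fixes V :: "'v set" and U :: "'u set" and W :: "'w set"
    and \<sigma> :: "'v \<Rightarrow> 'u multiset \<Rightarrow> 'a" and \<tau> :: "'u \<Rightarrow> 'w multiset \<Rightarrow> 'a"
  assumes V: "finite V" and U: "finite U"
    and \<sigma>: "\<And>v. v \<in> V \<Longrightarrow> \<sigma> v \<in> carrier (series_ring R U)" "\<And>v. v \<in> V \<Longrightarrow> \<sigma> v {#} = \<zero>"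
    and \<tau>: "\<And>u. u \<in> U \<Longrightarrow> \<tau> u \<in> carrier (series_ring R W)" "\<And>u. u \<in> U \<Longrightarrow> \<tau> u {#} = \<zero>"
    and F: "F \<in> carrier (series_ring R V)"
  shows "series_subst R U W (series_subst R V U F \<sigma>) \<tau> =
    series_subst R V W F (\<lambda>v. series_subst R U W (\<sigma> v) \<tau>)"
proof
  fix m :: "'w multiset"
  let ?F = "series_trunc (size m) F" and ?\<rho> = "\<lambda>v. series_subst R U W (\<sigma> v) \<tau>"
  have \<rho>: "?\<rho> v \<in> carrier (series_ring R W)" "?\<rho> v {#} = \<zero>" if "v \<in> V" for v
    using that by (simp_all add: series_subst_closed[OF U \<tau>] series_subst_zero_coeff[OF U \<tau>] \<sigma>)
  note t = series_trunc_mpoly[OF F V, of "size m"]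
  have hom: "(\<lambda>F. series_subst R U W (series_subst R V U F \<sigma>) \<tau>) \<in> ring_hom (mpoly_ring R V) (series_ring R W)"
    using ring_hom_trans[OF series_subst_mpoly_hom[OF V \<sigma>] series_subst_hom[OF U \<tau>]] by (simp add: comp_def)
  have "series_subst R U W (series_subst R V U F \<sigma>) \<tau> m = series_subst R U W (series_subst R V U ?F \<sigma>) \<tau> m"
    using F by (intro series_subst_local[OF U \<tau>] series_subst_closed[OF V \<sigma>])
      (auto simp: series_subst_trunc[OF V \<sigma>])
  also have "series_subst R U W (series_subst R V U ?F \<sigma>) \<tau> = series_subst R V W ?F ?\<rho>"
    using mpoly_hom_unique[OF cring_series_ring hom series_subst_mpoly_hom[OF V \<rho>] _ _ t]
    by (simp add: series_subst_const[OF V \<sigma>] series_subst_const[OF U \<tau>] series_subst_const[OF V \<rho>]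
      series_subst_var[OF V \<sigma>] series_subst_var[OF V \<rho>])
  also have "series_subst R V W ?F ?\<rho> m = series_subst R V W F ?\<rho> m"
    using F by (intro series_subst_trunc[OF V \<rho>]) auto
  finally show "series_subst R U W (series_subst R V U F \<sigma>) \<tau> m = series_subst R V W F ?\<rho> m" .
qed

end

section \<open>Naturality of substitution under ring homomorphisms\<close>

lemma series_map_hom:
  assumes "cring R" "cring R'" "\<phi> \<in> ring_hom R R'"
  shows "(\<lambda>p m. \<phi> (p m)) \<in> ring_hom (series_ring R W) (series_ring R' W)"
proof -
  interpret R: cring R by fact
  interpret R': cring R' by fact
  interpret \<phi>: ring_hom_cring R R' \<phi> by (intro ring_hom_cringI) (use assms in auto)
  show ?thesis
  proof (rule ring_hom_memI)
    fix p q assume *: "p \<in> carrier (series_ring R W)" "q \<in> carrier (series_ring R W)"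
    then show "(\<lambda>m. \<phi> ((p \<otimes>\<^bsub>series_ring R W\<^esub> q) m)) =
      (\<lambda>m. \<phi> (p m)) \<otimes>\<^bsub>series_ring R' W\<^esub> (\<lambda>m. \<phi> (q m))"
      using *[THEN series_coeff_closed]
      by (intro ext) (auto simp: series_simps \<phi>.hom_finsum comp_def intro!: R'.add.finprod_cong')
  qed (auto simp: series_carrier_iff series_simps)
qed

text \<open>Each coefficient of a substitution is a finite sum of products of coefficients of
  \<open>F\<close> and of the \<open>\<sigma> v\<close>. The lemma is what moves the laws of a
  formal group law along a ring homomorphism.\<close>

lemma series_subst_natural:
  assumes "cring R" "cring R'" "\<phi> \<in> ring_hom R R'" "finite V"
    and F: "\<And>k. F k \<in> carrier R" and \<sigma>: "\<And>v. v \<in> V \<Longrightarrow> \<sigma> v \<in> carrier (series_ring R W)"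
      "\<And>v. v \<in> V \<Longrightarrow> \<sigma> v {#} = \<zero>\<^bsub>R\<^esub>"
  shows "\<phi> (series_subst R V W F \<sigma> m) = series_subst R' V W (\<lambda>k. \<phi> (F k)) (\<lambda>v k. \<phi> (\<sigma> v k)) m"
proof -
  interpret R: cring R by fact
  interpret R': cring R' by fact
  interpret \<phi>: ring_hom_cring R R' \<phi> by (intro ring_hom_cringI) (use assms in auto)
  note h = series_map_hom[OF assms(1-3), of W]
  have \<sigma>': "(\<lambda>k. \<phi> (\<sigma> v k)) \<in> carrier (series_ring R' W)" "\<phi> (\<sigma> v {#}) = \<zero>\<^bsub>R'\<^esub>" if "v \<in> V" for v
    using ring_hom_closed[OF h \<sigma>(1)[OF that]] \<sigma>(2)[OF that] by auto
  have m: "\<phi> (mpow (series_ring R W) \<sigma> k m) = mpow (series_ring R' W) (\<lambda>v k. \<phi> (\<sigma> v k)) k m"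
    if "set_mset k \<subseteq> V" for k
    using ring_hom_mpow[OF R.cring_series_ring R'.cring_series_ring h, of \<sigma> k] that \<sigma>(1)
    by (metis (no_types, lifting) Pi_I subsetD)
  have c: "mpow (series_ring R W) \<sigma> k m \<in> carrier R" if "set_mset k \<subseteq> V" for k
    using series_coeff_closed[OF R.mpow_series_closed[of \<sigma> k W]] that \<sigma>(1) by blast
  have "\<phi> (series_subst R V W F \<sigma> m) = (\<Oplus>\<^bsub>R'\<^esub>k\<in>{k. set_mset k \<subseteq> V \<and> size k \<le> size m}.
      \<phi> (F k) \<otimes>\<^bsub>R'\<^esub> mpow (series_ring R' W) (\<lambda>v k. \<phi> (\<sigma> v k)) k m)"
  proof -
    have 1: "series_subst R V W F \<sigma> m =
      (\<Oplus>\<^bsub>R\<^esub>k\<in>{k. set_mset k \<subseteq> V \<and> size k \<le> size m}. F k \<otimes>\<^bsub>R\<^esub> mpow (series_ring R W) \<sigma> k m)"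
      using assms(4) \<sigma> F by (rule R.series_subst_coeff)
    show ?thesis
      unfolding 1 using c F
      by (subst \<phi>.hom_finsum) (auto simp: comp_def m intro!: R'.add.finprod_cong' simp flip: m)
  qed
  also have "\<dots> = series_subst R' V W (\<lambda>k. \<phi> (F k)) (\<lambda>v k. \<phi> (\<sigma> v k)) m"
    using F by (intro R'.series_subst_coeff[OF assms(4), symmetric] \<sigma>') auto
  finally show ?thesis .
qed


subsection \<open>Triangular substitutions\<close>

context cring
begin

context
  fixes V :: "'v set" and \<sigma> :: "'v \<Rightarrow> 'v multiset \<Rightarrow> 'a"
  assumes V: "finite V" and \<sigma>: "\<And>v. v \<in> V \<Longrightarrow> \<sigma> v \<in> carrier (series_ring R V)"
    and \<sigma>0: "\<And>v. v \<in> V \<Longrightarrow> \<sigma> v {#} = \<zero>"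
    and \<sigma>1: "\<And>v w. v \<in> V \<Longrightarrow> w \<in> V \<Longrightarrow> \<sigma> v {#w#} = (if v = w then \<one> else \<zero>)"
begin

interpretation S: cring "series_ring R V" by (rule cring_series_ring)

text \<open>Each \<open>\<sigma> v\<close> is \<open>v\<close> plus terms of higher degree, so the
  lowest part of the product is \<open>k\<close> itself. In the convolution for one more factor only
  \<open>l = {#v#}\<close> survives: other single variables have coefficient zero in
  \<open>\<sigma> v\<close>, and a larger \<open>l\<close> leaves a remainder below the order of the
  other factor.\<close>

lemma mpow_triangular:
  "set_mset k \<subseteq> V \<Longrightarrow> set_mset m \<subseteq> V \<Longrightarrow> size m = size k \<Longrightarrow>
    mpow (series_ring R V) \<sigma> k m = (if m = k then \<one> else \<zero>)"
proof (induction k arbitrary: m)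
  case empty
  then show ?case by (simp add: series_simps)
next
  case (add v k)
  have v: "v \<in> V" and k: "set_mset k \<subseteq> V" using add.prems by auto
  let ?f = "\<lambda>l. \<sigma> v l \<otimes> mpow (series_ring R V) \<sigma> k (m - l)"
  have c: "\<sigma> v l \<in> carrier R" "mpow (series_ring R V) \<sigma> k l \<in> carrier R" for l
    using series_coeff_closed[OF \<sigma>[OF v]] series_coeff_closed[OF mpow_subst_closed[OF V \<sigma> \<sigma>0 k]] by auto
  have z: "?f l = \<zero>" if l: "l \<subseteq># m" "l \<noteq> {#v#}" for l
  proof -
    consider "l = {#}" | w where "l = {#w#}" | "size l > 1"
      by (metis One_nat_def less_one linorder_neqE_nat size_1_singleton_mset size_eq_0_iff_empty)
    then show ?thesis
    proof cases
      case 1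
      then show ?thesis using c by (simp add: \<sigma>0[OF v])
    next
      case (2 w)
      then have "w \<in> V" using l add.prems by auto
      then show ?thesis using 2 l c by (simp add: \<sigma>1[OF v])
    next
      case 3
      then have "size (m - l) < size k" using add.prems(3) l size_mset_mono[OF l(1)] by (simp add: size_Diff_submset)
      then show ?thesis using c mpow_subst_zero[OF V \<sigma> \<sigma>0 k] by simp
    qed
  qed
  have "mpow (series_ring R V) \<sigma> (add_mset v k) = \<sigma> v \<otimes>\<^bsub>series_ring R V\<^esub> mpow (series_ring R V) \<sigma> k"
    using v k \<sigma> by (intro S.mpow_add_mset) auto
  then have *: "mpow (series_ring R V) \<sigma> (add_mset v k) m = (\<Oplus>l\<in>{l. l \<subseteq># m}. ?f l)"
    by (simp add: series_simps)
  show ?case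
  proof (cases "v \<in># m")
    case True
    then obtain m' where m': "m = add_mset v m'" by (meson multi_member_split)
    have "mpow (series_ring R V) \<sigma> (add_mset v k) m = ?f {#v#}"
      unfolding * using True z c by (intro finsum_eq_single) (auto simp: finite_subset_mset)
    then show ?thesis using add m' c k by (auto simp: \<sigma>1[OF v v])
  next
    case False
    then have "?f l = \<zero>" if "l \<subseteq># m" for l
      using z[OF that] that by (metis single_subset_iff)
    then have "mpow (series_ring R V) \<sigma> (add_mset v k) m = \<zero>"
      unfolding * by (intro add.finprod_one_eqI) auto
    then show ?thesis using False by auto
  qed
qed

text \<open>The contribution of the monomials smaller than \<open>m\<close>. The coefficient of
  \<open>m\<close> in the substitution is \<open>G m\<close> plus this tail, so the system of
  equations for the coefficients of \<open>G\<close> is triangular with unit diagonal.\<close>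

definition subst_tail :: "('v multiset \<Rightarrow> 'a) \<Rightarrow> 'v multiset \<Rightarrow> 'a" where
  "subst_tail G m = (\<Oplus>k\<in>{k. set_mset k \<subseteq> V \<and> size k < size m}. G k \<otimes> mpow (series_ring R V) \<sigma> k m)"

lemma subst_tail_closed: "(\<And>k. G k \<in> carrier R) \<Longrightarrow> subst_tail G m \<in> carrier R"
  unfolding subst_tail_def
  by (intro add.finprod_closed) (auto simp: series_coeff_closed[OF mpow_subst_closed[OF V \<sigma> \<sigma>0]])

lemma subst_tail_cong:
  "(\<And>k. G' k \<in> carrier R) \<Longrightarrow> (\<And>k. size k < size m \<Longrightarrow> G k = G' k) \<Longrightarrow> subst_tail G m = subst_tail G' m"
  unfolding subst_tail_def
  by (intro add.finprod_cong') (auto simp: series_coeff_closed[OF mpow_subst_closed[OF V \<sigma> \<sigma>0]] Pi_def)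

lemma series_subst_triangular:
  assumes G: "\<And>k. G k \<in> carrier R" and m: "set_mset m \<subseteq> V"
  shows "series_subst R V V G \<sigma> m = G m \<oplus> subst_tail G m"
proof -
  let ?K = "{k. set_mset k \<subseteq> V \<and> size k < size m}" and ?f = "\<lambda>k. G k \<otimes> mpow (series_ring R V) \<sigma> k m"
  have fin: "finite ?K"
    by (rule finite_subset[OF _ finite_bounded_multisets[OF V, of "size m"]]) auto
  have c: "?f k \<in> carrier R" if "set_mset k \<subseteq> V" for k
    using G series_coeff_closed[OF mpow_subst_closed[OF V \<sigma> \<sigma>0 that]] by auto
  have "series_subst R V V G \<sigma> m = (\<Oplus>k\<in>{k. set_mset k \<subseteq> V \<and> size k \<le> size m}. ?f k)"
    by (rule series_subst_coeff[OF V \<sigma> \<sigma>0 G])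
  also have "\<dots> = (\<Oplus>k\<in>insert m ?K. ?f k)"
    using m c fin finite_bounded_multisets[OF V] mpow_triangular[OF _ m] G
    by (intro add.finprod_mono_neutral_cong_right) (auto simp: Pi_def)
  also have "\<dots> = ?f m \<oplus> subst_tail G m"
    unfolding subst_tail_def using fin m c by (intro add.finprod_insert) auto
  also have "?f m = G m" using G mpow_triangular[OF m m] by simp
  finally show ?thesis .
qed

text \<open>By induction on the degree the two tails agree, and cancelling them leaves
  \<open>G m = G' m\<close>.\<close>

lemma series_subst_triangular_inj:
  assumes G: "G \<in> carrier (series_ring R V)" and G': "G' \<in> carrier (series_ring R V)"
    and eq: "series_subst R V V G \<sigma> = series_subst R V V G' \<sigma>"
  shows "G = G'"
proof
  fix m
  note c = series_coeff_closed[OF G] series_coeff_closed[OF G']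
  show "G m = G' m"
  proof (induction "size m" arbitrary: m rule: less_induct)
    case less
    show ?case
    proof (cases "set_mset m \<subseteq> V")
      case True
      have "subst_tail G m = subst_tail G' m" using c less by (intro subst_tail_cong) auto
      then have "G m \<oplus> subst_tail G m = G' m \<oplus> subst_tail G m"
        using fun_cong[OF eq, of m] True by (simp add: series_subst_triangular c)
      then show ?thesis using c by (simp add: subst_tail_closed)
    next
      case False
      then show ?thesis using series_coeff_outside[OF G] series_coeff_outside[OF G'] by simp
    qed
  qed
qed

lemma series_subst_triangular_surj:
  assumes H: "H \<in> carrier (series_ring R V)"
  obtains G where "G \<in> carrier (series_ring R V)" "series_subst R V V G \<sigma> = H"
proof
  \<comment> \<open>The equations \<open>G m = H m \<ominus> subst_tail G m\<close> are solved
    degree by degree. Stage \<open>Suc n\<close> fixes the monomials of size exactly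
    \<open>n\<close> from the previous stage and leaves all others alone, so a monomial has its
    final value from stage \<open>Suc (size m)\<close> on.\<close>
  define A where "A = rec_nat (\<lambda>_. \<zero>) (\<lambda>n B m. if size m = n \<and> set_mset m \<subseteq> V then H m \<ominus> subst_tail B m else B m)"
  have A0: "A 0 = (\<lambda>_. \<zero>)" and AS: "A (Suc n) = (\<lambda>m. if size m = n \<and> set_mset m \<subseteq> V then H m \<ominus> subst_tail (A n) m else A n m)" for n
    unfolding A_def by simp_all
  define G where "G = (\<lambda>m. A (Suc (size m)) m)"
  have Ac: "A n m \<in> carrier R" for n m
    by (induction n arbitrary: m) (auto simp: A0 AS series_coeff_closed[OF H] subst_tail_closed)
  have out: "A n m = \<zero>" if "\<not> set_mset m \<subseteq> V" for n m
    using that by (induction n) (auto simp: A0 AS)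
  show G: "G \<in> carrier (series_ring R V)"
    using Ac out by (auto simp: G_def series_carrier_iff)
  have stable: "A (Suc (size m) + n) m = G m" for n m
    by (induction n) (simp_all add: G_def AS)
  then have AG: "A n k = G k" if "size k < n" for n k
    using that by (metis Suc_leI le_add_diff_inverse)
  show "series_subst R V V G \<sigma> = H"
  proof
    fix m
    show "series_subst R V V G \<sigma> m = H m"
    proof (cases "set_mset m \<subseteq> V")
      case True
      have t: "subst_tail G m = subst_tail (A (size m)) m"
        using Ac AG by (intro subst_tail_cong) auto
      have "G m = H m \<ominus> subst_tail (A (size m)) m" using True by (simp add: G_def AS)
      moreover have "subst_tail (A (size m)) m \<in> carrier R" by (simp add: subst_tail_closed Ac)
      ultimately show ?thesis
        using True t series_coeff_closed[OF H, of m]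
        by (simp add: series_subst_triangular[OF series_coeff_closed[OF G]] minus_eq a_assoc l_neg)
    next
      case False
      then show ?thesis using series_coeff_outside[OF series_subst_closed[OF V \<sigma> \<sigma>0 G]]
        series_coeff_outside[OF H] by simp
    qed
  qed
qed

end

end


section \<open>Quotients and tensor products\<close>

lemma ring_hom_cring_of: "cring R \<Longrightarrow> cring S \<Longrightarrow> h \<in> ring_hom R S \<Longrightarrow> ring_hom_cring R S h"
  by (simp add: ring_hom_cringI)

text \<open>The kernel of \<open>h\<close> is an ideal that contains the generators, hence the ideal
  they generate.\<close>

lemma (in cring) quot_Idl_hom_ex:
  assumes G: "G \<subseteq> carrier R" and S: "cring S" and h: "h \<in> ring_hom R S"
    and z: "\<And>x. x \<in> G \<Longrightarrow> h x = \<zero>\<^bsub>S\<^esub>"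
  obtains g where "g \<in> ring_hom (R Quot Idl G) S" "\<And>x. x \<in> carrier R \<Longrightarrow> g (Idl G +> x) = h x"
proof
  interpret S: cring S by fact
  interpret h: ring_hom_ring R S h by (rule ring_hom_ringI2[OF ring_axioms S.ring_axioms h])
  interpret I: ideal "Idl G" R by (rule genideal_ideal[OF G])
  have "Idl G \<subseteq> a_kernel R S h"
  proof (rule genideal_minimal[OF h.kernel_is_ideal], rule subsetI)
    fix x assume "x \<in> G"
    then show "x \<in> a_kernel R S h" unfolding a_kernel_def' using G z[of x] by blast
  qed
  then have k: "h x = \<zero>\<^bsub>S\<^esub>" if "x \<in> Idl G" for x
    using that unfolding a_kernel_def' by blast
  \<comment> \<open>A chosen representative differs from \<open>x\<close> by an element of the
    ideal, which \<open>h\<close> sends to zero, so the choice does not matter.\<close>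
  define g where "g = (\<lambda>C. h (SOME x. x \<in> C))"
  show g: "g (Idl G +> x) = h x" if x: "x \<in> carrier R" for x
  proof -
    have "(SOME y. y \<in> Idl G +> x) \<in> Idl G +> x"
      using I.a_rcos_self[OF x] by (rule someI)
    then obtain i where i: "i \<in> Idl G" "(SOME y. y \<in> Idl G +> x) = i \<oplus> x"
      by (auto simp: a_r_coset_def')
    then show ?thesis using x k I.Icarr by (simp add: g_def)
  qed
  note q = I.rcos_ring_hom
  show "g \<in> ring_hom (R Quot Idl G) S"
  proof (rule ring_hom_memI)
    fix C D assume "C \<in> carrier (R Quot Idl G)" "D \<in> carrier (R Quot Idl G)"
    then obtain x y where xy: "x \<in> carrier R" "C = Idl G +> x" "y \<in> carrier R" "D = Idl G +> y"
      by (auto simp: FactRing_def A_RCOSETS_def')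
    show "g C \<in> carrier S" using xy g by simp
    show "g (C \<otimes>\<^bsub>R Quot Idl G\<^esub> D) = g C \<otimes>\<^bsub>S\<^esub> g D"
      using xy g ring_hom_mult[OF q xy(1,3), symmetric] by simp
    show "g (C \<oplus>\<^bsub>R Quot Idl G\<^esub> D) = g C \<oplus>\<^bsub>S\<^esub> g D"
      using xy g ring_hom_add[OF q xy(1,3), symmetric] by simp
  next
    show "g \<one>\<^bsub>R Quot Idl G\<^esub> = \<one>\<^bsub>S\<^esub>" using g[OF one_closed] ring_hom_one[OF q, symmetric] by simp
  qed
qed

lemma (in cring) quot_Idl_cring: "G \<subseteq> carrier R \<Longrightarrow> cring (R Quot Idl G)"
  using ideal.quotient_is_cring[OF genideal_ideal cring_axioms] by blast

lemma (in cring) quot_Idl_proj_hom: "G \<subseteq> carrier R \<Longrightarrow> (+>) (Idl G) \<in> ring_hom R (R Quot Idl G)"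
  using ideal.rcos_ring_hom[OF genideal_ideal] by blast

lemma (in cring) quot_Idl_relation:
  assumes "G \<subseteq> carrier R" "x \<in> G"
  shows "Idl G +> x = \<zero>\<^bsub>R Quot Idl G\<^esub>"
proof -
  interpret I: ideal "Idl G" R by (rule genideal_ideal[OF assms(1)])
  have "x \<in> Idl G" using genideal_self[OF assms(1)] assms(2) by blast
  then show ?thesis by (simp add: FactRing_def I.a_rcos_const)
qed

lemma quot_carrierE:
  assumes "C \<in> carrier (R Quot I)"
  obtains x where "x \<in> carrier R" "C = I +>\<^bsub>R\<^esub> x"
  using assms by (auto simp: FactRing_def A_RCOSETS_def')

text \<open>The way to unfold every definition made with \<open>the_hom\<close>. The described map
  is extensional, so the candidate enters as its restriction to the carrier, whereas uniqueness is
  asked only at points of the carrier.\<close>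

lemma the_homI:
  assumes R: "ring R" and h0: "h0 \<in> ring_hom R S" and P: "P (restrict h0 (carrier R))"
    and unique: "\<And>h x. h \<in> ring_hom R S \<Longrightarrow> P h \<Longrightarrow> x \<in> carrier R \<Longrightarrow> h x = h0 x"
  shows "the_hom R S P \<in> ring_hom R S" "P (the_hom R S P)"
    "\<And>x. x \<in> carrier R \<Longrightarrow> the_hom R S P x = h0 x"
proof -
  interpret R: ring R by fact
  have h: "restrict h0 (carrier R) \<in> ring_hom R S"
    using h0 by (auto simp: ring_hom_def)
  have "the_hom R S P = restrict h0 (carrier R)"
    unfolding the_hom_def
  proof (rule the_equality)
    fix h assume "h \<in> ring_hom R S \<and> h \<in> extensional (carrier R) \<and> P h"
    then show "h = restrict h0 (carrier R)"
      using unique by (intro extensionalityI[of _ "carrier R"]) auto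
  qed (use h P in auto)
  then show "the_hom R S P \<in> ring_hom R S" "P (the_hom R S P)"
    "\<And>x. x \<in> carrier R \<Longrightarrow> the_hom R S P x = h0 x"
    using h P by auto
qed


subsection \<open>The monoid ring on pairs\<close>

lemma frag_extend_fun_diff: "frag_extend (\<lambda>x. f x - g x) c = frag_extend f c - frag_extend g c"
proof -
  have "frag_cmul k (a - b) = frag_cmul k a - frag_cmul k b" for k and a b :: "'a \<Rightarrow>\<^sub>0 int"
    using frag_cmul_distrib2[of k a "- b"] frag_cmul_cmul[of k "-1" b] by simp
  then show ?thesis by (simp add: frag_extend_def sum_subtractf)
qed

lemma keys_diff_subset:
  "Poly_Mapping.keys a \<subseteq> E \<Longrightarrow> Poly_Mapping.keys b \<subseteq> E \<Longrightarrow> Poly_Mapping.keys (a - b) \<subseteq> E"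
  for a b :: "'a \<Rightarrow>\<^sub>0 int"
  using keys_diff[of a b] by blast

text \<open>The multiplication of \<open>pair_ring\<close> under a name of its own, so that its
  values on generators and its additivity in each argument can serve as rewrite rules.\<close>

definition pair_mult ::
  "('a, 'm) ring_scheme \<Rightarrow> ('b, 'n) ring_scheme \<Rightarrow> ('a \<times> 'b \<Rightarrow>\<^sub>0 int) \<Rightarrow> ('a \<times> 'b \<Rightarrow>\<^sub>0 int) \<Rightarrow> 'a \<times> 'b \<Rightarrow>\<^sub>0 int" where
  "pair_mult R S c d = frag_extend (\<lambda>(x, y). frag_extend (\<lambda>(x', y').
       frag_of (x \<otimes>\<^bsub>R\<^esub> x', y \<otimes>\<^bsub>S\<^esub> y')) d) c"

lemma pair_mult_of [simp]:
  "pair_mult R S (frag_of (x, y)) (frag_of (x', y')) = frag_of (x \<otimes>\<^bsub>R\<^esub> x', y \<otimes>\<^bsub>S\<^esub> y')"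
  by (simp add: pair_mult_def)

lemma pair_mult_diff [simp]:
  "pair_mult R S (a - b) c = pair_mult R S a c - pair_mult R S b c"
  "pair_mult R S c (a - b) = pair_mult R S c a - pair_mult R S c b"
  by (simp_all add: pair_mult_def frag_extend_diff frag_extend_fun_diff[symmetric] case_prod_unfold)

lemma pair_mult_zero [simp]: "pair_mult R S 0 c = 0" "pair_mult R S c 0 = 0"
  by (simp_all add: pair_mult_def frag_extend_eq_0 case_prod_unfold)

lemma pair_ring_simps [simp]:
  "carrier (pair_ring R S) = {c. Poly_Mapping.keys c \<subseteq> carrier R \<times> carrier S}"
  "c \<otimes>\<^bsub>pair_ring R S\<^esub> d = pair_mult R S c d"
  "\<one>\<^bsub>pair_ring R S\<^esub> = frag_of (\<one>\<^bsub>R\<^esub>, \<one>\<^bsub>S\<^esub>)"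
  "\<zero>\<^bsub>pair_ring R S\<^esub> = 0"
  "c \<oplus>\<^bsub>pair_ring R S\<^esub> d = c + d"
  by (simp_all add: pair_ring_def pair_mult_def)

lemma pair_mult_closed:
  assumes "cring R" "cring S" "Poly_Mapping.keys c \<subseteq> carrier R \<times> carrier S"
    "Poly_Mapping.keys d \<subseteq> carrier R \<times> carrier S"
  shows "Poly_Mapping.keys (pair_mult R S c d) \<subseteq> carrier R \<times> carrier S"
proof -
  interpret R: cring R by fact
  interpret S: cring S by fact
  show ?thesis using assms(3)
  proof (induction rule: frag_induction)
    case (one p)
    show ?case using assms(4)
    proof (induction rule: frag_induction)
      case (one q)
      then show ?case using \<open>p \<in> _\<close> by (cases p; cases q) simp
    next
      case (diff a b)
      then show ?case by (simp add: keys_diff_subset)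
    qed simp
  next
    case (diff a b)
    then show ?case by (simp add: keys_diff_subset)
  qed simp
qed

text \<open>This is the integral monoid ring of the product of the two multiplicative monoids. The
  laws of multiplication are checked on generators, by one induction for each argument.\<close>

lemma cring_pair_ring:
  assumes "cring R" "cring S"
  shows "cring (pair_ring R S)"
proof (rule cringI)
  interpret R: cring R by fact
  interpret S: cring S by fact
  show "abelian_group (pair_ring R S)"
  proof (rule abelian_groupI)
    fix c d assume "c \<in> carrier (pair_ring R S)" "d \<in> carrier (pair_ring R S)"
    then show "c \<oplus>\<^bsub>pair_ring R S\<^esub> d \<in> carrier (pair_ring R S)"
      using keys_add[of c d] by auto
  next
    fix c assume "c \<in> carrier (pair_ring R S)"
    then have "- c \<in> carrier (pair_ring R S) \<and> - c \<oplus>\<^bsub>pair_ring R S\<^esub> c = \<zero>\<^bsub>pair_ring R S\<^esub>"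
      by simp
    then show "\<exists>d\<in>carrier (pair_ring R S). d \<oplus>\<^bsub>pair_ring R S\<^esub> c = \<zero>\<^bsub>pair_ring R S\<^esub>" by blast
  qed (auto simp: algebra_simps)
  have comm: "pair_mult R S c d = pair_mult R S d c"
    if c: "Poly_Mapping.keys c \<subseteq> carrier R \<times> carrier S" and d: "Poly_Mapping.keys d \<subseteq> carrier R \<times> carrier S" for c d
    using c
  proof (induction rule: frag_induction)
    case (one p)
    show ?case using d
    proof (induction rule: frag_induction)
      case (one q)
      then show ?case using \<open>p \<in> _\<close> by (cases p; cases q) (simp add: R.m_comm S.m_comm)
    qed simp_all
  qed simp_all
  have assoc: "pair_mult R S (pair_mult R S c d) e = pair_mult R S c (pair_mult R S d e)"
    if c: "Poly_Mapping.keys c \<subseteq> carrier R \<times> carrier S" and d: "Poly_Mapping.keys d \<subseteq> carrier R \<times> carrier S"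
      and e: "Poly_Mapping.keys e \<subseteq> carrier R \<times> carrier S" for c d e
    using c
  proof (induction rule: frag_induction)
    case (one p)
    show ?case using d
    proof (induction rule: frag_induction)
      case (one q)
      show ?case using e
      proof (induction rule: frag_induction)
        case (one r)
        then show ?case using \<open>p \<in> _\<close> \<open>q \<in> _\<close>
          by (cases p; cases q; cases r) (simp add: R.m_assoc S.m_assoc)
      qed simp_all
    qed simp_all
  qed simp_all
  have unit: "pair_mult R S (frag_of (\<one>\<^bsub>R\<^esub>, \<one>\<^bsub>S\<^esub>)) c = c"
    if c: "Poly_Mapping.keys c \<subseteq> carrier R \<times> carrier S" for c
    using c by (induction rule: frag_induction) auto
  show "comm_monoid (pair_ring R S)"
    by (rule comm_monoidI) (use pair_mult_closed[OF assms] comm assoc unit in auto)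
  fix a b c
  have "pair_mult R S (a + b) c = pair_mult R S a c + pair_mult R S b c"
    by (simp add: pair_mult_def frag_extend_add)
  then show "(a \<oplus>\<^bsub>pair_ring R S\<^esub> b) \<otimes>\<^bsub>pair_ring R S\<^esub> c =
      a \<otimes>\<^bsub>pair_ring R S\<^esub> c \<oplus>\<^bsub>pair_ring R S\<^esub> b \<otimes>\<^bsub>pair_ring R S\<^esub> c"
    by simp
qed

lemma pair_ring_minus:
  assumes "cring R" "cring S" "c \<in> carrier (pair_ring R S)" "d \<in> carrier (pair_ring R S)"
  shows "c \<ominus>\<^bsub>pair_ring R S\<^esub> d = c - d"
proof -
  interpret P: cring "pair_ring R S" by (rule cring_pair_ring[OF assms(1,2)])
  have "\<ominus>\<^bsub>pair_ring R S\<^esub> d = - d"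
    using assms by (intro P.minus_equality) auto
  then show ?thesis by (simp add: P.minus_eq)
qed

text \<open>The universal property of the free abelian group gives the additive extension. It is
  multiplicative because it is so on generators, where this uses commutativity of
  \<open>B\<close>.\<close>

lemma pair_ring_hom_ex:
  assumes "cring R" "cring S" "cring B" and p: "p \<in> ring_hom R B" and q: "q \<in> ring_hom S B"
  obtains h where "h \<in> ring_hom (pair_ring R S) B"
    "\<And>x y. x \<in> carrier R \<Longrightarrow> y \<in> carrier S \<Longrightarrow> h (frag_of (x, y)) = p x \<otimes>\<^bsub>B\<^esub> q y"
proof -
  interpret R: cring R by fact
  interpret S: cring S by fact
  interpret B: cring B by fact
  interpret P: cring "pair_ring R S" by (rule cring_pair_ring[OF assms(1,2)])
  let ?X = "carrier R \<times> carrier S" and ?f = "\<lambda>z. p (fst z) \<otimes>\<^bsub>B\<^esub> q (snd z)"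
  have f: "?f z \<in> carrier B" if "z \<in> ?X" for z
    using that ring_hom_closed[OF p] ring_hom_closed[OF q] by auto
  obtain h where h: "h \<in> hom (free_Abelian_group ?X) (add_monoid B)"
    and hf: "\<And>z. z \<in> ?X \<Longrightarrow> h (frag_of z) = ?f z"
    using comm_group.free_Abelian_group_universal[OF B.a_comm_group, of ?f ?X] f by auto
  have hc: "h c \<in> carrier B" if "Poly_Mapping.keys c \<subseteq> ?X" for c
    using h that by (auto simp: hom_def free_Abelian_group_def)
  have ha: "h (c + d) = h c \<oplus>\<^bsub>B\<^esub> h d" if "Poly_Mapping.keys c \<subseteq> ?X" "Poly_Mapping.keys d \<subseteq> ?X" for c d
    using hom_mult[OF h, of c d] that by (simp add: free_Abelian_group_def)
  have hd: "h (c - d) = h c \<ominus>\<^bsub>B\<^esub> h d" if cd: "Poly_Mapping.keys c \<subseteq> ?X" "Poly_Mapping.keys d \<subseteq> ?X" for c d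
  proof -
    have k: "Poly_Mapping.keys (c - d) \<subseteq> ?X" using cd keys_diff[of c d] by blast
    have "h c = h (c - d) \<oplus>\<^bsub>B\<^esub> h d" using ha[OF k cd(2)] by simp
    then show ?thesis using hc[OF cd(1)] hc[OF cd(2)] hc[OF k] by (simp add: B.minus_eq B.a_assoc B.r_neg)
  qed
  have h0: "h 0 = \<zero>\<^bsub>B\<^esub>" using hd[of 0 0] hc[of 0] by (simp add: B.minus_eq B.r_neg)
  note cl = pair_mult_closed[OF assms(1,2)]
  have mult: "h (pair_mult R S c d) = h c \<otimes>\<^bsub>B\<^esub> h d"
    if c: "Poly_Mapping.keys c \<subseteq> ?X" and d: "Poly_Mapping.keys d \<subseteq> ?X" for c d
  proof -
    \<comment> \<open>The induction carries the support condition along, since its difference step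
      otherwise gives no information on the supports of the two parts.\<close>
    have "Poly_Mapping.keys c \<subseteq> ?X \<and> h (pair_mult R S c d) = h c \<otimes>\<^bsub>B\<^esub> h d" using c
    proof (induction rule: frag_induction)
      case (one u)
      have "Poly_Mapping.keys d \<subseteq> ?X \<and> h (pair_mult R S (frag_of u) d) = h (frag_of u) \<otimes>\<^bsub>B\<^esub> h d" using d
      proof (induction rule: frag_induction)
        case (one v)
        then show ?case using \<open>u \<in> _\<close> f hf ring_hom_closed[OF p] ring_hom_closed[OF q]
          by (cases u; cases v) (simp add: hf ring_hom_mult[OF p] ring_hom_mult[OF q] B.m_ac)
      next
        case (diff a b)
        have u: "Poly_Mapping.keys (frag_of u) \<subseteq> ?X" using \<open>u \<in> _\<close> by simp
        show ?case using diff u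
          by (simp add: hd cl hc keys_diff_subset B.minus_eq B.r_distr B.r_minus)
      qed (use \<open>u \<in> _\<close> f hf in \<open>simp add: h0\<close>)
      then show ?case using one by simp
    next
      case (diff a b)
      then show ?case using d by (simp add: hd cl hc keys_diff_subset B.minus_eq B.l_distr B.l_minus)
    qed (use hc[OF d] in \<open>simp add: h0\<close>)
    then show ?thesis by simp
  qed
  show ?thesis
  proof
    show "h \<in> ring_hom (pair_ring R S) B"
      by (rule ring_hom_memI)
        (use hc ha mult hf ring_hom_one[OF p] ring_hom_one[OF q] in \<open>auto simp: hf\<close>)
  qed (use hf in auto)
qed


subsection \<open>Tensor products\<close>

locale tensor =
  fixes A :: "('c, 'l) ring_scheme" and R :: "('a, 'm) ring_scheme" and f :: "'c \<Rightarrow> 'a"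
    and S :: "('b, 'n) ring_scheme" and g :: "'c \<Rightarrow> 'b"
  assumes A: "cring A" and R: "cring R" and S: "cring S"
    and f: "f \<in> ring_hom A R" and g: "g \<in> ring_hom A S"
begin

sublocale A: cring A by (rule A)
sublocale R: cring R by (rule R)
sublocale S: cring S by (rule S)
sublocale P: cring "pair_ring R S" by (rule cring_pair_ring[OF R S])

abbreviation T where "T \<equiv> tensor_ring A R f S g"
abbreviation pure where "pure \<equiv> pure_tensor A R f S g"

definition rels where
  "rels = {frag_of (x \<oplus>\<^bsub>R\<^esub> x', y) - frag_of (x, y) - frag_of (x', y) | x x' y.
        x \<in> carrier R \<and> x' \<in> carrier R \<and> y \<in> carrier S} \<union>
     {frag_of (x, y \<oplus>\<^bsub>S\<^esub> y') - frag_of (x, y) - frag_of (x, y') | x y y'.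
        x \<in> carrier R \<and> y \<in> carrier S \<and> y' \<in> carrier S} \<union>
     {frag_of (x \<otimes>\<^bsub>R\<^esub> f a, y) - frag_of (x, g a \<otimes>\<^bsub>S\<^esub> y) | x a y.
        x \<in> carrier R \<and> a \<in> carrier A \<and> y \<in> carrier S}"

lemma T_def: "T = pair_ring R S Quot Idl\<^bsub>pair_ring R S\<^esub> rels"
  by (simp add: tensor_ring_def tensor_ideal_def rels_def)

lemma pure_def: "pure x y = (Idl\<^bsub>pair_ring R S\<^esub> rels) +>\<^bsub>pair_ring R S\<^esub> frag_of (x, y)"
  by (simp add: pure_tensor_def tensor_ideal_def rels_def)

lemma of_carrier: "x \<in> carrier R \<Longrightarrow> y \<in> carrier S \<Longrightarrow> frag_of (x, y) \<in> carrier (pair_ring R S)"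
  by simp

lemma f_closed [simp]: "a \<in> carrier A \<Longrightarrow> f a \<in> carrier R"
  and g_closed [simp]: "a \<in> carrier A \<Longrightarrow> g a \<in> carrier S"
  using ring_hom_closed[OF f] ring_hom_closed[OF g] by auto

lemma rels_carrier: "rels \<subseteq> carrier (pair_ring R S)"
proof -
  have "Poly_Mapping.keys r \<subseteq> carrier R \<times> carrier S" if "r \<in> rels" for r
    using that unfolding rels_def by (elim UnE CollectE exE conjE; hypsubst; intro keys_diff_subset; simp)
  then show ?thesis by auto
qed

sublocale T: cring T
  unfolding T_def by (rule P.quot_Idl_cring[OF rels_carrier])

lemma pure_closed [simp]: "x \<in> carrier R \<Longrightarrow> y \<in> carrier S \<Longrightarrow> pure x y \<in> carrier T"
  unfolding T_def pure_def using ring_hom_closed[OF P.quot_Idl_proj_hom[OF rels_carrier] of_carrier] .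

lemma pure_mult:
  assumes "x \<in> carrier R" "y \<in> carrier S" "x' \<in> carrier R" "y' \<in> carrier S"
  shows "pure x y \<otimes>\<^bsub>T\<^esub> pure x' y' = pure (x \<otimes>\<^bsub>R\<^esub> x') (y \<otimes>\<^bsub>S\<^esub> y')"
  unfolding T_def pure_def
  using ring_hom_mult[OF P.quot_Idl_proj_hom[OF rels_carrier] of_carrier of_carrier, OF assms] by simp

lemma pure_one: "pure \<one>\<^bsub>R\<^esub> \<one>\<^bsub>S\<^esub> = \<one>\<^bsub>T\<^esub>"
  unfolding T_def pure_def
  using ring_hom_one[OF P.quot_Idl_proj_hom[OF rels_carrier]] by simp

lemma rel_eq:
  assumes "a - b \<in> rels" "a \<in> carrier (pair_ring R S)" "b \<in> carrier (pair_ring R S)"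
  shows "Idl\<^bsub>pair_ring R S\<^esub> rels +>\<^bsub>pair_ring R S\<^esub> a = Idl\<^bsub>pair_ring R S\<^esub> rels +>\<^bsub>pair_ring R S\<^esub> b"
proof -
  have "a \<ominus>\<^bsub>pair_ring R S\<^esub> b \<in> Idl\<^bsub>pair_ring R S\<^esub> rels"
    using P.genideal_self[OF rels_carrier] assms pair_ring_minus[OF R S] by auto
  then show ?thesis
    using P.quotient_eq_iff_same_a_r_cos[OF P.genideal_ideal[OF rels_carrier] assms(2,3)] by simp
qed

lemma pure_add_left:
  assumes "x \<in> carrier R" "x' \<in> carrier R" "y \<in> carrier S"
  shows "pure (x \<oplus>\<^bsub>R\<^esub> x') y = pure x y \<oplus>\<^bsub>T\<^esub> pure x' y"
proof -
  have "frag_of (x \<oplus>\<^bsub>R\<^esub> x', y) - (frag_of (x, y) + frag_of (x', y)) \<in> rels"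
    unfolding rels_def diff_diff_eq[symmetric] using assms by blast
  then have "pure (x \<oplus>\<^bsub>R\<^esub> x') y =
      Idl\<^bsub>pair_ring R S\<^esub> rels +>\<^bsub>pair_ring R S\<^esub> (frag_of (x, y) \<oplus>\<^bsub>pair_ring R S\<^esub> frag_of (x', y))"
    unfolding pure_def using assms P.a_closed[OF of_carrier of_carrier, of x y x' y]
    by (intro rel_eq) simp_all
  then show ?thesis
    unfolding T_def pure_def
    using ring_hom_add[OF P.quot_Idl_proj_hom[OF rels_carrier] of_carrier of_carrier] assms by simp
qed

lemma pure_add_right:
  assumes "x \<in> carrier R" "y \<in> carrier S" "y' \<in> carrier S"
  shows "pure x (y \<oplus>\<^bsub>S\<^esub> y') = pure x y \<oplus>\<^bsub>T\<^esub> pure x y'"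
proof -
  have "frag_of (x, y \<oplus>\<^bsub>S\<^esub> y') - (frag_of (x, y) + frag_of (x, y')) \<in> rels"
    unfolding rels_def diff_diff_eq[symmetric] using assms by blast
  then have "pure x (y \<oplus>\<^bsub>S\<^esub> y') =
      Idl\<^bsub>pair_ring R S\<^esub> rels +>\<^bsub>pair_ring R S\<^esub> (frag_of (x, y) \<oplus>\<^bsub>pair_ring R S\<^esub> frag_of (x, y'))"
    unfolding pure_def using assms P.a_closed[OF of_carrier of_carrier, of x y x y']
    by (intro rel_eq) simp_all
  then show ?thesis
    unfolding T_def pure_def
    using ring_hom_add[OF P.quot_Idl_proj_hom[OF rels_carrier] of_carrier of_carrier] assms by simp
qed

lemma pure_balanced:
  assumes "x \<in> carrier R" "a \<in> carrier A" "y \<in> carrier S"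
  shows "pure (x \<otimes>\<^bsub>R\<^esub> f a) y = pure x (g a \<otimes>\<^bsub>S\<^esub> y)"
proof -
  have "frag_of (x \<otimes>\<^bsub>R\<^esub> f a, y) - frag_of (x, g a \<otimes>\<^bsub>S\<^esub> y) \<in> rels"
    unfolding rels_def using assms by blast
  then show ?thesis unfolding pure_def using assms by (intro rel_eq) simp_all
qed

lemma pure_left_hom: "(\<lambda>x. pure x \<one>\<^bsub>S\<^esub>) \<in> ring_hom R T"
  by (rule ring_hom_memI) (simp_all add: pure_mult pure_one pure_add_left)

lemma pure_right_hom: "(\<lambda>y. pure \<one>\<^bsub>R\<^esub> y) \<in> ring_hom S T"
  by (rule ring_hom_memI) (simp_all add: pure_mult pure_one pure_add_right)

text \<open>The existence half of the universal property of the pushout of commutative rings. It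
  will show that certain tensors are nonzero, by mapping them to a ring in which they can be
  recognised.\<close>

lemma tensor_hom_ex:
  assumes B: "cring B" and p: "p \<in> ring_hom R B" and q: "q \<in> ring_hom S B"
    and pq: "\<And>a. a \<in> carrier A \<Longrightarrow> p (f a) = q (g a)"
  obtains h where "h \<in> ring_hom T B"
    "\<And>x y. x \<in> carrier R \<Longrightarrow> y \<in> carrier S \<Longrightarrow> h (pure x y) = p x \<otimes>\<^bsub>B\<^esub> q y"
proof -
  interpret B: cring B by fact
  obtain h where h: "h \<in> ring_hom (pair_ring R S) B"
    and hf: "\<And>x y. x \<in> carrier R \<Longrightarrow> y \<in> carrier S \<Longrightarrow> h (frag_of (x, y)) = p x \<otimes>\<^bsub>B\<^esub> q y"
    using pair_ring_hom_ex[OF R S B p q] by blast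
  interpret h: ring_hom_cring "pair_ring R S" B h by (rule ring_hom_cring_of[OF P.cring_axioms B h])
  note c = ring_hom_closed[OF p] ring_hom_closed[OF q]
  have hd: "h (a - b) = h a \<ominus>\<^bsub>B\<^esub> h b" if "a \<in> carrier (pair_ring R S)" "b \<in> carrier (pair_ring R S)" for a b
    using pair_ring_minus[OF R S that, symmetric] that by (simp only: P.minus_eq h.hom_add h.hom_a_inv P.a_inv_closed B.minus_eq)
  have hd3: "h (a - b - d) = h a \<ominus>\<^bsub>B\<^esub> h b \<ominus>\<^bsub>B\<^esub> h d"
    if "a \<in> carrier (pair_ring R S)" "b \<in> carrier (pair_ring R S)" "d \<in> carrier (pair_ring R S)" for a b d
    using that hd pair_ring_minus[OF R S that(1,2)] P.minus_closed[OF that(1,2)] by metis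
  have z2: "a \<oplus>\<^bsub>B\<^esub> b \<ominus>\<^bsub>B\<^esub> a \<ominus>\<^bsub>B\<^esub> b = \<zero>\<^bsub>B\<^esub>" if "a \<in> carrier B" "b \<in> carrier B" for a b
    using that by algebra
  have "h r = \<zero>\<^bsub>B\<^esub>" if "r \<in> rels" for r
    using that unfolding rels_def
  proof (elim UnE CollectE exE conjE)
    fix x x' y assume *: "r = frag_of (x \<oplus>\<^bsub>R\<^esub> x', y) - frag_of (x, y) - frag_of (x', y)"
      "x \<in> carrier R" "x' \<in> carrier R" "y \<in> carrier S"
    then have "h r = p (x \<oplus>\<^bsub>R\<^esub> x') \<otimes>\<^bsub>B\<^esub> q y \<ominus>\<^bsub>B\<^esub> p x \<otimes>\<^bsub>B\<^esub> q y \<ominus>\<^bsub>B\<^esub> p x' \<otimes>\<^bsub>B\<^esub> q y"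
      by (simp add: hd3 hf)
    then show ?thesis using * c by (simp add: ring_hom_add[OF p] B.l_distr z2)
  next
    fix x y y' assume *: "r = frag_of (x, y \<oplus>\<^bsub>S\<^esub> y') - frag_of (x, y) - frag_of (x, y')"
      "x \<in> carrier R" "y \<in> carrier S" "y' \<in> carrier S"
    then have "h r = p x \<otimes>\<^bsub>B\<^esub> q (y \<oplus>\<^bsub>S\<^esub> y') \<ominus>\<^bsub>B\<^esub> p x \<otimes>\<^bsub>B\<^esub> q y \<ominus>\<^bsub>B\<^esub> p x \<otimes>\<^bsub>B\<^esub> q y'"
      by (simp add: hd3 hf)
    then show ?thesis using * c by (simp add: ring_hom_add[OF q] B.r_distr z2)
  next
    fix x a y assume *: "r = frag_of (x \<otimes>\<^bsub>R\<^esub> f a, y) - frag_of (x, g a \<otimes>\<^bsub>S\<^esub> y)"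
      "x \<in> carrier R" "a \<in> carrier A" "y \<in> carrier S"
    then have "h r = p (x \<otimes>\<^bsub>R\<^esub> f a) \<otimes>\<^bsub>B\<^esub> q y \<ominus>\<^bsub>B\<^esub> p x \<otimes>\<^bsub>B\<^esub> q (g a \<otimes>\<^bsub>S\<^esub> y)"
      by (simp add: hd hf)
    then show ?thesis using * c
      by (simp add: ring_hom_mult[OF p] ring_hom_mult[OF q] pq B.m_assoc B.minus_eq B.r_neg)
  qed
  from P.quot_Idl_hom_ex[OF rels_carrier B h this]
  obtain k where k: "k \<in> ring_hom T B"
    "\<And>x. x \<in> carrier (pair_ring R S) \<Longrightarrow> k (Idl\<^bsub>pair_ring R S\<^esub> rels +>\<^bsub>pair_ring R S\<^esub> x) = h x"
    unfolding T_def by blast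
  then show ?thesis using that hf unfolding pure_def by simp
qed

end


section \<open>Modules and symmetric algebras\<close>

declare mpoly_ring_ops [simp del]

lemma (in abelian_monoid) finsum_in_subset:
  assumes "finite A" "f \<in> A \<rightarrow> N" "N \<subseteq> carrier G" "\<zero> \<in> N" "\<And>x y. x \<in> N \<Longrightarrow> y \<in> N \<Longrightarrow> x \<oplus> y \<in> N"
  shows "(\<Oplus>x\<in>A. f x) \<in> N"
  using assms(1,2)
proof (induction A rule: finite_induct)
  case (insert a A)
  have 1: "f \<in> A \<rightarrow> N" "f a \<in> N" using insert.prems by auto
  then have "f \<in> A \<rightarrow> carrier G" "f a \<in> carrier G" using assms(3) by blast+
  then have "(\<Oplus>x\<in>insert a A. f x) = f a \<oplus> (\<Oplus>x\<in>A. f x)"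
    using insert.hyps by simp
  then show ?case using insert.IH[OF 1(1)] 1(2) assms(5) by simp
qed (use assms in simp)

text \<open>For \<open>f\<close> the action of one scalar, the union that defines scalar
  multiplication of a coset is a union of equal cosets. The lemma serves both
  \<open>quotient_module\<close> in general and the cohomology module, where the action goes through
  the left unit.\<close>

lemma (in abelian_group) quotient_smult:
  assumes N: "additive_subgroup N G" and x: "x \<in> carrier G"
    and f: "\<And>y. y \<in> N \<Longrightarrow> f (y \<oplus> x) \<in> N +> f x"
    and c: "f x \<in> carrier G"
  shows "(\<Union>y\<in>N +> x. N +> f y) = N +> f x"
proof -
  interpret N: abelian_subgroup N G using N by (intro abelian_subgroupI3 abelian_group_axioms)
  have "N +> f y = N +> f x" if "y \<in> N +> x" for y
  proof -
    obtain n where n: "n \<in> N" "y = n \<oplus> x" using \<open>y \<in> N +> x\<close> by (auto simp: a_r_coset_def')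
    then show ?thesis using f[OF n(1)] N.a_repr_independence' c by metis
  qed
  moreover have "x \<in> N +> x" using x by (rule N.a_rcos_self)
  ultimately show ?thesis by blast
qed


subsection \<open>Free modules\<close>

lemma free_module_simps [simp]:
  "v \<in> carrier (free_module R B) \<longleftrightarrow>
    (\<forall>x. v x \<in> carrier R) \<and> (\<forall>x. x \<notin> B \<longrightarrow> v x = \<zero>\<^bsub>R\<^esub>) \<and> finite {x. v x \<noteq> \<zero>\<^bsub>R\<^esub>}"
  "\<zero>\<^bsub>free_module R B\<^esub> = (\<lambda>x. \<zero>\<^bsub>R\<^esub>)"
  "v \<oplus>\<^bsub>free_module R B\<^esub> w = (\<lambda>x. v x \<oplus>\<^bsub>R\<^esub> w x)"
  "r \<odot>\<^bsub>free_module R B\<^esub> v = (\<lambda>x. r \<otimes>\<^bsub>R\<^esub> v x)"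
  by (simp_all add: free_module_def)

context cring
begin

lemma free_module_neg:
  "v \<in> carrier (free_module R B) \<Longrightarrow> (\<lambda>x. \<ominus> v x) \<in> carrier (free_module R B)"
  by (auto elim!: finite_subset[rotated])

lemma module_free_module: "module R (free_module R B)"
proof (rule moduleI)
  show "abelian_group (free_module R B)"
  proof (rule abelian_groupI)
    fix v w assume "v \<in> carrier (free_module R B)" "w \<in> carrier (free_module R B)"
    moreover have "{x. v x \<oplus> w x \<noteq> \<zero>} \<subseteq> {x. v x \<noteq> \<zero>} \<union> {x. w x \<noteq> \<zero>}" by auto
    ultimately show "v \<oplus>\<^bsub>free_module R B\<^esub> w \<in> carrier (free_module R B)"
      using finite_subset finite_UnI by simp blast
  next
    fix v assume "v \<in> carrier (free_module R B)"
    then show "\<exists>w\<in>carrier (free_module R B). w \<oplus>\<^bsub>free_module R B\<^esub> v = \<zero>\<^bsub>free_module R B\<^esub>"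
      by (intro bexI[OF _ free_module_neg]) (auto simp: l_neg)
  qed (auto simp: a_ac)
  fix r v assume "r \<in> carrier R" "v \<in> carrier (free_module R B)"
  moreover from \<open>r \<in> carrier R\<close> have "{x. r \<otimes> v x \<noteq> \<zero>} \<subseteq> {x. v x \<noteq> \<zero>}" by auto
  ultimately show "r \<odot>\<^bsub>free_module R B\<^esub> v \<in> carrier (free_module R B)"
    using finite_subset by simp blast
qed (auto simp: l_distr r_distr m_assoc cring_axioms)

lemma unit_vec_closed [simp]: "x \<in> B \<Longrightarrow> unit_vec R x \<in> carrier (free_module R B)"
  by (auto simp: unit_vec_def)

lemma free_module_induct [consumes 1, case_names zero add single]:
  assumes v: "v \<in> carrier (free_module R B)"
    and zero: "P (\<lambda>x. \<zero>)"
    and add: "\<And>v w. v \<in> carrier (free_module R B) \<Longrightarrow> w \<in> carrier (free_module R B) \<Longrightarrow> P v \<Longrightarrow> P w \<Longrightarrow>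
      P (v \<oplus>\<^bsub>free_module R B\<^esub> w)"
    and single: "\<And>r x. r \<in> carrier R \<Longrightarrow> x \<in> B \<Longrightarrow> P (r \<odot>\<^bsub>free_module R B\<^esub> unit_vec R x)"
  shows "P v"
proof -
  interpret M: module R "free_module R B" by (rule module_free_module)
  have "(\<lambda>x. if x \<in> K then v x else \<zero>) \<in> carrier (free_module R B) \<and> P (\<lambda>x. if x \<in> K then v x else \<zero>)"
    if "finite K" "K \<subseteq> {x. v x \<noteq> \<zero>}" for K
    using that
  proof (induction K rule: finite_induct)
    case empty
    then show ?case using zero by simp
  next
    case (insert a K)
    let ?w = "\<lambda>x. if x \<in> K then v x else \<zero>" and ?s = "v a \<odot>\<^bsub>free_module R B\<^esub> unit_vec R a"
    have a: "a \<in> B" "v a \<in> carrier R" using insert.prems v by auto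
    have s: "?s \<in> carrier (free_module R B)" using a by (intro M.smult_closed unit_vec_closed)
    have w: "?w \<in> carrier (free_module R B)" "P ?w" using insert.IH insert.prems by blast+
    have "(\<lambda>x. if x \<in> insert a K then v x else \<zero>) = ?s \<oplus>\<^bsub>free_module R B\<^esub> ?w"
    proof
      fix x
      have "v x \<in> carrier R" using v by simp
      then show "(if x \<in> insert a K then v x else \<zero>) = (?s \<oplus>\<^bsub>free_module R B\<^esub> ?w) x"
        using insert.hyps(2) a by (cases "x = a") (simp_all add: unit_vec_def)
    qed
    then show ?case using add[OF s w(1) single[OF a(2,1)] w(2)] M.a_closed[OF s w(1)] by metis
  qed
  from this[of "{x. v x \<noteq> \<zero>}"] v have "P (\<lambda>x. if x \<in> {x. v x \<noteq> \<zero>} then v x else \<zero>)" by simp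
  moreover have "(\<lambda>x. if x \<in> {x. v x \<noteq> \<zero>} then v x else \<zero>) = v" by auto
  ultimately show ?thesis by simp
qed

text \<open>Linear maps out of a free module are evaluations of the associated linear forms.\<close>

definition linear_form :: "('x \<Rightarrow> 'a) \<Rightarrow> 'x multiset \<Rightarrow> 'a" where
  "linear_form v m = (if size m = 1 then v (THE x. m = {#x#}) else \<zero>)"

lemma linear_form_single [simp]: "linear_form v {#x#} = v x"
  by (simp add: linear_form_def)

lemma linear_form_eq_zero: "(\<And>x. m \<noteq> {#x#}) \<Longrightarrow> linear_form v m = \<zero>"
proof -
  assume "\<And>x. m \<noteq> {#x#}"
  then have "size m \<noteq> 1" using size_1_singleton_mset by blast
  then show ?thesis by (simp add: linear_form_def)
qed

lemma linear_form_mpoly: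
  assumes "v \<in> carrier (free_module R B)"
  shows "linear_form v \<in> carrier (mpoly_ring R B)"
proof (rule mpolyI)
  have "linear_form v m \<in> carrier R" for m
    using assms by (simp add: linear_form_def)
  moreover have "linear_form v m = \<zero>" if "\<not> set_mset m \<subseteq> B" for m
  proof (cases "\<exists>x. m = {#x#}")
    case True
    then show ?thesis using that assms by auto
  next
    case False
    then show ?thesis by (simp add: linear_form_eq_zero)
  qed
  ultimately show "linear_form v \<in> carrier (series_ring R B)" by (simp add: series_carrier_iff)
  have "{m. linear_form v m \<noteq> \<zero>} \<subseteq> (\<lambda>x. {#x#}) ` {x. v x \<noteq> \<zero>}"
  proof
    fix m assume "m \<in> {m. linear_form v m \<noteq> \<zero>}"
    then have m: "linear_form v m \<noteq> \<zero>" by simp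
    then have "\<exists>x. m = {#x#}" using linear_form_eq_zero[of m v] by metis
    then obtain x where "m = {#x#}" ..
    with m show "m \<in> (\<lambda>x. {#x#}) ` {x. v x \<noteq> \<zero>}" by simp
  qed
  then show "finite {m. linear_form v m \<noteq> \<zero>}"
    by (rule finite_subset) (use assms in simp)
qed

definition linear_ext ::
  "('c, 'n) ring_scheme \<Rightarrow> ('a \<Rightarrow> 'c) \<Rightarrow> ('x \<Rightarrow> 'c) \<Rightarrow> ('x \<Rightarrow> 'a) \<Rightarrow> 'c" where
  "linear_ext S \<phi> s v = mpoly_eval R S \<phi> s (linear_form v)"

text \<open>Passing from a vector to its linear form respects addition and turns a scalar into a
  constant factor, so linearity is that of polynomial evaluation.\<close>

lemma linear_ext:
  assumes S: "cring S" and \<phi>: "\<phi> \<in> ring_hom R S" and s: "s \<in> B \<rightarrow> carrier S"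
  shows "\<And>v. v \<in> carrier (free_module R B) \<Longrightarrow> linear_ext S \<phi> s v \<in> carrier S"
    "\<And>v w. v \<in> carrier (free_module R B) \<Longrightarrow> w \<in> carrier (free_module R B) \<Longrightarrow>
      linear_ext S \<phi> s (v \<oplus>\<^bsub>free_module R B\<^esub> w) = linear_ext S \<phi> s v \<oplus>\<^bsub>S\<^esub> linear_ext S \<phi> s w"
    "\<And>r v. r \<in> carrier R \<Longrightarrow> v \<in> carrier (free_module R B) \<Longrightarrow>
      linear_ext S \<phi> s (r \<odot>\<^bsub>free_module R B\<^esub> v) = \<phi> r \<otimes>\<^bsub>S\<^esub> linear_ext S \<phi> s v"
    "\<And>x. x \<in> B \<Longrightarrow> linear_ext S \<phi> s (unit_vec R x) = s x"
  unfolding linear_ext_def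
proof -
  let ?l = "\<lambda>v. mpoly_eval R S \<phi> s (linear_form v)"
  note ev = S \<phi> s
  fix v assume v: "v \<in> carrier (free_module R B)"
  note lv = linear_form_mpoly[OF v]
  show "?l v \<in> carrier S" by (rule mpoly_eval_closed[OF ev lv])
  show "?l (v \<oplus>\<^bsub>free_module R B\<^esub> w) = ?l v \<oplus>\<^bsub>S\<^esub> ?l w" if w: "w \<in> carrier (free_module R B)" for w
  proof -
    have "linear_form (v \<oplus>\<^bsub>free_module R B\<^esub> w) = linear_form v \<oplus>\<^bsub>series_ring R B\<^esub> linear_form w"
      by (auto simp: fun_eq_iff linear_form_def series_simps)
    then show ?thesis using mpoly_eval_add[OF ev lv linear_form_mpoly[OF w]] by simp
  qed
  show "?l (r \<odot>\<^bsub>free_module R B\<^esub> v) = \<phi> r \<otimes>\<^bsub>S\<^esub> ?l v" if r: "r \<in> carrier R" for r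
  proof -
    have "linear_form (r \<odot>\<^bsub>free_module R B\<^esub> v) = indexed_const r \<otimes>\<^bsub>series_ring R B\<^esub> linear_form v"
      using r lv by (auto simp: fun_eq_iff linear_form_def indexed_const_mult[OF r mpoly_series[OF lv]])
    then show ?thesis using mpoly_eval_const_mult[OF ev r lv] by simp
  qed
next
  fix x assume x: "x \<in> B"
  have "linear_form (unit_vec R x) = indexed_var x"
  proof
    fix m
    show "linear_form (unit_vec R x) m = indexed_var x m"
    proof (cases "\<exists>y. m = {#y#}")
      case True
      then show ?thesis by (auto simp: unit_vec_def indexed_var_eq split: if_splits)
    next
      case False
      then show ?thesis by (auto simp: linear_form_eq_zero indexed_var_eq)
    qed
  qed
  then show "mpoly_eval R S \<phi> s (linear_form (unit_vec R x)) = s x"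
    using mpoly_eval_var[OF S \<phi> s x] by simp
qed

end


subsection \<open>Quotient modules\<close>

context module
begin

lemma submodule_generated_submodule:
  assumes "S \<subseteq> carrier M"
  shows "submodule (submodule_generated R M S) R M"
proof -
  let ?F = "{N. submodule N R M \<and> S \<subseteq> N}"
  have car: "carrier M \<in> ?F" using assms carrier_is_submodule by simp
  note E = submoduleE[of N for N]
  have z: "\<zero>\<^bsub>M\<^esub> \<in> N" if "submodule N R M" for N
    using subgroup.one_closed[OF submodule.axioms(1)[OF that]] by simp
  show ?thesis
    unfolding submodule_generated_def
  proof (rule submoduleI)
    show "\<Inter> ?F \<subseteq> carrier M" using car by blast
    show "\<zero>\<^bsub>M\<^esub> \<in> \<Inter> ?F" using z by blast
    show "\<ominus>\<^bsub>M\<^esub> a \<in> \<Inter> ?F" if "a \<in> \<Inter> ?F" for a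
      using that E(3) by blast
    show "a \<oplus>\<^bsub>M\<^esub> b \<in> \<Inter> ?F" if "a \<in> \<Inter> ?F" "b \<in> \<Inter> ?F" for a b
      using that E(5) by blast
    show "a \<odot>\<^bsub>M\<^esub> x \<in> \<Inter> ?F" if "a \<in> carrier R" "x \<in> \<Inter> ?F" for a x
      using that E(4) by blast
  qed
qed

lemma submodule_generated_incl: "S \<subseteq> submodule_generated R M S"
  by (auto simp: submodule_generated_def)

lemma submodule_generated_minimal:
  "submodule N R M \<Longrightarrow> S \<subseteq> N \<Longrightarrow> submodule_generated R M S \<subseteq> N"
  by (auto simp: submodule_generated_def)

context
  fixes N assumes N: "submodule N R M"
begin

lemma additive_subgroup_submodule: "additive_subgroup N M"
  by (rule additive_subgroup.intro) (rule submodule.axioms(1)[OF N])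

interpretation N: abelian_subgroup N M
  by (rule abelian_subgroupI3[OF additive_subgroup_submodule M.abelian_group_axioms])

lemma quotient_module_carrier: "carrier (quotient_module M N) = {N +>\<^bsub>M\<^esub> x | x. x \<in> carrier M}"
  by (auto simp: quotient_module_def A_RCOSETS_def')

lemma quotient_module_add:
  "x \<in> carrier M \<Longrightarrow> y \<in> carrier M \<Longrightarrow>
    (N +>\<^bsub>M\<^esub> x) \<oplus>\<^bsub>quotient_module M N\<^esub> (N +>\<^bsub>M\<^esub> y) = N +>\<^bsub>M\<^esub> (x \<oplus>\<^bsub>M\<^esub> y)"
  by (simp add: quotient_module_def N.a_rcos_sum)

lemma quotient_module_smult:
  assumes "r \<in> carrier R" "x \<in> carrier M"
  shows "r \<odot>\<^bsub>quotient_module M N\<^esub> (N +>\<^bsub>M\<^esub> x) = N +>\<^bsub>M\<^esub> (r \<odot>\<^bsub>M\<^esub> x)"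
proof -
  have "(\<Union>y\<in>N +>\<^bsub>M\<^esub> x. N +>\<^bsub>M\<^esub> (r \<odot>\<^bsub>M\<^esub> y)) = N +>\<^bsub>M\<^esub> (r \<odot>\<^bsub>M\<^esub> x)"
  proof (rule M.quotient_smult[OF additive_subgroup_submodule assms(2)])
    fix y assume y: "y \<in> N"
    then have "r \<odot>\<^bsub>M\<^esub> (y \<oplus>\<^bsub>M\<^esub> x) = (r \<odot>\<^bsub>M\<^esub> y) \<oplus>\<^bsub>M\<^esub> (r \<odot>\<^bsub>M\<^esub> x)"
      using assms by (simp add: smult_r_distr)
    moreover have "r \<odot>\<^bsub>M\<^esub> y \<in> N" using submodule.smult_closed[OF N assms(1) y] .
    ultimately show "r \<odot>\<^bsub>M\<^esub> (y \<oplus>\<^bsub>M\<^esub> x) \<in> N +>\<^bsub>M\<^esub> (r \<odot>\<^bsub>M\<^esub> x)"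
      by (auto simp: a_r_coset_def')
  qed (use assms in simp)
  then show ?thesis by (simp add: quotient_module_def)
qed

lemma quotient_module_class_eq:
  assumes "x \<in> carrier M" "y \<in> carrier M" "x \<ominus>\<^bsub>M\<^esub> y \<in> N"
  shows "N +>\<^bsub>M\<^esub> x = N +>\<^bsub>M\<^esub> y"
proof -
  have "x \<in> N +>\<^bsub>M\<^esub> y" using assms by (intro N.a_rcos_module_rev) (simp_all add: M.minus_eq)
  then show ?thesis using N.a_repr_independence' assms(2) by metis
qed

end

end


subsection \<open>Symmetric algebras\<close>

locale sym_algebra = R: cring R for R :: "('a, 'm) ring_scheme" +
  fixes M :: "('a, 'b, 'n) module_scheme"
  assumes add_closed: "x \<in> carrier M \<Longrightarrow> y \<in> carrier M \<Longrightarrow> x \<oplus>\<^bsub>M\<^esub> y \<in> carrier M"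
    and smult_closed: "r \<in> carrier R \<Longrightarrow> x \<in> carrier M \<Longrightarrow> r \<odot>\<^bsub>M\<^esub> x \<in> carrier M"
begin

abbreviation P where "P \<equiv> mpoly_ring R (carrier M)"
sublocale P: cring P by (rule R.cring_mpoly_ring)

definition gens where
  "gens = {R.indexed_var (x \<oplus>\<^bsub>M\<^esub> y) \<ominus>\<^bsub>P\<^esub> (R.indexed_var x \<oplus>\<^bsub>P\<^esub> R.indexed_var y) | x y. x \<in> carrier M \<and> y \<in> carrier M} \<union>
       {R.indexed_var (r \<odot>\<^bsub>M\<^esub> x) \<ominus>\<^bsub>P\<^esub> (R.indexed_const r \<otimes>\<^bsub>P\<^esub> R.indexed_var x) | r x.
          r \<in> carrier R \<and> x \<in> carrier M}"

lemma Sym_ideal_eq: "Sym_ideal R M = Idl\<^bsub>P\<^esub> gens"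
  by (simp add: Sym_ideal_def gens_def Let_def)

lemma Sym_eq: "Sym R M = P Quot Idl\<^bsub>P\<^esub> gens"
  by (simp add: Sym_def Sym_ideal_eq)

lemma var_closed [simp]: "x \<in> carrier M \<Longrightarrow> R.indexed_var x \<in> carrier P"
  by (rule R.indexed_var_mpoly)

lemma const_closed [simp]: "r \<in> carrier R \<Longrightarrow> R.indexed_const r \<in> carrier P"
  by (rule R.indexed_const_mpoly)

lemma gens_carrier: "gens \<subseteq> carrier P"
proof -
  have "g \<in> carrier P" if "g \<in> gens" for g
    using that unfolding gens_def
    by (elim UnE CollectE exE conjE; hypsubst; intro P.minus_closed P.a_closed P.m_closed var_closed const_closed;
      simp add: add_closed smult_closed)
  then show ?thesis by blast
qed

sublocale Sym: cring "Sym R M"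
  unfolding Sym_eq by (rule P.quot_Idl_cring[OF gens_carrier])

abbreviation proj where "proj p \<equiv> Idl\<^bsub>P\<^esub> gens +>\<^bsub>P\<^esub> p"

lemma proj_hom: "proj \<in> ring_hom P (Sym R M)"
  unfolding Sym_eq by (rule P.quot_Idl_proj_hom[OF gens_carrier])

sublocale proj: ring_hom_cring P "Sym R M" proj
  by (rule ring_hom_cring_of[OF P.cring_axioms Sym.cring_axioms proj_hom])

lemma incl_eq: "Sym_incl R M x = proj (R.indexed_var x)"
  and const_eq: "Sym_const R M r = proj (R.indexed_const r)"
  by (simp_all add: Sym_incl_def Sym_const_def Sym_ideal_eq)

lemma proj_eqI:
  assumes "a \<in> carrier P" "b \<in> carrier P" "a \<ominus>\<^bsub>P\<^esub> b \<in> gens"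
  shows "proj a = proj b"
proof -
  have "proj (a \<ominus>\<^bsub>P\<^esub> b) = \<zero>\<^bsub>Sym R M\<^esub>"
    unfolding Sym_eq by (rule P.quot_Idl_relation[OF gens_carrier assms(3)])
  then have "proj a \<ominus>\<^bsub>Sym R M\<^esub> proj b = \<zero>\<^bsub>Sym R M\<^esub>"
    using assms(1,2) by (simp add: P.minus_eq Sym.minus_eq)
  then show ?thesis using assms(1,2) by (simp add: Sym.r_right_minus_eq)
qed

lemma const_hom: "Sym_const R M \<in> ring_hom R (Sym R M)"
  using ring_hom_trans[OF R.indexed_const_hom proj_hom] by (simp add: comp_def const_eq[abs_def])

lemma incl_closed [simp]: "x \<in> carrier M \<Longrightarrow> Sym_incl R M x \<in> carrier (Sym R M)"
  by (simp add: incl_eq)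

lemma Sym_const_closed [simp]: "r \<in> carrier R \<Longrightarrow> Sym_const R M r \<in> carrier (Sym R M)"
  by (simp add: const_eq)

lemma incl_add:
  assumes "x \<in> carrier M" "y \<in> carrier M"
  shows "Sym_incl R M (x \<oplus>\<^bsub>M\<^esub> y) = Sym_incl R M x \<oplus>\<^bsub>Sym R M\<^esub> Sym_incl R M y"
proof -
  have "proj (R.indexed_var (x \<oplus>\<^bsub>M\<^esub> y)) = proj (R.indexed_var x \<oplus>\<^bsub>P\<^esub> R.indexed_var y)"
    using assms by (intro proj_eqI) (auto simp: add_closed gens_def intro!: P.a_closed)
  then show ?thesis using assms proj.hom_add[of "R.indexed_var x" "R.indexed_var y"] by (simp add: incl_eq)
qed

lemma incl_smult:
  assumes "r \<in> carrier R" "x \<in> carrier M"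
  shows "Sym_incl R M (r \<odot>\<^bsub>M\<^esub> x) = Sym_const R M r \<otimes>\<^bsub>Sym R M\<^esub> Sym_incl R M x"
proof -
  have "proj (R.indexed_var (r \<odot>\<^bsub>M\<^esub> x)) = proj (R.indexed_const r \<otimes>\<^bsub>P\<^esub> R.indexed_var x)"
    using assms by (intro proj_eqI) (auto simp: smult_closed gens_def intro!: P.m_closed)
  then show ?thesis using assms proj.hom_mult[of "R.indexed_const r" "R.indexed_var x"]
    by (simp add: incl_eq const_eq)
qed

text \<open>Evaluation of polynomials in the elements of \<open>M\<close> at their values under
  \<open>l\<close> kills the generators of the ideal exactly because \<open>l\<close> is additive
  and compatible with scalars.\<close>

lemma Sym_hom_ex:
  assumes B: "cring B" and \<phi>: "\<phi> \<in> ring_hom R B"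
    and l: "\<And>x. x \<in> carrier M \<Longrightarrow> l x \<in> carrier B"
    and add: "\<And>x y. x \<in> carrier M \<Longrightarrow> y \<in> carrier M \<Longrightarrow> l (x \<oplus>\<^bsub>M\<^esub> y) = l x \<oplus>\<^bsub>B\<^esub> l y"
    and smult: "\<And>r x. r \<in> carrier R \<Longrightarrow> x \<in> carrier M \<Longrightarrow> l (r \<odot>\<^bsub>M\<^esub> x) = \<phi> r \<otimes>\<^bsub>B\<^esub> l x"
  obtains h where "h \<in> ring_hom (Sym R M) B" "\<And>r. r \<in> carrier R \<Longrightarrow> h (Sym_const R M r) = \<phi> r"
    "\<And>x. x \<in> carrier M \<Longrightarrow> h (Sym_incl R M x) = l x"
proof -
  interpret B: cring B by fact
  have l': "l \<in> carrier M \<rightarrow> carrier B" using l by auto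
  let ?e = "mpoly_eval R B \<phi> l"
  have e: "?e \<in> ring_hom P B" by (rule R.mpoly_eval_hom[OF B \<phi> l'])
  interpret e: ring_hom_cring P B ?e by (rule ring_hom_cring_of[OF P.cring_axioms B e])
  have ev: "?e (R.indexed_var x) = l x" if "x \<in> carrier M" for x
    by (rule R.mpoly_eval_var[OF B \<phi> l' that])
  have ec: "?e (R.indexed_const r) = \<phi> r" if "r \<in> carrier R" for r
    by (rule R.mpoly_eval_const[OF B \<phi> l' that])
  have em: "?e (a \<ominus>\<^bsub>P\<^esub> b) = ?e a \<ominus>\<^bsub>B\<^esub> ?e b" if "a \<in> carrier P" "b \<in> carrier P" for a b
    using that by (simp add: P.minus_eq B.minus_eq)
  have "?e g = \<zero>\<^bsub>B\<^esub>" if "g \<in> gens" for g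
    using that unfolding gens_def
  proof (elim UnE CollectE exE conjE)
    fix x y assume *: "g = R.indexed_var (x \<oplus>\<^bsub>M\<^esub> y) \<ominus>\<^bsub>P\<^esub> (R.indexed_var x \<oplus>\<^bsub>P\<^esub> R.indexed_var y)"
      "x \<in> carrier M" "y \<in> carrier M"
    then have "?e g = l (x \<oplus>\<^bsub>M\<^esub> y) \<ominus>\<^bsub>B\<^esub> (l x \<oplus>\<^bsub>B\<^esub> l y)"
      by (simp add: em add_closed ev e.hom_add P.a_closed)
    then show ?thesis using * l by (simp add: add B.minus_eq B.r_neg)
  next
    fix r x assume *: "g = R.indexed_var (r \<odot>\<^bsub>M\<^esub> x) \<ominus>\<^bsub>P\<^esub> (R.indexed_const r \<otimes>\<^bsub>P\<^esub> R.indexed_var x)"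
      "r \<in> carrier R" "x \<in> carrier M"
    then have "?e g = l (r \<odot>\<^bsub>M\<^esub> x) \<ominus>\<^bsub>B\<^esub> (\<phi> r \<otimes>\<^bsub>B\<^esub> l x)"
      by (simp add: em smult_closed ev ec e.hom_mult P.m_closed)
    then show ?thesis using * l ring_hom_closed[OF \<phi>] by (simp add: smult B.minus_eq B.r_neg)
  qed
  from P.quot_Idl_hom_ex[OF gens_carrier B e this]
  obtain h where "h \<in> ring_hom (Sym R M) B" "\<And>p. p \<in> carrier P \<Longrightarrow> h (proj p) = ?e p"
    unfolding Sym_eq by blast
  then show ?thesis using that ev ec by (simp add: incl_eq const_eq)
qed

lemma Sym_carrierE:
  assumes "u \<in> carrier (Sym R M)"
  obtains p where "p \<in> carrier P" "u = proj p"
  using assms unfolding Sym_eq by (rule quot_carrierE)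

lemma Sym_hom_unique:
  assumes B: "cring B" and h: "h \<in> ring_hom (Sym R M) B" "h' \<in> ring_hom (Sym R M) B"
    and c: "\<And>r. r \<in> carrier R \<Longrightarrow> h (Sym_const R M r) = h' (Sym_const R M r)"
    and i: "\<And>x. x \<in> carrier M \<Longrightarrow> h (Sym_incl R M x) = h' (Sym_incl R M x)"
    and u: "u \<in> carrier (Sym R M)"
  shows "h u = h' u"
proof -
  obtain p where p: "p \<in> carrier P" "u = proj p" using u by (rule Sym_carrierE)
  have "(h \<circ> proj) p = (h' \<circ> proj) p"
    by (rule R.mpoly_hom_unique[OF B ring_hom_trans[OF proj_hom h(1)] ring_hom_trans[OF proj_hom h(2)] _ _ p(1)])
      (use c i in \<open>auto simp: const_eq incl_eq\<close>)
  then show ?thesis using p by simp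
qed

text \<open>Evaluation at the variables and the identity are ring endomorphisms that agree on
  constants and variables. The equation writes \<open>p\<close> as the sum of its terms.\<close>

lemma mpoly_expand: "p \<in> carrier P \<Longrightarrow> mpoly_eval R P R.indexed_const R.indexed_var p = p"
proof -
  assume p: "p \<in> carrier P"
  have v: "R.indexed_var \<in> carrier M \<rightarrow> carrier P" by auto
  note ev = P.cring_axioms R.indexed_const_hom v
  have "mpoly_eval R P R.indexed_const R.indexed_var p = id p"
    by (rule R.mpoly_hom_unique[OF P.cring_axioms R.mpoly_eval_hom[OF ev] id_ring_hom _ _ p])
      (simp_all add: R.mpoly_eval_const[OF ev] R.mpoly_eval_var[OF ev])
  then show ?thesis by simp
qed

text \<open>Modulo the ideal a sum of terms of size one is the image of a single element of
  \<open>M\<close>. The element \<open>z\<close> plays the part of a zero of \<open>M\<close> and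
  covers the empty sum.\<close>

lemma Sym_grading_top:
  assumes d: "d > 0" and u: "u \<in> Sym_grading R M d d" and z: "z \<in> carrier M" "Sym_incl R M z = \<zero>\<^bsub>Sym R M\<^esub>"
  shows "u \<in> Sym_incl R M ` carrier M"
proof -
  obtain p where pg: "p \<in> mpoly_grading R (trivial_grading R) (carrier M) (\<lambda>_. d) d" and up: "u = proj p"
    using u by (auto simp: Sym_grading_def Sym_ideal_eq)
  have p: "p \<in> carrier P" using pg by (simp add: mpoly_grading_def)
  \<comment> \<open>All variables have weight \<open>d\<close>, so size two exceeds the degree,
    while a constant would have to lie in the trivial grading in degree \<open>d > 0\<close>, which
    is zero.\<close>
  have one: "\<exists>x\<in>carrier M. m = {#x#}" if "p m \<noteq> \<zero>\<^bsub>R\<^esub>" for m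
  proof -
    have "set_mset m \<subseteq> carrier M" using series_coeff_outside[OF R.mpoly_series[OF p]] that by blast
    moreover have "(if size m * d \<le> d then p m \<in> trivial_grading R (d - size m * d) else p m = \<zero>\<^bsub>R\<^esub>)"
    proof -
      have "(\<Sum>v\<in>#m. d) = size m * d" by simp
      then show ?thesis using pg unfolding mpoly_grading_def by (metis (mono_tags, lifting) mem_Collect_eq)
    qed
    then have "size m = 1" using that d
      by (cases "size m"; cases "size m - 1") (auto simp: trivial_grading_def split: if_splits)
    ultimately show ?thesis by (metis insert_subset set_mset_add_mset_insert size_1_singleton_mset)
  qed
  let ?f = "\<lambda>m. R.indexed_const (p m) \<otimes>\<^bsub>P\<^esub> mpow P R.indexed_var m" and ?K = "{m. p m \<noteq> \<zero>\<^bsub>R\<^esub>}"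
  have f: "?f m = R.indexed_const (p m) \<otimes>\<^bsub>P\<^esub> R.indexed_var x" if "m = {#x#}" "x \<in> carrier M" for m x
    using that by (simp add: P.mpow_add_mset Pi_def P.m_closed)
  note pc = series_coeff_closed[OF R.mpoly_series[OF p]]
  have fc: "?f m \<in> carrier P \<and> proj (?f m) \<in> Sym_incl R M ` carrier M" if "m \<in> ?K" for m
  proof -
    have "p m \<noteq> \<zero>\<^bsub>R\<^esub>" using that by simp
    then obtain x where x: "m = {#x#}" "x \<in> carrier M" using one by blast
    have "Sym_incl R M (p m \<odot>\<^bsub>M\<^esub> x) = proj (?f m)"
      using x pc f[OF x] incl_smult[OF pc x(2), of m]
      by (simp add: const_eq[symmetric] incl_eq[symmetric] proj.hom_mult)
    moreover have "p m \<odot>\<^bsub>M\<^esub> x \<in> carrier M" using x pc smult_closed by blast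
    ultimately show ?thesis using f[OF x] x pc P.m_closed[of "R.indexed_const (p m)" "R.indexed_var x"]
      by (metis const_closed image_eqI var_closed)
  qed
  have "p = (\<Oplus>\<^bsub>P\<^esub>m\<in>?K. ?f m)"
    using mpoly_expand[OF p] by (simp add: mpoly_eval_def)
  then have "u = proj (\<Oplus>\<^bsub>P\<^esub>m\<in>?K. ?f m)" using up by simp
  also have "\<dots> = (\<Oplus>\<^bsub>Sym R M\<^esub>m\<in>?K. (proj \<circ> ?f) m)"
  proof (rule proj.hom_finsum)
    show "?f \<in> ?K \<rightarrow> carrier P" using fc by blast
  qed
  also have "\<dots> \<in> Sym_incl R M ` carrier M"
  proof (rule Sym.finsum_in_subset)
    show "\<zero>\<^bsub>Sym R M\<^esub> \<in> Sym_incl R M ` carrier M" using z by (metis image_eqI)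
    show "x \<oplus>\<^bsub>Sym R M\<^esub> y \<in> Sym_incl R M ` carrier M"
      if "x \<in> Sym_incl R M ` carrier M" "y \<in> Sym_incl R M ` carrier M" for x y
      using that by (auto simp: incl_add[symmetric] add_closed)
    show "finite ?K" by (rule R.mpoly_finite_support[OF p])
    show "proj \<circ> ?f \<in> ?K \<rightarrow> Sym_incl R M ` carrier M"
      using fc unfolding Pi_def comp_def by blast
    show "Sym_incl R M ` carrier M \<subseteq> carrier (Sym R M)" by auto
  qed
  finally show ?thesis .
qed

lemma Sym_grading_zero:
  assumes "d > 0" "u \<in> Sym_grading R M d 0"
  obtains r where "r \<in> carrier R" "u = Sym_const R M r"
proof -
  obtain p where pg: "p \<in> mpoly_grading R (trivial_grading R) (carrier M) (\<lambda>_. d) 0" and up: "u = proj p"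
    using assms(2) by (auto simp: Sym_grading_def Sym_ideal_eq)
  then have "p m = \<zero>\<^bsub>R\<^esub>" if "m \<noteq> {#}" for m
    using that assms(1) by (auto simp: mpoly_grading_def split: if_splits dest!: spec[of _ m])
  then have "p = R.indexed_const (p {#})" by (auto simp: R.indexed_const_def)
  moreover have "p {#} \<in> carrier R" using pg by (auto simp: mpoly_grading_def intro: series_coeff_closed R.mpoly_series)
  ultimately show ?thesis using that up const_eq by metis
qed

lemma Sym_grading_incl: "x \<in> carrier M \<Longrightarrow> Sym_incl R M x \<in> Sym_grading R M d d"
  unfolding Sym_grading_def Sym_ideal_eq incl_eq
  by (intro imageI) (auto simp: mpoly_grading_def trivial_grading_def R.indexed_var_eq R.indexed_var_mpoly[unfolded R.indexed_var_eq])

lemma Sym_grading_const: "r \<in> carrier R \<Longrightarrow> Sym_const R M r \<in> Sym_grading R M d 0"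
  unfolding Sym_grading_def Sym_ideal_eq const_eq
  by (intro imageI) (auto simp: mpoly_grading_def trivial_grading_def R.indexed_const_def R.indexed_const_mpoly[unfolded R.indexed_const_def])

end

lemma sym_algebra_cring: "sym_algebra R M \<Longrightarrow> cring (Sym R M)"
proof -
  assume "sym_algebra R M"
  then interpret sym_algebra R M .
  show ?thesis by (rule Sym.cring_axioms)
qed


section \<open>The Hopf algebroid of formal module 2-buds\<close>

lemma additive_minus:
  assumes "abelian_group M" "abelian_group B"
    and l: "\<And>x. x \<in> carrier M \<Longrightarrow> l x \<in> carrier B"
    and add: "\<And>x y. x \<in> carrier M \<Longrightarrow> y \<in> carrier M \<Longrightarrow> l (x \<oplus>\<^bsub>M\<^esub> y) = l x \<oplus>\<^bsub>B\<^esub> l y"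
    and xy: "x \<in> carrier M" "y \<in> carrier M"
  shows "l (x \<ominus>\<^bsub>M\<^esub> y) = l x \<ominus>\<^bsub>B\<^esub> l y" "l \<zero>\<^bsub>M\<^esub> = \<zero>\<^bsub>B\<^esub>"
proof -
  interpret M: abelian_group M by fact
  interpret B: abelian_group B by fact
  have c: "l x \<in> carrier B" "l y \<in> carrier B" "l (x \<ominus>\<^bsub>M\<^esub> y) \<in> carrier B" "l \<zero>\<^bsub>M\<^esub> \<in> carrier B"
    using l xy by auto
  have "x \<ominus>\<^bsub>M\<^esub> y \<oplus>\<^bsub>M\<^esub> y = x" using xy by (simp add: M.minus_eq M.a_assoc M.l_neg)
  then have "l (x \<ominus>\<^bsub>M\<^esub> y) \<oplus>\<^bsub>B\<^esub> l y = l x" using add[of "x \<ominus>\<^bsub>M\<^esub> y" y] xy by simp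
  then have "l x \<ominus>\<^bsub>B\<^esub> l y = l (x \<ominus>\<^bsub>M\<^esub> y) \<oplus>\<^bsub>B\<^esub> l y \<ominus>\<^bsub>B\<^esub> l y" by simp
  also have "\<dots> = l (x \<ominus>\<^bsub>M\<^esub> y)" using c by (simp add: B.minus_eq B.a_assoc B.r_neg)
  finally show "l (x \<ominus>\<^bsub>M\<^esub> y) = l x \<ominus>\<^bsub>B\<^esub> l y" by simp
  have "l \<zero>\<^bsub>M\<^esub> \<oplus>\<^bsub>B\<^esub> l \<zero>\<^bsub>M\<^esub> = l \<zero>\<^bsub>M\<^esub> \<oplus>\<^bsub>B\<^esub> \<zero>\<^bsub>B\<^esub>"
    using add[of "\<zero>\<^bsub>M\<^esub>" "\<zero>\<^bsub>M\<^esub>"] c by simp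
  then show "l \<zero>\<^bsub>M\<^esub> = \<zero>\<^bsub>B\<^esub>" using c(4) B.add.l_cancel by blast
qed

locale bud_ring = A: cring A for A :: "('a, 'm) ring_scheme"
begin

abbreviation F where "F \<equiv> dr_free A"
abbreviation N where "N \<equiv> dr_submodule A"
abbreviation G0 where "G0 \<equiv> unit_vec A Gamma"
abbreviation C0 where "C0 a \<equiv> unit_vec A (Cee a)"

lemma module_dr_free: "module A F"
  unfolding dr_free_def by (rule A.module_free_module)

interpretation F: module A F by (rule module_dr_free)

lemma unit_closed [simp]: "G0 \<in> carrier F" "a \<in> carrier A \<Longrightarrow> C0 a \<in> carrier F"
  unfolding dr_free_def by (intro A.unit_vec_closed; simp)+

lemma relations_eq: "dr_relations A =
    {((a \<otimes>\<^bsub>A\<^esub> a \<ominus>\<^bsub>A\<^esub> a) \<odot>\<^bsub>F\<^esub> G0) \<ominus>\<^bsub>F\<^esub> (C0 a \<oplus>\<^bsub>F\<^esub> C0 a) | a. a \<in> carrier A} \<union>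
    {(C0 (a \<oplus>\<^bsub>A\<^esub> b) \<ominus>\<^bsub>F\<^esub> C0 a \<ominus>\<^bsub>F\<^esub> C0 b) \<ominus>\<^bsub>F\<^esub> ((a \<otimes>\<^bsub>A\<^esub> b) \<odot>\<^bsub>F\<^esub> G0) | a b.
       a \<in> carrier A \<and> b \<in> carrier A} \<union>
    {((a \<odot>\<^bsub>F\<^esub> C0 b) \<oplus>\<^bsub>F\<^esub> ((b \<otimes>\<^bsub>A\<^esub> b) \<odot>\<^bsub>F\<^esub> C0 a)) \<ominus>\<^bsub>F\<^esub> C0 (a \<otimes>\<^bsub>A\<^esub> b) | a b.
       a \<in> carrier A \<and> b \<in> carrier A}"
  by (simp add: dr_relations_def Let_def)

lemma relations_carrier: "dr_relations A \<subseteq> carrier F"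
proof -
  have "r \<in> carrier F" if "r \<in> dr_relations A" for r
    using that unfolding relations_eq
    by (elim UnE CollectE exE conjE; hypsubst; intro F.M.minus_closed F.M.a_closed F.smult_closed unit_closed; simp)
  then show ?thesis by blast
qed

lemma N_submodule: "submodule N A F"
  unfolding dr_submodule_def by (rule F.submodule_generated_submodule[OF relations_carrier])

lemma relations_N: "dr_relations A \<subseteq> N"
  unfolding dr_submodule_def by (rule F.submodule_generated_incl)

abbreviation cls where "cls v \<equiv> N +>\<^bsub>F\<^esub> v"

lemma Dr_carrier: "carrier (Dr A) = {cls v | v. v \<in> carrier F}"
  and Dr_add: "v \<in> carrier F \<Longrightarrow> w \<in> carrier F \<Longrightarrow> cls v \<oplus>\<^bsub>Dr A\<^esub> cls w = cls (v \<oplus>\<^bsub>F\<^esub> w)"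
  and Dr_smult: "r \<in> carrier A \<Longrightarrow> v \<in> carrier F \<Longrightarrow> r \<odot>\<^bsub>Dr A\<^esub> cls v = cls (r \<odot>\<^bsub>F\<^esub> v)"
  unfolding Dr_def
  using F.quotient_module_carrier[OF N_submodule] F.quotient_module_add[OF N_submodule]
    F.quotient_module_smult[OF N_submodule] by auto

lemma cls_closed [simp]: "v \<in> carrier F \<Longrightarrow> cls v \<in> carrier (Dr A)"
  unfolding Dr_carrier by blast

lemma sym_algebra_Dr: "sym_algebra A (Dr A)"
proof
  fix x y assume "x \<in> carrier (Dr A)" "y \<in> carrier (Dr A)"
  then obtain v w where "x = cls v" "v \<in> carrier F" "y = cls w" "w \<in> carrier F"
    unfolding Dr_carrier by (elim CollectE exE conjE)
  then show "x \<oplus>\<^bsub>Dr A\<^esub> y \<in> carrier (Dr A)" by (simp add: Dr_add)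
next
  fix r x assume "r \<in> carrier A" "x \<in> carrier (Dr A)"
  then obtain v where "x = cls v" "v \<in> carrier F"
    unfolding Dr_carrier by (elim CollectE exE conjE)
  then show "r \<odot>\<^bsub>Dr A\<^esub> x \<in> carrier (Dr A)" using \<open>r \<in> carrier A\<close> by (simp add: Dr_smult)
qed

lemma L_buds_eq: "Sym A (Dr A) = L_buds A"
  by (simp add: L_buds_def)

lemma L_cring: "cring (L_buds A)"
  using sym_algebra_cring[OF sym_algebra_Dr] by (simp add: L_buds_eq)

interpretation LA: cring "L_buds A" by (rule L_cring)

abbreviation J where "J v \<equiv> Sym_incl A (Dr A) (cls v)"

lemma J_closed [simp]: "v \<in> carrier F \<Longrightarrow> J v \<in> carrier (L_buds A)"
  using sym_algebra.incl_closed[OF sym_algebra_Dr, of "cls v"] by (simp add: L_buds_eq)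

lemma J_add: "v \<in> carrier F \<Longrightarrow> w \<in> carrier F \<Longrightarrow> J (v \<oplus>\<^bsub>F\<^esub> w) = J v \<oplus>\<^bsub>L_buds A\<^esub> J w"
  using sym_algebra.incl_add[OF sym_algebra_Dr, of "cls v" "cls w"] by (simp add: Dr_add L_buds_eq)

lemma J_smult: "r \<in> carrier A \<Longrightarrow> v \<in> carrier F \<Longrightarrow> J (r \<odot>\<^bsub>F\<^esub> v) = buds_scal A r \<otimes>\<^bsub>L_buds A\<^esub> J v"
  using sym_algebra.incl_smult[OF sym_algebra_Dr, of r "cls v"] by (simp add: Dr_smult L_buds_eq buds_scal_def)

lemma scal_hom: "buds_scal A \<in> ring_hom A (L_buds A)"
  using sym_algebra.const_hom[OF sym_algebra_Dr] by (simp add: buds_scal_def[abs_def] L_buds_eq)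

lemma gamma_eq: "buds_gamma A = J G0" and c_eq: "buds_c A a = J (C0 a)"
  by (simp_all add: buds_gamma_def buds_c_def)

text \<open>The equivalence is used in both directions: for the inclusion \<open>J\<close> of the
  free module it gives the relations between the symbols in the ring of 2-buds, and for a linear
  extension of prescribed values it shows that this extension descends to \<open>Dr\<close>.\<close>

lemma linear_relations:
  assumes B: "cring B" and \<phi>: "\<phi> \<in> ring_hom A B"
    and l: "\<And>v. v \<in> carrier F \<Longrightarrow> l v \<in> carrier B"
    and add: "\<And>v w. v \<in> carrier F \<Longrightarrow> w \<in> carrier F \<Longrightarrow> l (v \<oplus>\<^bsub>F\<^esub> w) = l v \<oplus>\<^bsub>B\<^esub> l w"
    and smult: "\<And>r v. r \<in> carrier A \<Longrightarrow> v \<in> carrier F \<Longrightarrow> l (r \<odot>\<^bsub>F\<^esub> v) = \<phi> r \<otimes>\<^bsub>B\<^esub> l v"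
  shows "(\<forall>r\<in>dr_relations A. l r = \<zero>\<^bsub>B\<^esub>) \<longleftrightarrow>
    (\<forall>a\<in>carrier A. \<phi> (a \<otimes>\<^bsub>A\<^esub> a \<ominus>\<^bsub>A\<^esub> a) \<otimes>\<^bsub>B\<^esub> l G0 = l (C0 a) \<oplus>\<^bsub>B\<^esub> l (C0 a)) \<and>
    (\<forall>a\<in>carrier A. \<forall>b\<in>carrier A.
      l (C0 (a \<oplus>\<^bsub>A\<^esub> b)) = l (C0 a) \<oplus>\<^bsub>B\<^esub> l (C0 b) \<oplus>\<^bsub>B\<^esub> \<phi> (a \<otimes>\<^bsub>A\<^esub> b) \<otimes>\<^bsub>B\<^esub> l G0) \<and>
    (\<forall>a\<in>carrier A. \<forall>b\<in>carrier A.
      \<phi> a \<otimes>\<^bsub>B\<^esub> l (C0 b) \<oplus>\<^bsub>B\<^esub> \<phi> (b \<otimes>\<^bsub>A\<^esub> b) \<otimes>\<^bsub>B\<^esub> l (C0 a) = l (C0 (a \<otimes>\<^bsub>A\<^esub> b)))"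
proof -
  interpret B: cring B by fact
  note p = ring_hom_closed[OF \<phi>]
  note m = additive_minus[of F B l, OF F.M.abelian_group_axioms B.abelian_group_axioms l add]
  have e: "x \<ominus>\<^bsub>B\<^esub> y = \<zero>\<^bsub>B\<^esub> \<longleftrightarrow> x = y" if "x \<in> carrier B" "y \<in> carrier B" for x y
    using that by (simp add: B.r_right_minus_eq)
  have e3: "x \<ominus>\<^bsub>B\<^esub> y \<ominus>\<^bsub>B\<^esub> z \<ominus>\<^bsub>B\<^esub> w = \<zero>\<^bsub>B\<^esub> \<longleftrightarrow> x = y \<oplus>\<^bsub>B\<^esub> z \<oplus>\<^bsub>B\<^esub> w"
    if "x \<in> carrier B" "y \<in> carrier B" "z \<in> carrier B" "w \<in> carrier B" for x y z w
  proof -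
    have "x \<ominus>\<^bsub>B\<^esub> y \<ominus>\<^bsub>B\<^esub> z \<ominus>\<^bsub>B\<^esub> w = x \<ominus>\<^bsub>B\<^esub> (y \<oplus>\<^bsub>B\<^esub> z \<oplus>\<^bsub>B\<^esub> w)"
      using that by algebra
    then show ?thesis using that by (simp add: e)
  qed
  have 1: "l (((a \<otimes>\<^bsub>A\<^esub> a \<ominus>\<^bsub>A\<^esub> a) \<odot>\<^bsub>F\<^esub> G0) \<ominus>\<^bsub>F\<^esub> (C0 a \<oplus>\<^bsub>F\<^esub> C0 a)) =
    \<phi> (a \<otimes>\<^bsub>A\<^esub> a \<ominus>\<^bsub>A\<^esub> a) \<otimes>\<^bsub>B\<^esub> l G0 \<ominus>\<^bsub>B\<^esub> (l (C0 a) \<oplus>\<^bsub>B\<^esub> l (C0 a))" if "a \<in> carrier A" for a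
    using that by (simp add: m add smult)
  have 2: "l ((C0 (a \<oplus>\<^bsub>A\<^esub> b) \<ominus>\<^bsub>F\<^esub> C0 a \<ominus>\<^bsub>F\<^esub> C0 b) \<ominus>\<^bsub>F\<^esub> ((a \<otimes>\<^bsub>A\<^esub> b) \<odot>\<^bsub>F\<^esub> G0)) =
    l (C0 (a \<oplus>\<^bsub>A\<^esub> b)) \<ominus>\<^bsub>B\<^esub> l (C0 a) \<ominus>\<^bsub>B\<^esub> l (C0 b) \<ominus>\<^bsub>B\<^esub> \<phi> (a \<otimes>\<^bsub>A\<^esub> b) \<otimes>\<^bsub>B\<^esub> l G0"
    if "a \<in> carrier A" "b \<in> carrier A" for a b
    using that by (simp add: m smult)
  have 3: "l (((a \<odot>\<^bsub>F\<^esub> C0 b) \<oplus>\<^bsub>F\<^esub> ((b \<otimes>\<^bsub>A\<^esub> b) \<odot>\<^bsub>F\<^esub> C0 a)) \<ominus>\<^bsub>F\<^esub> C0 (a \<otimes>\<^bsub>A\<^esub> b)) =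
    (\<phi> a \<otimes>\<^bsub>B\<^esub> l (C0 b) \<oplus>\<^bsub>B\<^esub> \<phi> (b \<otimes>\<^bsub>A\<^esub> b) \<otimes>\<^bsub>B\<^esub> l (C0 a)) \<ominus>\<^bsub>B\<^esub> l (C0 (a \<otimes>\<^bsub>A\<^esub> b))"
    if "a \<in> carrier A" "b \<in> carrier A" for a b
    using that by (simp add: m add smult)
  have i1: "l (((a \<otimes>\<^bsub>A\<^esub> a \<ominus>\<^bsub>A\<^esub> a) \<odot>\<^bsub>F\<^esub> G0) \<ominus>\<^bsub>F\<^esub> (C0 a \<oplus>\<^bsub>F\<^esub> C0 a)) = \<zero>\<^bsub>B\<^esub> \<longleftrightarrow>
    \<phi> (a \<otimes>\<^bsub>A\<^esub> a \<ominus>\<^bsub>A\<^esub> a) \<otimes>\<^bsub>B\<^esub> l G0 = l (C0 a) \<oplus>\<^bsub>B\<^esub> l (C0 a)" if "a \<in> carrier A" for a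
    unfolding 1[OF that] using that l p by (intro e) simp_all
  have i2: "l ((C0 (a \<oplus>\<^bsub>A\<^esub> b) \<ominus>\<^bsub>F\<^esub> C0 a \<ominus>\<^bsub>F\<^esub> C0 b) \<ominus>\<^bsub>F\<^esub> ((a \<otimes>\<^bsub>A\<^esub> b) \<odot>\<^bsub>F\<^esub> G0)) = \<zero>\<^bsub>B\<^esub> \<longleftrightarrow>
    l (C0 (a \<oplus>\<^bsub>A\<^esub> b)) = l (C0 a) \<oplus>\<^bsub>B\<^esub> l (C0 b) \<oplus>\<^bsub>B\<^esub> \<phi> (a \<otimes>\<^bsub>A\<^esub> b) \<otimes>\<^bsub>B\<^esub> l G0"
    if "a \<in> carrier A" "b \<in> carrier A" for a b
    unfolding 2[OF that] using that l p by (intro e3) simp_all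
  have i3: "l (((a \<odot>\<^bsub>F\<^esub> C0 b) \<oplus>\<^bsub>F\<^esub> ((b \<otimes>\<^bsub>A\<^esub> b) \<odot>\<^bsub>F\<^esub> C0 a)) \<ominus>\<^bsub>F\<^esub> C0 (a \<otimes>\<^bsub>A\<^esub> b)) = \<zero>\<^bsub>B\<^esub> \<longleftrightarrow>
    \<phi> a \<otimes>\<^bsub>B\<^esub> l (C0 b) \<oplus>\<^bsub>B\<^esub> \<phi> (b \<otimes>\<^bsub>A\<^esub> b) \<otimes>\<^bsub>B\<^esub> l (C0 a) = l (C0 (a \<otimes>\<^bsub>A\<^esub> b))"
    if "a \<in> carrier A" "b \<in> carrier A" for a b
    unfolding 3[OF that] using that l p by (intro e) simp_all
  have split: "(\<forall>r\<in>dr_relations A. Q r) \<longleftrightarrow>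
    (\<forall>a\<in>carrier A. Q (((a \<otimes>\<^bsub>A\<^esub> a \<ominus>\<^bsub>A\<^esub> a) \<odot>\<^bsub>F\<^esub> G0) \<ominus>\<^bsub>F\<^esub> (C0 a \<oplus>\<^bsub>F\<^esub> C0 a))) \<and>
    (\<forall>a\<in>carrier A. \<forall>b\<in>carrier A.
      Q ((C0 (a \<oplus>\<^bsub>A\<^esub> b) \<ominus>\<^bsub>F\<^esub> C0 a \<ominus>\<^bsub>F\<^esub> C0 b) \<ominus>\<^bsub>F\<^esub> ((a \<otimes>\<^bsub>A\<^esub> b) \<odot>\<^bsub>F\<^esub> G0))) \<and>
    (\<forall>a\<in>carrier A. \<forall>b\<in>carrier A.
      Q (((a \<odot>\<^bsub>F\<^esub> C0 b) \<oplus>\<^bsub>F\<^esub> ((b \<otimes>\<^bsub>A\<^esub> b) \<odot>\<^bsub>F\<^esub> C0 a)) \<ominus>\<^bsub>F\<^esub> C0 (a \<otimes>\<^bsub>A\<^esub> b)))" for Q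
    unfolding relations_eq by blast
  show ?thesis
    unfolding split by (simp only: i1 i2 i3 cong: ball_cong)
qed

lemma J_relations: "r \<in> dr_relations A \<Longrightarrow> J r = \<zero>\<^bsub>L_buds A\<^esub>"
proof -
  assume r: "r \<in> dr_relations A"
  note z = additive_minus(2)[of F "L_buds A" J, OF F.M.abelian_group_axioms LA.abelian_group_axioms J_closed J_add
    F.M.zero_closed F.M.zero_closed]
  have rF: "r \<in> carrier F" using r relations_carrier by blast
  then have "r \<ominus>\<^bsub>F\<^esub> \<zero>\<^bsub>F\<^esub> = r" by (simp add: F.M.minus_eq F.M.add.inv_one)
  then have "r \<ominus>\<^bsub>F\<^esub> \<zero>\<^bsub>F\<^esub> \<in> N" using subsetD[OF relations_N r] by simp
  then have "cls r = cls \<zero>\<^bsub>F\<^esub>"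
    using F.quotient_module_class_eq[OF N_submodule rF F.M.zero_closed] by blast
  then show ?thesis using z by simp
qed

lemma scal_closed [simp]: "a \<in> carrier A \<Longrightarrow> buds_scal A a \<in> carrier (L_buds A)"
  and gamma_closed [simp]: "buds_gamma A \<in> carrier (L_buds A)"
  and c_closed [simp]: "a \<in> carrier A \<Longrightarrow> buds_c A a \<in> carrier (L_buds A)"
  using ring_hom_closed[OF scal_hom] by (auto simp: gamma_eq c_eq)

lemma buds_relations:
  "a \<in> carrier A \<Longrightarrow> buds_scal A (a \<otimes>\<^bsub>A\<^esub> a \<ominus>\<^bsub>A\<^esub> a) \<otimes>\<^bsub>L_buds A\<^esub> buds_gamma A =
    buds_c A a \<oplus>\<^bsub>L_buds A\<^esub> buds_c A a"
  "a \<in> carrier A \<Longrightarrow> b \<in> carrier A \<Longrightarrow> buds_c A (a \<oplus>\<^bsub>A\<^esub> b) =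
    buds_c A a \<oplus>\<^bsub>L_buds A\<^esub> buds_c A b \<oplus>\<^bsub>L_buds A\<^esub> buds_scal A (a \<otimes>\<^bsub>A\<^esub> b) \<otimes>\<^bsub>L_buds A\<^esub> buds_gamma A"
  "a \<in> carrier A \<Longrightarrow> b \<in> carrier A \<Longrightarrow>
    buds_scal A a \<otimes>\<^bsub>L_buds A\<^esub> buds_c A b \<oplus>\<^bsub>L_buds A\<^esub> buds_scal A (b \<otimes>\<^bsub>A\<^esub> b) \<otimes>\<^bsub>L_buds A\<^esub> buds_c A a =
    buds_c A (a \<otimes>\<^bsub>A\<^esub> b)"
  using linear_relations[OF L_cring scal_hom J_closed J_add J_smult] J_relations
  unfolding gamma_eq c_eq by blast+

lemma Dr_induct [consumes 1, case_names gamma c add smult]: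
  assumes x: "x \<in> carrier (Dr A)"
    and "P (cls G0)" "\<And>a. a \<in> carrier A \<Longrightarrow> P (cls (C0 a))"
    and add: "\<And>x y. x \<in> carrier (Dr A) \<Longrightarrow> y \<in> carrier (Dr A) \<Longrightarrow> P x \<Longrightarrow> P y \<Longrightarrow> P (x \<oplus>\<^bsub>Dr A\<^esub> y)"
    and smult: "\<And>r x. r \<in> carrier A \<Longrightarrow> x \<in> carrier (Dr A) \<Longrightarrow> P x \<Longrightarrow> P (r \<odot>\<^bsub>Dr A\<^esub> x)"
  shows "P x"
proof -
  obtain v where v: "v \<in> carrier F" "x = cls v" using x unfolding Dr_carrier by blast
  have unit: "unit_vec A s \<in> carrier F \<and> P (cls (unit_vec A s))" if "s \<in> insert Gamma (Cee ` carrier A)" for s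
    using that assms(2,3) by auto
  have single: "P (cls (r \<odot>\<^bsub>F\<^esub> unit_vec A s))"
    if "r \<in> carrier A" "s \<in> insert Gamma (Cee ` carrier A)" for r s
    using smult[of r "cls (unit_vec A s)"] unit[OF that(2)] that(1) by (simp add: Dr_smult)
  have "P (cls v)" using v(1) unfolding dr_free_def
  proof (induction rule: A.free_module_induct)
    \<comment> \<open>The zero vector is the zero multiple of \<gamma>, so the induction rule has no
      separate case for it.\<close>
    case zero
    have "\<zero>\<^bsub>A\<^esub> \<odot>\<^bsub>F\<^esub> G0 = \<zero>\<^bsub>F\<^esub>" by simp
    then have "\<zero>\<^bsub>A\<^esub> \<odot>\<^bsub>F\<^esub> G0 = (\<lambda>x. \<zero>\<^bsub>A\<^esub>)" by (simp add: dr_free_def)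
    then show ?case using single[of "\<zero>\<^bsub>A\<^esub>" Gamma] by (simp add: dr_free_def)
  next
    case (add v w)
    then show ?case
      using assms(4)[of "cls v" "cls w"] Dr_add[of v w] by (simp add: dr_free_def[symmetric] del: free_module_simps)
  next
    case (single r s)
    then show ?case using \<open>\<And>r s. _ \<Longrightarrow> _ \<Longrightarrow> P (cls (r \<odot>\<^bsub>F\<^esub> unit_vec A s))\<close>
      by (simp add: dr_free_def[symmetric] del: free_module_simps)
  qed
  then show ?thesis using v by simp
qed

section \<open>The presentation of the ring of 2-buds and its part of degree 2\<close>

text \<open>A homomorphism from \<open>L_buds\<close> is a choice of values for \<gamma> and the c_a
  that satisfies the three families of relations. The values extend linearly to the free module,
  factor through \<open>Dr\<close>, and then extend to the symmetric algebra.\<close>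

lemma L_buds_hom_ex:
  assumes B: "cring B" and \<phi>: "\<phi> \<in> ring_hom A B"
    and G: "G \<in> carrier B" and C: "\<And>a. a \<in> carrier A \<Longrightarrow> C a \<in> carrier B"
    and r1: "\<And>a. a \<in> carrier A \<Longrightarrow> \<phi> (a \<otimes>\<^bsub>A\<^esub> a \<ominus>\<^bsub>A\<^esub> a) \<otimes>\<^bsub>B\<^esub> G = C a \<oplus>\<^bsub>B\<^esub> C a"
    and r2: "\<And>a b. a \<in> carrier A \<Longrightarrow> b \<in> carrier A \<Longrightarrow>
      C (a \<oplus>\<^bsub>A\<^esub> b) = C a \<oplus>\<^bsub>B\<^esub> C b \<oplus>\<^bsub>B\<^esub> \<phi> (a \<otimes>\<^bsub>A\<^esub> b) \<otimes>\<^bsub>B\<^esub> G"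
    and r3: "\<And>a b. a \<in> carrier A \<Longrightarrow> b \<in> carrier A \<Longrightarrow>
      \<phi> a \<otimes>\<^bsub>B\<^esub> C b \<oplus>\<^bsub>B\<^esub> \<phi> (b \<otimes>\<^bsub>A\<^esub> b) \<otimes>\<^bsub>B\<^esub> C a = C (a \<otimes>\<^bsub>A\<^esub> b)"
  obtains h where "h \<in> ring_hom (L_buds A) B" "\<And>a. a \<in> carrier A \<Longrightarrow> h (buds_scal A a) = \<phi> a"
    "h (buds_gamma A) = G" "\<And>a. a \<in> carrier A \<Longrightarrow> h (buds_c A a) = C a"
proof -
  interpret B: cring B by fact
  define s where "s = (\<lambda>x. case x of Gamma \<Rightarrow> G | Cee a \<Rightarrow> C a)"
  have s: "s \<in> insert Gamma (Cee ` carrier A) \<rightarrow> carrier B" using G C by (auto simp: s_def)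
  define l where "l = A.linear_ext B \<phi> s"
  note l = A.linear_ext(1)[OF B \<phi> s, folded dr_free_def l_def]
    and add = A.linear_ext(2)[OF B \<phi> s, folded dr_free_def l_def]
    and smult = A.linear_ext(3)[OF B \<phi> s, folded dr_free_def l_def]
    and lu = A.linear_ext(4)[OF B \<phi> s, folded l_def]
  have lG: "l G0 = G" and lC: "\<And>a. a \<in> carrier A \<Longrightarrow> l (C0 a) = C a"
    using lu by (auto simp: s_def)
  have m: "l (v \<ominus>\<^bsub>F\<^esub> w) = l v \<ominus>\<^bsub>B\<^esub> l w" "l \<zero>\<^bsub>F\<^esub> = \<zero>\<^bsub>B\<^esub>"
    if "v \<in> carrier F" "w \<in> carrier F" for v w
    using additive_minus[of F B l v w, OF F.M.abelian_group_axioms B.abelian_group_axioms] l add that by auto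
  have rel: "\<forall>r\<in>dr_relations A. l r = \<zero>\<^bsub>B\<^esub>"
    by (rule iffD2[OF linear_relations[of B \<phi> l, OF B \<phi>]])
      (use l add smult in \<open>simp_all add: lG lC r1 r2 r3\<close>)
  \<comment> \<open>The kernel is a submodule that contains the relations, so it contains the
    submodule they generate.\<close>
  let ?K = "{v \<in> carrier F. l v = \<zero>\<^bsub>B\<^esub>}"
  have "submodule ?K A F"
  proof (rule F.submoduleI)
    show "\<zero>\<^bsub>F\<^esub> \<in> ?K" using m(2)[OF F.M.zero_closed F.M.zero_closed] by simp
    fix v assume v: "v \<in> ?K"
    show "\<ominus>\<^bsub>F\<^esub> v \<in> ?K"
      using v m(1)[OF F.M.zero_closed, of v] m(2)[OF F.M.zero_closed F.M.zero_closed]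
      by (simp add: F.M.minus_eq B.minus_eq)
    show "v \<oplus>\<^bsub>F\<^esub> w \<in> ?K" if "w \<in> ?K" for w using v that by (simp add: add)
    show "r \<odot>\<^bsub>F\<^esub> v \<in> ?K" if "r \<in> carrier A" for r
      using v that ring_hom_closed[OF \<phi>] by (simp add: smult)
  qed auto
  then have NK: "N \<subseteq> ?K" unfolding dr_submodule_def
    by (rule F.submodule_generated_minimal) (use rel relations_carrier in auto)
  interpret N: abelian_subgroup N F
    by (rule abelian_subgroupI3[OF F.additive_subgroup_submodule[OF N_submodule] F.M.abelian_group_axioms])
  define k where "k = (\<lambda>c. l (SOME v. v \<in> c))"
  have k: "k (cls v) = l v" if v: "v \<in> carrier F" for v
  proof -
    have "(SOME w. w \<in> cls v) \<in> cls v" using N.a_rcos_self[OF v]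
      by (rule someI[where P = "\<lambda>w. w \<in> cls v"])
    then obtain n where n: "n \<in> N" "(SOME w. w \<in> cls v) = n \<oplus>\<^bsub>F\<^esub> v" by (auto simp: a_r_coset_def')
    then have "n \<in> carrier F" "l n = \<zero>\<^bsub>B\<^esub>" using NK by auto
    then show ?thesis using n v l by (simp add: k_def add)
  qed
  obtain h where h: "h \<in> ring_hom (L_buds A) B" "\<And>r. r \<in> carrier A \<Longrightarrow> h (Sym_const A (Dr A) r) = \<phi> r"
    "\<And>x. x \<in> carrier (Dr A) \<Longrightarrow> h (Sym_incl A (Dr A) x) = k x"
  proof (rule sym_algebra.Sym_hom_ex[OF sym_algebra_Dr B \<phi>, of k, unfolded L_buds_eq])
    fix x assume x: "x \<in> carrier (Dr A)"
    then obtain v where v: "x = cls v" "v \<in> carrier F" unfolding Dr_carrier by (elim CollectE exE conjE)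
    then show "k x \<in> carrier B" by (simp add: k l)
    show "k (r \<odot>\<^bsub>Dr A\<^esub> x) = \<phi> r \<otimes>\<^bsub>B\<^esub> k x" if "r \<in> carrier A" for r
      using v that by (simp add: Dr_smult k smult)
    fix y assume "y \<in> carrier (Dr A)"
    then obtain w where "y = cls w" "w \<in> carrier F" unfolding Dr_carrier by (elim CollectE exE conjE)
    then show "k (x \<oplus>\<^bsub>Dr A\<^esub> y) = k x \<oplus>\<^bsub>B\<^esub> k y" using v by (simp add: Dr_add k add)
  next
    fix h' assume "h' \<in> ring_hom (L_buds A) B"
      "\<And>r. r \<in> carrier A \<Longrightarrow> h' (Sym_const A (Dr A) r) = \<phi> r"
      "\<And>x. x \<in> carrier (Dr A) \<Longrightarrow> h' (Sym_incl A (Dr A) x) = k x"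
    then show thesis by (rule that)
  qed
  show ?thesis
    by (rule that[OF h(1)]) (simp_all add: h(2,3) k lG lC buds_scal_def gamma_eq c_eq)
qed

lemma L_buds_hom_unique:
  assumes B: "cring B" and h: "h \<in> ring_hom (L_buds A) B" "h' \<in> ring_hom (L_buds A) B"
    and s: "\<And>r. r \<in> carrier A \<Longrightarrow> h (buds_scal A r) = h' (buds_scal A r)"
    and G: "h (buds_gamma A) = h' (buds_gamma A)"
    and C: "\<And>a. a \<in> carrier A \<Longrightarrow> h (buds_c A a) = h' (buds_c A a)"
    and u: "u \<in> carrier (L_buds A)"
  shows "h u = h' u"
proof (rule sym_algebra.Sym_hom_unique[OF sym_algebra_Dr, unfolded L_buds_eq, OF B h _ _ u])
  fix x assume "x \<in> carrier (Dr A)"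
  then show "h (Sym_incl A (Dr A) x) = h' (Sym_incl A (Dr A) x)"
  proof (induction rule: Dr_induct)
    case gamma
    then show ?case using G by (simp add: gamma_eq)
  next
    case (c a)
    then show ?case using C by (simp add: c_eq)
  next
    case (add x y)
    then show ?case
      using ring_hom_add[OF h(1)] ring_hom_add[OF h(2)] sym_algebra.incl_closed[OF sym_algebra_Dr]
      by (simp add: sym_algebra.incl_add[OF sym_algebra_Dr] L_buds_eq)
  next
    case (smult r x)
    then show ?case
      using ring_hom_mult[OF h(1)] ring_hom_mult[OF h(2)] sym_algebra.incl_closed[OF sym_algebra_Dr] s
      by (simp add: sym_algebra.incl_smult[OF sym_algebra_Dr] L_buds_eq buds_scal_def[symmetric])
  qed
qed (use s in \<open>simp add: buds_scal_def\<close>)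

abbreviation L2 where "L2 \<equiv> Sym_grading A (Dr A) 2 2"

lemma L2_eq: "L2 = Sym_incl A (Dr A) ` carrier (Dr A)"
proof
  note z = additive_minus(2)[of F "L_buds A" J, OF F.M.abelian_group_axioms LA.abelian_group_axioms J_closed J_add
    F.M.zero_closed F.M.zero_closed]
  show "L2 \<subseteq> Sym_incl A (Dr A) ` carrier (Dr A)"
    using sym_algebra.Sym_grading_top[OF sym_algebra_Dr, of 2 _ "cls \<zero>\<^bsub>F\<^esub>"] z by (auto simp: L_buds_eq)
qed (use sym_algebra.Sym_grading_incl[OF sym_algebra_Dr] in blast)

lemma L2_closed: "u \<in> L2 \<Longrightarrow> u \<in> carrier (L_buds A)"
  unfolding L2_eq using sym_algebra.incl_closed[OF sym_algebra_Dr] by (auto simp: L_buds_eq)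

lemma L2_add: "u \<in> L2 \<Longrightarrow> v \<in> L2 \<Longrightarrow> u \<oplus>\<^bsub>L_buds A\<^esub> v \<in> L2"
  unfolding L2_eq using sym_algebra.incl_add[OF sym_algebra_Dr, symmetric] sym_algebra.add_closed[OF sym_algebra_Dr] by (auto simp: L_buds_eq)

lemma L2_smult: "r \<in> carrier A \<Longrightarrow> u \<in> L2 \<Longrightarrow> buds_scal A r \<otimes>\<^bsub>L_buds A\<^esub> u \<in> L2"
  unfolding L2_eq using sym_algebra.incl_smult[OF sym_algebra_Dr, symmetric] sym_algebra.smult_closed[OF sym_algebra_Dr] by (auto simp: L_buds_eq buds_scal_def)

lemma gamma_L2: "buds_gamma A \<in> L2" and c_L2: "a \<in> carrier A \<Longrightarrow> buds_c A a \<in> L2"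
  unfolding L2_eq gamma_eq c_eq by auto

text \<open>The part of degree 2 is the image of \<open>Dr\<close>, hence spanned by \<gamma> and
  the c_a over \<open>A\<close>. The rule is what later checks that coboundaries go to
  coboundaries.\<close>

lemma L2_induct [consumes 1, case_names gamma c add smult]:
  assumes u: "u \<in> L2" and "P (buds_gamma A)" "\<And>a. a \<in> carrier A \<Longrightarrow> P (buds_c A a)"
    and "\<And>u v. u \<in> L2 \<Longrightarrow> v \<in> L2 \<Longrightarrow> P u \<Longrightarrow> P v \<Longrightarrow> P (u \<oplus>\<^bsub>L_buds A\<^esub> v)"
    and "\<And>r u. r \<in> carrier A \<Longrightarrow> u \<in> L2 \<Longrightarrow> P u \<Longrightarrow> P (buds_scal A r \<otimes>\<^bsub>L_buds A\<^esub> u)"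
  shows "P u"
proof -
  obtain x where x: "x \<in> carrier (Dr A)" "u = Sym_incl A (Dr A) x" using u L2_eq by blast
  have "P (Sym_incl A (Dr A) x)" using x(1)
  proof (induction rule: Dr_induct)
    case (add x y)
    then show ?case using assms(4) L2_eq by (simp add: sym_algebra.incl_add[OF sym_algebra_Dr] L_buds_eq)
  next
    case (smult r x)
    then show ?case using assms(5) L2_eq by (simp add: sym_algebra.incl_smult[OF sym_algebra_Dr] L_buds_eq buds_scal_def[symmetric])
  qed (use assms(2,3) gamma_eq c_eq in auto)
  then show ?thesis using x by simp
qed

end


subsection \<open>First cohomology generated by a primitive element\<close>

text \<open>What the computation of the first cohomology in degree \<open>d\<close> rests on, common
  to 2-buds and formal group laws. The map \<open>e\<close> is a common retraction of both units;
  each instance builds it from the universal property of its morphism ring.\<close>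

locale cotor1 =
  fixes H :: "('k, 'a, 'g) hopf_algebroid" and \<tau> :: 'g and d :: nat and e :: "'g \<Rightarrow> 'a"
  assumes base: "cring (base H)" and obj: "cring (obj H)" and mor: "cring (mor H)"
    and etaL: "etaL H \<in> ring_hom (obj H) (mor H)" and etaR: "etaR H \<in> ring_hom (obj H) (mor H)"
    and scal: "scal H \<in> ring_hom (base H) (obj H)"
    and etaR_scal: "\<And>r. r \<in> carrier (base H) \<Longrightarrow> etaR H (scal H r) = etaL H (scal H r)"
    and e: "e \<in> ring_hom (mor H) (obj H)" and e_etaL: "\<And>x. x \<in> carrier (obj H) \<Longrightarrow> e (etaL H x) = x"
    and e_etaR: "\<And>x. x \<in> carrier (obj H) \<Longrightarrow> e (etaR H x) = x"
    and comult: "comult H \<in> ring_hom (mor H) (mor_tensor H)"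
    and comult_etaL: "\<And>x. x \<in> carrier (obj H) \<Longrightarrow>
      comult H (etaL H x) = mor_pure_tensor H (etaL H x) \<one>\<^bsub>mor H\<^esub>"
    and tau: "\<tau> \<in> carrier (mor H)"
    and comult_tau: "comult H \<tau> =
      mor_pure_tensor H \<tau> \<one>\<^bsub>mor H\<^esub> \<oplus>\<^bsub>mor_tensor H\<^esub> mor_pure_tensor H \<one>\<^bsub>mor H\<^esub> \<tau>"
    and mor_grading: "mor_grading H d = {etaL H u \<oplus>\<^bsub>mor H\<^esub> etaL H (scal H r) \<otimes>\<^bsub>mor H\<^esub> \<tau> | u r.
      u \<in> obj_grading H d \<and> r \<in> carrier (base H)}"
    and obj_sub: "obj_grading H d \<subseteq> carrier (obj H)"
    and obj_zero: "\<zero>\<^bsub>obj H\<^esub> \<in> obj_grading H d"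
    and obj_add: "\<And>u v. u \<in> obj_grading H d \<Longrightarrow> v \<in> obj_grading H d \<Longrightarrow> u \<oplus>\<^bsub>obj H\<^esub> v \<in> obj_grading H d"
    and obj_smult: "\<And>r u. r \<in> carrier (base H) \<Longrightarrow> u \<in> obj_grading H d \<Longrightarrow>
      scal H r \<otimes>\<^bsub>obj H\<^esub> u \<in> obj_grading H d"
begin

sublocale K: cring "base H" by (rule base)
sublocale A: cring "obj H" by (rule obj)
sublocale M: cring "mor H" by (rule mor)
sublocale T: tensor "obj H" "mor H" "etaR H" "mor H" "etaL H"
  by (rule tensor.intro[OF obj mor mor etaR etaL])

abbreviation s where "s r \<equiv> etaL H (scal H r)"

lemma scal_closed [simp]: "r \<in> carrier (base H) \<Longrightarrow> scal H r \<in> carrier (obj H)"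
  and etaL_closed [simp]: "x \<in> carrier (obj H) \<Longrightarrow> etaL H x \<in> carrier (mor H)"
  and etaR_closed [simp]: "x \<in> carrier (obj H) \<Longrightarrow> etaR H x \<in> carrier (mor H)"
  using ring_hom_closed[OF scal] ring_hom_closed[OF etaL] ring_hom_closed[OF etaR] by auto

declare tau [simp]

text \<open>Balancing turns the right unit on the left factor into the left unit on the right
  factor, so \<open>1 \<otimes> etaL u\<close> becomes \<open>etaR u \<otimes> 1\<close>. Scalars of
  the base ring have the same image under both units and move freely across the tensor sign.\<close>

lemma cobar_d1_eq:
  assumes u: "u \<in> carrier (obj H)" and r: "r \<in> carrier (base H)"
  shows "cobar_d1 H (etaL H u \<oplus>\<^bsub>mor H\<^esub> s r \<otimes>\<^bsub>mor H\<^esub> \<tau>) = mor_pure_tensor H (etaR H u) \<one>\<^bsub>mor H\<^esub>"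
proof -
  let ?a = "T.pure (etaR H u) \<one>\<^bsub>mor H\<^esub>" and ?b = "T.pure (s r) \<tau>"
    and ?c = "T.pure (etaL H u) \<one>\<^bsub>mor H\<^esub>" and ?e = "T.pure (s r \<otimes>\<^bsub>mor H\<^esub> \<tau>) \<one>\<^bsub>mor H\<^esub>"
  let ?x = "etaL H u \<oplus>\<^bsub>mor H\<^esub> s r \<otimes>\<^bsub>mor H\<^esub> \<tau>"
  have c: "?a \<in> carrier T.T" "?b \<in> carrier T.T" "?c \<in> carrier T.T" "?e \<in> carrier T.T"
    using u r by simp_all
  have "T.pure \<one>\<^bsub>mor H\<^esub> (etaL H u) = ?a"
    using T.pure_balanced[of "\<one>\<^bsub>mor H\<^esub>" u "\<one>\<^bsub>mor H\<^esub>"] u by simp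
  moreover have "T.pure \<one>\<^bsub>mor H\<^esub> (s r \<otimes>\<^bsub>mor H\<^esub> \<tau>) = ?b"
    using T.pure_balanced[of "\<one>\<^bsub>mor H\<^esub>" "scal H r" \<tau>] r by (simp add: etaR_scal)
  ultimately have 1: "T.pure \<one>\<^bsub>mor H\<^esub> ?x = ?a \<oplus>\<^bsub>T.T\<^esub> ?b"
    using u r by (simp add: T.pure_add_right)
  have 2: "T.pure ?x \<one>\<^bsub>mor H\<^esub> = ?c \<oplus>\<^bsub>T.T\<^esub> ?e" using u r by (simp add: T.pure_add_left)
  have "comult H (s r \<otimes>\<^bsub>mor H\<^esub> \<tau>) = T.pure (s r) \<one>\<^bsub>mor H\<^esub> \<otimes>\<^bsub>T.T\<^esub>
      (T.pure \<tau> \<one>\<^bsub>mor H\<^esub> \<oplus>\<^bsub>T.T\<^esub> T.pure \<one>\<^bsub>mor H\<^esub> \<tau>)"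
    using ring_hom_mult[OF comult, of "s r" \<tau>] r
    by (simp add: comult_etaL comult_tau mor_tensor_def mor_pure_tensor_def)
  also have "\<dots> = ?e \<oplus>\<^bsub>T.T\<^esub> ?b" using r by (simp add: T.T.r_distr T.pure_mult)
  finally have 3: "comult H ?x = ?c \<oplus>\<^bsub>T.T\<^esub> (?e \<oplus>\<^bsub>T.T\<^esub> ?b)"
    using ring_hom_add[OF comult, of "etaL H u" "s r \<otimes>\<^bsub>mor H\<^esub> \<tau>"] u r
    by (simp add: comult_etaL mor_tensor_def mor_pure_tensor_def)
  \<comment> \<open>As \<open>\<tau>\<close> is primitive, its two summands in the diagonal cancel
    against the outer terms, and so does the summand from \<open>etaL u\<close>. Only
    \<open>?a\<close> is left.\<close>
  have "cobar_d1 H ?x = (?a \<oplus>\<^bsub>T.T\<^esub> ?b) \<ominus>\<^bsub>T.T\<^esub> (?c \<oplus>\<^bsub>T.T\<^esub> (?e \<oplus>\<^bsub>T.T\<^esub> ?b)) \<oplus>\<^bsub>T.T\<^esub> (?c \<oplus>\<^bsub>T.T\<^esub> ?e)"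
    unfolding cobar_d1_def mor_tensor_def mor_pure_tensor_def 1 2 3 by simp
  also have "\<dots> = ?a"
    using c by algebra
  finally show ?thesis by (simp add: mor_pure_tensor_def)
qed

text \<open>Because \<open>e\<close> retracts both units, applying it to each factor respects the
  balancing relation. The resulting map from the tensor product sends
  \<open>etaR u \<otimes> 1\<close> back to \<open>u\<close>.\<close>

lemma pure_etaR_zero_iff:
  assumes u: "u \<in> carrier (obj H)"
  shows "mor_pure_tensor H (etaR H u) \<one>\<^bsub>mor H\<^esub> = \<zero>\<^bsub>mor_tensor H\<^esub> \<longleftrightarrow> u = \<zero>\<^bsub>obj H\<^esub>"
proof
  assume *: "mor_pure_tensor H (etaR H u) \<one>\<^bsub>mor H\<^esub> = \<zero>\<^bsub>mor_tensor H\<^esub>"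
  obtain k where k: "k \<in> ring_hom T.T (obj H)"
    "\<And>x y. x \<in> carrier (mor H) \<Longrightarrow> y \<in> carrier (mor H) \<Longrightarrow> k (T.pure x y) = e x \<otimes>\<^bsub>obj H\<^esub> e y"
    using T.tensor_hom_ex[OF obj e e] e_etaL e_etaR by metis
  have "k (T.pure (etaR H u) \<one>\<^bsub>mor H\<^esub>) = u"
    using k(2)[of "etaR H u" "\<one>\<^bsub>mor H\<^esub>"] u by (simp add: e_etaR ring_hom_one[OF e])
  moreover have "k \<zero>\<^bsub>T.T\<^esub> = \<zero>\<^bsub>obj H\<^esub>"
    using ring_hom_zero[OF k(1) T.T.ring_axioms A.ring_axioms] .
  ultimately show "u = \<zero>\<^bsub>obj H\<^esub>" using * by (simp add: mor_tensor_def mor_pure_tensor_def)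
next
  assume "u = \<zero>\<^bsub>obj H\<^esub>"
  moreover have "etaR H \<zero>\<^bsub>obj H\<^esub> = \<zero>\<^bsub>mor H\<^esub>" using ring_hom_zero[OF etaR A.ring_axioms M.ring_axioms] .
  moreover have "T.pure \<zero>\<^bsub>mor H\<^esub> \<one>\<^bsub>mor H\<^esub> = \<zero>\<^bsub>T.T\<^esub>"
    using ring_hom_zero[OF T.pure_left_hom M.ring_axioms T.T.ring_axioms] .
  ultimately show "mor_pure_tensor H (etaR H u) \<one>\<^bsub>mor H\<^esub> = \<zero>\<^bsub>mor_tensor H\<^esub>"
    by (simp add: mor_tensor_def mor_pure_tensor_def)
qed

lemma etaL_zero: "etaL H \<zero>\<^bsub>obj H\<^esub> = \<zero>\<^bsub>mor H\<^esub>"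
  using ring_hom_zero[OF etaL A.ring_axioms M.ring_axioms] .

lemma cobar_Z1_carrier: "carrier (cobar_Z1 H d) = {s r \<otimes>\<^bsub>mor H\<^esub> \<tau> | r. r \<in> carrier (base H)}"
proof -
  have "cobar_d1 H (etaL H u \<oplus>\<^bsub>mor H\<^esub> s r \<otimes>\<^bsub>mor H\<^esub> \<tau>) = \<zero>\<^bsub>mor_tensor H\<^esub> \<longleftrightarrow> u = \<zero>\<^bsub>obj H\<^esub>"
    if "u \<in> obj_grading H d" "r \<in> carrier (base H)" for u r
    using that obj_sub by (simp add: cobar_d1_eq pure_etaR_zero_iff subset_iff)
  then have "carrier (cobar_Z1 H d) =
      {etaL H \<zero>\<^bsub>obj H\<^esub> \<oplus>\<^bsub>mor H\<^esub> s r \<otimes>\<^bsub>mor H\<^esub> \<tau> | r. r \<in> carrier (base H)}"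
    using obj_zero unfolding cobar_Z1_def mor_grading by auto
  also have "\<dots> = {s r \<otimes>\<^bsub>mor H\<^esub> \<tau> | r. r \<in> carrier (base H)}"
  proof -
    have "etaL H \<zero>\<^bsub>obj H\<^esub> \<oplus>\<^bsub>mor H\<^esub> s r \<otimes>\<^bsub>mor H\<^esub> \<tau> = s r \<otimes>\<^bsub>mor H\<^esub> \<tau>" if "r \<in> carrier (base H)" for r
      using that by (simp add: etaL_zero)
    then show ?thesis by force
  qed
  finally show ?thesis .
qed

lemma d0_closed [simp]: "u \<in> carrier (obj H) \<Longrightarrow> cobar_d0 H u \<in> carrier (mor H)"
  by (simp add: cobar_d0_def)

lemma d0_add: "u \<in> carrier (obj H) \<Longrightarrow> v \<in> carrier (obj H) \<Longrightarrow>
    cobar_d0 H (u \<oplus>\<^bsub>obj H\<^esub> v) = cobar_d0 H u \<oplus>\<^bsub>mor H\<^esub> cobar_d0 H v"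
  by (simp add: cobar_d0_def ring_hom_add[OF etaR] ring_hom_add[OF etaL] M.minus_eq M.minus_add M.a_ac)

lemma d0_smult: "r \<in> carrier (base H) \<Longrightarrow> u \<in> carrier (obj H) \<Longrightarrow>
    cobar_d0 H (scal H r \<otimes>\<^bsub>obj H\<^esub> u) = s r \<otimes>\<^bsub>mor H\<^esub> cobar_d0 H u"
  by (simp add: cobar_d0_def ring_hom_mult[OF etaR] ring_hom_mult[OF etaL] etaR_scal M.minus_eq
    M.r_distr M.r_minus)

lemma B1_smult: "r \<in> carrier (base H) \<Longrightarrow> b \<in> cobar_B1 H d \<Longrightarrow> s r \<otimes>\<^bsub>mor H\<^esub> b \<in> cobar_B1 H d"
  using obj_sub obj_smult unfolding cobar_B1_def by (force simp: d0_smult[symmetric] subset_iff)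

lemma B1_add: "b \<in> cobar_B1 H d \<Longrightarrow> b' \<in> cobar_B1 H d \<Longrightarrow> b \<oplus>\<^bsub>mor H\<^esub> b' \<in> cobar_B1 H d"
  using obj_sub obj_add unfolding cobar_B1_def by (force simp: d0_add[symmetric] subset_iff)

lemma B1_sub: "cobar_B1 H d \<subseteq> carrier (mor H)"
  using obj_sub unfolding cobar_B1_def by auto

lemma B1_additive: "additive_subgroup (cobar_B1 H d) (mor H)"
proof (rule additive_subgroup.intro, rule subgroup.intro)
  have h: "s \<in> ring_hom (base H) (mor H)" using ring_hom_trans[OF scal etaL] by (simp add: comp_def)
  have "cobar_d0 H \<zero>\<^bsub>obj H\<^esub> = \<zero>\<^bsub>mor H\<^esub>"
    using ring_hom_zero[OF etaR A.ring_axioms M.ring_axioms] by (simp add: cobar_d0_def etaL_zero M.minus_eq)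
  then show "\<one>\<^bsub>add_monoid (mor H)\<^esub> \<in> cobar_B1 H d"
    using obj_zero unfolding cobar_B1_def by (metis image_eqI monoid.select_convs(2))
  fix b assume b: "b \<in> cobar_B1 H d"
  then have bc: "b \<in> carrier (mor H)" using B1_sub by blast
  \<comment> \<open>Negation is the action of the scalar -1 of the base ring, and coboundaries are
    closed under such scalars.\<close>
  interpret h: ring_hom_cring "base H" "mor H" s by (rule ring_hom_cring_of[OF base mor h])
  have "s (\<ominus>\<^bsub>base H\<^esub> \<one>\<^bsub>base H\<^esub>) = \<ominus>\<^bsub>mor H\<^esub> \<one>\<^bsub>mor H\<^esub>"
    using h.hom_a_inv[of "\<one>\<^bsub>base H\<^esub>"] h.hom_one by simp
  then have "\<ominus>\<^bsub>mor H\<^esub> b = s (\<ominus>\<^bsub>base H\<^esub> \<one>\<^bsub>base H\<^esub>) \<otimes>\<^bsub>mor H\<^esub> b"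
    using bc by (simp add: M.l_minus)
  then have "\<ominus>\<^bsub>mor H\<^esub> b \<in> cobar_B1 H d" using B1_smult[OF _ b, of "\<ominus>\<^bsub>base H\<^esub> \<one>\<^bsub>base H\<^esub>"] by simp
  then show "inv\<^bsub>add_monoid (mor H)\<^esub> b \<in> cobar_B1 H d" by (simp add: a_inv_def)
qed (use B1_sub B1_add in auto)

sublocale B: abelian_subgroup "cobar_B1 H d" "mor H"
  by (rule abelian_subgroupI3[OF B1_additive M.abelian_group_axioms])

abbreviation coset where "coset x \<equiv> cobar_B1 H d +>\<^bsub>mor H\<^esub> x"

lemma Z1_coset: "cobar_B1 H d +>\<^bsub>cobar_Z1 H d\<^esub> x = coset x"
  by (simp add: a_r_coset_def' cobar_Z1_def)

lemma Cotor1_carrier: "carrier (Cotor1 H d) = {coset (s r \<otimes>\<^bsub>mor H\<^esub> \<tau>) | r. r \<in> carrier (base H)}"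
proof -
  have "carrier (Cotor1 H d) = {coset x | x. x \<in> carrier (cobar_Z1 H d)}"
    by (auto simp: Cotor1_def quotient_module_def A_RCOSETS_def' Z1_coset)
  then show ?thesis unfolding cobar_Z1_carrier by blast
qed

lemma Cotor1_smult:
  assumes r: "r \<in> carrier (base H)" and x: "x \<in> carrier (mor H)"
  shows "r \<odot>\<^bsub>Cotor1 H d\<^esub> coset x = coset (s r \<otimes>\<^bsub>mor H\<^esub> x)"
proof -
  have "(\<Union>y\<in>coset x. coset (s r \<otimes>\<^bsub>mor H\<^esub> y)) = coset (s r \<otimes>\<^bsub>mor H\<^esub> x)"
  proof (rule M.quotient_smult[OF B1_additive x])
    fix y assume y: "y \<in> cobar_B1 H d"
    then have "s r \<otimes>\<^bsub>mor H\<^esub> (y \<oplus>\<^bsub>mor H\<^esub> x) = s r \<otimes>\<^bsub>mor H\<^esub> y \<oplus>\<^bsub>mor H\<^esub> s r \<otimes>\<^bsub>mor H\<^esub> x"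
      using r x B1_sub by (intro M.r_distr) auto
    then show "s r \<otimes>\<^bsub>mor H\<^esub> (y \<oplus>\<^bsub>mor H\<^esub> x) \<in> coset (s r \<otimes>\<^bsub>mor H\<^esub> x)"
      using B1_smult[OF r y] by (auto simp: a_r_coset_def')
  qed (use r x in simp)
  moreover have "r \<odot>\<^bsub>Cotor1 H d\<^esub> coset x = (\<Union>y\<in>coset x. coset (s r \<otimes>\<^bsub>mor H\<^esub> y))"
    by (simp add: Cotor1_def quotient_module_def Z1_coset cobar_Z1_def a_r_coset_def')
  ultimately show ?thesis by simp
qed

theorem Cotor1_generator: "module_generator (base H) (Cotor1 H d) (coset \<tau>)"
proof -
  have "s \<one>\<^bsub>base H\<^esub> = \<one>\<^bsub>mor H\<^esub>" using ring_hom_one[OF scal] ring_hom_one[OF etaL] by simp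
  then have "coset \<tau> \<in> carrier (Cotor1 H d)"
    unfolding Cotor1_carrier by (auto intro!: exI[of _ "\<one>\<^bsub>base H\<^esub>"])
  moreover have "carrier (Cotor1 H d) = {r \<odot>\<^bsub>Cotor1 H d\<^esub> coset \<tau> | r. r \<in> carrier (base H)}"
    unfolding Cotor1_carrier using Cotor1_smult[OF _ tau] by auto
  ultimately show ?thesis by (simp add: module_generator_def)
qed

end


subsection \<open>Cohomology of the stack of 2-buds\<close>

text \<open>The polynomial ring \<open>UP\<close> is a record with extra fields for monomials and
  coefficients, whereas the field \<open>mor\<close> holds a plain ring. Truncation forgets these
  fields and changes neither the ring operations nor the tensor products and homomorphisms formed
  from them.\<close>

lemma ring_truncate_simps [simp]:
  "carrier (ring.truncate R) = carrier R" "(\<otimes>\<^bsub>ring.truncate R\<^esub>) = (\<otimes>\<^bsub>R\<^esub>)" "\<one>\<^bsub>ring.truncate R\<^esub> = \<one>\<^bsub>R\<^esub>"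
  "(\<oplus>\<^bsub>ring.truncate R\<^esub>) = (\<oplus>\<^bsub>R\<^esub>)" "\<zero>\<^bsub>ring.truncate R\<^esub> = \<zero>\<^bsub>R\<^esub>"
  by (simp_all add: ring.truncate_def)

lemma cring_truncate: "cring R \<Longrightarrow> cring (ring.truncate R)"
proof -
  assume "cring R"
  then interpret R: cring R .
  show ?thesis
  proof (rule cringI)
    show "abelian_group (ring.truncate R)"
    proof (rule abelian_groupI)
      fix x assume "x \<in> carrier (ring.truncate R)"
      then show "\<exists>y\<in>carrier (ring.truncate R). y \<oplus>\<^bsub>ring.truncate R\<^esub> x = \<zero>\<^bsub>ring.truncate R\<^esub>"
        by (intro bexI[of _ "\<ominus>\<^bsub>R\<^esub> x"]) (auto simp: R.l_neg)
    qed (auto simp: R.a_ac)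
    show "comm_monoid (ring.truncate R)"
      by (rule comm_monoidI) (auto simp: R.m_ac)
  qed (simp add: R.l_distr)
qed

lemma pair_ring_truncate: "pair_ring (ring.truncate R) (ring.truncate S) = pair_ring R S"
  by (simp add: pair_ring_def)

lemma tensor_truncate:
  "tensor_ring A (ring.truncate R) f (ring.truncate S) g = tensor_ring A R f S g"
  "pure_tensor A (ring.truncate R) f (ring.truncate S) g = pure_tensor A R f S g"
  by (simp_all add: tensor_ring_def tensor_ideal_def pair_ring_truncate pure_tensor_def[abs_def])

lemma ring_hom_truncate:
  "ring_hom (ring.truncate R) S = ring_hom R S" "ring_hom R (ring.truncate S) = ring_hom R S"
  by (simp_all add: ring_hom_def)

section \<open>The structure maps of the Hopf algebroid of 2-buds\<close>

lemma UP_hom_ex: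
  assumes "cring R" "cring S" "h \<in> ring_hom R S" "s \<in> carrier S"
  obtains k where "k \<in> ring_hom (UP R) S" "\<And>r. r \<in> carrier R \<Longrightarrow> k (monom (UP R) r 0) = h r"
    "k (monom (UP R) \<one>\<^bsub>R\<^esub> 1) = s"
proof -
  interpret U: UP_pre_univ_prop R S h "UP R"
    by (rule UP_pre_univ_propI[OF assms(1-3)])
  show ?thesis
    by (rule that[OF U.eval_ring_hom[OF assms(4)]])
      (simp_all add: U.eval_const U.eval_monom1 assms(4) del: One_nat_def)
qed

lemma UP_hom_unique:
  assumes "cring R" "cring S" "k \<in> ring_hom (UP R) S" "k' \<in> ring_hom (UP R) S"
    and "\<And>r. r \<in> carrier R \<Longrightarrow> k (monom (UP R) r 0) = k' (monom (UP R) r 0)"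
    and "k (monom (UP R) \<one>\<^bsub>R\<^esub> 1) = k' (monom (UP R) \<one>\<^bsub>R\<^esub> 1)"
    and "p \<in> carrier (UP R)"
  shows "k p = k' p"
proof -
  interpret R: UP_cring R "UP R" by (rule UP_cring.intro[OF assms(1)])
  have h: "(\<lambda>r. k (up_ring.monom (UP R) r 0)) \<in> ring_hom R S"
    using ring_hom_trans[OF R.const_ring_hom assms(3)] by (simp add: comp_def)
  interpret U: UP_pre_univ_prop R S "\<lambda>r. k (up_ring.monom (UP R) r 0)" "UP R"
    by (rule UP_pre_univ_propI[OF assms(1,2) h])
  have "k (up_ring.monom (UP R) \<one>\<^bsub>R\<^esub> 1) \<in> carrier S"
    by (rule ring_hom_closed[OF assms(3)]) simp
  then show ?thesis
    by (intro U.UP_hom_unique[of k "k (up_ring.monom (UP R) \<one>\<^bsub>R\<^esub> 1)" k'])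
      (use assms in \<open>auto intro!: U.ring_homD\<close>)
qed

context bud_ring
begin

interpretation LA: cring "L_buds A" by (rule L_cring)
lemma UP_cring_LB: "UP_cring (L_buds A)" by (rule UP_cring.intro[OF L_cring])

lemma LB_cring: "cring (LB_buds A)"
  unfolding LB_buds_def by (rule UP_cring.UP_cring[OF UP_cring_LB])

abbreviation BB where "BB \<equiv> LB_buds A"
abbreviation eL where "eL \<equiv> buds_etaL A"
abbreviation tt where "tt \<equiv> buds_t A"

lemma etaL_hom: "eL \<in> ring_hom (L_buds A) BB"
  using UP_ring.const_ring_hom[OF UP_ring.intro[OF LA.ring_axioms]]
  by (simp add: buds_etaL_def[abs_def] LB_buds_def)

lemma eL_closed [simp]: "x \<in> carrier (L_buds A) \<Longrightarrow> eL x \<in> carrier BB"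
  and tt_closed [simp]: "tt \<in> carrier BB"
  using ring_hom_closed[OF etaL_hom] UP_ring.monom_closed[OF UP_ring.intro[OF LA.ring_axioms]]
  by (auto simp: buds_t_def LB_buds_def)

lemma LB_buds_hom_ex:
  assumes "cring S" "h \<in> ring_hom (L_buds A) S" "s \<in> carrier S"
  shows "\<exists>k. k \<in> ring_hom BB S \<and> (\<forall>x\<in>carrier (L_buds A). k (eL x) = h x) \<and> k tt = s"
proof -
  obtain k where "k \<in> ring_hom (UP (L_buds A)) S"
    "\<And>r. r \<in> carrier (L_buds A) \<Longrightarrow> k (up_ring.monom (UP (L_buds A)) r 0) = h r"
    "k (up_ring.monom (UP (L_buds A)) \<one>\<^bsub>L_buds A\<^esub> 1) = s"
    using UP_hom_ex[OF L_cring assms] by blast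
  then show ?thesis unfolding buds_etaL_def buds_t_def LB_buds_def by blast
qed

lemma LB_buds_hom_unique:
  assumes "cring S" "k \<in> ring_hom BB S" "k' \<in> ring_hom BB S"
    and "\<And>x. x \<in> carrier (L_buds A) \<Longrightarrow> k (eL x) = k' (eL x)" "k tt = k' tt" "p \<in> carrier BB"
  shows "k p = k' p"
  using UP_hom_unique[OF L_cring assms(1), of k k' p] assms(2-)
  unfolding buds_etaL_def buds_t_def LB_buds_def by blast

text \<open>The prescribed values for the right unit must again satisfy the relations of
  \<open>Dr\<close>. Each relation splits into the same relation for the old values, which are
  \<open>b1\<close> to \<open>b3\<close>, and an identity for the corrections by multiples of
  \<open>t\<close>.\<close>

lemma etaR_ex:
  obtains h where "h \<in> ring_hom (L_buds A) BB"
    "\<And>a. a \<in> carrier A \<Longrightarrow> h (buds_scal A a) = eL (buds_scal A a)"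
    "h (buds_gamma A) = eL (buds_gamma A) \<oplus>\<^bsub>BB\<^esub> (tt \<oplus>\<^bsub>BB\<^esub> tt)"
    "\<And>a. a \<in> carrier A \<Longrightarrow> h (buds_c A a) =
      eL (buds_c A a) \<oplus>\<^bsub>BB\<^esub> (eL (buds_scal A (a \<otimes>\<^bsub>A\<^esub> a \<ominus>\<^bsub>A\<^esub> a)) \<otimes>\<^bsub>BB\<^esub> tt)"
proof -
  interpret B: cring BB by (rule LB_cring)
  define \<phi> where "\<phi> = (\<lambda>a. eL (buds_scal A a))"
  have \<phi>: "\<phi> \<in> ring_hom A BB"
    using ring_hom_trans[OF scal_hom etaL_hom] by (simp add: comp_def \<phi>_def)
  interpret \<phi>: ring_hom_cring A BB \<phi> by (rule ring_hom_cring_of[OF A.cring_axioms LB_cring \<phi>])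
  define g where "g = eL (buds_gamma A)"
  define c where "c = (\<lambda>a. eL (buds_c A a))"
  have cl: "g \<in> carrier BB" "\<And>a. a \<in> carrier A \<Longrightarrow> c a \<in> carrier BB" by (simp_all add: g_def c_def)
  have \<phi>D: "\<phi> (a \<otimes>\<^bsub>A\<^esub> a \<ominus>\<^bsub>A\<^esub> a) = \<phi> a \<otimes>\<^bsub>BB\<^esub> \<phi> a \<ominus>\<^bsub>BB\<^esub> \<phi> a" if "a \<in> carrier A" for a
  proof -
    have "\<phi> (a \<otimes>\<^bsub>A\<^esub> a \<ominus>\<^bsub>A\<^esub> a) = \<phi> (a \<otimes>\<^bsub>A\<^esub> a) \<oplus>\<^bsub>BB\<^esub> \<phi> (\<ominus>\<^bsub>A\<^esub> a)"
      unfolding A.minus_eq using that by (intro \<phi>.hom_add) simp_all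
    then show ?thesis unfolding B.minus_eq using that by simp
  qed
  have b1: "(\<phi> a \<otimes>\<^bsub>BB\<^esub> \<phi> a \<ominus>\<^bsub>BB\<^esub> \<phi> a) \<otimes>\<^bsub>BB\<^esub> g = c a \<oplus>\<^bsub>BB\<^esub> c a" if "a \<in> carrier A" for a
    unfolding \<phi>D[OF that, symmetric] unfolding \<phi>_def g_def c_def
    using arg_cong[OF buds_relations(1)[OF that], of eL] that
    by (simp add: ring_hom_mult[OF etaL_hom] ring_hom_add[OF etaL_hom])
  have \<phi>m: "\<phi> a \<otimes>\<^bsub>BB\<^esub> \<phi> b = \<phi> (a \<otimes>\<^bsub>A\<^esub> b)" if "a \<in> carrier A" "b \<in> carrier A" for a b
    using that by simp
  have b2: "c (a \<oplus>\<^bsub>A\<^esub> b) = c a \<oplus>\<^bsub>BB\<^esub> c b \<oplus>\<^bsub>BB\<^esub> (\<phi> a \<otimes>\<^bsub>BB\<^esub> \<phi> b) \<otimes>\<^bsub>BB\<^esub> g"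
    if "a \<in> carrier A" "b \<in> carrier A" for a b
    unfolding \<phi>m[OF that] unfolding \<phi>_def g_def c_def
    using arg_cong[OF buds_relations(2)[OF that], of eL] that
    by (simp add: ring_hom_mult[OF etaL_hom] ring_hom_add[OF etaL_hom])
  have b3: "c (a \<otimes>\<^bsub>A\<^esub> b) = \<phi> a \<otimes>\<^bsub>BB\<^esub> c b \<oplus>\<^bsub>BB\<^esub> (\<phi> b \<otimes>\<^bsub>BB\<^esub> \<phi> b) \<otimes>\<^bsub>BB\<^esub> c a"
    if "a \<in> carrier A" "b \<in> carrier A" for a b
    unfolding \<phi>m[OF that(2,2)] unfolding \<phi>_def g_def c_def
    using arg_cong[OF buds_relations(3)[OF that], of eL, symmetric] that
    by (simp add: ring_hom_mult[OF etaL_hom] ring_hom_add[OF etaL_hom])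
  \<comment> \<open>The relations with free variables in place of the images of scalars and symbols,
    which makes them statements about an arbitrary commutative ring. Only the first needs a relation
    of \<open>Dr\<close> as a premise.\<close>
  have 1: "(x \<otimes>\<^bsub>BB\<^esub> x \<ominus>\<^bsub>BB\<^esub> x) \<otimes>\<^bsub>BB\<^esub> (g \<oplus>\<^bsub>BB\<^esub> (t \<oplus>\<^bsub>BB\<^esub> t)) =
      (u \<oplus>\<^bsub>BB\<^esub> (x \<otimes>\<^bsub>BB\<^esub> x \<ominus>\<^bsub>BB\<^esub> x) \<otimes>\<^bsub>BB\<^esub> t) \<oplus>\<^bsub>BB\<^esub> (u \<oplus>\<^bsub>BB\<^esub> (x \<otimes>\<^bsub>BB\<^esub> x \<ominus>\<^bsub>BB\<^esub> x) \<otimes>\<^bsub>BB\<^esub> t)"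
    if "(x \<otimes>\<^bsub>BB\<^esub> x \<ominus>\<^bsub>BB\<^esub> x) \<otimes>\<^bsub>BB\<^esub> g = u \<oplus>\<^bsub>BB\<^esub> u" "x \<in> carrier BB" "u \<in> carrier BB" "t \<in> carrier BB" for x u t
    using that cl(1) by (simp add: B.r_distr B.a_ac)
  have 2: "(u \<oplus>\<^bsub>BB\<^esub> v \<oplus>\<^bsub>BB\<^esub> (x \<otimes>\<^bsub>BB\<^esub> y) \<otimes>\<^bsub>BB\<^esub> g) \<oplus>\<^bsub>BB\<^esub> ((x \<oplus>\<^bsub>BB\<^esub> y) \<otimes>\<^bsub>BB\<^esub> (x \<oplus>\<^bsub>BB\<^esub> y) \<ominus>\<^bsub>BB\<^esub> (x \<oplus>\<^bsub>BB\<^esub> y)) \<otimes>\<^bsub>BB\<^esub> t =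
      (u \<oplus>\<^bsub>BB\<^esub> (x \<otimes>\<^bsub>BB\<^esub> x \<ominus>\<^bsub>BB\<^esub> x) \<otimes>\<^bsub>BB\<^esub> t) \<oplus>\<^bsub>BB\<^esub> (v \<oplus>\<^bsub>BB\<^esub> (y \<otimes>\<^bsub>BB\<^esub> y \<ominus>\<^bsub>BB\<^esub> y) \<otimes>\<^bsub>BB\<^esub> t) \<oplus>\<^bsub>BB\<^esub>
      (x \<otimes>\<^bsub>BB\<^esub> y) \<otimes>\<^bsub>BB\<^esub> (g \<oplus>\<^bsub>BB\<^esub> (t \<oplus>\<^bsub>BB\<^esub> t))"
    if "x \<in> carrier BB" "y \<in> carrier BB" "u \<in> carrier BB" "v \<in> carrier BB" "t \<in> carrier BB" for x y u v t
    using that cl(1) by algebra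
  have 3: "x \<otimes>\<^bsub>BB\<^esub> (v \<oplus>\<^bsub>BB\<^esub> (y \<otimes>\<^bsub>BB\<^esub> y \<ominus>\<^bsub>BB\<^esub> y) \<otimes>\<^bsub>BB\<^esub> t) \<oplus>\<^bsub>BB\<^esub> (y \<otimes>\<^bsub>BB\<^esub> y) \<otimes>\<^bsub>BB\<^esub> (u \<oplus>\<^bsub>BB\<^esub> (x \<otimes>\<^bsub>BB\<^esub> x \<ominus>\<^bsub>BB\<^esub> x) \<otimes>\<^bsub>BB\<^esub> t) =
      (x \<otimes>\<^bsub>BB\<^esub> v \<oplus>\<^bsub>BB\<^esub> (y \<otimes>\<^bsub>BB\<^esub> y) \<otimes>\<^bsub>BB\<^esub> u) \<oplus>\<^bsub>BB\<^esub> ((x \<otimes>\<^bsub>BB\<^esub> y) \<otimes>\<^bsub>BB\<^esub> (x \<otimes>\<^bsub>BB\<^esub> y) \<ominus>\<^bsub>BB\<^esub> (x \<otimes>\<^bsub>BB\<^esub> y)) \<otimes>\<^bsub>BB\<^esub> t"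
    if "x \<in> carrier BB" "y \<in> carrier BB" "u \<in> carrier BB" "v \<in> carrier BB" "t \<in> carrier BB" for x y u v t
    using that by algebra
  let ?C = "\<lambda>a. c a \<oplus>\<^bsub>BB\<^esub> (\<phi> a \<otimes>\<^bsub>BB\<^esub> \<phi> a \<ominus>\<^bsub>BB\<^esub> \<phi> a) \<otimes>\<^bsub>BB\<^esub> tt"
  obtain h where h: "h \<in> ring_hom (L_buds A) BB" and hs: "\<And>a. a \<in> carrier A \<Longrightarrow> h (buds_scal A a) = \<phi> a"
    and hg: "h (buds_gamma A) = g \<oplus>\<^bsub>BB\<^esub> (tt \<oplus>\<^bsub>BB\<^esub> tt)" and hc: "\<And>a. a \<in> carrier A \<Longrightarrow> h (buds_c A a) = ?C a"
  proof (rule L_buds_hom_ex[OF LB_cring \<phi>, of "g \<oplus>\<^bsub>BB\<^esub> (tt \<oplus>\<^bsub>BB\<^esub> tt)" ?C])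
    fix a assume a: "a \<in> carrier A"
    show "\<phi> (a \<otimes>\<^bsub>A\<^esub> a \<ominus>\<^bsub>A\<^esub> a) \<otimes>\<^bsub>BB\<^esub> (g \<oplus>\<^bsub>BB\<^esub> (tt \<oplus>\<^bsub>BB\<^esub> tt)) = ?C a \<oplus>\<^bsub>BB\<^esub> ?C a"
      unfolding \<phi>D[OF a] using a by (intro 1 b1) (simp_all add: cl)
    fix b assume b: "b \<in> carrier A"
    show "?C (a \<oplus>\<^bsub>A\<^esub> b) = ?C a \<oplus>\<^bsub>BB\<^esub> ?C b \<oplus>\<^bsub>BB\<^esub> \<phi> (a \<otimes>\<^bsub>A\<^esub> b) \<otimes>\<^bsub>BB\<^esub> (g \<oplus>\<^bsub>BB\<^esub> (tt \<oplus>\<^bsub>BB\<^esub> tt))"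
      using 2[of "\<phi> a" "\<phi> b" "c a" "c b" tt] a b by (simp add: b2 cl)
    show "\<phi> a \<otimes>\<^bsub>BB\<^esub> ?C b \<oplus>\<^bsub>BB\<^esub> \<phi> (b \<otimes>\<^bsub>A\<^esub> b) \<otimes>\<^bsub>BB\<^esub> ?C a = ?C (a \<otimes>\<^bsub>A\<^esub> b)"
      using 3[of "\<phi> a" "\<phi> b" "c a" "c b" tt] a b by (simp add: b3 cl)
  next
    fix h assume "h \<in> ring_hom (L_buds A) BB" "\<And>a. a \<in> carrier A \<Longrightarrow> h (buds_scal A a) = \<phi> a"
      "h (buds_gamma A) = g \<oplus>\<^bsub>BB\<^esub> (tt \<oplus>\<^bsub>BB\<^esub> tt)" "\<And>a. a \<in> carrier A \<Longrightarrow> h (buds_c A a) = ?C a"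
    then show thesis by (rule that)
  qed (simp_all add: cl)
  have D: "\<phi> a \<otimes>\<^bsub>BB\<^esub> \<phi> a \<ominus>\<^bsub>BB\<^esub> \<phi> a = eL (buds_scal A (a \<otimes>\<^bsub>A\<^esub> a \<ominus>\<^bsub>A\<^esub> a))" if "a \<in> carrier A" for a
    using \<phi>D[OF that] by (simp add: \<phi>_def)
  show ?thesis
    by (rule that[OF h]) (use hs hg hc D in \<open>simp_all add: g_def c_def \<phi>_def\<close>)
qed

lemma buds_etaR:
  shows etaR_hom: "buds_etaR A \<in> ring_hom (L_buds A) BB"
    and etaR_scal: "\<And>a. a \<in> carrier A \<Longrightarrow> buds_etaR A (buds_scal A a) = eL (buds_scal A a)"
    and etaR_gamma: "buds_etaR A (buds_gamma A) = eL (buds_gamma A) \<oplus>\<^bsub>BB\<^esub> (tt \<oplus>\<^bsub>BB\<^esub> tt)"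
    and etaR_c: "\<And>a. a \<in> carrier A \<Longrightarrow> buds_etaR A (buds_c A a) =
      eL (buds_c A a) \<oplus>\<^bsub>BB\<^esub> (eL (buds_scal A (a \<otimes>\<^bsub>A\<^esub> a \<ominus>\<^bsub>A\<^esub> a)) \<otimes>\<^bsub>BB\<^esub> tt)"
proof -
  let ?P = "\<lambda>h. (\<forall>a\<in>carrier A. h (buds_scal A a) = eL (buds_scal A a)) \<and>
    h (buds_gamma A) = eL (buds_gamma A) \<oplus>\<^bsub>BB\<^esub> (tt \<oplus>\<^bsub>BB\<^esub> tt) \<and>
    (\<forall>a\<in>carrier A. h (buds_c A a) =
      eL (buds_c A a) \<oplus>\<^bsub>BB\<^esub> (eL (buds_scal A (a \<otimes>\<^bsub>A\<^esub> a \<ominus>\<^bsub>A\<^esub> a)) \<otimes>\<^bsub>BB\<^esub> tt))"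
  obtain h0 where h0: "h0 \<in> ring_hom (L_buds A) BB" "?P h0" using etaR_ex by metis
  have P: "?P (restrict h0 (carrier (L_buds A)))" using h0(2) by simp
  have u: "h x = h0 x" if "h \<in> ring_hom (L_buds A) BB" "?P h" "x \<in> carrier (L_buds A)" for h x
    by (rule L_buds_hom_unique[OF LB_cring that(1) h0(1) _ _ _ that(3)]) (use that(2) h0(2) in simp_all)
  have "the_hom (L_buds A) BB ?P \<in> ring_hom (L_buds A) BB"
    by (rule the_homI(1)[of "L_buds A" h0 BB ?P, OF LA.ring_axioms h0(1) P]) (rule u)
  moreover have "?P (the_hom (L_buds A) BB ?P)"
    by (rule the_homI(2)[of "L_buds A" h0 BB ?P, OF LA.ring_axioms h0(1) P]) (rule u)
  ultimately have *: "buds_etaR A \<in> ring_hom (L_buds A) BB \<and> ?P (buds_etaR A)"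
    unfolding buds_etaR_def by blast
  show "buds_etaR A \<in> ring_hom (L_buds A) BB"
    "\<And>a. a \<in> carrier A \<Longrightarrow> buds_etaR A (buds_scal A a) = eL (buds_scal A a)"
    "buds_etaR A (buds_gamma A) = eL (buds_gamma A) \<oplus>\<^bsub>BB\<^esub> (tt \<oplus>\<^bsub>BB\<^esub> tt)"
    "\<And>a. a \<in> carrier A \<Longrightarrow> buds_etaR A (buds_c A a) =
      eL (buds_c A a) \<oplus>\<^bsub>BB\<^esub> (eL (buds_scal A (a \<otimes>\<^bsub>A\<^esub> a \<ominus>\<^bsub>A\<^esub> a)) \<otimes>\<^bsub>BB\<^esub> tt)"
    using * by simp_all
qed

text \<open>Sending \<open>t\<close> to zero removes the corrections by which the right unit differs
  from the left one.\<close>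

lemma counit_ex:
  "\<exists>e. e \<in> ring_hom BB (L_buds A) \<and> (\<forall>x\<in>carrier (L_buds A). e (eL x) = x \<and> e (buds_etaR A x) = x)"
proof -
  obtain e where e: "e \<in> ring_hom BB (L_buds A)" "\<And>x. x \<in> carrier (L_buds A) \<Longrightarrow> e (eL x) = x"
    "e tt = \<zero>\<^bsub>L_buds A\<^esub>"
    using LB_buds_hom_ex[OF L_cring id_ring_hom LA.zero_closed] by auto
  interpret e: ring_hom_cring BB "L_buds A" e by (rule ring_hom_cring_of[OF LB_cring L_cring e(1)])
  have "(e \<circ> buds_etaR A) x = id x" if "x \<in> carrier (L_buds A)" for x
    by (rule L_buds_hom_unique[OF L_cring ring_hom_trans[OF etaR_hom e(1)] id_ring_hom _ _ _ that])
      (simp_all add: etaR_scal etaR_gamma etaR_c e)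
  then show ?thesis using e by auto
qed

lemma tensor_buds: "tensor (L_buds A) BB (buds_etaR A) BB (buds_etaL A)"
  by (rule tensor.intro[OF L_cring LB_cring LB_cring etaR_hom etaL_hom])

interpretation T: tensor "L_buds A" BB "buds_etaR A" BB "buds_etaL A" by (rule tensor_buds)

lemma buds_comult:
  shows comult_hom: "buds_comult A \<in> ring_hom BB T.T"
    and comult_etaL: "\<And>x. x \<in> carrier (L_buds A) \<Longrightarrow> buds_comult A (eL x) = T.pure (eL x) \<one>\<^bsub>BB\<^esub>"
    and comult_t: "buds_comult A tt = T.pure tt \<one>\<^bsub>BB\<^esub> \<oplus>\<^bsub>T.T\<^esub> T.pure \<one>\<^bsub>BB\<^esub> tt"
proof -
  let ?P = "\<lambda>h. (\<forall>x\<in>carrier (L_buds A). h (eL x) = T.pure (eL x) \<one>\<^bsub>BB\<^esub>) \<and>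
    h tt = T.pure tt \<one>\<^bsub>BB\<^esub> \<oplus>\<^bsub>T.T\<^esub> T.pure \<one>\<^bsub>BB\<^esub> tt"
  have s: "T.pure tt \<one>\<^bsub>BB\<^esub> \<oplus>\<^bsub>T.T\<^esub> T.pure \<one>\<^bsub>BB\<^esub> tt \<in> carrier T.T"
    by simp
  obtain h0 where h0: "h0 \<in> ring_hom BB T.T" "?P h0"
    using LB_buds_hom_ex[OF T.T.cring_axioms ring_hom_trans[OF etaL_hom T.pure_left_hom] s] by auto
  have P: "?P (restrict h0 (carrier BB))" using h0(2) by simp
  have u: "h x = h0 x" if "h \<in> ring_hom BB T.T" "?P h" "x \<in> carrier BB" for h x
    by (rule LB_buds_hom_unique[OF T.T.cring_axioms that(1) h0(1) _ _ that(3)]) (use that(2) h0(2) in simp_all)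
  have "the_hom BB T.T ?P \<in> ring_hom BB T.T"
    by (rule the_homI(1)[of BB h0 T.T ?P, OF cring.axioms(1)[OF LB_cring] h0(1) P]) (rule u)
  moreover have "?P (the_hom BB T.T ?P)"
    by (rule the_homI(2)[of BB h0 T.T ?P, OF cring.axioms(1)[OF LB_cring] h0(1) P]) (rule u)
  moreover have "buds_comult A = the_hom BB T.T ?P" by (simp add: buds_comult_def Let_def)
  ultimately have *: "buds_comult A \<in> ring_hom BB T.T \<and> ?P (buds_comult A)" by simp
  then show "buds_comult A \<in> ring_hom BB T.T"
    "\<And>x. x \<in> carrier (L_buds A) \<Longrightarrow> buds_comult A (eL x) = T.pure (eL x) \<one>\<^bsub>BB\<^esub>"
    "buds_comult A tt = T.pure tt \<one>\<^bsub>BB\<^esub> \<oplus>\<^bsub>T.T\<^esub> T.pure \<one>\<^bsub>BB\<^esub> tt"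
    using * by simp_all
qed

text \<open>As \<open>t\<close> has degree 2, the constant coefficient has degree 2, the coefficient
  of \<open>t\<close> has degree 0 and is therefore a scalar of \<open>A\<close>, and all higher
  coefficients vanish.\<close>

lemma UP_grading_eq: "UP_grading (L_buds A) (Sym_grading A (Dr A) 2) 2 2 =
  {eL u \<oplus>\<^bsub>BB\<^esub> eL (buds_scal A r) \<otimes>\<^bsub>BB\<^esub> tt | u r. u \<in> L2 \<and> r \<in> carrier A}"
proof -
  interpret U: UP_cring "L_buds A" "LB_buds A"
    unfolding LB_buds_def by (rule UP_cring_LB)
  have co: "coeff BB (eL u \<oplus>\<^bsub>BB\<^esub> eL x \<otimes>\<^bsub>BB\<^esub> tt) = (\<lambda>k. if k = 0 then u else if k = 1 then x else \<zero>\<^bsub>L_buds A\<^esub>)"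
    if "u \<in> carrier (L_buds A)" "x \<in> carrier (L_buds A)" for u x
  proof -
    have eq: "eL x \<otimes>\<^bsub>BB\<^esub> tt = up_ring.monom BB x 1"
      using U.monom_mult[of x "\<one>\<^bsub>L_buds A\<^esub>" 0 1] that by (simp add: buds_etaL_def buds_t_def)
    show ?thesis
    proof
      fix k
      show "coeff BB (eL u \<oplus>\<^bsub>BB\<^esub> eL x \<otimes>\<^bsub>BB\<^esub> tt) k = (if k = 0 then u else if k = 1 then x else \<zero>\<^bsub>L_buds A\<^esub>)"
        unfolding eq unfolding buds_etaL_def using that by simp
    qed
  qed
  show ?thesis
  proof (intro equalityI subsetI)
    fix p assume p: "p \<in> UP_grading (L_buds A) (Sym_grading A (Dr A) 2) 2 2"
    then have pc: "p \<in> carrier BB" and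
      g: "\<And>k. if 2 * k \<le> 2 then coeff BB p k \<in> Sym_grading A (Dr A) 2 (2 - 2 * k) else coeff BB p k = \<zero>\<^bsub>L_buds A\<^esub>"
      by (auto simp: UP_grading_def LB_buds_def)
    have u: "coeff BB p 0 \<in> L2" and 1: "coeff BB p 1 \<in> Sym_grading A (Dr A) 2 0"
      and z: "\<And>k. k \<noteq> 0 \<Longrightarrow> k \<noteq> 1 \<Longrightarrow> coeff BB p k = \<zero>\<^bsub>L_buds A\<^esub>"
      using g[of 0] g[of 1] g by (auto split: if_splits)
    obtain r where r: "r \<in> carrier A" "coeff BB p 1 = buds_scal A r"
      using sym_algebra.Sym_grading_zero[OF sym_algebra_Dr _ 1] by (auto simp: buds_scal_def)
    have "p = eL (coeff BB p 0) \<oplus>\<^bsub>BB\<^esub> eL (buds_scal A r) \<otimes>\<^bsub>BB\<^esub> tt"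
      using pc r L2_closed[OF u] z
      by (intro U.up_eqI) (auto simp: co)
    then show "p \<in> {eL u \<oplus>\<^bsub>BB\<^esub> eL (buds_scal A r) \<otimes>\<^bsub>BB\<^esub> tt | u r. u \<in> L2 \<and> r \<in> carrier A}"
      using u r(1) by blast
  next
    fix p assume "p \<in> {eL u \<oplus>\<^bsub>BB\<^esub> eL (buds_scal A r) \<otimes>\<^bsub>BB\<^esub> tt | u r. u \<in> L2 \<and> r \<in> carrier A}"
    then obtain u r where ur: "u \<in> L2" "r \<in> carrier A" "p = eL u \<oplus>\<^bsub>BB\<^esub> eL (buds_scal A r) \<otimes>\<^bsub>BB\<^esub> tt"
      by blast
    have "buds_scal A r \<in> Sym_grading A (Dr A) 2 0"
      using sym_algebra.Sym_grading_const[OF sym_algebra_Dr ur(2)] by (simp add: buds_scal_def)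
    moreover have "p \<in> carrier BB" using ur L2_closed[OF ur(1)] by simp
    ultimately show "p \<in> UP_grading (L_buds A) (Sym_grading A (Dr A) 2) 2 2"
      using ur co[OF L2_closed[OF ur(1)] scal_closed[OF ur(2)]]
      by (auto simp: UP_grading_def LB_buds_def[symmetric])
  qed
qed

lemma L2_zero: "\<zero>\<^bsub>L_buds A\<^esub> \<in> L2"
  using L2_smult[OF A.zero_closed gamma_L2] ring_hom_zero[OF scal_hom A.ring_axioms LA.ring_axioms] by simp

end

lemma M_buds_simps:
  "base (M_buds A) = A" "obj (M_buds A) = L_buds A" "mor (M_buds A) = ring.truncate (LB_buds A)"
  "scal (M_buds A) = buds_scal A" "etaL (M_buds A) = buds_etaL A" "etaR (M_buds A) = buds_etaR A"
  "comult (M_buds A) = buds_comult A" "obj_grading (M_buds A) = Sym_grading A (Dr A) 2"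
  "mor_grading (M_buds A) = UP_grading (L_buds A) (Sym_grading A (Dr A) 2) 2"
  by (simp_all add: M_buds_def)

lemma cotor1_buds:
  fixes A :: "'a ring"
  assumes "cring A"
  obtains e where "cotor1 (M_buds A) (buds_t A) 2 e"
proof -
  interpret bud_ring A by (rule bud_ring.intro[OF assms])
  obtain e where e: "e \<in> ring_hom BB (L_buds A)"
    "\<forall>x\<in>carrier (L_buds A). e (eL x) = x \<and> e (buds_etaR A x) = x"
    using counit_ex by (elim exE conjE)
  have "cotor1 (M_buds A) (buds_t A) 2 e"
    unfolding cotor1_def mor_tensor_def mor_pure_tensor_def M_buds_simps tensor_truncate ring_hom_truncate
      ring_truncate_simps
    apply (intro conjI allI impI)
    apply (rule assms)
    apply (rule L_cring)
    apply (rule cring_truncate[OF LB_cring])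
    apply (rule etaL_hom)
    apply (rule etaR_hom)
    apply (rule scal_hom)
    apply (erule etaR_scal)
    apply (rule e(1))
    apply (use e(2) in blast)
    apply (use e(2) in blast)
    apply (rule comult_hom)
    apply (erule comult_etaL)
    apply (rule tt_closed)
    apply (rule comult_t)
    apply (rule UP_grading_eq)
    apply (rule subsetI, erule L2_closed)
    apply (rule L2_zero)
    apply (erule (1) L2_add)
    apply (erule (1) L2_smult)
    done
  then show ?thesis by (rule that)
qed


section \<open>Formal group laws\<close>

lemma subset_add_mset_cases:
  assumes "k \<subseteq># add_mset x m"
  shows "k \<subseteq># m \<or> (\<exists>l. l \<subseteq># m \<and> k = add_mset x l)"
proof (cases "x \<in># k")
  case True
  then obtain l where "k = add_mset x l" by (meson multi_member_split)
  then show ?thesis using assms by auto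
next
  case False
  have "count k y \<le> count m y" for y
    using assms False by (cases "y = x") (auto simp: subseteq_mset_def not_in_iff dest: spec[of _ y])
  then show ?thesis by (simp add: subseteq_mset_def)
qed

section \<open>Substitutions that keep some variables and annihilate the others\<close>

context cring
begin

lemma zero_series: "\<zero>\<^bsub>series_ring R W\<^esub> = (\<lambda>m. \<zero>)"
  by (simp add: series_simps)

lemma series_subst_cong:
  assumes "finite V" "\<And>v. v \<in> V \<Longrightarrow> s v \<in> carrier (series_ring R W)" "\<And>v. v \<in> V \<Longrightarrow> s v {#} = \<zero>"
    and F: "\<And>k. F k \<in> carrier R" and eq: "\<And>v. v \<in> V \<Longrightarrow> s v = s' v"
  shows "series_subst R V W F s = series_subst R V W F s'"
proof
  fix m
  have s': "\<And>v. v \<in> V \<Longrightarrow> s' v \<in> carrier (series_ring R W)" "\<And>v. v \<in> V \<Longrightarrow> s' v {#} = \<zero>"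
    using assms by auto
  have m: "mpow (series_ring R W) s k = mpow (series_ring R W) s' k" if "set_mset k \<subseteq> V" for k
  proof (rule cring.mpow_cong[OF cring_series_ring])
    show "s v = s' v" if "v \<in># k" for v using that \<open>set_mset k \<subseteq> V\<close> eq by blast
    show "s \<in> set_mset k \<rightarrow> carrier (series_ring R W)" using that assms(2) by blast
  qed
  have c: "mpow (series_ring R W) s' k m \<in> carrier R" if "set_mset k \<subseteq> V" for k
    by (rule series_coeff_closed[OF mpow_subst_closed]) (use assms(1) s' that in auto)
  have "series_subst R V W F s m =
      (\<Oplus>k\<in>{k. set_mset k \<subseteq> V \<and> size k \<le> size m}. F k \<otimes> mpow (series_ring R W) s k m)"
    using assms(1-4) by (rule series_subst_coeff)
  also have "\<dots> = (\<Oplus>k\<in>{k. set_mset k \<subseteq> V \<and> size k \<le> size m}. F k \<otimes> mpow (series_ring R W) s' k m)"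
    using F c m by (intro add.finprod_cong') auto
  also have "\<dots> = series_subst R V W F s' m"
    by (rule series_subst_coeff[symmetric]) (use assms(1) s' F in auto)
  finally show "series_subst R V W F s m = series_subst R V W F s' m" .
qed

lemma mpow_project:
  assumes "U \<subseteq> W"
  shows "mpow (series_ring R W) (\<lambda>v. if v \<in> U then indexed_var v else (\<lambda>m. \<zero>)) k =
    (\<lambda>m. if set_mset k \<subseteq> U \<and> m = k then \<one> else \<zero>)"
proof (induction k)
  case empty
  interpret S: cring "series_ring R W" by (rule cring_series_ring)
  show ?case by (auto simp: series_simps)
next
  case (add v k)
  interpret S: cring "series_ring R W" by (rule cring_series_ring)
  let ?s = "\<lambda>v. if v \<in> U then indexed_var v else (\<lambda>m. \<zero>)"
  have s: "?s v \<in> carrier (series_ring R W)" for v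
    using assms indexed_var_series[of v W] S.zero_closed unfolding zero_series by auto
  have mc: "mpow (series_ring R W) ?s k \<in> carrier (series_ring R W)" by (intro mpow_series_closed) (use s in auto)
  have "mpow (series_ring R W) ?s (add_mset v k) = ?s v \<otimes>\<^bsub>series_ring R W\<^esub> mpow (series_ring R W) ?s k"
    by (rule S.mpow_add_mset) (use s in auto)
  also have "\<dots> = (\<lambda>m. if set_mset (add_mset v k) \<subseteq> U \<and> m = add_mset v k then \<one> else \<zero>)"
  proof (cases "v \<in> U")
    case True
    have "?s v \<otimes>\<^bsub>series_ring R W\<^esub> mpow (series_ring R W) ?s k = indexed_pmult (mpow (series_ring R W) ?s k) v"
      using True indexed_var_mult[OF mc] by simp
    also have "\<dots> = (\<lambda>m. if set_mset (add_mset v k) \<subseteq> U \<and> m = add_mset v k then \<one> else \<zero>)"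
      unfolding add.IH indexed_pmult_def using True by (auto simp: fun_eq_iff dest!: multi_member_split)
    finally show ?thesis .
  next
    case False
    have "?s v \<otimes>\<^bsub>series_ring R W\<^esub> mpow (series_ring R W) ?s k = \<zero>\<^bsub>series_ring R W\<^esub>"
      using False S.l_null[OF mc] unfolding zero_series by simp
    then show ?thesis using False by (simp add: zero_series)
  qed
  finally show ?case .
qed

text \<open>Three choices of \<open>U\<close> matter: all of \<open>V\<close> gives the identity
  substitution, a single variable gives the restrictions in the unit laws, and the empty set gives
  the value at zero.\<close>

lemma series_subst_project:
  assumes V: "finite V" and U: "U \<subseteq> V" "U \<subseteq> W" and F: "F \<in> carrier (series_ring R V)"
    and s: "\<And>v. v \<in> V \<Longrightarrow> s v = (if v \<in> U then indexed_var v else (\<lambda>m. \<zero>))"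
  shows "series_subst R V W F s = (\<lambda>m. if set_mset m \<subseteq> U then F m else \<zero>)"
proof
  fix m
  interpret S: cring "series_ring R W" by (rule cring_series_ring)
  let ?s = "\<lambda>v. if v \<in> U then indexed_var v else (\<lambda>m. \<zero>)"
  have sc: "?s v \<in> carrier (series_ring R W)" "?s v {#} = \<zero>" for v
    using U indexed_var_series[of v W] S.zero_closed unfolding zero_series by (auto simp: indexed_var_eq)
  note Fc = series_coeff_closed[OF F]
  have "series_subst R V W F s = series_subst R V W F ?s"
    using s sc by (intro series_subst_cong[OF V _ _ Fc]) auto
  moreover have "series_subst R V W F ?s m = (\<Oplus>k\<in>{m}. if set_mset m \<subseteq> U then F m else \<zero>)"
  proof -
    have "series_subst R V W F ?s m = (\<Oplus>k\<in>{k. set_mset k \<subseteq> V \<and> size k \<le> size m}.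
        F k \<otimes> (if set_mset k \<subseteq> U \<and> m = k then \<one> else \<zero>))"
      unfolding series_subst_coeff[OF V sc Fc] mpow_project[OF U(2)] ..
    also have "\<dots> = (\<Oplus>k\<in>{k. set_mset k \<subseteq> V \<and> size k \<le> size m}.
        if m = k then (if set_mset k \<subseteq> U then F k else \<zero>) else \<zero>)"
      using Fc by (intro add.finprod_cong') auto
    also have "\<dots> = (if set_mset m \<subseteq> U then F m else \<zero>)"
    proof (cases "set_mset m \<subseteq> V")
      case True
      then show ?thesis
        using Fc finite_bounded_multisets[OF V]
        by (subst finsum_eq_single[of _ m]) auto
    next
      case False
      then have "\<not> set_mset m \<subseteq> U" using U by blast
      moreover have "(\<Oplus>k\<in>{k. set_mset k \<subseteq> V \<and> size k \<le> size m}.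
        if m = k then (if set_mset k \<subseteq> U then F k else \<zero>) else \<zero>) = \<zero>"
        using False by (intro add.finprod_one_eqI) auto
      ultimately show ?thesis by simp
    qed
    finally show ?thesis using Fc by simp
  qed
  ultimately show "series_subst R V W F s m = (if set_mset m \<subseteq> U then F m else \<zero>)"
    using Fc by simp
qed

lemma series_subst_id:
  assumes "finite V" "V \<subseteq> W" "F \<in> carrier (series_ring R V)" "\<And>v. v \<in> V \<Longrightarrow> s v = indexed_var v"
  shows "series_subst R V W F s = F"
proof
  fix m
  have "series_subst R V W F s = (\<lambda>m. if set_mset m \<subseteq> V then F m else \<zero>)"
    by (rule series_subst_project[OF assms(1) subset_refl assms(2,3)]) (use assms(4) in simp)
  then show "series_subst R V W F s m = F m" using series_coeff_outside[OF assms(3), of m] by simp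
qed

section \<open>Formal group laws over a commutative ring\<close>

text \<open>The shape \<open>X + Y\<close> plus mixed terms, which the generic series has by
  construction. It is equivalent to the two unit laws, see \<open>fgl_form_iff\<close>.\<close>

definition fgl_form :: "(fgl_var multiset \<Rightarrow> 'a) \<Rightarrow> bool" where
  "fgl_form F \<longleftrightarrow> F \<in> carrier (series_ring R {VX, VY}) \<and>
    (\<forall>m. set_mset m \<noteq> {VX, VY} \<longrightarrow> F m = (if m = {#VX#} \<or> m = {#VY#} then \<one> else \<zero>))"

abbreviation W3 :: "fgl_var set" where "W3 \<equiv> {VX, VY, VZ}"

definition fgl :: "(fgl_var multiset \<Rightarrow> 'a) \<Rightarrow> bool" where
  "fgl F \<longleftrightarrow> fgl_form F \<and>
    subst2 R W3 F (subst2 R W3 F (indexed_var VX) (indexed_var VY)) (indexed_var VZ) =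
    subst2 R W3 F (indexed_var VX) (subst2 R W3 F (indexed_var VY) (indexed_var VZ)) \<and>
    subst2 R W3 F (indexed_var VX) (indexed_var VY) = subst2 R W3 F (indexed_var VY) (indexed_var VX)"

text \<open>The series that may be substituted for a variable: their powers vanish to growing
  order.\<close>

definition nil :: "'w set \<Rightarrow> ('w multiset \<Rightarrow> 'a) set" where
  "nil W = {u \<in> carrier (series_ring R W). u {#} = \<zero>}"

lemma nilD: "u \<in> nil W \<Longrightarrow> u \<in> carrier (series_ring R W)" "u \<in> nil W \<Longrightarrow> u {#} = \<zero>"
  by (auto simp: nil_def)

lemma var_nil: "v \<in> W \<Longrightarrow> indexed_var v \<in> nil W"
  by (simp add: nil_def indexed_var_series) (simp add: indexed_var_eq)

lemma zero_nil: "(\<lambda>m. \<zero>) \<in> nil W"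
  by (simp add: nil_def series_carrier_iff)

lemma subst1_nil:
  assumes "f \<in> nil {VX}" "u \<in> nil W"
  shows "subst1 R W f u \<in> nil W"
  using series_subst_closed[of "{VX}" "\<lambda>_. u" W f] series_subst_zero_coeff[of "{VX}" "\<lambda>_. u" W f] assms
  by (auto simp: nil_def subst1_def)

lemma subst2_nil:
  assumes "F \<in> nil {VX, VY}" "u \<in> nil W" "v \<in> nil W"
  shows "subst2 R W F u v \<in> nil W"
  using series_subst_closed[of "{VX, VY}" "\<lambda>x. if x = VX then u else v" W F]
    series_subst_zero_coeff[of "{VX, VY}" "\<lambda>x. if x = VX then u else v" W F] assms
  by (auto simp: nil_def subst2_def)

lemma fgl_form_nil: "fgl_form F \<Longrightarrow> F \<in> nil {VX, VY}"
  by (auto simp: fgl_form_def nil_def)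

lemma subst_subst1:
  assumes "finite U" "\<And>x. x \<in> U \<Longrightarrow> r x \<in> nil W" "f \<in> nil {VX}" "u \<in> nil U"
  shows "series_subst R U W (subst1 R U f u) r = subst1 R W f (series_subst R U W u r)"
  unfolding subst1_def
  by (rule series_subst_subst) (use assms in \<open>auto simp: nil_def\<close>)

lemma subst_subst2:
  assumes U: "finite U" and r: "\<And>x. x \<in> U \<Longrightarrow> r x \<in> nil W" and F: "F \<in> nil {VX, VY}" and uv: "u \<in> nil U" "v \<in> nil U"
  shows "series_subst R U W (subst2 R U F u v) r = subst2 R W F (series_subst R U W u r) (series_subst R U W v r)"
proof -
  have "series_subst R U W (subst2 R U F u v) r =
    series_subst R {VX, VY} W F (\<lambda>x. series_subst R U W (if x = VX then u else v) r)"
    unfolding subst2_def by (rule series_subst_subst) (use assms in \<open>auto simp: nil_def\<close>)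
  also have "(\<lambda>x. series_subst R U W (if x = VX then u else v) r) =
    (\<lambda>x. if x = VX then series_subst R U W u r else series_subst R U W v r)" by auto
  finally show ?thesis by (simp add: subst2_def)
qed

lemma subst_var:
  assumes "finite U" "\<And>x. x \<in> U \<Longrightarrow> r x \<in> nil W" "v \<in> U"
  shows "series_subst R U W (indexed_var v) r = r v"
  by (rule series_subst_var) (use assms in \<open>auto simp: nil_def\<close>)

lemma subst2_self:
  "F \<in> nil {VX, VY} \<Longrightarrow> subst2 R {VX, VY} F (indexed_var VX) (indexed_var VY) = F"
  unfolding subst2_def by (rule series_subst_id) (auto simp: nil_def)

lemma subst2_zero:
  assumes "F \<in> nil {VX, VY}" "{VX, VY} \<subseteq> W"
  shows "subst2 R W F (indexed_var VX) (\<lambda>m. \<zero>) = (\<lambda>m. if set_mset m \<subseteq> {VX} then F m else \<zero>)"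
    "subst2 R W F (\<lambda>m. \<zero>) (indexed_var VY) = (\<lambda>m. if set_mset m \<subseteq> {VY} then F m else \<zero>)"
  unfolding subst2_def by (rule series_subst_project; use assms in \<open>auto simp: nil_def\<close>)+

text \<open>Setting one variable to zero leaves the pure powers of the other one, and mixed terms
  stay free. In the form of equations between substitutions the condition can be transported along
  an isomorphism, which is not visible from the coefficients.\<close>

lemma fgl_form_iff:
  assumes F: "F \<in> nil {VX, VY}" and W: "{VX, VY} \<subseteq> W"
  shows "fgl_form F \<longleftrightarrow> subst2 R W F (indexed_var VX) (\<lambda>m. \<zero>) = indexed_var VX \<and>
    subst2 R W F (\<lambda>m. \<zero>) (indexed_var VY) = indexed_var VY"
proof
  assume f: "fgl_form F"
  then have "F m = (if m = {#VX#} then \<one> else \<zero>)" if "set_mset m \<subseteq> {VX}" for m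
  proof -
    have "set_mset m \<noteq> {VX, VY}" "m \<noteq> {#VY#}" using that by auto
    then show ?thesis using f by (simp add: fgl_form_def)
  qed
  moreover have "F m = (if m = {#VY#} then \<one> else \<zero>)" if "set_mset m \<subseteq> {VY}" for m
  proof -
    have "set_mset m \<noteq> {VX, VY}" "m \<noteq> {#VX#}" using that by auto
    then show ?thesis using f by (simp add: fgl_form_def)
  qed
  ultimately show "subst2 R W F (indexed_var VX) (\<lambda>m. \<zero>) = indexed_var VX \<and>
    subst2 R W F (\<lambda>m. \<zero>) (indexed_var VY) = indexed_var VY"
    unfolding subst2_zero[OF F W] unfolding indexed_var_eq by (auto simp: fun_eq_iff)
next
  assume "subst2 R W F (indexed_var VX) (\<lambda>m. \<zero>) = indexed_var VX \<and>
    subst2 R W F (\<lambda>m. \<zero>) (indexed_var VY) = indexed_var VY"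
  then have *: "(if set_mset m \<subseteq> {VX} then F m else \<zero>) = (if m = {#VX#} then \<one> else \<zero>)"
    "(if set_mset m \<subseteq> {VY} then F m else \<zero>) = (if m = {#VY#} then \<one> else \<zero>)" for m
    unfolding subst2_zero[OF F W] unfolding indexed_var_eq by (auto simp: fun_eq_iff)
  have "F m = (if m = {#VX#} \<or> m = {#VY#} then \<one> else \<zero>)" if m: "set_mset m \<noteq> {VX, VY}" for m
  proof -
    consider "set_mset m \<subseteq> {VX}" | "set_mset m \<subseteq> {VY}" | "\<not> set_mset m \<subseteq> {VX, VY}"
      using m by blast
    then show ?thesis
    proof cases
      case 1
      then have "m \<noteq> {#VY#}" by auto
      then show ?thesis using *(1)[of m] 1 by simp
    next
      case 2
      then have "m \<noteq> {#VX#}" by auto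
      then show ?thesis using *(2)[of m] 2 by simp
    next
      case 3
      then have "m \<noteq> {#VX#}" "m \<noteq> {#VY#}" by auto
      then show ?thesis using series_coeff_outside[OF nilD(1)[OF F] 3] by simp
    qed
  qed
  then show "fgl_form F" using nilD(1)[OF F] by (simp add: fgl_form_def)
qed

subsection \<open>Transport along a strict isomorphism\<close>

context
  fixes f :: "fgl_var multiset \<Rightarrow> 'a"
  assumes f: "f \<in> nil {VX}" and f1: "f {#VX#} = \<one>"
begin

abbreviation iso_at :: "fgl_var set \<Rightarrow> fgl_var \<Rightarrow> fgl_var multiset \<Rightarrow> 'a" where
  "iso_at W v \<equiv> subst1 R W f (indexed_var v)"

lemma iso_at_nil: "v \<in> W \<Longrightarrow> iso_at W v \<in> nil W"
  by (intro subst1_nil f var_nil)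

text \<open>Only the linear term of \<open>f\<close> reaches degree one, because \<open>u\<close>
  has no constant term. It makes \<open>iso_at\<close> a triangular substitution.\<close>

lemma subst1_linear:
  assumes u: "u \<in> nil W"
  shows "subst1 R W f u {#w#} = u {#w#}"
proof -
  interpret S: cring "series_ring R W" by (rule cring_series_ring)
  have z: "f k = \<zero>" if "k = {#}" for k using nilD(2)[OF f] that by simp
  have "subst1 R W f u {#w#} = (\<Oplus>k\<in>{{#VX#}}. f k \<otimes> mpow (series_ring R W) (\<lambda>_. u) k {#w#})"
    unfolding subst1_def
  proof (rule series_subst_coeff_superset)
    fix k :: "fgl_var multiset"
    assume k: "set_mset k \<subseteq> {VX}" "size k \<le> size {#w#}" "f k \<noteq> \<zero>"
    then have "k \<noteq> {#}" using z by auto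
    then have "size k = 1" using k(2) by (cases k) auto
    then obtain x where "k = {#x#}" using size_1_singleton_mset by blast
    then show "k \<in> {{#VX#}}" using k(1) by simp
  qed (use u nilD[OF u] series_coeff_closed[OF nilD(1)[OF f]] in auto)
  also have "\<dots> = u {#w#}"
    using nilD(1)[OF u] f1 series_coeff_closed[OF nilD(1)[OF u]]
    by (simp add: S.mpow_add_mset Pi_def)
  finally show ?thesis .
qed

lemma iso_at_tri:
  assumes "v \<in> W"
  shows "iso_at W v \<in> carrier (series_ring R W)" "iso_at W v {#} = \<zero>"
    "iso_at W v {#w#} = (if v = w then \<one> else \<zero>)"
  using nilD[OF iso_at_nil[OF assms]] subst1_linear[OF var_nil[OF assms], of w] by (auto simp: indexed_var_eq)

lemma subst1_zero:
  fixes W :: "fgl_var set"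
  shows "subst1 R W f (\<lambda>m. \<zero>) = (\<lambda>m. \<zero>)"
proof -
  have "subst1 R W f (\<lambda>m. \<zero>) = (\<lambda>m. if set_mset m \<subseteq> {} then f m else \<zero>)"
    unfolding subst1_def by (rule series_subst_project) (use nilD[OF f] in auto)
  then show ?thesis using nilD(2)[OF f] by auto
qed

lemma iso_at_VX: "VX \<in> W \<Longrightarrow> iso_at W VX = f"
  unfolding subst1_def by (rule series_subst_id) (use nilD[OF f] in auto)

lemma iso_at_inj:
  assumes "finite W" "p \<in> nil W" "q \<in> nil W" "series_subst R W W p (iso_at W) = series_subst R W W q (iso_at W)"
  shows "p = q"
proof (rule series_subst_triangular_inj[of W "iso_at W"])
  show "p \<in> carrier (series_ring R W)" "q \<in> carrier (series_ring R W)"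
    by (rule nilD(1)[OF assms(2)], rule nilD(1)[OF assms(3)])
qed (use assms(1,4) iso_at_tri in simp_all)

context
  fixes F assumes F: "fgl F"
begin

lemma F_form: "fgl_form F" and F_nil: "F \<in> nil {VX, VY}"
  using F fgl_form_nil by (auto simp: fgl_def)

abbreviation W2 :: "fgl_var set" where "W2 \<equiv> {VX, VY}"

text \<open>\<open>f (F (X, Y)) = G (f X, f Y)\<close>\<close>

definition transports where
  "transports G \<longleftrightarrow> G \<in> carrier (series_ring R W2) \<and> subst1 R W2 f F = subst2 R W2 G f (iso_at W2 VY)"

text \<open>Since \<open>f\<close> is its own value at the first variable, the right side of the
  transport equation is a triangular substitution applied to \<open>G\<close>, so that existence and
  uniqueness of \<open>G\<close> become surjectivity and injectivity.\<close>

lemma subst2_iso_at: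
  assumes "G \<in> carrier (series_ring R W2)"
  shows "subst2 R W2 G f (iso_at W2 VY) = series_subst R W2 W2 G (iso_at W2)"
  unfolding subst2_def
proof (rule series_subst_cong)
  fix v assume "v \<in> W2"
  then have v: "(if v = VX then f else iso_at W2 VY) = iso_at W2 v" by (auto simp: iso_at_VX)
  then show "(if v = VX then f else iso_at W2 VY) = iso_at W2 v" .
  show "(if v = VX then f else iso_at W2 VY) \<in> carrier (series_ring R W2)"
    "(if v = VX then f else iso_at W2 VY) {#} = \<zero>"
    unfolding v using iso_at_tri \<open>v \<in> W2\<close> by auto
qed (use series_coeff_closed[OF assms] in auto)

lemma transports_unique: "transports G \<Longrightarrow> transports G' \<Longrightarrow> G = G'"
proof -
  assume *: "transports G" "transports G'"
  then have "G \<in> carrier (series_ring R W2)" "G' \<in> carrier (series_ring R W2)"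
    "series_subst R W2 W2 G (iso_at W2) = series_subst R W2 W2 G' (iso_at W2)"
    by (simp_all add: transports_def subst2_iso_at)
  then show ?thesis
    by (rule series_subst_triangular_inj[of W2 "iso_at W2", rotated 4]) (simp_all add: iso_at_tri)
qed

lemma transports_ex: "\<exists>G. transports G"
proof -
  have "subst1 R W2 f F \<in> carrier (series_ring R W2)"
    using nilD(1)[OF subst1_nil[OF f F_nil]] .
  then have "\<exists>G. G \<in> carrier (series_ring R W2) \<and> series_subst R W2 W2 G (iso_at W2) = subst1 R W2 f F"
  proof (rule series_subst_triangular_surj[of W2 "iso_at W2" "subst1 R W2 f F", rotated 4])
    fix G assume "G \<in> carrier (series_ring R W2)" "series_subst R W2 W2 G (iso_at W2) = subst1 R W2 f F"
    then show ?thesis by blast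
  qed (use iso_at_tri in auto)
  then show ?thesis by (metis transports_def subst2_iso_at)
qed

context
  fixes G assumes G: "transports G"
begin

lemma G_series: "G \<in> carrier (series_ring R W2)" and G_eq: "series_subst R W2 W2 G (iso_at W2) = subst1 R W2 f F"
  using G by (auto simp: transports_def subst2_iso_at)

lemma G_nil: "G \<in> nil W2"
proof -
  have "G {#} = series_subst R W2 W2 G (iso_at W2) {#}"
    by (rule series_subst_zero_coeff[symmetric]) (use iso_at_tri G_series in auto)
  also have "\<dots> = \<zero>" unfolding G_eq using nilD(2)[OF subst1_nil[OF f F_nil]] .
  finally show ?thesis using G_series by (simp add: nil_def)
qed

text \<open>The defining equation holds for the variables, hence for any two series without constant
  term: \<open>f\<close> is a homomorphism from \<open>F\<close> to \<open>G\<close>.\<close>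

lemma G_subst:
  assumes u: "u \<in> nil W" and v: "v \<in> nil W"
  shows "subst2 R W G (subst1 R W f u) (subst1 R W f v) = subst1 R W f (subst2 R W F u v)"
proof -
  let ?r = "\<lambda>x. if x = VX then u else v"
  have r: "?r x \<in> nil W" for x using u v by auto
  have "subst1 R W f (subst2 R W F u v) = series_subst R W2 W (subst1 R W2 f F) ?r"
    using subst_subst1[of W2 ?r W f F] r f F_nil by (simp add: subst2_def)
  also have "subst1 R W2 f F = subst2 R W2 G (iso_at W2 VX) (iso_at W2 VY)"
    using subst2_iso_at[OF G_series] G_eq iso_at_VX[of W2] by simp
  also have "series_subst R W2 W \<dots> ?r =
      subst2 R W G (series_subst R W2 W (iso_at W2 VX) ?r) (series_subst R W2 W (iso_at W2 VY) ?r)"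
    using r by (intro subst_subst2 G_nil iso_at_nil) auto
  also have "series_subst R W2 W (iso_at W2 VX) ?r = subst1 R W f u"
    using subst_subst1[of W2 ?r W f "indexed_var VX"] subst_var[of W2 ?r W VX] r f var_nil[of VX W2] by simp
  also have "series_subst R W2 W (iso_at W2 VY) ?r = subst1 R W f v"
    using subst_subst1[of W2 ?r W f "indexed_var VY"] subst_var[of W2 ?r W VY] r f var_nil[of VY W2] by simp
  finally show ?thesis by simp
qed

lemma G_fat:
  assumes "u \<in> nil W3" "v \<in> nil W3"
  shows "series_subst R W3 W3 (subst2 R W3 G u v) (iso_at W3) =
    subst2 R W3 G (series_subst R W3 W3 u (iso_at W3)) (series_subst R W3 W3 v (iso_at W3))"
  using assms by (intro subst_subst2 G_nil iso_at_nil) auto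

lemma iso_at_of_var: "v \<in> W3 \<Longrightarrow> series_subst R W3 W3 (indexed_var v) (iso_at W3) = iso_at W3 v"
  by (intro subst_var iso_at_nil) auto

text \<open>Each law is verified after substituting \<open>f\<close> into every variable, which is
  injective. There \<open>G_subst\<close> rewrites both sides as \<open>f\<close> applied to the two
  sides of the same law for \<open>F\<close>.\<close>

lemma transports_fgl: "fgl G"
proof -
  have x: "indexed_var VX \<in> nil W3" and y: "indexed_var VY \<in> nil W3" and z: "indexed_var VZ \<in> nil W3"
    by (auto intro: var_nil)
  note nil = x y z zero_nil subst2_nil[OF G_nil] subst2_nil[OF F_nil]
  have inj: "p = q" if "p \<in> nil W3" "q \<in> nil W3"
    "series_subst R W3 W3 p (iso_at W3) = series_subst R W3 W3 q (iso_at W3)" for p q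
    by (rule iso_at_inj[OF _ that]) simp
  have zero: "series_subst R W3 W3 (\<lambda>m. \<zero>) (iso_at W3) = subst1 R W3 f (\<lambda>m. \<zero>)"
  proof -
    have "(\<lambda>p. series_subst R W3 W3 p (iso_at W3)) \<in> ring_hom (series_ring R W3) (series_ring R W3)"
      by (rule series_subst_hom) (use iso_at_tri in auto)
    from ring_hom_zero[OF this cring.axioms(1)[OF cring_series_ring] cring.axioms(1)[OF cring_series_ring]]
    show ?thesis unfolding zero_series subst1_zero .
  qed
  note sub = G_fat iso_at_of_var zero G_subst nil
  have F0: "subst2 R W3 F (indexed_var VX) (\<lambda>m. \<zero>) = indexed_var VX"
    "subst2 R W3 F (\<lambda>m. \<zero>) (indexed_var VY) = indexed_var VY"
    using fgl_form_iff[OF F_nil, of W3] F_form by auto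
  have "subst2 R W3 G (indexed_var VX) (\<lambda>m. \<zero>) = indexed_var VX"
    by (rule inj) (simp_all add: sub F0)
  moreover have "subst2 R W3 G (\<lambda>m. \<zero>) (indexed_var VY) = indexed_var VY"
    by (rule inj) (simp_all add: sub F0)
  ultimately have 1: "fgl_form G" using fgl_form_iff[OF G_nil, of W3] by auto
  have comm: "subst2 R W3 F (indexed_var VX) (indexed_var VY) = subst2 R W3 F (indexed_var VY) (indexed_var VX)"
    and assoc: "subst2 R W3 F (subst2 R W3 F (indexed_var VX) (indexed_var VY)) (indexed_var VZ) =
      subst2 R W3 F (indexed_var VX) (subst2 R W3 F (indexed_var VY) (indexed_var VZ))"
    using F unfolding fgl_def by blast+
  have 2: "subst2 R W3 G (indexed_var VX) (indexed_var VY) = subst2 R W3 G (indexed_var VY) (indexed_var VX)"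
    by (rule inj) (simp_all add: sub comm)
  have 3: "subst2 R W3 G (subst2 R W3 G (indexed_var VX) (indexed_var VY)) (indexed_var VZ) =
    subst2 R W3 G (indexed_var VX) (subst2 R W3 G (indexed_var VY) (indexed_var VZ))"
    by (rule inj) (simp_all add: sub assoc)
  show ?thesis unfolding fgl_def using 1 2 3 by blast
qed

text \<open>The coefficient of XY in the transport equation. On the left the quadratic term of
  \<open>f\<close> contributes twice its coefficient, because the square of X + Y contains XY twice;
  on the right only the mixed coefficient of \<open>G\<close> appears. This is the source of the
  factor two in the cohomology.\<close>

lemma transports_XY:
  "G {#VX, VY#} = F {#VX, VY#} \<oplus> (f {#VX, VX#} \<oplus> f {#VX, VX#})"
proof -
  interpret S: cring "series_ring R W2" by (rule cring_series_ring)
  let ?m = "{#VX, VY#}"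
  note Fc = series_coeff_closed[OF nilD(1)[OF F_nil]] and fc = series_coeff_closed[OF nilD(1)[OF f]]
  \<comment> \<open>Only the terms of \<open>f\<close> in degrees one and two can reach a monomial
    of size two.\<close>
  have small: "k \<in> {{#VX#}, {#VX, VX#}}" if "set_mset k \<subseteq> {VX}" "size k \<le> 2" "f k \<noteq> \<zero>" for k
  proof -
    have "k = replicate_mset (size k) VX"
      using that(1) by (metis multiset_eqI count_replicate_mset set_mset_subset_singletonD size_replicate_mset)
    moreover have "size k \<noteq> 0" using that(3) nilD(2)[OF f] by auto
    ultimately have "k = replicate_mset 1 VX \<or> k = replicate_mset 2 VX"
      using that(2) by (metis One_nat_def le_SucE le_zero_eq numeral_2_eq_2)
    then show ?thesis by (auto simp: numeral_2_eq_2)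
  qed
  have sub: "subst1 R W2 f u ?m = u ?m \<oplus> f {#VX, VX#} \<otimes> (u \<otimes>\<^bsub>series_ring R W2\<^esub> u) ?m" if u: "u \<in> nil W2" for u
  proof -
    have uc: "u \<in> carrier (series_ring R W2)" by (rule nilD(1)[OF u])
    have "subst1 R W2 f u ?m = (\<Oplus>k\<in>{{#VX#}, {#VX, VX#}}. f k \<otimes> mpow (series_ring R W2) (\<lambda>_. u) k ?m)"
      unfolding subst1_def
      by (rule series_subst_coeff_superset) (use nilD[OF u] small fc in auto)
    then show ?thesis
      using uc f1 fc series_coeff_closed[OF uc] series_coeff_closed[OF S.m_closed[OF uc uc]]
      by (simp add: S.mpow_add_mset Pi_def)
  qed
  have "k \<in> {{#}, {#VX#}, {#VY#}, {#VX, VY#}}" if "k \<subseteq># ?m" for k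
    using subset_add_mset_cases[OF that] by (auto dest!: subset_add_mset_cases)
  then have subs: "{k. k \<subseteq># ?m} = {{#}, {#VX#}, {#VY#}, {#VX, VY#}}"
    by auto
  have sq: "(u \<otimes>\<^bsub>series_ring R W2\<^esub> u) ?m = u {#VX#} \<otimes> u {#VY#} \<oplus> u {#VY#} \<otimes> u {#VX#}" if u: "u \<in> nil W2" for u
    unfolding series_simps subs using series_coeff_closed[OF nilD(1)[OF u]] nilD(2)[OF u]
    by simp
  have F1: "F {#VX#} = \<one>" "F {#VY#} = \<one>"
    using F_form by (auto simp: fgl_form_def)
  have L: "subst1 R W2 f F ?m = F ?m \<oplus> (f {#VX, VX#} \<oplus> f {#VX, VX#})"
    unfolding sub[OF F_nil] sq[OF F_nil] F1 using fc by (simp add: r_distr)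
  \<comment> \<open>The series f(X) and f(Y) involve one variable each and have no mixed terms, so
    the linear part of \<open>G\<close> adds nothing.\<close>
  have fz: "iso_at W2 v ?m = \<zero>" if "v \<in> W2" for v
    unfolding sub[OF var_nil[OF that]] sq[OF var_nil[OF that]] using fc that by (auto simp: indexed_var_eq)
  have Gc: "G k \<in> carrier R" for k by (rule series_coeff_closed[OF G_series])
  have "subst_tail W2 (iso_at W2) G ?m =
      (\<Oplus>k\<in>{k. set_mset k \<subseteq> W2 \<and> size k < size ?m}. G k \<otimes> mpow (series_ring R W2) (iso_at W2) k ?m)"
    by (rule subst_tail_def) (use iso_at_tri in auto)
  also have "\<dots> = \<zero>"
  proof (rule add.finprod_one_eqI)
    fix k :: "fgl_var multiset" assume "k \<in> {k. set_mset k \<subseteq> W2 \<and> size k < size ?m}"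
    then have k: "set_mset k \<subseteq> W2" "size k \<le> 1" by auto
    show "G k \<otimes> mpow (series_ring R W2) (iso_at W2) k ?m = \<zero>"
    proof (cases "k = {#}")
      case True
      then show ?thesis using nilD(2)[OF G_nil] by (simp add: series_simps)
    next
      case False
      then have "size k = 1" using k(2) by (cases k) auto
      then obtain v where v: "k = {#v#}" using size_1_singleton_mset by blast
      then have "v \<in> W2" using k by simp
      then have "mpow (series_ring R W2) (iso_at W2) k = iso_at W2 v"
        using v iso_at_tri(1)[of v W2] by (simp add: S.mpow_add_mset Pi_def)
      then show ?thesis using fz[OF \<open>v \<in> W2\<close>] Gc by simp
    qed
  qed
  finally have "subst_tail W2 (iso_at W2) G ?m = \<zero>" .
  moreover have "series_subst R W2 W2 G (iso_at W2) ?m = G ?m \<oplus> subst_tail W2 (iso_at W2) G ?m"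
    by (rule series_subst_triangular) (use iso_at_tri Gc in auto)
  ultimately show ?thesis using G_eq L Gc by simp
qed

end
end
end
end


subsection \<open>The integers as initial ring\<close>

lemma cring_int: "cring \<Z>"
  by (rule int_is_cring)

lemma int_hom: "cring S \<Longrightarrow> (\<lambda>n. [n] \<cdot>\<^bsub>S\<^esub> \<one>\<^bsub>S\<^esub>) \<in> ring_hom \<Z> S"
proof -
  assume "cring S"
  then interpret S: cring S .
  show ?thesis
  proof (rule ring_hom_memI)
    fix m n :: int
    have "add_pow S m \<one>\<^bsub>S\<^esub> \<otimes>\<^bsub>S\<^esub> add_pow S n \<one>\<^bsub>S\<^esub> = add_pow S m (add_pow S n \<one>\<^bsub>S\<^esub>)"
      by (simp add: S.add_pow_ldistr_int)
    also have "\<dots> = add_pow S (n * m) \<one>\<^bsub>S\<^esub>" by (rule S.add.int_pow_pow) simp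
    finally show "add_pow S (m \<otimes>\<^bsub>\<Z>\<^esub> n) \<one>\<^bsub>S\<^esub> = add_pow S m \<one>\<^bsub>S\<^esub> \<otimes>\<^bsub>S\<^esub> add_pow S n \<one>\<^bsub>S\<^esub>"
      by (simp add: mult.commute)
    show "add_pow S (m \<oplus>\<^bsub>\<Z>\<^esub> n) \<one>\<^bsub>S\<^esub> = add_pow S m \<one>\<^bsub>S\<^esub> \<oplus>\<^bsub>S\<^esub> add_pow S n \<one>\<^bsub>S\<^esub>"
      by (simp add: S.add.int_pow_mult)
  qed auto
qed

lemma int_hom_eq:
  assumes "cring S" "h \<in> ring_hom \<Z> S"
  shows "h n = [n] \<cdot>\<^bsub>S\<^esub> \<one>\<^bsub>S\<^esub>"
proof -
  interpret S: cring S by fact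
  interpret h: ring_hom_cring \<Z> S h by (rule ring_hom_cring_of[OF cring_int assms])
  have add: "h (a + b) = h a \<oplus>\<^bsub>S\<^esub> h b" for a b using h.hom_add[of a b] by simp
  have hc: "h a \<in> carrier S" for a using h.hom_closed[of a] by simp
  have z: "h 0 = \<zero>\<^bsub>S\<^esub>" and o: "h 1 = \<one>\<^bsub>S\<^esub>" using h.hom_zero h.hom_one by simp_all
  have st: "[(a + 1)] \<cdot>\<^bsub>S\<^esub> \<one>\<^bsub>S\<^esub> = [a] \<cdot>\<^bsub>S\<^esub> \<one>\<^bsub>S\<^esub> \<oplus>\<^bsub>S\<^esub> \<one>\<^bsub>S\<^esub>" for a :: int
    using S.add.int_pow_mult[of "\<one>\<^bsub>S\<^esub>" a 1] by simp
  show ?thesis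
  proof (induction n rule: int_induct[of _ 0])
    case base
    then show ?case by (simp add: z add_pow_def)
  next
    case (step1 i)
    then show ?case by (simp add: st add o)
  next
    case (step2 i)
    have "h (i - 1) \<oplus>\<^bsub>S\<^esub> \<one>\<^bsub>S\<^esub> = [(i - 1)] \<cdot>\<^bsub>S\<^esub> \<one>\<^bsub>S\<^esub> \<oplus>\<^bsub>S\<^esub> \<one>\<^bsub>S\<^esub>"
      using step2 st[of "i - 1"] add[of "i - 1" 1] o by simp
    then show ?case using hc by simp
  qed
qed

lemma int_hom_unique:
  "cring S \<Longrightarrow> h \<in> ring_hom \<Z> S \<Longrightarrow> h' \<in> ring_hom \<Z> S \<Longrightarrow> h n = h' n"
  by (simp add: int_hom_eq)


subsection \<open>The Lazard ring\<close>

lemma cring_lazard_poly: "cring lazard_poly"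
  unfolding lazard_poly_def by (rule cring.cring_mpoly_ring[OF cring_int])

interpretation PP: cring lazard_poly by (rule cring_lazard_poly)

lemma lazard_var_closed: "1 \<le> i \<Longrightarrow> 1 \<le> j \<Longrightarrow> ring.indexed_var \<Z> (i, j) \<in> carrier lazard_poly"
  unfolding lazard_poly_def by (rule cring.indexed_var_mpoly[OF cring_int]) (simp add: lazard_vars_def)

lemma generic_form: "PP.fgl_form generic_series"
proof -
  have "generic_series m \<in> carrier lazard_poly" for m
  proof (cases "set_mset m = {VX, VY}")
    case True
    then have "VX \<in># m" "VY \<in># m" by auto
    then have "1 \<le> count m VX" "1 \<le> count m VY" by (auto simp: Suc_le_eq)
    then show ?thesis using lazard_var_closed by (auto simp: generic_series_def)
  next
    case False
    then show ?thesis by (auto simp: generic_series_def)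
  qed
  moreover have "generic_series m = \<zero>\<^bsub>lazard_poly\<^esub>" if "\<not> set_mset m \<subseteq> {VX, VY}" for m
  proof -
    have "m \<noteq> {#VX#}" "m \<noteq> {#VY#}" "set_mset m \<noteq> {VX, VY}" using that by auto
    then show ?thesis by (simp add: generic_series_def)
  qed
  ultimately show ?thesis
    by (auto simp: PP.fgl_form_def series_carrier_iff generic_series_def)
qed

lemma generic_nil: "generic_series \<in> PP.nil {VX, VY}"
  by (rule PP.fgl_form_nil[OF generic_form])

definition lazard_gens :: "((nat \<times> nat) multiset \<Rightarrow> int) set" where
  "lazard_gens =
    (let P = lazard_poly; F = generic_series; W = {VX, VY, VZ};
         x = ring.indexed_var P VX; y = ring.indexed_var P VY; z = ring.indexed_var P VZ
     in ({subst2 P W F (subst2 P W F x y) z m \<ominus>\<^bsub>P\<^esub> subst2 P W F x (subst2 P W F y z) m | m. True} \<union>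
        {subst2 P W F x y m \<ominus>\<^bsub>P\<^esub> subst2 P W F y x m | m. True}))"

lemma lazard_ideal_eq: "lazard_ideal = Idl\<^bsub>lazard_poly\<^esub> lazard_gens"
  by (simp add: lazard_ideal_def lazard_gens_def Let_def)

lemma subst2_coeff_closed:
  "u \<in> PP.nil W \<Longrightarrow> v \<in> PP.nil W \<Longrightarrow> subst2 lazard_poly W generic_series u v m \<in> carrier lazard_poly"
  using series_coeff_closed[OF PP.nilD(1)[OF PP.subst2_nil[OF generic_nil]]] .

lemma lazard_gens_closed: "lazard_gens \<subseteq> carrier lazard_poly"
  unfolding lazard_gens_def Let_def
  by (auto intro!: PP.minus_closed subst2_coeff_closed PP.subst2_nil[OF generic_nil] PP.var_nil)

lemma cring_L: "cring L"
  unfolding L_def lazard_ideal_eq by (rule PP.quot_Idl_cring[OF lazard_gens_closed])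

interpretation L: cring L by (rule cring_L)

abbreviation lproj where "lproj \<equiv> (+>\<^bsub>lazard_poly\<^esub>) lazard_ideal"

lemma lproj_hom: "lproj \<in> ring_hom lazard_poly L"
  unfolding L_def lazard_ideal_eq by (rule PP.quot_Idl_proj_hom[OF lazard_gens_closed])

lemma universal_eq: "universal_fgl = (\<lambda>m. lproj (generic_series m))"
  by (auto simp: universal_fgl_def)

lemma subst2_natural:
  assumes "cring R" "cring S" and h: "h \<in> ring_hom R S" and F: "F \<in> cring.nil R {VX, VY}"
    and u: "u \<in> cring.nil R W" and v: "v \<in> cring.nil R W"
  shows "(\<lambda>m. h (subst2 R W F u v m)) = subst2 S W (\<lambda>m. h (F m)) (\<lambda>m. h (u m)) (\<lambda>m. h (v m))"
proof
  interpret R: cring R by fact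
  fix m
  have "h (series_subst R {VX, VY} W F (\<lambda>x. if x = VX then u else v) m) =
    series_subst S {VX, VY} W (\<lambda>k. h (F k)) (\<lambda>x k. h ((if x = VX then u else v) k)) m"
    by (rule series_subst_natural[OF assms(1-3)])
      (use series_coeff_closed[OF R.nilD(1)[OF F]] R.nilD[OF u] R.nilD[OF v] in auto)
  moreover have "(\<lambda>x k. h ((if x = VX then u else v) k)) = (\<lambda>x. if x = VX then (\<lambda>m. h (u m)) else (\<lambda>m. h (v m)))"
    by auto
  ultimately show "h (subst2 R W F u v m) = subst2 S W (\<lambda>m. h (F m)) (\<lambda>m. h (u m)) (\<lambda>m. h (v m)) m"
    by (simp add: subst2_def)
qed

lemma subst1_natural:
  assumes "cring R" "cring S" and h: "h \<in> ring_hom R S" and F: "F \<in> cring.nil R {VX}"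
    and u: "u \<in> cring.nil R W"
  shows "(\<lambda>m. h (subst1 R W F u m)) = subst1 S W (\<lambda>m. h (F m)) (\<lambda>m. h (u m))"
proof
  interpret R: cring R by fact
  fix m
  show "h (subst1 R W F u m) = subst1 S W (\<lambda>m. h (F m)) (\<lambda>m. h (u m)) m"
    unfolding subst1_def
    by (rule series_subst_natural[OF assms(1-3)])
      (use series_coeff_closed[OF R.nilD(1)[OF F]] R.nilD[OF u] in auto)
qed

lemma ring_hom_indexed_var:
  assumes "cring R" "cring S" "h \<in> ring_hom R S"
  shows "(\<lambda>m. h (ring.indexed_var R v m)) = ring.indexed_var S v"
proof -
  interpret R: cring R by fact
  interpret S: cring S by fact
  show ?thesis
    using ring_hom_one[OF assms(3)] ring_hom_zero[OF assms(3) R.ring_axioms S.ring_axioms]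
    by (auto simp: R.indexed_var_eq S.indexed_var_eq)
qed

lemma ring_hom_nil:
  assumes "cring R" "cring S" "h \<in> ring_hom R S" "u \<in> cring.nil R W"
  shows "(\<lambda>m. h (u m)) \<in> cring.nil S W"
proof -
  interpret R: cring R by fact
  interpret S: cring S by fact
  show ?thesis
    using ring_hom_closed[OF series_map_hom[OF assms(1-3)] R.nilD(1)[OF assms(4)]] R.nilD(2)[OF assms(4)]
      ring_hom_zero[OF assms(3) R.ring_axioms S.ring_axioms]
    by (simp add: S.nil_def)
qed

lemma ring_hom_fgl_form:
  assumes "cring R" "cring S" "h \<in> ring_hom R S" "cring.fgl_form R F"
  shows "cring.fgl_form S (\<lambda>m. h (F m))"
proof -
  interpret R: cring R by fact
  interpret S: cring S by fact
  show ?thesis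
    using ring_hom_closed[OF series_map_hom[OF assms(1-3)], of F "{VX, VY}"] assms(4)
      ring_hom_zero[OF assms(3) R.ring_axioms S.ring_axioms] ring_hom_one[OF assms(3)]
    by (auto simp: S.fgl_form_def R.fgl_form_def)
qed

text \<open>Each side of associativity and commutativity is mapped separately, without supposing
  that the sides agree. The generic series needs this form, as its laws hold only modulo the
  ideal.\<close>

lemma ring_hom_fgl_laws:
  assumes "cring R" "cring S" and h: "h \<in> ring_hom R S" and F: "F \<in> cring.nil R {VX, VY}"
  shows "(\<lambda>m. h (subst2 R {VX, VY, VZ} F (subst2 R {VX, VY, VZ} F (ring.indexed_var R VX) (ring.indexed_var R VY)) (ring.indexed_var R VZ) m)) =
    subst2 S {VX, VY, VZ} (\<lambda>m. h (F m)) (subst2 S {VX, VY, VZ} (\<lambda>m. h (F m)) (ring.indexed_var S VX) (ring.indexed_var S VY)) (ring.indexed_var S VZ)"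
    "(\<lambda>m. h (subst2 R {VX, VY, VZ} F (ring.indexed_var R VX) (subst2 R {VX, VY, VZ} F (ring.indexed_var R VY) (ring.indexed_var R VZ)) m)) =
    subst2 S {VX, VY, VZ} (\<lambda>m. h (F m)) (ring.indexed_var S VX) (subst2 S {VX, VY, VZ} (\<lambda>m. h (F m)) (ring.indexed_var S VY) (ring.indexed_var S VZ))"
    "\<And>v w. v \<in> {VX, VY, VZ} \<Longrightarrow> w \<in> {VX, VY, VZ} \<Longrightarrow>
      (\<lambda>m. h (subst2 R {VX, VY, VZ} F (ring.indexed_var R v) (ring.indexed_var R w) m)) =
      subst2 S {VX, VY, VZ} (\<lambda>m. h (F m)) (ring.indexed_var S v) (ring.indexed_var S w)"
proof -
  interpret R: cring R by fact
  interpret S: cring S by fact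
  note n = subst2_natural[OF assms(1,2) h F] ring_hom_indexed_var[OF assms(1,2) h] R.subst2_nil[OF F] R.var_nil
  show "(\<lambda>m. h (subst2 R {VX, VY, VZ} F (subst2 R {VX, VY, VZ} F (R.indexed_var VX) (R.indexed_var VY)) (R.indexed_var VZ) m)) =
    subst2 S {VX, VY, VZ} (\<lambda>m. h (F m)) (subst2 S {VX, VY, VZ} (\<lambda>m. h (F m)) (S.indexed_var VX) (S.indexed_var VY)) (S.indexed_var VZ)"
    by (simp add: n)
  show "(\<lambda>m. h (subst2 R {VX, VY, VZ} F (R.indexed_var VX) (subst2 R {VX, VY, VZ} F (R.indexed_var VY) (R.indexed_var VZ)) m)) =
    subst2 S {VX, VY, VZ} (\<lambda>m. h (F m)) (S.indexed_var VX) (subst2 S {VX, VY, VZ} (\<lambda>m. h (F m)) (S.indexed_var VY) (S.indexed_var VZ))"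
    by (simp add: n)
  show "(\<lambda>m. h (subst2 R {VX, VY, VZ} F (R.indexed_var v) (R.indexed_var w) m)) =
      subst2 S {VX, VY, VZ} (\<lambda>m. h (F m)) (S.indexed_var v) (S.indexed_var w)"
    if "v \<in> {VX, VY, VZ}" "w \<in> {VX, VY, VZ}" for v w
    unfolding n(1)[OF R.var_nil[OF that(1)] R.var_nil[OF that(2)]] n(2) ..
qed

lemma lproj_gens: "g \<in> lazard_gens \<Longrightarrow> lproj g = \<zero>\<^bsub>L\<^esub>"
  unfolding L_def lazard_ideal_eq by (rule PP.quot_Idl_relation[OF lazard_gens_closed])

lemma lproj_eqI:
  assumes "a \<ominus>\<^bsub>lazard_poly\<^esub> b \<in> lazard_gens" "a \<in> carrier lazard_poly" "b \<in> carrier lazard_poly"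
  shows "lproj a = lproj b"
proof -
  interpret h: ring_hom_cring lazard_poly L lproj
    by (rule ring_hom_cring_of[OF cring_lazard_poly cring_L lproj_hom])
  have "lproj a \<ominus>\<^bsub>L\<^esub> lproj b = \<zero>\<^bsub>L\<^esub>"
    using lproj_gens[OF assms(1)] assms(2,3) by (simp add: PP.minus_eq L.minus_eq)
  then show ?thesis using assms(2,3) by (simp add: L.r_right_minus_eq)
qed

text \<open>The generators of the ideal are the coefficients of the differences of both sides, so
  the laws hold coefficientwise in the quotient.\<close>

lemma universal_is_fgl: "L.fgl universal_fgl"
proof -
  note n = ring_hom_fgl_laws[OF cring_lazard_poly cring_L lproj_hom generic_nil]
  let ?s = "subst2 lazard_poly {VX, VY, VZ} generic_series"
  have c: "?s (?s (PP.indexed_var VX) (PP.indexed_var VY)) (PP.indexed_var VZ) m \<in> carrier lazard_poly"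
    "?s (PP.indexed_var VX) (?s (PP.indexed_var VY) (PP.indexed_var VZ)) m \<in> carrier lazard_poly"
    "?s (PP.indexed_var VX) (PP.indexed_var VY) m \<in> carrier lazard_poly"
    "?s (PP.indexed_var VY) (PP.indexed_var VX) m \<in> carrier lazard_poly" for m
    by (intro subst2_coeff_closed PP.subst2_nil[OF generic_nil] PP.var_nil; simp)+
  have 1: "(\<lambda>m. lproj (?s (?s (PP.indexed_var VX) (PP.indexed_var VY)) (PP.indexed_var VZ) m)) =
    (\<lambda>m. lproj (?s (PP.indexed_var VX) (?s (PP.indexed_var VY) (PP.indexed_var VZ)) m))"
    by (rule ext, rule lproj_eqI[OF _ c(1,2)]) (auto simp: lazard_gens_def Let_def)
  have 2: "(\<lambda>m. lproj (?s (PP.indexed_var VX) (PP.indexed_var VY) m)) =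
    (\<lambda>m. lproj (?s (PP.indexed_var VY) (PP.indexed_var VX) m))"
    by (rule ext, rule lproj_eqI[OF _ c(3,4)]) (auto simp: lazard_gens_def Let_def)
  have v: "VX \<in> {VX, VY, VZ}" "VY \<in> {VX, VY, VZ}" by auto
  show ?thesis
    unfolding L.fgl_def universal_eq
    by (intro conjI ring_hom_fgl_form[OF cring_lazard_poly cring_L lproj_hom generic_form]
      1[unfolded n(1,2)] 2[unfolded n(3)[OF v(1,2)] n(3)[OF v(2,1)]])
qed

lemma not_single_var:
  assumes "set_mset m = {VX, VY}"
  shows "m \<noteq> {#VX#}" "m \<noteq> {#VY#}"
proof -
  have "VX \<in># m" "VY \<in># m" unfolding assms by simp_all
  then show "m \<noteq> {#VX#}" "m \<noteq> {#VY#}" by (metis set_mset_single singletonD fgl_var.distinct(1))+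
qed

definition xy_mono :: "nat \<Rightarrow> nat \<Rightarrow> fgl_var multiset" where
  "xy_mono i j = replicate_mset i VX + replicate_mset j VY"

lemma xy_mono_eq: "set_mset m = {VX, VY} \<Longrightarrow> xy_mono (count m VX) (count m VY) = m"
  by (rule multiset_eqI) (auto simp: xy_mono_def not_in_iff[symmetric])

lemma generic_xy_mono:
  "1 \<le> i \<Longrightarrow> 1 \<le> j \<Longrightarrow> generic_series (xy_mono i j) = ring.indexed_var \<Z> (i, j)"
proof -
  assume ij: "1 \<le> i" "1 \<le> j"
  then have s: "set_mset (xy_mono i j) = {VX, VY}" by (auto simp: xy_mono_def)
  have "generic_series (xy_mono i j) = ring.indexed_var \<Z> (count (xy_mono i j) VX, count (xy_mono i j) VY)"
    using not_single_var[OF s] s by (simp only: generic_series_def if_False if_True disj_not1 simp_thms)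
  then show ?thesis by (simp add: xy_mono_def)
qed

lemma L_carrierE:
  assumes "x \<in> carrier L"
  obtains p where "p \<in> carrier lazard_poly" "x = lproj p"
  using assms unfolding L_def by (rule quot_carrierE)

text \<open>The Lazard ring is generated by the mixed coefficients of the universal law, and on
  integer constants two homomorphisms agree because the integers are initial.\<close>

lemma L_hom_unique:
  assumes S: "cring S" and h: "h \<in> ring_hom L S" "h' \<in> ring_hom L S"
    and eq: "\<And>m. h (universal_fgl m) = h' (universal_fgl m)" and x: "x \<in> carrier L"
  shows "h x = h' x"
proof -
  obtain p where p: "p \<in> carrier lazard_poly" "x = lproj p"
    by (rule L_carrierE[OF x])
  have H: "h \<circ> lproj \<in> ring_hom lazard_poly S" "h' \<circ> lproj \<in> ring_hom lazard_poly S"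
    using ring_hom_trans[OF lproj_hom h(1)] ring_hom_trans[OF lproj_hom h(2)] .
  have c: "ring.indexed_const \<Z> \<in> ring_hom \<Z> lazard_poly"
    unfolding lazard_poly_def by (rule cring.indexed_const_hom[OF cring_int])
  have "(h \<circ> lproj) p = (h' \<circ> lproj) p"
  proof (rule cring.mpoly_hom_unique[OF cring_int S])
    show "h \<circ> lproj \<in> ring_hom (mpoly_ring \<Z> lazard_vars) S" "h' \<circ> lproj \<in> ring_hom (mpoly_ring \<Z> lazard_vars) S"
      "p \<in> carrier (mpoly_ring \<Z> lazard_vars)"
      using H p by (simp_all add: lazard_poly_def)
    show "(h \<circ> lproj) (ring.indexed_const \<Z> k) = (h' \<circ> lproj) (ring.indexed_const \<Z> k)" for k
      using int_hom_unique[OF S ring_hom_trans[OF c H(1)] ring_hom_trans[OF c H(2)], of k] by simp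
    fix v assume "v \<in> lazard_vars"
    then obtain i j where v: "v = (i, j)" "1 \<le> i" "1 \<le> j" by (auto simp: lazard_vars_def)
    then show "(h \<circ> lproj) (ring.indexed_var \<Z> v) = (h' \<circ> lproj) (ring.indexed_var \<Z> v)"
      using eq[of "xy_mono i j"] generic_xy_mono[OF v(2,3)] by (simp add: universal_eq)
  qed
  then show ?thesis using p by simp
qed

text \<open>The universal property found by Lazard. Sending each variable to the corresponding
  coefficient of \<open>G\<close> maps the generic series to \<open>G\<close>, so the defining
  relations go to the coefficients of the laws of \<open>G\<close>.\<close>

lemma L_hom_ex:
  assumes S: "cring S" and G: "cring.fgl S G"
  shows "\<exists>h. h \<in> ring_hom L S \<and> (\<forall>m. h (universal_fgl m) = G m)"
proof -
  interpret S: cring S by fact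
  let ?\<phi> = "\<lambda>n::int. [n] \<cdot>\<^bsub>S\<^esub> \<one>\<^bsub>S\<^esub>" and ?s = "\<lambda>v. G (xy_mono (fst v) (snd v))"
  have form: "S.fgl_form G" using G unfolding S.fgl_def by blast
  note GA = conjunct1[OF conjunct2[OF G[unfolded S.fgl_def]]]
    and GC = conjunct2[OF conjunct2[OF G[unfolded S.fgl_def]]]
  have Gc: "G m \<in> carrier S" for m
    using series_coeff_closed[OF S.nilD(1)[OF S.fgl_form_nil[OF form]]] .
  have s: "?s \<in> lazard_vars \<rightarrow> carrier S" using Gc by auto
  define e where "e = mpoly_eval \<Z> S ?\<phi> ?s"
  have e: "e \<in> ring_hom lazard_poly S"
    unfolding e_def lazard_poly_def by (rule cring.mpoly_eval_hom[OF cring_int S int_hom[OF S] s])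
  interpret e: ring_hom_cring lazard_poly S e by (rule ring_hom_cring_of[OF cring_lazard_poly S e])
  have ev: "e (ring.indexed_var \<Z> v) = ?s v" if "v \<in> lazard_vars" for v
    unfolding e_def by (rule cring.mpoly_eval_var[OF cring_int S int_hom[OF S] s that])
  \<comment> \<open>For mixed monomials this is the choice of the evaluation; at all others both
    series have the coefficients that \<open>fgl_form\<close> prescribes.\<close>
  have eg: "e (generic_series m) = G m" for m
  proof (cases "set_mset m = {VX, VY}")
    case True
    then have "generic_series m = ring.indexed_var \<Z> (count m VX, count m VY)"
      using not_single_var[OF True] by (simp only: generic_series_def if_False if_True simp_thms)
    moreover have "VX \<in># m" "VY \<in># m" unfolding True by simp_all
    then have "(count m VX, count m VY) \<in> lazard_vars"
      by (simp add: lazard_vars_def Suc_le_eq)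
    ultimately show ?thesis using ev[of "(count m VX, count m VY)"] xy_mono_eq[OF True] by simp
  next
    case False
    then show ?thesis using form by (auto simp: generic_series_def S.fgl_form_def)
  qed
  then have geq: "(\<lambda>m. e (generic_series m)) = G" by auto
  note n = ring_hom_fgl_laws[OF cring_lazard_poly S e generic_nil, unfolded geq]
  have em: "e (a \<ominus>\<^bsub>lazard_poly\<^esub> b) = e a \<ominus>\<^bsub>S\<^esub> e b" if "a \<in> carrier lazard_poly" "b \<in> carrier lazard_poly" for a b
    using that by (simp add: PP.minus_eq S.minus_eq)
  let ?t = "subst2 lazard_poly {VX, VY, VZ} generic_series"
  have c: "?t (?t (PP.indexed_var VX) (PP.indexed_var VY)) (PP.indexed_var VZ) m \<in> carrier lazard_poly"
    "?t (PP.indexed_var VX) (?t (PP.indexed_var VY) (PP.indexed_var VZ)) m \<in> carrier lazard_poly"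
    "?t (PP.indexed_var VX) (PP.indexed_var VY) m \<in> carrier lazard_poly"
    "?t (PP.indexed_var VY) (PP.indexed_var VX) m \<in> carrier lazard_poly" for m
    by (intro subst2_coeff_closed PP.subst2_nil[OF generic_nil] PP.var_nil; simp)+
  have a: "e (?t (?t (PP.indexed_var VX) (PP.indexed_var VY)) (PP.indexed_var VZ) m) =
    e (?t (PP.indexed_var VX) (?t (PP.indexed_var VY) (PP.indexed_var VZ)) m)" for m
    by (rule fun_cong[OF trans[OF n(1) trans[OF GA n(2)[symmetric]]]])
  have v: "VX \<in> {VX, VY, VZ}" "VY \<in> {VX, VY, VZ}" by auto
  have co: "e (?t (PP.indexed_var VX) (PP.indexed_var VY) m) = e (?t (PP.indexed_var VY) (PP.indexed_var VX) m)" for m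
    by (rule fun_cong[OF trans[OF n(3)[OF v(1,2)] trans[OF GC n(3)[OF v(2,1), symmetric]]]])
  have "e g = \<zero>\<^bsub>S\<^esub>" if g: "g \<in> lazard_gens" for g
  proof -
    consider m where "g = ?t (?t (PP.indexed_var VX) (PP.indexed_var VY)) (PP.indexed_var VZ) m \<ominus>\<^bsub>lazard_poly\<^esub>
        ?t (PP.indexed_var VX) (?t (PP.indexed_var VY) (PP.indexed_var VZ)) m"
      | m where "g = ?t (PP.indexed_var VX) (PP.indexed_var VY) m \<ominus>\<^bsub>lazard_poly\<^esub>
        ?t (PP.indexed_var VY) (PP.indexed_var VX) m"
      using g by (auto simp: lazard_gens_def Let_def)
    then show ?thesis
    proof cases
      case (1 m)
      then show ?thesis using em[OF c(1,2)] a[of m] e.hom_closed[OF c(2)] by (simp add: S.minus_eq S.r_neg)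
    next
      case (2 m)
      then show ?thesis using em[OF c(3,4)] co[of m] e.hom_closed[OF c(4)] by (simp add: S.minus_eq S.r_neg)
    qed
  qed
  from PP.quot_Idl_hom_ex[OF lazard_gens_closed S e this]
  obtain h where h: "h \<in> ring_hom L S" "\<And>p. p \<in> carrier lazard_poly \<Longrightarrow> h (lproj p) = e p"
    unfolding L_def lazard_ideal_eq by blast
  have "generic_series m \<in> carrier lazard_poly" for m
    using series_coeff_closed[OF PP.nilD(1)[OF generic_nil]] .
  then show ?thesis using h eg by (intro exI[of _ h]) (simp add: universal_eq)
qed


subsection \<open>The Hopf algebroid of formal group laws\<close>

lemma ring_hom_fgl:
  assumes "cring R" "cring S" and h: "h \<in> ring_hom R S" and F: "cring.fgl R F"
  shows "cring.fgl S (\<lambda>m. h (F m))"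
proof -
  interpret R: cring R by fact
  interpret S: cring S by fact
  note Fd = F[unfolded R.fgl_def]
  note form = conjunct1[OF Fd] and A = conjunct1[OF conjunct2[OF Fd]] and C = conjunct2[OF conjunct2[OF Fd]]
  note n = ring_hom_fgl_laws[OF assms(1,2) h R.fgl_form_nil[OF form]]
  have v: "VX \<in> {VX, VY, VZ}" "VY \<in> {VX, VY, VZ}" by auto
  note A' = trans[OF n(1)[symmetric] trans[OF arg_cong[OF A, of "\<lambda>p m. h (p m)"] n(2)]]
  note C' = trans[OF n(3)[OF v(1,2), symmetric] trans[OF arg_cong[OF C, of "\<lambda>p m. h (p m)"] n(3)[OF v(2,1)]]]
  show ?thesis
    unfolding S.fgl_def
    by (rule conjI[OF ring_hom_fgl_form[OF assms(1,2) h form] conjI[OF A' C']])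
qed

lemma (in cring) nil_mono: "U \<subseteq> W \<Longrightarrow> u \<in> nil U \<Longrightarrow> u \<in> nil W"
  unfolding nil_def series_carrier_iff mem_Collect_eq by blast

text \<open>The quadratic coefficient of a composite of two series starting with X is the sum of
  their quadratic coefficients. Applied to the composite of two universal isomorphisms it makes
  \<open>LB_t 1\<close> primitive.\<close>

lemma (in cring) subst1_XX:
  assumes f: "f \<in> nil {VX}" and u: "u \<in> nil {VX}" "u {#VX#} = \<one>"  and f1: "f {#VX#} = \<one>"
  shows "subst1 R {VX} f u {#VX, VX#} = u {#VX, VX#} \<oplus> f {#VX, VX#}"
proof -
  interpret S: cring "series_ring R {VX}" by (rule cring_series_ring)
  let ?m = "{#VX, VX#}"
  note fc = series_coeff_closed[OF nilD(1)[OF f]] and uc = series_coeff_closed[OF nilD(1)[OF u(1)]]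
  have tri: "u \<in> carrier (series_ring R {VX})" "u {#} = \<zero>" "\<And>v w. v \<in> {VX} \<Longrightarrow> w \<in> {VX} \<Longrightarrow> u {#w#} = (if v = w then \<one> else \<zero>)"
    using nilD[OF u(1)] u(2) by auto
  let ?K = "{k. set_mset k \<subseteq> {VX} \<and> size k < size ?m}"
  have K: "finite ?K" by (rule finite_subset[OF _ finite_bounded_multisets[of "{VX}" 2]]) auto
  have one: "mpow (series_ring R {VX}) (\<lambda>_. u) {#VX#} = u"
    using tri(1) by (simp add: S.mpow_add_mset Pi_def)
  have "subst_tail {VX} (\<lambda>_. u) f ?m = (\<Oplus>k\<in>?K. f k \<otimes> mpow (series_ring R {VX}) (\<lambda>_. u) k ?m)"
    by (rule subst_tail_def) (use tri in auto)
  also have "\<dots> = f {#VX#} \<otimes> mpow (series_ring R {VX}) (\<lambda>_. u) {#VX#} ?m"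
  proof (rule finsum_eq_single[OF K])
    fix k assume k: "k \<in> ?K" "k \<noteq> {#VX#}"
    have "k = {#}"
    proof (rule ccontr)
      assume "k \<noteq> {#}"
      then have "size k = 1" using k(1) by (cases k) auto
      then obtain v where "k = {#v#}" using size_1_singleton_mset by blast
      then show False using k by auto
    qed
    then show "f k \<otimes> mpow (series_ring R {VX}) (\<lambda>_. u) k ?m = \<zero>"
      using nilD(2)[OF f] by (simp add: series_simps)
  qed (use fc uc one in auto)
  also have "\<dots> = u ?m" using one f1 uc by simp
  finally have t: "subst_tail {VX} (\<lambda>_. u) f ?m = u ?m" .
  have "subst1 R {VX} f u ?m = f ?m \<oplus> subst_tail {VX} (\<lambda>_. u) f ?m"
    unfolding subst1_def by (rule series_subst_triangular) (use tri fc in auto)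
  then show ?thesis using t fc uc by (simp add: a_comm)
qed

interpretation L: cring L by (rule cring_L)

lemma cring_LB: "cring LB"
  unfolding LB_def by (rule L.cring_mpoly_ring)

interpretation B: cring LB by (rule cring_LB)

lemma LB_etaL_hom: "LB_etaL \<in> ring_hom L LB"
  unfolding LB_def using L.indexed_const_hom by (simp add: LB_etaL_def[abs_def])

lemma LB_t_closed [simp]: "1 \<le> i \<Longrightarrow> LB_t i \<in> carrier LB"
  unfolding LB_def LB_t_def by (rule L.indexed_var_mpoly) simp

lemma universal_iso_one: "universal_iso {#VX#} = \<one>\<^bsub>LB\<^esub>"
  by (simp add: universal_iso_def)

lemma universal_iso_t:
  assumes "1 \<le> i"
  shows "universal_iso (replicate_mset (Suc i) VX) = LB_t i"
proof -
  have "size (replicate_mset (Suc i) VX) \<noteq> size {#VX#}" using assms by simp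
  then have "replicate_mset (Suc i) VX \<noteq> {#VX#}" by metis
  then show ?thesis by (simp add: universal_iso_def)
qed

lemma universal_iso_cases:
  obtains "m = {#VX#}" | i where "1 \<le> i" "m = replicate_mset (Suc i) VX" | "set_mset m \<noteq> {VX}"
proof (cases "set_mset m = {VX}")
  case True
  then have "set_mset m \<subseteq> {VX}" by (rule equalityD1)
  then have m: "m = replicate_mset (size m) VX" by (rule set_mset_subset_singletonD)
  have "m \<noteq> {#}"
  proof
    assume "m = {#}"
    with True show False by simp
  qed
  then have "size m \<noteq> 0" unfolding size_eq_0_iff_empty .
  then have "\<exists>i. size m = Suc i" by (rule not0_implies_Suc)
  then obtain i where i: "size m = Suc i" by (elim exE)
  show ?thesis
  proof (cases "i = 0")
    case True
    then show ?thesis by (intro that(1)) (use m[unfolded i] in simp)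
  next
    case False
    then show ?thesis by (intro that(2)[of i]) (use m[unfolded i] in simp_all)
  qed
next
  case False
  then show ?thesis by (rule that(3))
qed

lemma universal_iso_zero: "set_mset m \<noteq> {VX} \<Longrightarrow> universal_iso m = \<zero>\<^bsub>LB\<^esub>"
proof -
  assume m: "set_mset m \<noteq> {VX}"
  have "m \<noteq> {#VX#}"
  proof
    assume "m = {#VX#}"
    with m show False by simp
  qed
  then show ?thesis using m by (simp only: universal_iso_def if_False)
qed

lemma universal_iso_nil: "universal_iso \<in> B.nil {VX}"
proof -
  have "universal_iso m \<in> carrier LB" for m
  proof (rule universal_iso_cases[of m])
    fix i assume i: "1 \<le> i" "m = replicate_mset (Suc i) VX"
    show ?thesis unfolding i(2) universal_iso_t[OF i(1)] by (rule LB_t_closed[OF i(1)])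
  next
    assume "m = {#VX#}"
    then show ?thesis by (simp only: universal_iso_one B.one_closed)
  next
    assume m: "set_mset m \<noteq> {VX}"
    show ?thesis unfolding universal_iso_zero[OF m] by (rule B.zero_closed)
  qed
  moreover have "universal_iso m = \<zero>\<^bsub>LB\<^esub>" if m: "\<not> set_mset m \<subseteq> {VX}" for m
  proof (rule universal_iso_zero, rule notI)
    assume "set_mset m = {VX}"
    with m show False by (simp only: order_refl not_True_eq_False)
  qed
  moreover have "universal_iso {#} = \<zero>\<^bsub>LB\<^esub>"
    by (rule universal_iso_zero) (simp only: set_mset_empty insert_not_empty[symmetric], simp)
  ultimately show ?thesis
    unfolding B.nil_def series_carrier_iff mem_Collect_eq by blast
qed

abbreviation lfgl where "lfgl \<equiv> \<lambda>m. LB_etaL (universal_fgl m)"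

lemma lfgl_fgl: "B.fgl lfgl"
  by (rule ring_hom_fgl[OF cring_L cring_LB LB_etaL_hom universal_is_fgl])

lemma universal_form: "L.fgl_form universal_fgl"
  using universal_is_fgl unfolding L.fgl_def by blast

lemma universal_nil: "universal_fgl \<in> L.nil {VX, VY}"
  by (rule L.fgl_form_nil[OF universal_form])

lemma universal_closed [simp]: "universal_fgl m \<in> carrier L"
  by (rule series_coeff_closed[OF L.nilD(1)[OF universal_nil]])

lemmas transp = B.transports_def[OF universal_iso_nil universal_iso_one lfgl_fgl]

text \<open>The target of the universal isomorphism is a formal group law over \<open>LB\<close>, so
  the universal property of \<open>L\<close> classifies it. Uniqueness of the transported law is
  what makes the definite description meaningful.\<close>

lemma LB_etaR_facts:
  shows LB_etaR_hom: "LB_etaR \<in> ring_hom L LB"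
    and LB_etaR_transports: "B.transports universal_iso lfgl (\<lambda>m. LB_etaR (universal_fgl m))"
proof -
  note fF = universal_iso_nil universal_iso_one lfgl_fgl
  obtain G where G: "B.transports universal_iso lfgl G" using B.transports_ex[OF fF] by blast
  obtain h0 where h0: "h0 \<in> ring_hom L LB" "\<And>m. h0 (universal_fgl m) = G m"
    using L_hom_ex[OF cring_LB B.transports_fgl[OF fF G]] by blast
  let ?P = "\<lambda>h. subst1 LB {VX, VY} universal_iso lfgl =
    subst2 LB {VX, VY} (\<lambda>m. h (universal_fgl m)) universal_iso (subst1 LB {VX, VY} universal_iso (ring.indexed_var LB VY))"
  have ser: "(\<lambda>m. h (universal_fgl m)) \<in> carrier (series_ring LB {VX, VY})" if "h \<in> ring_hom L LB" for h
    using ring_hom_closed[OF series_map_hom[OF cring_L cring_LB that] L.nilD(1)[OF universal_nil]] .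
  have tr: "B.transports universal_iso lfgl (\<lambda>m. h (universal_fgl m)) \<longleftrightarrow> ?P h" if "h \<in> ring_hom L LB" for h
    unfolding transp using ser[OF that] by blast
  have eqG: "(\<lambda>m. h0 (universal_fgl m)) = G" using h0(2) by auto
  have "?P h0" by (rule iffD1[OF tr[OF h0(1)] G[folded eqG]])
  then have P: "?P (restrict h0 (carrier L))" by simp
  have u: "h x = h0 x" if h: "h \<in> ring_hom L LB" and Ph: "?P h" and x: "x \<in> carrier L" for h x
  proof (rule L_hom_unique[OF cring_LB h h0(1) _ x])
    have "B.transports universal_iso lfgl (\<lambda>m. h (universal_fgl m))" using Ph tr[OF h] by blast
    from B.transports_unique[OF fF this G] have "(\<lambda>m. h (universal_fgl m)) = G" .
    then show "h (universal_fgl m) = h0 (universal_fgl m)" for m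
      using h0(2) by (metis (no_types))
  qed
  have E: "LB_etaR = the_hom L LB ?P" by (simp add: LB_etaR_def Let_def)
  have 1: "the_hom L LB ?P \<in> ring_hom L LB"
    by (rule the_homI(1)[of L h0 LB ?P, OF L.ring_axioms h0(1) P]) (rule u)
  have 2: "?P (the_hom L LB ?P)"
    by (rule the_homI(2)[of L h0 LB ?P, OF L.ring_axioms h0(1) P]) (rule u)
  show "LB_etaR \<in> ring_hom L LB" unfolding E by (rule 1)
  then show "B.transports universal_iso lfgl (\<lambda>m. LB_etaR (universal_fgl m))"
    using tr[of LB_etaR] 2[folded E] by blast
qed

lemma LB_etaR_XY:
  "LB_etaR (universal_fgl {#VX, VY#}) = LB_etaL (universal_fgl {#VX, VY#}) \<oplus>\<^bsub>LB\<^esub> (LB_t 1 \<oplus>\<^bsub>LB\<^esub> LB_t 1)"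
proof -
  have "replicate_mset (Suc 1) VX = {#VX, VX#}" by simp
  then have "universal_iso {#VX, VX#} = LB_t 1" using universal_iso_t[of 1] by simp
  then show ?thesis
    using B.transports_XY[OF universal_iso_nil universal_iso_one lfgl_fgl LB_etaR_transports] by simp
qed

text \<open>Sending every t_i to zero turns the universal isomorphism into the identity series. The
  transport equation then says that \<open>e\<close> maps the target law to the universal one, so
  \<open>e\<close> retracts the right unit as well.\<close>

lemma LB_counit_ex:
  "\<exists>e. e \<in> ring_hom LB L \<and> (\<forall>x\<in>carrier L. e (LB_etaL x) = x \<and> e (LB_etaR x) = x)"
proof -
  define e where "e = mpoly_eval L L id (\<lambda>_::nat. \<zero>\<^bsub>L\<^esub>)"
  have z: "(\<lambda>_. \<zero>\<^bsub>L\<^esub>) \<in> {1::nat..} \<rightarrow> carrier L" by simp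
  have e: "e \<in> ring_hom LB L"
    unfolding e_def LB_def by (rule L.mpoly_eval_hom[OF cring_L id_ring_hom z])
  have el: "e (LB_etaL x) = x" if "x \<in> carrier L" for x
    using L.mpoly_eval_const[OF cring_L id_ring_hom z that] by (simp add: e_def LB_etaL_def)
  have et: "e (LB_t i) = \<zero>\<^bsub>L\<^esub>" if "1 \<le> i" for i
    using L.mpoly_eval_var[OF cring_L id_ring_hom z, of i] that by (simp add: e_def LB_t_def)
  have ef: "(\<lambda>m. e (universal_iso m)) = L.indexed_var VX"
  proof
    fix m
    show "e (universal_iso m) = L.indexed_var VX m"
    proof (rule universal_iso_cases[of m])
      assume "m = {#VX#}"
      then show ?thesis using ring_hom_one[OF e] by (simp add: universal_iso_one L.indexed_var_eq)
    next
      fix i assume i: "1 \<le> i" "m = replicate_mset (Suc i) VX"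
      then have "size m \<noteq> size {#VX#}" by simp
      then have "m \<noteq> {#VX#}" by metis
      then show ?thesis using i universal_iso_t[OF i(1)] et[OF i(1)] by (simp add: L.indexed_var_eq)
    next
      assume m: "set_mset m \<noteq> {VX}"
      have "m \<noteq> {#VX#}"
      proof
        assume "m = {#VX#}"
        with m show False by simp
      qed
      then show ?thesis unfolding universal_iso_zero[OF m] ring_hom_zero[OF e B.ring_axioms L.ring_axioms]
        by (simp only: L.indexed_var_eq if_False)
    qed
  qed
  let ?W = "{VX, VY}" and ?G = "\<lambda>m. LB_etaR (universal_fgl m)"
  have eF: "(\<lambda>m. e (lfgl m)) = universal_fgl" using el by auto
  have eq: "subst1 LB ?W universal_iso lfgl = subst2 LB ?W ?G universal_iso (subst1 LB ?W universal_iso (B.indexed_var VY))"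
    using LB_etaR_transports unfolding transp by blast
  have Fn: "lfgl \<in> B.nil ?W"
    by (rule ring_hom_nil[OF cring_L cring_LB LB_etaL_hom universal_nil])
  have Gn: "?G \<in> B.nil ?W"
    by (rule ring_hom_nil[OF cring_L cring_LB LB_etaR_hom universal_nil])
  have fn: "universal_iso \<in> B.nil ?W" by (rule B.nil_mono[OF _ universal_iso_nil]) auto
  have yn: "B.indexed_var VY \<in> B.nil ?W" by (rule B.var_nil) simp
  have x1: "subst1 L ?W (L.indexed_var VX) u = u" if "u \<in> L.nil ?W" for u
    unfolding subst1_def by (rule L.series_subst_var) (use L.nilD[OF that] in auto)
  have "universal_fgl = subst1 L ?W (L.indexed_var VX) universal_fgl"
    by (rule x1[OF universal_nil, symmetric])
  also have "\<dots> = (\<lambda>m. e (subst1 LB ?W universal_iso lfgl m))"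
    unfolding subst1_natural[OF cring_LB cring_L e universal_iso_nil Fn] ef eF ..
  also have "\<dots> = subst2 L ?W (\<lambda>m. e (?G m)) (L.indexed_var VX)
      (\<lambda>m. e (subst1 LB ?W universal_iso (B.indexed_var VY) m))"
    unfolding eq subst2_natural[OF cring_LB cring_L e Gn fn B.subst1_nil[OF universal_iso_nil yn]] ef ..
  also have "(\<lambda>m. e (subst1 LB ?W universal_iso (B.indexed_var VY) m)) = L.indexed_var VY"
    unfolding subst1_natural[OF cring_LB cring_L e universal_iso_nil yn] ef ring_hom_indexed_var[OF cring_LB cring_L e]
    by (rule x1[OF L.var_nil]) simp
  also have "subst2 L ?W (\<lambda>m. e (?G m)) (L.indexed_var VX) (L.indexed_var VY) = (\<lambda>m. e (?G m))"
    by (rule L.subst2_self[OF ring_hom_nil[OF cring_LB cring_L e Gn]])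
  finally have eG: "e (LB_etaR (universal_fgl m)) = universal_fgl m" for m by metis
  have "(e \<circ> LB_etaR) x = id x" if "x \<in> carrier L" for x
    by (rule L_hom_unique[OF cring_L ring_hom_trans[OF LB_etaR_hom e] id_ring_hom _ that]) (simp add: eG)
  then show ?thesis using e el by auto
qed

lemma tensor_LB: "tensor L LB LB_etaR LB LB_etaL"
  by (rule tensor.intro[OF cring_L cring_LB cring_LB LB_etaR_hom LB_etaL_hom])

interpretation T: tensor L LB LB_etaR LB LB_etaL by (rule tensor_LB)

text \<open>As \<open>LB\<close> is a polynomial ring over \<open>L\<close>, a homomorphism is
  determined by its values on \<open>L\<close> and on the t_i. The values on the t_i are read off
  the composite series \<open>k\<close>; that \<open>k\<close> starts with X and involves only
  powers of X makes the equation hold at the remaining monomials too.\<close>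

lemma LB_comult_facts:
  shows LB_comult_hom: "LB_comult \<in> ring_hom LB T.T"
    and LB_comult_etaL: "\<And>x. x \<in> carrier L \<Longrightarrow> LB_comult (LB_etaL x) = T.pure (LB_etaL x) \<one>\<^bsub>LB\<^esub>"
    and LB_comult_t1: "LB_comult (LB_t 1) = T.pure (LB_t 1) \<one>\<^bsub>LB\<^esub> \<oplus>\<^bsub>T.T\<^esub> T.pure \<one>\<^bsub>LB\<^esub> (LB_t 1)"
proof -
  note TT = T.T.cring_axioms
  let ?fr = "\<lambda>m. T.pure \<one>\<^bsub>LB\<^esub> (universal_iso m)" and ?fl = "\<lambda>m. T.pure (universal_iso m) \<one>\<^bsub>LB\<^esub>"
  have fr: "?fr \<in> T.T.nil {VX}" by (rule ring_hom_nil[OF cring_LB TT T.pure_right_hom universal_iso_nil])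
  have fl: "?fl \<in> T.T.nil {VX}" by (rule ring_hom_nil[OF cring_LB TT T.pure_left_hom universal_iso_nil])
  have fr1: "?fr {#VX#} = \<one>\<^bsub>T.T\<^esub>" and fl1: "?fl {#VX#} = \<one>\<^bsub>T.T\<^esub>"
    by (simp_all add: universal_iso_one T.pure_one)
  define k where "k = subst1 T.T {VX} ?fr ?fl"
  have kn: "k \<in> T.T.nil {VX}" unfolding k_def by (rule T.T.subst1_nil[OF fr fl])
  have k1: "k {#VX#} = \<one>\<^bsub>T.T\<^esub>" unfolding k_def T.T.subst1_linear[OF fr fr1 fl] by (rule fl1)
  have kc: "k m \<in> carrier T.T" for m by (rule series_coeff_closed[OF T.T.nilD(1)[OF kn]])
  let ?\<phi> = "(\<lambda>x. T.pure x \<one>\<^bsub>LB\<^esub>) \<circ> LB_etaL" and ?s = "\<lambda>i. k (replicate_mset (Suc i) VX)"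
  have \<phi>: "?\<phi> \<in> ring_hom L T.T" by (rule ring_hom_trans[OF LB_etaL_hom T.pure_left_hom])
  have s: "?s \<in> {1..} \<rightarrow> carrier T.T" using kc by auto
  define h0 where "h0 = mpoly_eval L T.T ?\<phi> ?s"
  have h0: "h0 \<in> ring_hom LB T.T" unfolding h0_def by (rule L.mpoly_eval_hom[OF TT \<phi> s, folded LB_def])
  have hl: "h0 (LB_etaL x) = T.pure (LB_etaL x) \<one>\<^bsub>LB\<^esub>" if "x \<in> carrier L" for x
    using L.mpoly_eval_const[OF TT \<phi> s that] by (simp add: h0_def LB_etaL_def)
  have ht: "h0 (LB_t i) = ?s i" if "1 \<le> i" for i
    using L.mpoly_eval_var[OF TT \<phi> s, of i] that by (simp add: h0_def LB_t_def)
  let ?P = "\<lambda>h. (\<forall>x\<in>carrier L. h (LB_etaL x) = T.pure (LB_etaL x) \<one>\<^bsub>LB\<^esub>) \<and> (\<lambda>m. h (universal_iso m)) = k"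
  have hf: "h0 (universal_iso m) = k m" for m
  proof (rule universal_iso_cases[of m])
    assume "m = {#VX#}"
    then show ?thesis using ring_hom_one[OF h0] k1 by (simp add: universal_iso_one)
  next
    fix i assume i: "1 \<le> i" "m = replicate_mset (Suc i) VX"
    show ?thesis unfolding i(2) universal_iso_t[OF i(1)] by (rule ht[OF i(1)])
  next
    assume m: "set_mset m \<noteq> {VX}"
    have "universal_iso m = \<zero>\<^bsub>LB\<^esub>" by (rule universal_iso_zero[OF m])
    moreover have "m = {#} \<or> \<not> set_mset m \<subseteq> {VX}"
      using m unfolding subset_singleton_iff set_mset_eq_empty_iff by blast
    then have "k m = \<zero>\<^bsub>T.T\<^esub>"
      using T.T.nilD(2)[OF kn] series_coeff_outside[OF T.T.nilD(1)[OF kn]] by blast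
    ultimately show ?thesis using ring_hom_zero[OF h0 B.ring_axioms T.T.ring_axioms] by simp
  qed
  have uc: "universal_iso m \<in> carrier LB" for m by (rule series_coeff_closed[OF B.nilD(1)[OF universal_iso_nil]])
  have el: "LB_etaL x \<in> carrier LB" if "x \<in> carrier L" for x by (rule ring_hom_closed[OF LB_etaL_hom that])
  have P: "?P (restrict h0 (carrier LB))"
    using hl by (auto simp: uc el hf simp del: LB_t_closed)
  have u: "h x = h0 x" if h: "h \<in> ring_hom LB T.T" and Ph: "?P h" and x: "x \<in> carrier LB" for h x
  proof (rule L.mpoly_hom_unique[OF TT, of h "{1..}" h0 x, folded LB_def, OF h h0 _ _ x])
    show "h (L.indexed_const c) = h0 (L.indexed_const c)" if "c \<in> carrier L" for c
      using Ph hl[OF that] that by (simp add: LB_etaL_def)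
    fix i :: nat assume i: "i \<in> {1..}"
    have "h (universal_iso (replicate_mset (Suc i) VX)) = k (replicate_mset (Suc i) VX)"
      using Ph by (metis (no_types))
    then show "h (L.indexed_var i) = h0 (L.indexed_var i)"
      using i universal_iso_t[of i] ht[of i] by (simp add: LB_t_def)
  qed
  have E: "LB_comult = the_hom LB T.T ?P" by (simp add: LB_comult_def Let_def k_def)
  have 1: "the_hom LB T.T ?P \<in> ring_hom LB T.T"
    by (rule the_homI(1)[of LB h0 T.T ?P, OF B.ring_axioms h0 P]) (rule u)
  have 2: "?P (the_hom LB T.T ?P)"
    by (rule the_homI(2)[of LB h0 T.T ?P, OF B.ring_axioms h0 P]) (rule u)
  show "LB_comult \<in> ring_hom LB T.T" unfolding E by (rule 1)
  show "LB_comult (LB_etaL x) = T.pure (LB_etaL x) \<one>\<^bsub>LB\<^esub>" if "x \<in> carrier L" for x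
    using 2[folded E] that by blast
  have XX: "replicate_mset (Suc 1) VX = {#VX, VX#}" by simp
  then have t: "universal_iso {#VX, VX#} = LB_t 1" using universal_iso_t[of 1] by simp
  have "LB_comult (LB_t 1) = k {#VX, VX#}" using 2[folded E] t by metis
  also have "\<dots> = T.pure (LB_t 1) \<one>\<^bsub>LB\<^esub> \<oplus>\<^bsub>T.T\<^esub> T.pure \<one>\<^bsub>LB\<^esub> (LB_t 1)"
    unfolding k_def T.T.subst1_XX[OF fr fl fl1 fr1] t ..
  finally show "LB_comult (LB_t 1) = T.pure (LB_t 1) \<one>\<^bsub>LB\<^esub> \<oplus>\<^bsub>T.T\<^esub> T.pure \<one>\<^bsub>LB\<^esub> (LB_t 1)" .
qed

section \<open>The Lazard ring and its strict isomorphisms in degrees 0 and 2\<close>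

lemma zero_int_ring: "\<zero>\<^bsub>\<Z>\<^esub> = 0"
  by simp

lemma L_scal_hom: "L_scal \<in> ring_hom \<Z> L"
  using int_hom[OF cring_L] by (simp add: L_scal_def[abs_def])

text \<open>All variables have weight at least 2, which leaves the empty monomial in degree 0 and at
  most one variable in degree 2.\<close>

lemma weight_ge:
  fixes w :: "'v \<Rightarrow> nat"
  shows "(\<And>v. v \<in># m \<Longrightarrow> 2 \<le> w v) \<Longrightarrow> 2 * size m \<le> (\<Sum>v\<in>#m. w v)"
proof (induction m)
  case (add v m)
  have "2 * size m \<le> (\<Sum>v\<in>#m. w v)" "2 \<le> w v" using add by auto
  then show ?case by simp
qed simp

abbreviation lazard_weight :: "nat \<times> nat \<Rightarrow> nat" where "lazard_weight \<equiv> \<lambda>(i, j). 2 * (i + j - 1)"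

lemma lazard_weight_ge: "set_mset m \<subseteq> lazard_vars \<Longrightarrow> 2 * size m \<le> (\<Sum>v\<in>#m. lazard_weight v)"
proof (rule weight_ge)
  fix v assume "set_mset m \<subseteq> lazard_vars" "v \<in># m"
  then have "v \<in> lazard_vars" by blast
  then show "2 \<le> lazard_weight v" by (auto simp: lazard_vars_def)
qed

lemma lproj_const: "lproj (ring.indexed_const \<Z> k) = L_scal k"
proof -
  have "ring.indexed_const \<Z> \<in> ring_hom \<Z> lazard_poly"
    unfolding lazard_poly_def by (rule cring.indexed_const_hom[OF cring_int])
  from int_hom_unique[OF cring_L ring_hom_trans[OF this lproj_hom] L_scal_hom, of k] show ?thesis by simp
qed

lemma L_grading_zero: "L_grading 0 = range L_scal"
proof (intro equalityI subsetI)
  fix x assume "x \<in> L_grading 0"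
  then obtain p where p: "p \<in> mpoly_grading \<Z> (trivial_grading \<Z>) lazard_vars lazard_weight 0" "x = lproj p"
    by (auto simp: L_grading_def)
  then have ps: "p \<in> carrier (series_ring \<Z> lazard_vars)"
    by (auto simp: mpoly_grading_def intro: cring.mpoly_series[OF cring_int])
  have "p m = 0" if "m \<noteq> {#}" for m
  proof (cases "set_mset m \<subseteq> lazard_vars")
    case True
    then have "2 * size m \<le> (\<Sum>v\<in>#m. lazard_weight v)" by (rule lazard_weight_ge)
    moreover have "size m > 0" using that by (simp add: nonempty_has_size)
    ultimately have "\<not> (\<Sum>v\<in>#m. lazard_weight v) \<le> 0" by linarith
    then show ?thesis using p(1) by (auto simp: mpoly_grading_def)
  next
    case False
    then show ?thesis using series_coeff_outside[OF ps] by simp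
  qed
  then have "p = ring.indexed_const \<Z> (p {#})"
    by (auto simp: ring.indexed_const_def[OF cring.axioms(1)[OF cring_int]])
  then show "x \<in> range L_scal" using p(2) lproj_const by (metis rangeI)
next
  fix x assume "x \<in> range L_scal"
  then obtain k where k: "x = L_scal k" by blast
  have "ring.indexed_const \<Z> k \<in> mpoly_grading \<Z> (trivial_grading \<Z>) lazard_vars lazard_weight 0"
    using cring.indexed_const_mpoly[OF cring_int, of k lazard_vars]
    by (auto simp: mpoly_grading_def trivial_grading_def ring.indexed_const_def[OF cring.axioms(1)[OF cring_int]])
  then show "x \<in> L_grading 0" unfolding L_grading_def k lproj_const[symmetric] by (rule imageI)
qed

abbreviation a11 where "a11 \<equiv> universal_fgl {#VX, VY#}"

lemma a11_eq: "a11 = lproj (ring.indexed_var \<Z> (1, 1))"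
proof -
  have "xy_mono 1 1 = {#VX, VY#}" by (simp add: xy_mono_def)
  then show ?thesis using generic_xy_mono[of 1 1] by (simp add: universal_eq)
qed

text \<open>The weight 2(i + j - 1) equals 2 only for the variable with both indices equal to one,
  and a nonzero constant does not have degree 2.\<close>

lemma L_grading_two: "L_grading 2 = {L_scal k \<otimes>\<^bsub>L\<^esub> a11 | k. True}"
proof -
  have mono: "lproj (\<lambda>m. if m = {#(1, 1)#} then k else 0) = L_scal k \<otimes>\<^bsub>L\<^esub> a11" for k
  proof -
    have v: "(1, 1) \<in> lazard_vars" by (simp add: lazard_vars_def)
    have "(\<lambda>m. if m = {#(1, 1)#} then k else 0) =
      ring.indexed_const \<Z> k \<otimes>\<^bsub>lazard_poly\<^esub> ring.indexed_var \<Z> (1, 1)"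
      unfolding lazard_poly_def mpoly_ring_ops
      using cring.indexed_const_mult[OF cring_int, of k "ring.indexed_var \<Z> (1, 1)" lazard_vars]
        cring.indexed_var_series[OF cring_int v]
      by (auto simp: cring.indexed_var_eq[OF cring_int])
    moreover have "ring.indexed_const \<Z> k \<in> carrier lazard_poly" "ring.indexed_var \<Z> (1, 1) \<in> carrier lazard_poly"
      unfolding lazard_poly_def
      by (rule cring.indexed_const_mpoly[OF cring_int], simp, rule cring.indexed_var_mpoly[OF cring_int v])
    ultimately show ?thesis
      using ring_hom_mult[OF lproj_hom] by (simp only: lproj_const a11_eq)
  qed
  show ?thesis
  proof (intro equalityI subsetI)
    fix x assume "x \<in> L_grading 2"
    then obtain p where p: "p \<in> mpoly_grading \<Z> (trivial_grading \<Z>) lazard_vars lazard_weight 2" "x = lproj p"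
      by (auto simp: L_grading_def)
    then have ps: "p \<in> carrier (series_ring \<Z> lazard_vars)"
      by (auto simp: mpoly_grading_def intro: cring.mpoly_series[OF cring_int])
    have g: "if (\<Sum>v\<in>#m. lazard_weight v) \<le> 2 then p m \<in> trivial_grading \<Z> (2 - (\<Sum>v\<in>#m. lazard_weight v)) else p m = 0" for m
      using p(1) by (auto simp: mpoly_grading_def)
    have "p m = 0" if m: "m \<noteq> {#(1, 1)#}" for m
    proof (cases "set_mset m \<subseteq> lazard_vars")
      case True
      have ge: "2 * size m \<le> (\<Sum>v\<in>#m. lazard_weight v)" by (rule lazard_weight_ge[OF True])
      consider "m = {#}" | v where "m = {#v#}" | "size m > 1"
        by (metis One_nat_def less_one linorder_neqE_nat size_1_singleton_mset size_eq_0_iff_empty)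
      then show ?thesis
      proof cases
        case 1
        then show ?thesis using g[of m] by (simp add: trivial_grading_def)
      next
        case (2 v)
        obtain i j where v: "v = (i, j)" by (cases v)
        have ij: "1 \<le> i" "1 \<le> j" using True 2 v by (auto simp: lazard_vars_def)
        moreover have "(i, j) \<noteq> (1, 1)" using m 2 v by auto
        ultimately have "\<not> (\<Sum>v\<in>#m. lazard_weight v) \<le> 2" using 2 v by auto
        then show ?thesis using g[of m] by simp
      next
        case 3
        then have "\<not> (\<Sum>v\<in>#m. lazard_weight v) \<le> 2" using ge by linarith
        then show ?thesis using g[of m] by simp
      qed
    next
      case False
      then show ?thesis using series_coeff_outside[OF ps] by simp
    qed
    then have "p = (\<lambda>m. if m = {#(1, 1)#} then p {#(1, 1)#} else 0)" by (intro ext) simp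
    then have "x = lproj (\<lambda>m. if m = {#(1, 1)#} then p {#(1, 1)#} else 0)" using p(2) by (rule back_subst[of "\<lambda>q. x = lproj q", rotated])
    then show "x \<in> {L_scal k \<otimes>\<^bsub>L\<^esub> a11 | k. True}" unfolding mono by blast
  next
    fix x assume "x \<in> {L_scal k \<otimes>\<^bsub>L\<^esub> a11 | k. True}"
    then obtain k where k: "x = L_scal k \<otimes>\<^bsub>L\<^esub> a11" by blast
    have "(\<lambda>m. if m = {#(1, 1)#} then k else 0) \<in> mpoly_grading \<Z> (trivial_grading \<Z>) lazard_vars lazard_weight 2"
      using cring.monomial_mpoly[OF cring_int, of k "{#(1, 1)#}" lazard_vars, unfolded zero_int_ring]
      by (auto simp: mpoly_grading_def trivial_grading_def lazard_vars_def)
    then show "x \<in> L_grading 2" unfolding L_grading_def k mono[symmetric] by (rule imageI)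
  qed
qed

lemma L_scal_closed [simp]: "L_scal k \<in> carrier L"
  using ring_hom_closed[OF L_scal_hom, of k] by simp

lemma L_grading_two_closed: "u \<in> L_grading 2 \<Longrightarrow> u \<in> carrier L"
  unfolding L_grading_two by auto

text \<open>Only t_1 has weight 2 among the t_i. Its coefficient has degree 0, hence is an integer,
  and the constant term has degree 2.\<close>

lemma LB_grading_two: "mpoly_grading L L_grading {1..} (\<lambda>i. 2 * i) 2 =
  {LB_etaL u \<oplus>\<^bsub>LB\<^esub> LB_etaL (L_scal r) \<otimes>\<^bsub>LB\<^esub> LB_t 1 | u r. u \<in> L_grading 2 \<and> r \<in> carrier \<Z>}"
proof -
  have co: "(LB_etaL u \<oplus>\<^bsub>LB\<^esub> LB_etaL x \<otimes>\<^bsub>LB\<^esub> LB_t 1) =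
      (\<lambda>m. if m = {#} then u else if m = {#1#} then x else \<zero>\<^bsub>L\<^esub>)"
    if "u \<in> carrier L" "x \<in> carrier L" for u x
  proof -
    have v: "L.indexed_var (1::nat) \<in> carrier (series_ring L {1..})" by (rule L.indexed_var_series) simp
    have "L.indexed_const x \<otimes>\<^bsub>series_ring L {1::nat..}\<^esub> L.indexed_var 1 = (\<lambda>m. x \<otimes>\<^bsub>L\<^esub> L.indexed_var 1 m)"
      by (rule L.indexed_const_mult[OF that(2) v])
    then show ?thesis
      unfolding LB_def mpoly_ring_ops LB_etaL_def LB_t_def using that
      by (auto simp: series_simps fun_eq_iff L.indexed_const_def L.indexed_var_eq)
  qed
  have w: "2 * size m \<le> (\<Sum>i\<in>#m. 2 * i)" if "set_mset m \<subseteq> {1..}" for m :: "nat multiset"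
    by (rule weight_ge) (use that in auto)
  show ?thesis
  proof (intro equalityI subsetI)
    fix p assume p: "p \<in> mpoly_grading L L_grading {1..} (\<lambda>i. 2 * i) 2"
    then have ps: "p \<in> carrier (series_ring L {1..})"
      by (auto simp: mpoly_grading_def intro: L.mpoly_series)
    have g: "if (\<Sum>i\<in>#m. 2 * i) \<le> 2 then p m \<in> L_grading (2 - (\<Sum>i\<in>#m. 2 * i)) else p m = \<zero>\<^bsub>L\<^esub>" for m
      using p by (auto simp: mpoly_grading_def)
    have u: "p {#} \<in> L_grading 2" using g[of "{#}"] by simp
    have "p {#1#} \<in> L_grading 0" using g[of "{#1#}"] by simp
    then obtain r where r: "p {#1#} = L_scal r" unfolding L_grading_zero by blast
    have z: "p m = \<zero>\<^bsub>L\<^esub>" if m: "m \<noteq> {#}" "m \<noteq> {#1#}" for m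
    proof (cases "set_mset m \<subseteq> {1..}")
      case True
      consider v where "m = {#v#}" | "size m > 1"
        using m by (metis One_nat_def less_one linorder_neqE_nat size_1_singleton_mset size_eq_0_iff_empty)
      then have "\<not> (\<Sum>i\<in>#m. 2 * i) \<le> 2"
      proof cases
        case (1 v)
        then have "v \<ge> 1" "v \<noteq> 1" using True m by auto
        then show ?thesis using 1 by simp
      next
        case 2
        then show ?thesis using w[OF True] by linarith
      qed
      then show ?thesis using g[of m] by simp
    next
      case False
      then show ?thesis using series_coeff_outside[OF ps] by simp
    qed
    have "p = (\<lambda>m. if m = {#} then p {#} else if m = {#1#} then L_scal r else \<zero>\<^bsub>L\<^esub>)"
      by (intro ext) (simp add: z r[simplified])
    then have "p = LB_etaL (p {#}) \<oplus>\<^bsub>LB\<^esub> LB_etaL (L_scal r) \<otimes>\<^bsub>LB\<^esub> LB_t 1"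
      unfolding co[OF L_grading_two_closed[OF u] L_scal_closed] .
    then show "p \<in> {LB_etaL u \<oplus>\<^bsub>LB\<^esub> LB_etaL (L_scal r) \<otimes>\<^bsub>LB\<^esub> LB_t 1 | u r. u \<in> L_grading 2 \<and> r \<in> carrier \<Z>}"
      using u by auto
  next
    fix p assume "p \<in> {LB_etaL u \<oplus>\<^bsub>LB\<^esub> LB_etaL (L_scal r) \<otimes>\<^bsub>LB\<^esub> LB_t 1 | u r. u \<in> L_grading 2 \<and> r \<in> carrier \<Z>}"
    then obtain u r where ur: "u \<in> L_grading 2" "p = LB_etaL u \<oplus>\<^bsub>LB\<^esub> LB_etaL (L_scal r) \<otimes>\<^bsub>LB\<^esub> LB_t 1"
      by blast
    have "p \<in> carrier LB"
      unfolding ur(2) using L_grading_two_closed[OF ur(1)]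
      by (intro B.a_closed B.m_closed ring_hom_closed[OF LB_etaL_hom]) simp_all
    moreover have "p = (\<lambda>m. if m = {#} then u else if m = {#1#} then L_scal r else \<zero>\<^bsub>L\<^esub>)"
      unfolding ur(2) by (rule co[OF L_grading_two_closed[OF ur(1)] L_scal_closed])
    moreover have "L_scal r \<in> L_grading 0" unfolding L_grading_zero by simp
    moreover have "\<zero>\<^bsub>L\<^esub> \<in> L_grading n" for n
    proof -
      \<comment> \<open>The graded pieces are images of polynomials, so that each contains zero has
        to be shown; the vanishing coefficients need it.\<close>
      have z: "(\<lambda>m. 0) \<in> mpoly_grading \<Z> (trivial_grading \<Z>) lazard_vars lazard_weight n"
        using cring.monomial_mpoly[OF cring_int, of 0 "{#}" lazard_vars, unfolded zero_int_ring]
        by (auto simp: mpoly_grading_def trivial_grading_def)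
      have "lproj (\<lambda>m. 0) = \<zero>\<^bsub>L\<^esub>"
        using ring_hom_zero[OF lproj_hom cring.axioms(1)[OF cring_lazard_poly] L.ring_axioms]
        by (simp add: lazard_poly_def mpoly_ring_ops series_simps)
      then show ?thesis using z unfolding L_grading_def by (metis imageI)
    qed
    ultimately show "p \<in> mpoly_grading L L_grading {1..} (\<lambda>i. 2 * i) 2"
      using ur(1) by (auto simp: mpoly_grading_def LB_def)
  qed
qed

lemma M_fgl_simps:
  "base M_fgl = \<Z>" "obj M_fgl = L" "mor M_fgl = LB" "scal M_fgl = L_scal" "etaL M_fgl = LB_etaL"
  "etaR M_fgl = LB_etaR" "comult M_fgl = LB_comult" "obj_grading M_fgl = L_grading"
  "mor_grading M_fgl = mpoly_grading L L_grading {1..} (\<lambda>i. 2 * i)"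
  by (simp_all add: M_fgl_def)

lemma cotor1_fgl: "\<exists>e. cotor1 M_fgl (LB_t 1) 2 e"
proof -
  obtain e where e: "e \<in> ring_hom LB L" "\<forall>x\<in>carrier L. e (LB_etaL x) = x \<and> e (LB_etaR x) = x"
    using LB_counit_ex by (elim exE conjE)
  have sc: "LB_etaR (L_scal r) = LB_etaL (L_scal r)" for r
    using int_hom_unique[OF cring_LB ring_hom_trans[OF L_scal_hom LB_etaR_hom] ring_hom_trans[OF L_scal_hom LB_etaL_hom], of r]
    by simp
  have sadd: "L_scal (a + b) = L_scal a \<oplus>\<^bsub>L\<^esub> L_scal b" and smult: "L_scal (a * b) = L_scal a \<otimes>\<^bsub>L\<^esub> L_scal b" for a b
    using ring_hom_add[OF L_scal_hom, of a b] ring_hom_mult[OF L_scal_hom, of a b] by simp_all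
  have s0: "L_scal 0 = \<zero>\<^bsub>L\<^esub>"
    using ring_hom_zero[OF L_scal_hom cring.axioms(1)[OF cring_int] L.ring_axioms] by simp
  have g0: "\<zero>\<^bsub>L\<^esub> \<in> L_grading 2"
    unfolding L_grading_two
    by (rule CollectI, rule exI[of _ 0]) (simp add: s0)
  have ga: "u \<oplus>\<^bsub>L\<^esub> v \<in> L_grading 2" if uv: "u \<in> L_grading 2" "v \<in> L_grading 2" for u v
  proof -
    obtain a b where "u = L_scal a \<otimes>\<^bsub>L\<^esub> a11" "v = L_scal b \<otimes>\<^bsub>L\<^esub> a11"
      using uv unfolding L_grading_two by blast
    then have "u \<oplus>\<^bsub>L\<^esub> v = L_scal (a + b) \<otimes>\<^bsub>L\<^esub> a11" by (simp add: sadd L.l_distr)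
    then show ?thesis unfolding L_grading_two by blast
  qed
  have gs: "L_scal r \<otimes>\<^bsub>L\<^esub> u \<in> L_grading 2" if u: "u \<in> L_grading 2" for r u
  proof -
    obtain a where "u = L_scal a \<otimes>\<^bsub>L\<^esub> a11" using u unfolding L_grading_two by blast
    then have "L_scal r \<otimes>\<^bsub>L\<^esub> u = L_scal (r * a) \<otimes>\<^bsub>L\<^esub> a11" by (simp add: smult L.m_assoc)
    then show ?thesis unfolding L_grading_two by blast
  qed
  have "cotor1 M_fgl (LB_t 1) 2 e"
    unfolding cotor1_def mor_tensor_def mor_pure_tensor_def M_fgl_simps
    apply (intro conjI allI impI)
    apply (rule cring_int)
    apply (rule cring_L)
    apply (rule cring_LB)
    apply (rule LB_etaL_hom)
    apply (rule LB_etaR_hom)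
    apply (rule L_scal_hom)
    apply (rule sc)
    apply (rule e(1))
    apply (use e(2) in blast)
    apply (use e(2) in blast)
    apply (rule LB_comult_hom)
    apply (erule LB_comult_etaL)
    apply (rule LB_t_closed, simp)
    apply (rule LB_comult_t1)
    apply (rule LB_grading_two)
    apply (rule subsetI, erule L_grading_two_closed)
    apply (rule g0)
    apply (erule (1) ga)
    apply (erule gs)
    done
  then show ?thesis by blast
qed


subsection \<open>Maps out of the 2-buds over the integers\<close>

interpretation Z: bud_ring \<Z> by (rule bud_ring.intro[OF cring_int])

text \<open>The relation for a sum with second term one reads c_(n+1) = c_n + n \<gamma>, because
  c_1 vanishes. The factor is thus the binomial coefficient of n over 2, also for negative
  n.\<close>

lemma buds_c_int: "buds_c \<Z> n = buds_scal \<Z> (n * (n - 1) div 2) \<otimes>\<^bsub>L_buds \<Z>\<^esub> buds_gamma \<Z>"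
proof -
  interpret S: cring "L_buds \<Z>" by (rule Z.L_cring)
  let ?s = "buds_scal \<Z>" and ?c = "buds_c \<Z>" and ?g = "buds_gamma \<Z>"
  have cl [simp]: "?s a \<in> carrier (L_buds \<Z>)" "?c a \<in> carrier (L_buds \<Z>)" for a by simp_all
  have s1: "?s 1 = \<one>\<^bsub>L_buds \<Z>\<^esub>" using ring_hom_one[OF Z.scal_hom] by simp
  have s0: "?s 0 = \<zero>\<^bsub>L_buds \<Z>\<^esub>"
    using ring_hom_zero[OF Z.scal_hom cring.axioms(1)[OF cring_int] S.ring_axioms] by simp
  have sadd: "?s (a + b) = ?s a \<oplus>\<^bsub>L_buds \<Z>\<^esub> ?s b" for a b using ring_hom_add[OF Z.scal_hom, of a b] by simp
  \<comment> \<open>The multiplicative relation at one and the additive relation at zero make c_1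
    and c_0 equal to their own doubles.\<close>
  have idem: "x = \<zero>\<^bsub>L_buds \<Z>\<^esub>" if "x \<in> carrier (L_buds \<Z>)" "x = x \<oplus>\<^bsub>L_buds \<Z>\<^esub> x" for x
    using that S.add.r_cancel_one' by metis
  have c1: "?c 1 = \<zero>\<^bsub>L_buds \<Z>\<^esub>"
    by (rule idem) (use Z.buds_relations(3)[of 1 1] s1 in simp_all)
  have c0: "?c 0 = \<zero>\<^bsub>L_buds \<Z>\<^esub>"
    by (rule idem) (use Z.buds_relations(2)[of 0 0] s0 in simp_all)
  have step: "?c (a + 1) = ?c a \<oplus>\<^bsub>L_buds \<Z>\<^esub> ?s a \<otimes>\<^bsub>L_buds \<Z>\<^esub> ?g" for a
    using Z.buds_relations(2)[of a 1] c1 by simp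
  have T: "(a + 1) * (a + 1 - 1) div 2 = a * (a - 1) div 2 + a" for a :: int
  proof -
    have "(a + 1) * (a + 1 - 1) = a * (a - 1) + a * 2" by (simp add: algebra_simps)
    then show ?thesis by simp
  qed
  have Ts: "?s ((a + 1) * (a + 1 - 1) div 2) \<otimes>\<^bsub>L_buds \<Z>\<^esub> ?g =
      ?s (a * (a - 1) div 2) \<otimes>\<^bsub>L_buds \<Z>\<^esub> ?g \<oplus>\<^bsub>L_buds \<Z>\<^esub> ?s a \<otimes>\<^bsub>L_buds \<Z>\<^esub> ?g" for a
    unfolding T sadd by (rule S.l_distr) simp_all
  show ?thesis
  proof (induction n rule: int_induct[where k = 0])
    case base
    then show ?case by (simp add: c0 s0)
  next
    case (step1 i)
    then show ?case unfolding step Ts by simp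
  next
    \<comment> \<open>Downwards the recursion is read backwards: the common summand from the step
      between \<open>i - 1\<close> and \<open>i\<close> is cancelled.\<close>
    case (step2 i)
    have "i = i - 1 + 1" by simp
    then have "?c i = ?c (i - 1) \<oplus>\<^bsub>L_buds \<Z>\<^esub> ?s (i - 1) \<otimes>\<^bsub>L_buds \<Z>\<^esub> ?g"
      "?s (i * (i - 1) div 2) \<otimes>\<^bsub>L_buds \<Z>\<^esub> ?g = ?s ((i - 1) * (i - 1 - 1) div 2) \<otimes>\<^bsub>L_buds \<Z>\<^esub> ?g
        \<oplus>\<^bsub>L_buds \<Z>\<^esub> ?s (i - 1) \<otimes>\<^bsub>L_buds \<Z>\<^esub> ?g"
      using step[of "i - 1"] Ts[of "i - 1"] by (simp_all only:)
    with step2.IH have "?c (i - 1) \<oplus>\<^bsub>L_buds \<Z>\<^esub> ?s (i - 1) \<otimes>\<^bsub>L_buds \<Z>\<^esub> ?g =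
      ?s ((i - 1) * (i - 1 - 1) div 2) \<otimes>\<^bsub>L_buds \<Z>\<^esub> ?g \<oplus>\<^bsub>L_buds \<Z>\<^esub> ?s (i - 1) \<otimes>\<^bsub>L_buds \<Z>\<^esub> ?g"
      by (simp only:)
    then show ?case
      by (rule iffD1[OF S.add.right_cancel, rotated 3]) (rule S.m_closed cl Z.gamma_closed)+
  qed
qed

text \<open>Serves both comparison maps. For any value \<open>g\<close> of \<gamma> the multiples of
  \<open>g\<close> by binomial coefficients satisfy the relations, which gives existence; uniqueness
  holds because \<open>buds_c_int\<close> forces these values.\<close>

lemma int_buds_the_hom:
  fixes S :: "('b, 'm) ring_scheme"
  assumes S: "cring S" and g: "g \<in> carrier S" and \<tau>: "\<tau> \<in> carrier S"
  defines "h \<equiv> the_hom (LB_buds \<Z>) S (\<lambda>h. h (buds_etaL \<Z> (buds_gamma \<Z>)) = g \<and> h (buds_t \<Z>) = \<tau>)"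
  shows "h \<in> ring_hom (LB_buds \<Z>) S" "h (buds_t \<Z>) = \<tau>"
proof -
  interpret S: cring S by fact
  interpret BZ: cring "LB_buds \<Z>" by (rule Z.LB_cring)
  define T where "T = (\<lambda>n::int. n * (n - 1) div 2)"
  let ?\<phi> = "\<lambda>n::int. [n] \<cdot>\<^bsub>S\<^esub> \<one>\<^bsub>S\<^esub>"
  note \<phi> = int_hom[OF S]
  \<comment> \<open>Division by two is exact here. The identities for \<open>T\<close> are therefore
    proved after doubling, where they are polynomial identities.\<close>
  have T2: "T n + T n = n * n - n" for n
  proof -
    have "even (n * (n - 1))" by simp
    then have "2 * T n = n * (n - 1)" unfolding T_def by (rule dvd_mult_div_cancel)
    then show ?thesis by (simp add: algebra_simps)
  qed
  have Tadd: "T (a + b) = T a + T b + a * b" for a b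
  proof -
    have "2 * T (a + b) = 2 * (T a + T b + a * b)"
      using T2[of "a + b"] T2[of a] T2[of b] by (simp add: algebra_simps)
    then show ?thesis by simp
  qed
  have Tmult: "a * T b + b * b * T a = T (a * b)" for a b
  proof -
    have "2 * (a * T b + b * b * T a) = a * (T b + T b) + b * b * (T a + T a)"
      by (simp add: algebra_simps)
    also have "\<dots> = 2 * T (a * b)" unfolding T2 using T2[of "a * b"] by (simp add: algebra_simps)
    finally show ?thesis by simp
  qed
  have \<phi>c: "?\<phi> n \<in> carrier S" for n by simp
  have \<phi>a: "?\<phi> (a + b) = ?\<phi> a \<oplus>\<^bsub>S\<^esub> ?\<phi> b" and \<phi>m: "?\<phi> (a * b) = ?\<phi> a \<otimes>\<^bsub>S\<^esub> ?\<phi> b" for a b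
    using ring_hom_add[OF \<phi>, of a b] ring_hom_mult[OF \<phi>, of a b] by simp_all
  define C where "C = (\<lambda>n. ?\<phi> (T n) \<otimes>\<^bsub>S\<^esub> g)"
  obtain h1 where h1: "h1 \<in> ring_hom (L_buds \<Z>) S" "h1 (buds_gamma \<Z>) = g"
  proof (rule Z.L_buds_hom_ex[OF S \<phi> g, of C])
    fix a b :: int
    show "C a \<in> carrier S" unfolding C_def by (rule S.m_closed[OF \<phi>c g])
    show "?\<phi> (a * a - a) \<otimes>\<^bsub>S\<^esub> g = C a \<oplus>\<^bsub>S\<^esub> C a"
      unfolding T2[symmetric] \<phi>a C_def by (rule S.l_distr[OF \<phi>c \<phi>c g])
    show "C (a + b) = C a \<oplus>\<^bsub>S\<^esub> C b \<oplus>\<^bsub>S\<^esub> ?\<phi> (a * b) \<otimes>\<^bsub>S\<^esub> g"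
      unfolding C_def Tadd \<phi>a using \<phi>c g by (simp add: S.l_distr)
    have "?\<phi> a \<otimes>\<^bsub>S\<^esub> C b \<oplus>\<^bsub>S\<^esub> ?\<phi> (b * b) \<otimes>\<^bsub>S\<^esub> C a = ?\<phi> (a * T b + b * b * T a) \<otimes>\<^bsub>S\<^esub> g"
      unfolding C_def \<phi>a \<phi>m[of a "T b"] \<phi>m[of "b * b" "T a"] using \<phi>c g by (simp add: S.l_distr S.m_assoc)
    then show "?\<phi> a \<otimes>\<^bsub>S\<^esub> C b \<oplus>\<^bsub>S\<^esub> ?\<phi> (b * b) \<otimes>\<^bsub>S\<^esub> C a = C (a * b)"
      unfolding Tmult by (simp add: C_def)
  next
    fix h assume "h \<in> ring_hom (L_buds \<Z>) S" "h (buds_gamma \<Z>) = g"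
    then show thesis by (rule that)
  qed
  obtain h0 where h0: "h0 \<in> ring_hom (LB_buds \<Z>) S" "\<And>x. x \<in> carrier (L_buds \<Z>) \<Longrightarrow> h0 (buds_etaL \<Z> x) = h1 x"
    "h0 (buds_t \<Z>) = \<tau>"
    using Z.LB_buds_hom_ex[OF S h1(1) \<tau>] by blast
  let ?P = "\<lambda>h. h (buds_etaL \<Z> (buds_gamma \<Z>)) = g \<and> h (buds_t \<Z>) = \<tau>"
  have P0: "?P h0" using h0 h1(2) by simp
  then have P: "?P (restrict h0 (carrier (LB_buds \<Z>)))" by simp
  have u: "k x = h0 x" if k: "k \<in> ring_hom (LB_buds \<Z>) S" "?P k" and x: "x \<in> carrier (LB_buds \<Z>)" for k x
  proof (rule Z.LB_buds_hom_unique[OF S k(1) h0(1) _ _ x])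
    show "k (buds_t \<Z>) = h0 (buds_t \<Z>)" using k(2) P0 by simp
    fix y assume y: "y \<in> carrier (L_buds \<Z>)"
    have kL: "k \<circ> buds_etaL \<Z> \<in> ring_hom (L_buds \<Z>) S" and hL: "h0 \<circ> buds_etaL \<Z> \<in> ring_hom (L_buds \<Z>) S"
      by (rule ring_hom_trans[OF Z.etaL_hom k(1)], rule ring_hom_trans[OF Z.etaL_hom h0(1)])
    have sc: "(k \<circ> buds_etaL \<Z>) (buds_scal \<Z> n) = (h0 \<circ> buds_etaL \<Z>) (buds_scal \<Z> n)" for n
      using int_hom_unique[OF S ring_hom_trans[OF Z.scal_hom kL] ring_hom_trans[OF Z.scal_hom hL], of n]
      by (simp only: comp_apply)
    have ga: "(k \<circ> buds_etaL \<Z>) (buds_gamma \<Z>) = (h0 \<circ> buds_etaL \<Z>) (buds_gamma \<Z>)"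
      using k(2) P0 by simp
    have "(k \<circ> buds_etaL \<Z>) y = (h0 \<circ> buds_etaL \<Z>) y"
    proof (rule Z.L_buds_hom_unique[OF S kL hL sc ga _ y])
      fix n :: int
      have "buds_scal \<Z> n \<in> carrier (L_buds \<Z>)" for n by simp
      then show "(k \<circ> buds_etaL \<Z>) (buds_c \<Z> n) = (h0 \<circ> buds_etaL \<Z>) (buds_c \<Z> n)"
        unfolding buds_c_int using ring_hom_mult[OF kL _ Z.gamma_closed] ring_hom_mult[OF hL _ Z.gamma_closed]
        by (simp only: sc ga)
    qed
    then show "k (buds_etaL \<Z> y) = h0 (buds_etaL \<Z> y)" by simp
  qed
  show "h \<in> ring_hom (LB_buds \<Z>) S" unfolding h_def
    by (rule the_homI(1)[of _ h0 S ?P, OF BZ.ring_axioms h0(1) P]) (rule u)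
  have "?P h" unfolding h_def
    by (rule the_homI(2)[of _ h0 S ?P, OF BZ.ring_axioms h0(1) P]) (rule u)
  then show "h (buds_t \<Z>) = \<tau>" ..
qed

lemma universal_iso_XX: "universal_iso {#VX, VX#} = LB_t 1"
proof -
  have "replicate_mset (Suc 1) VX = {#VX, VX#}" by simp
  then show ?thesis using universal_iso_t[of 1] by simp
qed

lemma fgl_underlying_bud:
  "fgl_underlying_bud \<in> ring_hom (LB_buds \<Z>) LB" "fgl_underlying_bud (buds_t \<Z>) = LB_t 1"
  unfolding fgl_underlying_bud_def universal_iso_XX
  by (rule int_buds_the_hom[OF cring_LB ring_hom_closed[OF LB_etaL_hom universal_closed] LB_t_closed[OF order_refl]])+

lemma buds_forget:
  assumes "cring A"
  shows "buds_forget A \<in> ring_hom (LB_buds \<Z>) (LB_buds A)" "buds_forget A (buds_t \<Z>) = buds_t A"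
proof -
  interpret bud_ring A by (rule bud_ring.intro[OF assms])
  show "buds_forget A \<in> ring_hom (LB_buds \<Z>) (LB_buds A)" "buds_forget A (buds_t \<Z>) = buds_t A"
    unfolding buds_forget_def
    by (rule int_buds_the_hom[OF LB_cring ring_hom_closed[OF etaL_hom gamma_closed] tt_closed])+
qed


subsection \<open>Induced maps on cohomology\<close>

context cotor1
begin

lemma d0_eqI:
  assumes "u \<in> carrier (obj H)" "b \<in> carrier (mor H)" "etaR H u = etaL H u \<oplus>\<^bsub>mor H\<^esub> b"
  shows "cobar_d0 H u = b"
proof -
  have *: "(x \<oplus>\<^bsub>mor H\<^esub> b) \<ominus>\<^bsub>mor H\<^esub> x = b" if "x \<in> carrier (mor H)" for x
    using that assms(2) by algebra
  show ?thesis unfolding cobar_d0_def assms(3) by (rule *[OF etaL_closed[OF assms(1)]])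
qed

lemma int_s:
  fixes k :: int
  shows "s ([k] \<cdot>\<^bsub>base H\<^esub> \<one>\<^bsub>base H\<^esub>) = [k] \<cdot>\<^bsub>mor H\<^esub> \<one>\<^bsub>mor H\<^esub>"
  using int_hom_eq[OF mor ring_hom_trans[OF int_hom[OF base] ring_hom_trans[OF scal etaL]], of k]
  by (simp only: comp_apply)

lemma int_B1:
  fixes k :: int
  assumes "b \<in> cobar_B1 H d"
  shows "([k] \<cdot>\<^bsub>mor H\<^esub> \<one>\<^bsub>mor H\<^esub>) \<otimes>\<^bsub>mor H\<^esub> b \<in> cobar_B1 H d"
  unfolding int_s[symmetric] by (rule B1_smult[OF _ assms]) simp

lemma coset_add_B1:
  assumes "b \<in> cobar_B1 H d" "x \<in> carrier (mor H)"
  shows "coset (b \<oplus>\<^bsub>mor H\<^esub> x) = coset x"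
proof -
  have "b \<oplus>\<^bsub>mor H\<^esub> x \<in> coset x" using assms(1) by (auto simp: a_r_coset_def')
  from M.a_repr_independence[OF this assms(2) additive_subgroup.a_subgroup[OF B1_additive]] show ?thesis by (rule sym)
qed

text \<open>An even multiple of \<open>\<tau>\<close> is an integer multiple of the coboundary
  \<open>\<tau> \<oplus> \<tau>\<close>, and an odd one differs from \<open>\<tau>\<close> by such a
  multiple. Only integer multiples are treated, as these are the ones that arise from 2-buds over
  the integers.\<close>

lemma coset_parity:
  fixes r :: int
  assumes two: "\<tau> \<oplus>\<^bsub>mor H\<^esub> \<tau> \<in> cobar_B1 H d"
  shows "coset (([r] \<cdot>\<^bsub>mor H\<^esub> \<one>\<^bsub>mor H\<^esub>) \<otimes>\<^bsub>mor H\<^esub> \<tau>) = (if even r then cobar_B1 H d else coset \<tau>)"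
proof -
  let ?i = "\<lambda>k::int. [k] \<cdot>\<^bsub>mor H\<^esub> \<one>\<^bsub>mor H\<^esub>"
  have ic: "?i k \<in> carrier (mor H)" for k by simp
  have ia: "?i (a + b) = ?i a \<oplus>\<^bsub>mor H\<^esub> ?i b" for a b
    using ring_hom_add[OF int_hom[OF mor], of a b] by simp
  have i1: "?i 1 = \<one>\<^bsub>mor H\<^esub>" using ring_hom_one[OF int_hom[OF mor]] by simp
  have dbl: "?i (k + k) \<otimes>\<^bsub>mor H\<^esub> \<tau> \<in> cobar_B1 H d" for k
  proof -
    have "?i (k + k) \<otimes>\<^bsub>mor H\<^esub> \<tau> = ?i k \<otimes>\<^bsub>mor H\<^esub> (\<tau> \<oplus>\<^bsub>mor H\<^esub> \<tau>)"
      unfolding ia M.l_distr[OF ic ic tau] M.r_distr[OF tau tau ic] ..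
    then show ?thesis using int_B1[OF two, of k] by simp
  qed
  show ?thesis
  proof (cases "even r")
    case True
    then obtain k where r: "r = k + k" by (auto elim: evenE)
    have "coset (?i r \<otimes>\<^bsub>mor H\<^esub> \<tau>) = cobar_B1 H d"
      unfolding r by (rule B.a_rcos_const[OF dbl])
    then show ?thesis using True by simp
  next
    case False
    then obtain k where "r = 2 * k + 1" by (auto elim: oddE)
    then have r: "r = k + k + 1" by simp
    have "?i r \<otimes>\<^bsub>mor H\<^esub> \<tau> = ?i (k + k) \<otimes>\<^bsub>mor H\<^esub> \<tau> \<oplus>\<^bsub>mor H\<^esub> \<tau>"
      unfolding r ia[of "k + k"] i1 M.l_distr[OF ic M.one_closed tau] M.l_one[OF tau] ..
    then have "coset (?i r \<otimes>\<^bsub>mor H\<^esub> \<tau>) = coset \<tau>" using coset_add_B1[OF dbl tau] by simp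
    then show ?thesis using False by simp
  qed
qed

lemma coset_tau_neq: "\<tau> \<notin> cobar_B1 H d \<Longrightarrow> coset \<tau> \<noteq> cobar_B1 H d"
  using B.a_rcos_self[OF tau] by auto

end

lemma buds_two_B1:
  fixes A :: "'a ring"
  assumes A: "cring A"
  shows "buds_t A \<oplus>\<^bsub>LB_buds A\<^esub> buds_t A \<in> cobar_B1 (M_buds A) 2"
proof -
  interpret bud_ring A by (rule bud_ring.intro[OF A])
  obtain e where "cotor1 (M_buds A) (buds_t A) 2 e" by (rule cotor1_buds[OF A])
  then interpret H: cotor1 "M_buds A" "buds_t A" 2 e .
  have "cobar_d0 (M_buds A) (buds_gamma A) = buds_t A \<oplus>\<^bsub>LB_buds A\<^esub> buds_t A"
    by (rule H.d0_eqI) (use H.M.a_closed[OF H.tau H.tau] in \<open>simp_all add: M_buds_simps etaR_gamma\<close>)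
  then show ?thesis
    unfolding cobar_B1_def M_buds_simps using gamma_L2 by (metis imageI)
qed

text \<open>One computation for both comparison maps. The premises on \<open>\<phi>\<close> say
  nothing about right units, so preservation of coboundaries is derived from the value at
  \<open>t\<close> alone.\<close>

lemma buds_Cotor1_map:
  fixes r :: int
  assumes H: "cotor1 H \<tau> 2 e" and \<phi>: "\<phi> \<in> ring_hom (LB_buds \<Z>) (mor H)" and t: "\<phi> (buds_t \<Z>) = \<tau>"
    and two: "\<tau> \<oplus>\<^bsub>mor H\<^esub> \<tau> \<in> cobar_B1 H 2"
  shows "Cotor1_map H 2 \<phi> (cobar_B1 (M_buds \<Z>) 2 +>\<^bsub>LB_buds \<Z>\<^esub>
      (([r] \<cdot>\<^bsub>LB_buds \<Z>\<^esub> \<one>\<^bsub>LB_buds \<Z>\<^esub>) \<otimes>\<^bsub>LB_buds \<Z>\<^esub> buds_t \<Z>)) =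
    (if even r then cobar_B1 H 2 else cobar_B1 H 2 +>\<^bsub>mor H\<^esub> \<tau>)"
proof -
  interpret H: cotor1 H \<tau> 2 e by fact
  interpret BZ: cring "LB_buds \<Z>" by (rule Z.LB_cring)
  obtain e0 where "cotor1 (M_buds \<Z>) (buds_t \<Z>) 2 e0" by (rule cotor1_buds[OF cring_int])
  then interpret Z0: cotor1 "M_buds \<Z>" "buds_t \<Z>" 2 e0 .
  let ?i = "\<lambda>k::int. [k] \<cdot>\<^bsub>mor H\<^esub> \<one>\<^bsub>mor H\<^esub>" and ?s = "\<lambda>k. buds_etaL \<Z> (buds_scal \<Z> k)"
  have sc: "?s k \<in> carrier (LB_buds \<Z>)" for k
    by (rule ring_hom_closed[OF Z.etaL_hom]) simp
  have \<phi>s: "\<phi> (?s k) = ?i k" for k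
    using int_hom_eq[OF H.mor ring_hom_trans[OF ring_hom_trans[OF Z.scal_hom Z.etaL_hom] \<phi>], of k]
    by (simp only: comp_apply)
  have dc: "cobar_d0 (M_buds \<Z>) u \<in> carrier (LB_buds \<Z>)" if "u \<in> Z.L2" for u
    by (rule Z0.d0_closed[unfolded M_buds_simps ring_truncate_simps, OF Z.L2_closed[OF that]])
  \<comment> \<open>Scalars over the integers are mapped to integer multiples of one, so it suffices
    to treat \<gamma> and the c_a.\<close>
  have d0: "\<phi> (cobar_d0 (M_buds \<Z>) u) \<in> cobar_B1 H 2" if "u \<in> Z.L2" for u
    using that
  proof (induction u rule: Z.L2_induct)
    case gamma
    have "cobar_d0 (M_buds \<Z>) (buds_gamma \<Z>) = buds_t \<Z> \<oplus>\<^bsub>LB_buds \<Z>\<^esub> buds_t \<Z>"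
      by (rule Z0.d0_eqI) (simp_all add: M_buds_simps Z.etaR_gamma)
    then show ?case using two by (simp add: ring_hom_add[OF \<phi>] t)
  next
    case (c a)
    \<comment> \<open>The coboundary of c_a is (a^2 - a) times \<open>t\<close>. The factor is even,
      so the image is an even multiple of \<open>\<tau>\<close> and bounds.\<close>
    define k where "k = a * (a - 1) div 2"
    have "even (a * (a - 1))" by simp
    then have "2 * k = a * (a - 1)" unfolding k_def by (rule dvd_mult_div_cancel)
    then have k: "a * a - a = k + k" by (simp add: algebra_simps)
    have "cobar_d0 (M_buds \<Z>) (buds_c \<Z> a) = ?s (k + k) \<otimes>\<^bsub>LB_buds \<Z>\<^esub> buds_t \<Z>"
      by (rule Z0.d0_eqI) (use sc[of "k + k"] in \<open>simp_all add: M_buds_simps Z.etaR_c k\<close>)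
    then have "\<phi> (cobar_d0 (M_buds \<Z>) (buds_c \<Z> a)) = ?i (k + k) \<otimes>\<^bsub>mor H\<^esub> \<tau>"
      using ring_hom_mult[OF \<phi> sc Z.tt_closed] by (simp only: \<phi>s t)
    moreover have "?i (k + k) \<otimes>\<^bsub>mor H\<^esub> \<tau> \<in> cobar_B1 H 2"
      using H.coset_parity[OF two, of "k + k"] H.B.a_rcos_self[of "?i (k + k) \<otimes>\<^bsub>mor H\<^esub> \<tau>"] by simp
    ultimately show ?case by simp
  next
    case (add u v)
    note c = Z.L2_closed[OF add(1)] Z.L2_closed[OF add(2)]
    have "\<phi> (cobar_d0 (M_buds \<Z>) (u \<oplus>\<^bsub>L_buds \<Z>\<^esub> v)) =
        \<phi> (cobar_d0 (M_buds \<Z>) u) \<oplus>\<^bsub>mor H\<^esub> \<phi> (cobar_d0 (M_buds \<Z>) v)"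
      unfolding Z0.d0_add[unfolded M_buds_simps ring_truncate_simps, OF c]
      by (rule ring_hom_add[OF \<phi> dc[OF add(1)] dc[OF add(2)]])
    then show ?case using H.B1_add[OF add(3,4)] by (simp only:)
  next
    case (smult k u)
    note c = Z.L2_closed[OF smult(2)]
    have "\<phi> (cobar_d0 (M_buds \<Z>) (buds_scal \<Z> k \<otimes>\<^bsub>L_buds \<Z>\<^esub> u)) = ?i k \<otimes>\<^bsub>mor H\<^esub> \<phi> (cobar_d0 (M_buds \<Z>) u)"
      unfolding Z0.d0_smult[unfolded M_buds_simps ring_truncate_simps int_carrier_eq, OF UNIV_I c]
        ring_hom_mult[OF \<phi> sc dc[OF smult(2)]] \<phi>s ..
    then show ?case using H.int_B1[OF smult(3)] by (simp only:)
  qed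
  define z where "z = ([r] \<cdot>\<^bsub>LB_buds \<Z>\<^esub> \<one>\<^bsub>LB_buds \<Z>\<^esub>) \<otimes>\<^bsub>LB_buds \<Z>\<^esub> buds_t \<Z>"
  have zc: "z \<in> carrier (LB_buds \<Z>)" unfolding z_def
    by (rule BZ.m_closed[OF BZ.add.int_pow_closed[folded add_pow_def, OF BZ.one_closed] Z.tt_closed])
  have \<phi>i: "\<phi> ([r] \<cdot>\<^bsub>LB_buds \<Z>\<^esub> \<one>\<^bsub>LB_buds \<Z>\<^esub>) = ?i r"
    using int_hom_eq[OF H.mor ring_hom_trans[OF int_hom[OF Z.LB_cring] \<phi>], of r] by (simp only: comp_apply)
  have \<phi>z: "\<phi> z = ?i r \<otimes>\<^bsub>mor H\<^esub> \<tau>"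
    unfolding z_def using ring_hom_mult[OF \<phi> _ Z.tt_closed, of "[r] \<cdot>\<^bsub>LB_buds \<Z>\<^esub> \<one>\<^bsub>LB_buds \<Z>\<^esub>"] by (simp add: \<phi>i t)
  have \<phi>zc: "\<phi> z \<in> carrier (mor H)" by (rule ring_hom_closed[OF \<phi> zc])
  let ?C = "cobar_B1 (M_buds \<Z>) 2 +>\<^bsub>LB_buds \<Z>\<^esub> z"
  \<comment> \<open>All representatives of the class have images in the same coset, so the union in
    \<open>Cotor1_map\<close> is that coset.\<close>
  have co: "H.coset (\<phi> x) = H.coset (\<phi> z)" if x: "x \<in> ?C" for x
  proof -
    obtain b where b: "b \<in> cobar_B1 (M_buds \<Z>) 2" "x = b \<oplus>\<^bsub>LB_buds \<Z>\<^esub> z"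
      using x unfolding a_r_coset_def' by blast
    from b(1) obtain u where u: "b = cobar_d0 (M_buds \<Z>) u" "u \<in> Z.L2"
      unfolding cobar_B1_def M_buds_simps by (rule imageE)
    have eq: "\<phi> x = \<phi> (cobar_d0 (M_buds \<Z>) u) \<oplus>\<^bsub>mor H\<^esub> \<phi> z"
      unfolding b(2) u(1) by (rule ring_hom_add[OF \<phi> dc[OF u(2)] zc])
    show ?thesis unfolding eq by (rule H.coset_add_B1[OF d0[OF u(2)] \<phi>zc])
  qed
  have "z \<in> Z0.coset z" by (rule Z0.B.a_rcos_self) (simp add: M_buds_simps zc)
  then have "z \<in> ?C" by (simp add: a_r_coset_def' M_buds_simps)
  then have "Cotor1_map H 2 \<phi> ?C = H.coset (\<phi> z)" unfolding Cotor1_map_def using co by blast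
  also have "\<dots> = (if even r then cobar_B1 H 2 else H.coset \<tau>)"
    unfolding \<phi>z by (rule H.coset_parity[OF two])
  finally show ?thesis unfolding z_def .
qed


subsection \<open>The class of the universal strict isomorphism\<close>

lemma fgl_two_B1: "LB_t 1 \<oplus>\<^bsub>LB\<^esub> LB_t 1 \<in> cobar_B1 M_fgl 2"
  and fgl_B1_cases: "b \<in> cobar_B1 M_fgl 2 \<Longrightarrow> \<exists>k. b = LB_etaL (L_scal k) \<otimes>\<^bsub>LB\<^esub> (LB_t 1 \<oplus>\<^bsub>LB\<^esub> LB_t 1)"
proof -
  obtain e where "cotor1 M_fgl (LB_t 1) 2 e" using cotor1_fgl by blast
  then interpret H: cotor1 M_fgl "LB_t 1" 2 e .
  have t: "LB_t 1 \<in> carrier LB" by (rule LB_t_closed) simp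
  have d: "cobar_d0 M_fgl a11 = LB_t 1 \<oplus>\<^bsub>LB\<^esub> LB_t 1"
    by (rule H.d0_eqI) (use t in \<open>simp_all add: M_fgl_simps LB_etaR_XY\<close>)
  have dk: "cobar_d0 M_fgl (L_scal k \<otimes>\<^bsub>L\<^esub> a11) = LB_etaL (L_scal k) \<otimes>\<^bsub>LB\<^esub> (LB_t 1 \<oplus>\<^bsub>LB\<^esub> LB_t 1)" for k
    using H.d0_smult[of k a11] by (simp add: M_fgl_simps d)
  have "L_scal 1 = \<one>\<^bsub>L\<^esub>" using ring_hom_one[OF L_scal_hom] by simp
  then have "a11 = L_scal 1 \<otimes>\<^bsub>L\<^esub> a11" by simp
  then have "a11 \<in> L_grading 2" unfolding L_grading_two by blast
  then show "LB_t 1 \<oplus>\<^bsub>LB\<^esub> LB_t 1 \<in> cobar_B1 M_fgl 2"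
    unfolding cobar_B1_def M_fgl_simps d[symmetric] by (rule imageI)
  assume "b \<in> cobar_B1 M_fgl 2"
  then show "\<exists>k. b = LB_etaL (L_scal k) \<otimes>\<^bsub>LB\<^esub> (LB_t 1 \<oplus>\<^bsub>LB\<^esub> LB_t 1)"
    unfolding cobar_B1_def M_fgl_simps L_grading_two using dk by blast
qed

lemma (in cring) additive_fgl: "\<exists>F. fgl F"
proof -
  let ?F = "indexed_var VX \<oplus>\<^bsub>series_ring R {VX, VY}\<^esub> indexed_var VY"
  interpret P: cring "series_ring R {VX, VY}" by (rule cring_series_ring)
  interpret W: cring "series_ring R W3" by (rule cring_series_ring)
  have v: "indexed_var VX \<in> carrier (series_ring R {VX, VY})" "indexed_var VY \<in> carrier (series_ring R {VX, VY})"
    by (auto intro: indexed_var_series)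
  have F: "subst2 R W3 ?F u w = u \<oplus>\<^bsub>series_ring R W3\<^esub> w" if u: "u \<in> nil W3" and w: "w \<in> nil W3" for u w
  proof -
    let ?r = "\<lambda>x. if x = VX then u else w"
    have r: "finite {VX, VY}" "\<And>x. x \<in> {VX, VY} \<Longrightarrow> ?r x \<in> carrier (series_ring R W3)"
      "\<And>x. x \<in> {VX, VY} \<Longrightarrow> ?r x {#} = \<zero>"
      using nilD[OF u] nilD[OF w] by auto
    have rx: "series_subst R {VX, VY} W3 (indexed_var VX) ?r = ?r VX"
      by (rule series_subst_var[OF r]) simp_all
    have ry: "series_subst R {VX, VY} W3 (indexed_var VY) ?r = ?r VY"
      by (rule series_subst_var[OF r]) simp_all
    show ?thesis
      unfolding subst2_def
      using ring_hom_add[OF series_subst_hom[OF r] v] rx ry by simp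
  qed
  have Fv: "?F m = (if m = {#VX#} \<or> m = {#VY#} then \<one> else \<zero>)" for m
    by (simp add: series_simps indexed_var_eq)
  have form: "fgl_form ?F"
    unfolding fgl_form_def using Fv P.a_closed[OF v] by blast
  have x: "indexed_var VX \<in> nil W3" "indexed_var VY \<in> nil W3" "indexed_var VZ \<in> nil W3"
    by (auto intro: var_nil)
  have s: "u \<oplus>\<^bsub>series_ring R W3\<^esub> w \<in> nil W3" if "u \<in> nil W3" "w \<in> nil W3" for u w
    using subst2_nil[OF fgl_form_nil[OF form] that] unfolding F[OF that] .
  note c = nilD(1)[OF x(1)] nilD(1)[OF x(2)] nilD(1)[OF x(3)]
  have "fgl ?F"
    unfolding fgl_def F[OF x(1,2)] F[OF x(2,3)] F[OF x(2,1)] F[OF s[OF x(1,2)] x(3)] F[OF x(1) s[OF x(2,3)]]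
    using form W.a_assoc[OF c(1,2,3)] W.a_comm[OF c(1,2)] by simp
  then show ?thesis by blast
qed

lemma LB_t_not_B1: "LB_t 1 \<notin> cobar_B1 M_fgl 2"
proof
  assume "LB_t 1 \<in> cobar_B1 M_fgl 2"
  then obtain k where k: "LB_t 1 = LB_etaL (L_scal k) \<otimes>\<^bsub>LB\<^esub> (LB_t 1 \<oplus>\<^bsub>LB\<^esub> LB_t 1)"
    using fgl_B1_cases by blast
  obtain F where F: "cring.fgl \<Z> F" using cring.additive_fgl[OF cring_int] by blast
  obtain h where h: "h \<in> ring_hom L \<Z>" using L_hom_ex[OF cring_int F] by blast
  \<comment> \<open>The classifying map of the additive law extends to \<open>LB\<close> by the
    value one on all t_i. Applied to the assumed equation it makes one an even integer.\<close>
  define j where "j = mpoly_eval L \<Z> h (\<lambda>_::nat. 1)"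
  have one: "(\<lambda>_. 1) \<in> {1::nat..} \<rightarrow> carrier \<Z>" by simp
  have j: "j \<in> ring_hom LB \<Z>"
    unfolding j_def LB_def by (rule L.mpoly_eval_hom[OF cring_int h one])
  have jt: "j (LB_t 1) = 1"
    using L.mpoly_eval_var[OF cring_int h one, of 1] by (simp add: j_def LB_t_def)
  have t: "LB_t 1 \<in> carrier LB" by (rule LB_t_closed) simp
  have "j (LB_t 1) = j (LB_etaL (L_scal k) \<otimes>\<^bsub>LB\<^esub> (LB_t 1 \<oplus>\<^bsub>LB\<^esub> LB_t 1))"
    using k by (rule arg_cong)
  also have "\<dots> = j (LB_etaL (L_scal k)) * (j (LB_t 1) + j (LB_t 1))"
    unfolding ring_hom_mult[OF j ring_hom_closed[OF LB_etaL_hom L_scal_closed] B.a_closed[OF t t]]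
      ring_hom_add[OF j t t] by simp
  finally have "j (LB_t 1) = j (LB_etaL (L_scal k)) * (j (LB_t 1) + j (LB_t 1))" .
  then have "1 = 2 * j (LB_etaL (L_scal k))" unfolding jt by simp
  then show False by presburger
qed

text \<open>The cohomology group consists of the zero class and the class of t_1, which are
  distinct. Zero generates only itself, so the definite description has exactly one
  solution.\<close>

lemma eta_eq: "eta = cobar_B1 M_fgl 2 +>\<^bsub>LB\<^esub> LB_t 1"
proof -
  obtain e where "cotor1 M_fgl (LB_t 1) 2 e" using cotor1_fgl by blast
  then interpret H: cotor1 M_fgl "LB_t 1" 2 e .
  note two = fgl_two_B1[folded M_fgl_simps(3)]
  have H1: "H1_fl M_fgl 1 = Cotor1 M_fgl 2" by (simp add: H1_fl_def)
  have s: "H.s r = [r] \<cdot>\<^bsub>mor M_fgl\<^esub> \<one>\<^bsub>mor M_fgl\<^esub>" for r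
    using int_hom_eq[OF H.mor ring_hom_trans[OF H.scal H.etaL, unfolded M_fgl_simps(1)], of r] by simp
  have car: "carrier (Cotor1 M_fgl 2) = {if even r then cobar_B1 M_fgl 2 else H.coset (LB_t 1) | r :: int. True}"
    unfolding H.Cotor1_carrier s H.coset_parity[OF two] by (simp add: M_fgl_simps)
  note gen = H.Cotor1_generator[unfolded M_fgl_simps(1)]
  have "x = H.coset (LB_t 1)" if x: "module_generator \<Z> (Cotor1 M_fgl 2) x" for x
  proof (rule ccontr)
    assume "x \<noteq> H.coset (LB_t 1)"
    then have xB: "x = cobar_B1 M_fgl 2"
      using x unfolding module_generator_def car by (auto split: if_splits)
    have "H.coset (LB_t 1) \<in> carrier (Cotor1 M_fgl 2)" using gen unfolding module_generator_def by blast
    then obtain r where r: "H.coset (LB_t 1) = r \<odot>\<^bsub>Cotor1 M_fgl 2\<^esub> x"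
      using x unfolding module_generator_def by blast
    \<comment> \<open>The zero class is rewritten as the coset of zero, the form in which scalar
      multiples can be computed.\<close>
    have x0: "x = H.coset \<zero>\<^bsub>mor M_fgl\<^esub>"
      unfolding xB by (rule H.B.a_rcos_const[symmetric]) simp
    have "r \<odot>\<^bsub>Cotor1 M_fgl 2\<^esub> x = H.coset (H.s r \<otimes>\<^bsub>mor M_fgl\<^esub> \<zero>\<^bsub>mor M_fgl\<^esub>)"
      unfolding x0 by (rule H.Cotor1_smult) (simp_all add: M_fgl_simps(1))
    also have "\<dots> = H.coset \<zero>\<^bsub>mor M_fgl\<^esub>"
      using H.etaL_closed[OF H.scal_closed, of r] by (simp add: M_fgl_simps(1))
    finally have "H.coset (LB_t 1) = cobar_B1 M_fgl 2" using r x0 xB by simp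
    then show False using H.coset_tau_neq[OF LB_t_not_B1] by simp
  qed
  then have "eta = H.coset (LB_t 1)"
    unfolding eta_def H1 using gen by (intro the_equality)
  then show ?thesis by (simp add: M_fgl_simps)
qed

section \<open>Comparison of the three cohomology groups\<close>

lemma a_r_coset_truncate: "I +>\<^bsub>ring.truncate R\<^esub> x = I +>\<^bsub>R\<^esub> x"
  by (simp add: a_r_coset_def')

lemma add_pow_truncate: "add_pow (ring.truncate R) (k::int) x = add_pow R k x"
  by (simp add: add_pow_def int_pow_def nat_pow_def m_inv_def Let_def)

theorem mainTheorem15:
  fixes A :: "'a ring"
  assumes "cring A"
    and "noetherian_ring A"
    and "\<And>(n :: nat) a. \<lbrakk>n > 0; a \<in> carrier A; [n] \<cdot>\<^bsub>A\<^esub> a = \<zero>\<^bsub>A\<^esub>\<rbrakk> \<Longrightarrow> a = \<zero>\<^bsub>A\<^esub>"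
  shows "\<exists>x \<in> carrier (H1_fl (M_buds \<Z>) 1).
    H1_fl_map M_fgl 1 fgl_underlying_bud x = eta \<and>
    (\<forall>y \<in> carrier (H1_fl (M_buds \<Z>) 1). H1_fl_map M_fgl 1 fgl_underlying_bud y = eta \<longrightarrow> y = x) \<and>
    module_generator A (H1_fl (M_buds A) 1) (H1_fl_map (M_buds A) 1 (buds_forget A) x)"
proof -
  obtain e where "cotor1 (M_buds A) (buds_t A) 2 e" by (rule cotor1_buds[OF assms(1)])
  then interpret A: cotor1 "M_buds A" "buds_t A" 2 e .
  obtain e' where "cotor1 (M_buds \<Z>) (buds_t \<Z>) 2 e'" by (rule cotor1_buds[OF cring_int])
  then interpret Z': cotor1 "M_buds \<Z>" "buds_t \<Z>" 2 e' .
  obtain e'' where "cotor1 M_fgl (LB_t 1) 2 e''" using cotor1_fgl by blast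
  then interpret F: cotor1 M_fgl "LB_t 1" 2 e'' .
  let ?B = "cobar_B1 (M_buds \<Z>) 2" and ?C = "\<lambda>x. cobar_B1 (M_buds \<Z>) 2 +>\<^bsub>LB_buds \<Z>\<^esub> x"
  let ?z = "\<lambda>r::int. ([r] \<cdot>\<^bsub>LB_buds \<Z>\<^esub> \<one>\<^bsub>LB_buds \<Z>\<^esub>) \<otimes>\<^bsub>LB_buds \<Z>\<^esub> buds_t \<Z>"
  have s: "buds_etaL \<Z> (buds_scal \<Z> r) = [r] \<cdot>\<^bsub>LB_buds \<Z>\<^esub> \<one>\<^bsub>LB_buds \<Z>\<^esub>" for r
    using int_hom_eq[OF Z.LB_cring ring_hom_trans[OF Z.scal_hom Z.etaL_hom], of r] by simp
  have car: "carrier (H1_fl (M_buds \<Z>) 1) = {?C (?z r) | r. True}"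
    using Z'.Cotor1_carrier by (simp add: H1_fl_def M_buds_simps s a_r_coset_def')
  \<comment> \<open>All odd multiples of \<open>t\<close> represent the same class; this gives
    uniqueness of the preimage.\<close>
  have par: "?C (?z r) = ?C (?z 1)" if "odd r" for r
  proof -
    note p = Z'.coset_parity[unfolded M_buds_simps ring_truncate_simps, OF buds_two_B1[OF cring_int]]
    show ?thesis using p[of r] p[of 1] that by (simp add: a_r_coset_truncate add_pow_truncate)
  qed
  have fgl: "H1_fl_map M_fgl 1 fgl_underlying_bud (?C (?z r)) =
      (if even r then cobar_B1 M_fgl 2 else eta)" for r
    unfolding H1_fl_map_def eta_eq
    using buds_Cotor1_map[OF F.cotor1_axioms, unfolded M_fgl_simps, OF fgl_underlying_bud fgl_two_B1, of r] by simp
  \<comment> \<open>The scalar one is odd, so the class of \<open>t\<close> goes to the class of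
    \<open>t\<close> over \<open>A\<close>, which generates.\<close>
  have forget: "H1_fl_map (M_buds A) 1 (buds_forget A) (?C (?z 1)) = A.coset (buds_t A)"
    unfolding H1_fl_map_def
    using buds_Cotor1_map[OF A.cotor1_axioms, of "buds_forget A" 1] buds_forget[OF assms(1)] buds_two_B1[OF assms(1)]
    by (simp add: M_buds_simps ring_hom_truncate)
  \<comment> \<open>Needed to exclude the even multiples as preimages: they go to the zero
    class.\<close>
  have ne: "eta \<noteq> cobar_B1 M_fgl 2"
    using F.coset_tau_neq[OF LB_t_not_B1] unfolding eta_eq M_fgl_simps .
  show ?thesis
  proof (intro bexI conjI ballI impI)
    show "?C (?z 1) \<in> carrier (H1_fl (M_buds \<Z>) 1)" unfolding car by blast
    show "H1_fl_map M_fgl 1 fgl_underlying_bud (?C (?z 1)) = eta" using fgl[of 1] by simp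
    show "module_generator A (H1_fl (M_buds A) 1) (H1_fl_map (M_buds A) 1 (buds_forget A) (?C (?z 1)))"
      using A.Cotor1_generator unfolding forget by (simp add: H1_fl_def M_buds_simps)
    fix y assume "y \<in> carrier (H1_fl (M_buds \<Z>) 1)" and y: "H1_fl_map M_fgl 1 fgl_underlying_bud y = eta"
    then obtain r where r: "y = ?C (?z r)" unfolding car by blast
    have "odd r"
    proof
      assume "even r"
      then have "H1_fl_map M_fgl 1 fgl_underlying_bud y = cobar_B1 M_fgl 2" unfolding r fgl by (rule if_P)
      then show False using y ne by metis
    qed
    then show "y = ?C (?z 1)" unfolding r by (rule par)
  qed
qed

end
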